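(* Let $m=(m_1,m_2)\in\mathbb{Z}_{\ge 1}^2$, $k=(k_1,k_2)\in\mathbb{Z}_{\ge 1}^2$, $p=(p_1,p_2)\in\mathbb{N}^2$, $\gamma=(m,k,p)$ and $n=m_1+p_1+m_2+p_2+1$. The collection $$\mathcal{BB}_\gamma=\left\{h_q(X_n)\,h_{q'}(Y_n)\,b\ :\ b\in\mathcal{B}_\gamma,\ q\in Q_{k_1-1,p_1+1},\ q'\in Q_{k_2-1,p_2+1}\right\}$$ is linearly independent in $\mathbb{C}[X_n,Y_n]_{\mathcal{I}_\gamma}=\mathbb{C}[X_n,Y_n]/\mathcal{I}_\gamma$, and hence forms a basis for $\mathbb{C}[X_n,Y_n]_{\mathcal{I}_\gamma}$ over $\mathbb{C}$.
   Context: $\mathbb{N}=\{0,1,2,\dots\}$; $X_n=\{x_1,\dots,x_n\}$, $Y_n=\{y_1,\dots,y_n\}$. Hollow lattice diagram and ideal: for $\gamma=(m,k,p)$ let $\boldsymbol\alpha=(\alpha_1,\dots,\alpha_n)$ be the list of elements of $\mathbb{N}^2$ $$(0,m_2+k_2+p_2-1),(0,m_2+k_2+p_2-2),\dots,(0,m_2+k_2),(0,m_2+k_2-1),(0,m_2-1),\dots,(0,1),(0,0),(1,0),\dots,(m_1-1,0),(m_1+k_1-1,0),\dots,(m_1+k_1+p_1-1,0).$$ Put $\Delta_\gamma=\det\big(x_j^{\alpha_{i,1}}y_j^{\alpha_{i,2}}\big)_{1\le i,j\le n}$. For $P\in\mathbb{C}[X_n,Y_n]$, $P(\partial_X,\partial_Y)$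 is the differential operator obtained by substituting $\partial/\partial x_i$ for $x_i$ and $\partial/\partial y_i$ for $y_i$. Then $\mathcal{I}_\gamma=\{P: P(\partial_X,\partial_Y)\Delta_\gamma=0\}$. $Q_{c,\ell}=\{(q_1,\dots,q_\ell)\in\mathbb{N}^\ell: c\ge q_1\ge q_2\ge\cdots\ge q_\ell\}$. For a tuple $q=(q_1,\dots,q_\ell)$, $h_q=h_{q_1}\cdots h_{q_\ell}$ is the product of complete homogeneous symmetric polynomials ($h_0=1$). The set $\mathcal{B}_\gamma$: tableaux are drawn in French convention (row 1 at the bottom, left-justified, in the first quadrant). $SYT_n$ is the set of standard tableaux with $n$ cells (entries $1,\dots,n$ once each, increasing along rows from left to right and up columns). For $T\in SYT_n$ set $\pi(1)=0$ and, for $i>1$, $\pi(i)=\pi(i-1)$ if $i$ occurs weakly southeast of $i-1$ in $T$, and $\pi(i)=\pi(i-1)+1$ if $i$ occurs weakly northwest of $i-1$. Let $d=\pi(m_2+p_2+1)$, $h_\gamma(a)=(a-d,0)$ if $a\ge d$ and $h_\gamma(a)=(0,d-a)$ if $a<d$. The cocharge diagram $C_\gamma(T)$ is obtained from $T$ by replacing each entry $i$ by $h_\gamma(\pi(i))$, and $\mathcal{CO}_{n,\gamma}=\{C_\gamma(T):T\in SYT_n\}$. For $T\in SYT_n$ and a diagram $V$ of the same shape filled with elements of $\mathbb{N}^2$, let $v^T_i=(v^T_{i,1},v^T_{i,2})$ be the entry of $V$ in the cell where $T$ has $i$, let $R(T)\le S_n$ be the subgroup of permutations preserving the set of entries of each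 row of $T$, and set the bipermanent $[T,V]_{\mathrm{per}}=\sum_{\sigma\in R(T)}\prod_{i=1}^n x_{\sigma(i)}^{v^T_{i,1}}y_{\sigma(i)}^{v^T_{i,2}}$. Then $\mathcal{B}_\gamma=\{[T,V]_{\mathrm{per}}: T\in SYT_n,\ V\in\mathcal{CO}_{n,\gamma},\ T\text{ and }V\text{ of the same shape}\}$. *)

theory Defs
  imports "HOL-Library.Poly_Mapping" "HOL-Algebra.QuotRing" "Jordan_Normal_Form.VS_Connect"
begin

text \<open>
  The polynomial ring in the variables \<open>x\<^sub>i, y\<^sub>i\<close> (\<open>i = 0, 1, 2, \<dots>\<close>): a monomial is a finitely
  supported exponent function, a polynomial a finitely supported function on monomials.
  The ring in the \<open>2 n\<close> variables with \<open>1 \<le> i \<le> n\<close> is carved out as a carrier set.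
\<close>

datatype xyvar = Xvar nat | Yvar nat

type_synonym monom = "xyvar \<Rightarrow>\<^sub>0 nat"
type_synonym xypoly = "monom \<Rightarrow>\<^sub>0 complex"

definition var :: "xyvar \<Rightarrow> xypoly" where
  "var v = Poly_Mapping.single (Poly_Mapping.single v 1) 1"

definition const :: "complex \<Rightarrow> xypoly" where
  "const c = Poly_Mapping.single 0 c"

definition xvars :: "nat \<Rightarrow> xyvar list" where
  "xvars n = map Xvar [1..<Suc n]"

definition yvars :: "nat \<Rightarrow> xyvar list" where
  "yvars n = map Yvar [1..<Suc n]"

definition xy_ring :: "nat \<Rightarrow> xypoly ring" where
  "xy_ring n = \<lparr>carrier = {f. \<forall>a\<in>Poly_Mapping.keys f. Poly_Mapping.keys a \<subseteq> set (xvars n @ yvars n)},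
     monoid.mult = (*), one = 1, zero = 0, add = (+)\<rparr>"

text \<open>
  The exponent subtraction is truncated, but a monomial without \<open>v\<close> gets coefficient 0.
\<close>

definition pdiff :: "xyvar \<Rightarrow> xypoly \<Rightarrow> xypoly" where
  "pdiff v f = (\<Sum>a\<in>Poly_Mapping.keys f. Poly_Mapping.single (a - Poly_Mapping.single v 1)
                              (of_nat (Poly_Mapping.lookup a v) * Poly_Mapping.lookup f a))"

text \<open>
  Partial derivatives commute, so the order in which they are composed is immaterial.
\<close>

definition monom_diff :: "nat \<Rightarrow> monom \<Rightarrow> xypoly \<Rightarrow> xypoly" where
  "monom_diff n a = foldr (\<lambda>v. pdiff v ^^ Poly_Mapping.lookup a v) (xvars n @ yvars n)"

definition diffop :: "nat \<Rightarrow> xypoly \<Rightarrow> xypoly \<Rightarrow> xypoly" where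
  "diffop n P f = (\<Sum>a\<in>Poly_Mapping.keys P. const (Poly_Mapping.lookup P a) * monom_diff n a f)"

text \<open>The parameters \<open>\<gamma> = ((m\<^sub>1, m\<^sub>2), (k\<^sub>1, k\<^sub>2), (p\<^sub>1, p\<^sub>2))\<close>.\<close>

type_synonym params = "(nat \<times> nat) \<times> (nat \<times> nat) \<times> (nat \<times> nat)"

fun hollow :: "params \<Rightarrow> (nat \<times> nat) list" where
  "hollow ((m1, m2), (k1, k2), (p1, p2)) =
     map (\<lambda>j. (0, j)) (rev [m2 + k2 - 1..<m2 + k2 + p2]) @
     map (\<lambda>j. (0, j)) (rev [0..<m2]) @
     map (\<lambda>j. (j, 0)) [1..<m1] @
     map (\<lambda>j. (j, 0)) [m1 + k1 - 1..<m1 + k1 + p1]"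

text \<open>Matrix indices start at 0, the variables and the \<open>\<alpha>\<^sub>i\<close> at 1.\<close>

definition hollow_det :: "nat \<Rightarrow> params \<Rightarrow> xypoly" where
  "hollow_det n \<gamma> = det (mat n n (\<lambda>(i, j).
     var (Xvar (Suc j)) ^ fst (hollow \<gamma> ! i) * var (Yvar (Suc j)) ^ snd (hollow \<gamma> ! i)))"

definition hollow_ideal :: "nat \<Rightarrow> params \<Rightarrow> xypoly set" where
  "hollow_ideal n \<gamma> = {P \<in> carrier (xy_ring n). diffop n P (hollow_det n \<gamma>) = 0}"

definition quot_map :: "nat \<Rightarrow> xypoly set \<Rightarrow> xypoly \<Rightarrow> xypoly set" where
  "quot_map n I P = I +>\<^bsub>xy_ring n\<^esub> P"

text \<open>
  The quotient ring with scalars acting through the cosets of constants; see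
  \<open>vectorspace_hollow_quotient\<close> below for the locale predicate.
\<close>

definition quot_space :: "nat \<Rightarrow> xypoly set \<Rightarrow> (complex, xypoly set) module" where
  "quot_space n I = (let Q = xy_ring n Quot I in
     \<lparr>carrier = carrier Q, monoid.mult = monoid.mult Q, one = one Q, zero = zero Q, add = add Q,
      smult = (\<lambda>c A. quot_map n I (const c) \<otimes>\<^bsub>Q\<^esub> A)\<rparr>)"

definition complete_hom :: "xyvar set \<Rightarrow> nat \<Rightarrow> xypoly" where
  "complete_hom V r = (\<Sum>a\<in>{a. Poly_Mapping.keys a \<subseteq> V \<and> (\<Sum>v\<in>V. Poly_Mapping.lookup a v) = r}. Poly_Mapping.single a 1)"

definition complete_hom_prod :: "xyvar set \<Rightarrow> nat list \<Rightarrow> xypoly" where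
  "complete_hom_prod V q = prod_list (map (complete_hom V) q)"

definition Qset :: "nat \<Rightarrow> nat \<Rightarrow> nat list set" where
  "Qset c l = {q. length q = l \<and> sorted_wrt (\<ge>) q \<and> (\<forall>r\<in>set q. r \<le> c)}"

text \<open>
  A filling of a Young diagram is the list of its rows from bottom to top, each row read from
  left to right. So \<open>T ! r ! c\<close> is the entry in column \<open>c\<close> of the \<open>r\<close>-th row from the bottom (both
  counted from 0), and a smaller row index means further south.
\<close>

definition shape :: "'a list list \<Rightarrow> nat list" where
  "shape V = map length V"

definition SYT :: "nat \<Rightarrow> nat list list set" where
  "SYT n = {T. [] \<notin> set T \<and> sorted_wrt (\<ge>) (shape T) \<and>
     distinct (concat T) \<and> set (concat T) = {1..n} \<and>
     (\<forall>R\<in>set T. sorted_wrt (<) R) \<and>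
     (\<forall>r c. Suc r < length T \<longrightarrow> c < length (T ! Suc r) \<longrightarrow> T ! r ! c < T ! Suc r ! c)}"

definition row_of :: "nat list list \<Rightarrow> nat \<Rightarrow> nat" where
  "row_of T i = (THE r. r < length T \<and> i \<in> set (T ! r))"

definition col_of :: "nat list list \<Rightarrow> nat \<Rightarrow> nat" where
  "col_of T i = (THE c. c < length (T ! row_of T i) \<and> T ! row_of T i ! c = i)"

definition weakly_SE :: "nat list list \<Rightarrow> nat \<Rightarrow> nat \<Rightarrow> bool" where
  "weakly_SE T i j \<longleftrightarrow> row_of T i \<le> row_of T j \<and> col_of T i \<ge> col_of T j"

text \<open>
  The value at 0 is irrelevant. In a standard tableau \<open>i + 1\<close> is either weakly southeast or weakly
  northwest of \<open>i\<close>, never both.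
\<close>

fun cocharge :: "nat list list \<Rightarrow> nat \<Rightarrow> nat" where
  "cocharge T 0 = 0"
| "cocharge T (Suc 0) = 0"
| "cocharge T (Suc (Suc i)) =
     (if weakly_SE T (Suc (Suc i)) (Suc i) then cocharge T (Suc i) else cocharge T (Suc i) + 1)"

definition split_at :: "nat \<Rightarrow> nat \<Rightarrow> nat \<times> nat" where
  "split_at d a = (if a \<ge> d then (a - d, 0) else (0, d - a))"

fun cocharge_diagram :: "params \<Rightarrow> nat list list \<Rightarrow> (nat \<times> nat) list list" where
  "cocharge_diagram ((m1, m2), (k1, k2), (p1, p2)) T =
     map (map (\<lambda>i. split_at (cocharge T (m2 + p2 + 1)) (cocharge T i))) T"

definition CO :: "nat \<Rightarrow> params \<Rightarrow> (nat \<times> nat) list list set" where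
  "CO n \<gamma> = cocharge_diagram \<gamma> ` SYT n"

definition row_group :: "nat \<Rightarrow> nat list list \<Rightarrow> (nat \<Rightarrow> nat) set" where
  "row_group n T = {\<sigma>. \<sigma> permutes {1..n} \<and> (\<forall>R\<in>set T. \<sigma> ` set R = set R)}"

definition bipermanent :: "nat \<Rightarrow> nat list list \<Rightarrow> (nat \<times> nat) list list \<Rightarrow> xypoly" where
  "bipermanent n T V = (\<Sum>\<sigma>\<in>row_group n T. \<Prod>i\<in>{1..n}.
     (let v = V ! row_of T i ! col_of T i in var (Xvar (\<sigma> i)) ^ fst v * var (Yvar (\<sigma> i)) ^ snd v))"

definition Bset :: "nat \<Rightarrow> params \<Rightarrow> xypoly set" where
  "Bset n \<gamma> = {bipermanent n T V | T V. T \<in> SYT n \<and> V \<in> CO n \<gamma> \<and> shape T = shape V}"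

fun BBset :: "nat \<Rightarrow> params \<Rightarrow> xypoly set" where
  "BBset n ((m1, m2), (k1, k2), (p1, p2)) =
     {complete_hom_prod (set (xvars n)) q * complete_hom_prod (set (yvars n)) q' * b | q q' b.
        b \<in> Bset n ((m1, m2), (k1, k2), (p1, p2)) \<and>
        q \<in> Qset (k1 - 1) (p1 + 1) \<and> q' \<in> Qset (k2 - 1) (p2 + 1)}"

lemma carrier_xy_ring: "f \<in> carrier (xy_ring n) \<longleftrightarrow>
    (\<forall>a\<in>Poly_Mapping.keys f. Poly_Mapping.keys a \<subseteq> set (xvars n @ yvars n))"
  by (simp add: xy_ring_def)

lemma xy_ring_simps [simp]:
  "f \<otimes>\<^bsub>xy_ring n\<^esub> g = f * g" "f \<oplus>\<^bsub>xy_ring n\<^esub> g = f + g"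
  "\<one>\<^bsub>xy_ring n\<^esub> = 1" "\<zero>\<^bsub>xy_ring n\<^esub> = 0"
  by (simp_all add: xy_ring_def)

lemma xy_ring_closed:
  assumes "f \<in> carrier (xy_ring n)" "g \<in> carrier (xy_ring n)"
  shows "f + g \<in> carrier (xy_ring n)" "f * g \<in> carrier (xy_ring n)" "- f \<in> carrier (xy_ring n)"
proof -
  show "f + g \<in> carrier (xy_ring n)"
    using assms Poly_Mapping.keys_add[of f g] unfolding carrier_xy_ring by blast
  show "- f \<in> carrier (xy_ring n)"
    using assms(1) unfolding carrier_xy_ring by (auto simp: in_keys_iff)
  show "f * g \<in> carrier (xy_ring n)"
    unfolding carrier_xy_ring
  proof
    fix a assume "a \<in> Poly_Mapping.keys (f * g)"
    then obtain b c where "a = b + c" "b \<in> Poly_Mapping.keys f" "c \<in> Poly_Mapping.keys g"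
      using keys_mult[of f g] by blast
    then show "Poly_Mapping.keys a \<subseteq> set (xvars n @ yvars n)"
      using assms Poly_Mapping.keys_add[of b c] unfolding carrier_xy_ring by blast
  qed
qed

lemma const_in_carrier [simp]: "const c \<in> carrier (xy_ring n)"
  by (auto simp: carrier_xy_ring const_def)

lemma zero_one_in_carrier [simp]: "0 \<in> carrier (xy_ring n)" "1 \<in> carrier (xy_ring n)"
  by (simp_all add: carrier_xy_ring)

lemma const_simps:
  "const (a + b) = const a + const b" "const (a * b) = const a * const b" "const 1 = 1" "const 0 = 0"
  by (simp_all add: const_def single_add mult_single)

lemma cring_xy_ring: "cring (xy_ring n)"
proof (rule cringI)
  show "abelian_group (xy_ring n)"
  proof (rule abelian_groupI)
    fix x assume "x \<in> carrier (xy_ring n)"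
    then show "\<exists>y\<in>carrier (xy_ring n). y \<oplus>\<^bsub>xy_ring n\<^esub> x = \<zero>\<^bsub>xy_ring n\<^esub>"
      by (intro bexI[of _ "- x"]) (auto simp: xy_ring_closed)
  qed (auto simp: xy_ring_closed algebra_simps)
  show "comm_monoid (xy_ring n)"
    by (rule comm_monoidI) (auto simp: xy_ring_closed algebra_simps)
qed (auto simp: algebra_simps)

lemma lookup_const_mult: "Poly_Mapping.lookup (const c * f) a = c * Poly_Mapping.lookup f a"
  unfolding const_def mult_map_scale_conv_mult[symmetric]
  by (simp add: Poly_Mapping.map.rep_eq when_def)

lemma lookup_pdiff:
  "Poly_Mapping.lookup (pdiff v f) b =
     of_nat (Poly_Mapping.lookup b v + 1) * Poly_Mapping.lookup f (b + Poly_Mapping.single v 1)"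
proof -
  let ?s = "Poly_Mapping.single v (1::nat)"
  have *: "Poly_Mapping.lookup (Poly_Mapping.single (a - ?s)
        (of_nat (Poly_Mapping.lookup a v) * Poly_Mapping.lookup f a)) b =
      (if a = b + ?s then of_nat (Poly_Mapping.lookup b v + 1) * Poly_Mapping.lookup f (b + ?s) else 0)"
    for a
  proof (cases "a = b + ?s")
    case True
    then show ?thesis by (simp add: lookup_add)
  next
    case False
    have "Poly_Mapping.lookup a v = 0" if "a - ?s = b"
    proof (rule ccontr)
      assume "Poly_Mapping.lookup a v \<noteq> 0"
      then have "a = (a - ?s) + ?s"
        by (intro poly_mapping_eqI) (auto simp: lookup_add lookup_minus lookup_single when_def)
      with that False show False by simp
    qed
    with False show ?thesis by (auto simp: lookup_single when_def)
  qed
  show ?thesis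
    unfolding pdiff_def lookup_sum *
    by (cases "b + ?s \<in> Poly_Mapping.keys f") (auto simp: sum.delta' in_keys_iff)
qed

lemma pdiff_linear:
  "pdiff v (f + g) = pdiff v f + pdiff v g" "pdiff v (const c * f) = const c * pdiff v f"
  by (auto intro!: poly_mapping_eqI simp: lookup_pdiff lookup_add lookup_const_mult distrib_left)

lemma pdiff_commute: "pdiff v (pdiff w f) = pdiff w (pdiff v f)"
  by (cases "v = w")
    (auto intro!: poly_mapping_eqI simp: lookup_pdiff lookup_add lookup_single when_def algebra_simps)

lemma pdiff_pow_linear:
  "(pdiff v ^^ k) (f + g) = (pdiff v ^^ k) f + (pdiff v ^^ k) g"
  "(pdiff v ^^ k) (const c * f) = const c * (pdiff v ^^ k) f"
  by (induction k) (simp_all add: pdiff_linear)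

lemma pdiff_pow_commute1: "pdiff w ((pdiff v ^^ k) f) = (pdiff v ^^ k) (pdiff w f)"
  by (induction k) (simp_all add: pdiff_commute[of w v])

lemma pdiff_pow_commute: "(pdiff w ^^ l) ((pdiff v ^^ k) f) = (pdiff v ^^ k) ((pdiff w ^^ l) f)"
  by (induction l) (simp_all add: pdiff_pow_commute1)

lemma foldr_pdiff_linear:
  "foldr (\<lambda>v. pdiff v ^^ e v) vs (f + g) = foldr (\<lambda>v. pdiff v ^^ e v) vs f + foldr (\<lambda>v. pdiff v ^^ e v) vs g"
  "foldr (\<lambda>v. pdiff v ^^ e v) vs (const c * f) = const c * foldr (\<lambda>v. pdiff v ^^ e v) vs f"
  by (induction vs) (simp_all add: pdiff_pow_linear)

lemma foldr_pdiff_commute1: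
  "(pdiff w ^^ l) (foldr (\<lambda>v. pdiff v ^^ e v) vs f) = foldr (\<lambda>v. pdiff v ^^ e v) vs ((pdiff w ^^ l) f)"
  by (induction vs) (simp_all add: pdiff_pow_commute[of l w])

lemma foldr_pdiff_add:
  "foldr (\<lambda>v. pdiff v ^^ (d v + e v)) vs f =
   foldr (\<lambda>v. pdiff v ^^ d v) vs (foldr (\<lambda>v. pdiff v ^^ e v) vs f)"
  by (induction vs) (simp_all add: funpow_add foldr_pdiff_commute1)

lemma monom_diff_linear:
  "monom_diff n a (f + g) = monom_diff n a f + monom_diff n a g"
  "monom_diff n a (const c * f) = const c * monom_diff n a f"
  unfolding monom_diff_def by (rule foldr_pdiff_linear)+

lemma monom_diff_add: "monom_diff n (a + b) f = monom_diff n a (monom_diff n b f)"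
  unfolding monom_diff_def by (simp only: lookup_add foldr_pdiff_add)

lemma monom_diff_0 [simp]: "monom_diff n a 0 = 0"
  using monom_diff_linear(2)[of n a 0 0] by (simp add: const_simps)

lemma monom_diff_sum: "monom_diff n a (sum f A) = (\<Sum>i\<in>A. monom_diff n a (f i))"
  by (induction A rule: infinite_finite_induct) (simp_all add: monom_diff_linear)

lemma diffop_superset:
  assumes "finite A" "Poly_Mapping.keys P \<subseteq> A"
  shows "diffop n P f = (\<Sum>a\<in>A. const (Poly_Mapping.lookup P a) * monom_diff n a f)"
  unfolding diffop_def using assms
  by (intro sum.mono_neutral_left) (auto simp: in_keys_iff const_simps)

lemma diffop_add: "diffop n (P + Q) f = diffop n P f + diffop n Q f"
proof -
  let ?A = "Poly_Mapping.keys P \<union> Poly_Mapping.keys Q"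
  have "Poly_Mapping.keys (P + Q) \<subseteq> ?A" by (rule Poly_Mapping.keys_add)
  then show ?thesis
    by (simp add: diffop_superset[of ?A] lookup_add const_simps algebra_simps sum.distrib)
qed

lemma diffop_0 [simp]: "diffop n 0 f = 0" by (simp add: diffop_def)

lemma diffop_0_right [simp]: "diffop n P 0 = 0" by (simp add: diffop_def)

lemma diffop_sum: "diffop n (sum P A) f = (\<Sum>i\<in>A. diffop n (P i) f)"
  by (induction A rule: infinite_finite_induct) (simp_all add: diffop_add)

lemma diffop_single: "diffop n (Poly_Mapping.single a c) f = const c * monom_diff n a f"
  by (simp add: diffop_def const_simps)

lemma sum_of_monoms: "(\<Sum>a\<in>Poly_Mapping.keys P. Poly_Mapping.single a (Poly_Mapping.lookup P a)) = P"
  by (intro poly_mapping_eqI) (auto simp: lookup_sum lookup_single when_def in_keys_iff sum.delta)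

lemma diffop_mult: "diffop n (P * Q) f = diffop n P (diffop n Q f)"
proof -
  have "P * Q = (\<Sum>a\<in>Poly_Mapping.keys P. \<Sum>b\<in>Poly_Mapping.keys Q.
      Poly_Mapping.single (a + b) (Poly_Mapping.lookup P a * Poly_Mapping.lookup Q b))"
    by (subst (1) sum_of_monoms[of P, symmetric], subst (1) sum_of_monoms[of Q, symmetric])
      (simp add: sum_product mult_single)
  then have "diffop n (P * Q) f = (\<Sum>a\<in>Poly_Mapping.keys P. \<Sum>b\<in>Poly_Mapping.keys Q.
      const (Poly_Mapping.lookup P a * Poly_Mapping.lookup Q b) * monom_diff n a (monom_diff n b f))"
    by (simp add: diffop_sum diffop_single monom_diff_add)
  also have "\<dots> = diffop n P (diffop n Q f)"
    unfolding diffop_def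
    by (simp add: monom_diff_sum monom_diff_linear const_simps sum_distrib_left mult.assoc)
  finally show ?thesis .
qed

lemma ideal_hollow_ideal: "ideal (hollow_ideal n \<gamma>) (xy_ring n)"
proof -
  interpret cring "xy_ring n" by (rule cring_xy_ring)
  have neg: "- P \<in> hollow_ideal n \<gamma>" if "P \<in> hollow_ideal n \<gamma>" for P
  proof -
    have "diffop n (- P) f = - diffop n P f" for f
      using diffop_add[of n P "- P" f] by (simp add: eq_neg_iff_add_eq_0 add.commute)
    then show ?thesis using that
      by (auto simp: hollow_ideal_def xy_ring_closed)
  qed
  show ?thesis
  proof (rule idealI)
    show "ring (xy_ring n)" by (rule ring_axioms)
    show "subgroup (hollow_ideal n \<gamma>) (add_monoid (xy_ring n))"
    proof (rule add.subgroupI)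
      fix P assume P: "P \<in> hollow_ideal n \<gamma>"
      then have Pc: "P \<in> carrier (xy_ring n)" by (simp add: hollow_ideal_def)
      have "\<ominus>\<^bsub>xy_ring n\<^esub> P = - P"
        by (rule minus_equality) (use Pc in \<open>auto simp: xy_ring_closed\<close>)
      then show "\<ominus>\<^bsub>xy_ring n\<^esub> P \<in> hollow_ideal n \<gamma>" using neg[OF P] by simp
    qed (auto simp: hollow_ideal_def xy_ring_closed diffop_add intro!: exI[of _ 0])
  next
    fix P f assume P: "P \<in> hollow_ideal n \<gamma>" and f: "f \<in> carrier (xy_ring n)"
    then show "f \<otimes>\<^bsub>xy_ring n\<^esub> P \<in> hollow_ideal n \<gamma>"
      by (simp add: hollow_ideal_def xy_ring_closed diffop_mult)
    then show "P \<otimes>\<^bsub>xy_ring n\<^esub> f \<in> hollow_ideal n \<gamma>"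
      by (simp add: mult.commute)
  qed
qed

lemma vectorspace_quot_space:
  assumes "ideal I (xy_ring n)"
  shows "vectorspace class_ring (quot_space n I)"
proof -
  interpret ideal I "xy_ring n" by (rule assms)
  interpret R: cring "xy_ring n" by (rule cring_xy_ring)
  interpret Q: cring "xy_ring n Quot I" by (rule quotient_is_cring[OF cring_xy_ring])
  interpret h: ring_hom_ring "xy_ring n" "xy_ring n Quot I" "quot_map n I"
    using rcos_ring_hom_ring by (simp add: quot_map_def[abs_def])
  have add: "quot_map n I (const (a + b)) = quot_map n I (const a) \<oplus>\<^bsub>xy_ring n Quot I\<^esub> quot_map n I (const b)"
    for a b using h.hom_add[of "const a" "const b"] by (simp add: const_simps)
  have mul: "quot_map n I (const (a * b)) = quot_map n I (const a) \<otimes>\<^bsub>xy_ring n Quot I\<^esub> quot_map n I (const b)"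
    for a b using h.hom_mult[of "const a" "const b"] by (simp add: const_simps)
  have one: "quot_map n I (const 1) = \<one>\<^bsub>xy_ring n Quot I\<^esub>"
    using h.hom_one by (simp add: const_simps)
  have [simp]: "quot_map n I (const a) \<in> carrier (xy_ring n Quot I)" for a
    by (rule h.hom_closed) simp
  have [simp]: "carrier (quot_space n I) = carrier (xy_ring n Quot I)"
    "add (quot_space n I) = add (xy_ring n Quot I)" "zero (quot_space n I) = zero (xy_ring n Quot I)"
    "smult (quot_space n I) = (\<lambda>c A. quot_map n I (const c) \<otimes>\<^bsub>xy_ring n Quot I\<^esub> A)"
    by (simp_all add: quot_space_def Let_def)
  have "module class_ring (quot_space n I)"
  proof (rule moduleI)
    show "cring (class_ring :: complex ring)" using class_field[where 'a = complex] unfolding field_def domain_def by blast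
    show "abelian_group (quot_space n I)"
    proof (rule abelian_groupI)
      fix x assume "x \<in> carrier (quot_space n I)"
      then show "\<exists>y\<in>carrier (quot_space n I). y \<oplus>\<^bsub>quot_space n I\<^esub> x = \<zero>\<^bsub>quot_space n I\<^esub>"
        by (intro bexI[of _ "\<ominus>\<^bsub>xy_ring n Quot I\<^esub> x"]) (auto simp: Q.l_neg)
    qed (simp_all add: Q.a_ac)
  qed (auto simp: add mul one Q.l_distr Q.r_distr Q.m_assoc)
  then show ?thesis
    using class_field unfolding vectorspace_def by blast
qed

corollary vectorspace_hollow_quotient:
  "vectorspace class_ring (quot_space n (hollow_ideal n \<gamma>))"
  by (intro vectorspace_quot_space ideal_hollow_ideal)

lemma length_hollow:
  "m2 \<ge> 1 \<Longrightarrow> m1 \<ge> 1 \<Longrightarrow> k1 \<ge> 1 \<Longrightarrow> k2 \<ge> 1 \<Longrightarrow>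
    length (hollow ((m1, m2), (k1, k2), (p1, p2))) = m1 + p1 + m2 + p2 + 1"
  by simp

end

theory Submission
  imports Defs "HOL-Library.Product_Lexorder"
begin

text \<open>
  Up to nonzero factors, \<open>P(\<partial>)\<Delta>\<close> is the action of \<open>P\<close> by shifts on the coefficient function of
  \<open>\<Delta>\<close>, an antisymmetric function that only sees monomials without a factor \<open>x\<^sub>i y\<^sub>i\<close>. Symmetric
  polynomials act on such functions by a Pieri rule. It shows that the action of the products
  \<open>h\<^sub>q(X) h\<^sub>q\<^sub>'(Y)\<close> on \<open>\<Delta>\<close> is triangular with respect to the moves that fill the holes of the diagram,
  so that these products form a basis of the symmetric polynomials modulo the annihilator of \<open>\<Delta>\<close>.

  Upper bound: straightening writes every polynomial, modulo the ideal, as a combination of the \<open>n!\<close>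
  descent monomials with symmetric coefficients, so the dimension is at most \<open>n!\<close> times the number of
  pairs \<open>(q, q')\<close>.

  Independence: pair the bipermanent of \<open>(T, S)\<close> with the sum, over the column group of \<open>T'\<close>, of the
  monomials whose exponents are \<open>j - N\<close> minus the shifted cocharges of \<open>S'\<close> (\<open>N\<close> the index with
  exponent 0). In that degree a symmetric coefficient acts as a scalar on the determinant with
  exponents \<open>j - N\<close>, and by dominance arguments the resulting matrix is triangular with
  nonzero diagonal. As there are \<open>n!\<close> pairs \<open>(T, S)\<close> of standard tableaux of equal shape, the
  independent family is as large as the generating one.
\<close>

section \<open>Counting standard tableaux\<close>

text \<open>The holes leave room between the determinant and the one with the contiguous exponents
  \<open>\<rho>\<close>, and this room is what the symmetric coefficients fill. Up to order,
  \<open>\<rho>\<close> is the only pattern of distinct exponents of its degree or less that shifts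
  of \<open>\<Delta>\<close> can reach. So in that range every symmetric operator carries
  \<open>\<Delta>\<close> to a multiple of the contiguous determinant. Straightening is therefore
  used twice: for the upper bound and, because descent monomials have degree at most that of
  \<open>\<rho>\<close>, to show that a symmetric operator kills \<open>\<Delta>\<close> once all
  its symmetric multiples have scalar 0.

  Cocharge enters through one dichotomy. From j to j + 1 a standard tableau either keeps its
  cocharge and does not move up, or raises it and does not move right; in the second case the
  complement, j minus the cocharge, is what stays constant. Level sets of cocharge thus control rows
  and level sets of the complement control columns. This is why row sums are paired with column
  sums, and why dominance can decide equality.\<close>

definition downset :: "(nat \<times> nat) set \<Rightarrow> bool" where
  "downset D \<longleftrightarrow> (\<forall>r c r' c'. (r, c) \<in> D \<longrightarrow> r' \<le> r \<longrightarrow> c' \<le> c \<longrightarrow> (r', c') \<in> D)"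

lemma downsetD: "downset D \<Longrightarrow> (r, c) \<in> D \<Longrightarrow> r' \<le> r \<Longrightarrow> c' \<le> c \<Longrightarrow> (r', c') \<in> D"
  unfolding downset_def by blast

lemma downset_Un: "downset D \<Longrightarrow> downset E \<Longrightarrow> downset (D \<union> E)"
  unfolding downset_def by blast

lemma downset_Int: "downset D \<Longrightarrow> downset E \<Longrightarrow> downset (D \<inter> E)"
  unfolding downset_def by blast

lemma downset_empty [simp]: "downset {}"
  unfolding downset_def by blast

text \<open>A downset meets every row in an initial segment, so counting the cells of a row turns
  membership into one inequality. Corners, tableaux and the comparison of rows with columns are all
  read off this profile.\<close>

lemma downset_rows:
  assumes "finite D" "downset D"
  obtains len where "\<And>r c. (r, c) \<in> D \<longleftrightarrow> c < len r" "antimono len"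
proof -
  define len where "len r = card {c. (r, c) \<in> D}" for r
  have mem: "(r, c) \<in> D \<longleftrightarrow> c < len r" for r c
  proof -
    have fin: "finite {c. (r, c) \<in> D}"
    proof -
      have "{c. (r, c) \<in> D} \<subseteq> snd ` D" by force
      then show ?thesis using assms(1) by (meson finite_imageI finite_subset)
    qed
    show ?thesis
    proof
      assume "(r, c) \<in> D"
      then have "{..c} \<subseteq> {c. (r, c) \<in> D}" using downsetD[OF assms(2)] by auto
      then have "card {..c} \<le> len r" unfolding len_def by (intro card_mono fin)
      then show "c < len r" by simp
    next
      assume c: "c < len r"
      show "(r, c) \<in> D"
      proof (rule ccontr)
        assume "(r, c) \<notin> D"
        then have "{c. (r, c) \<in> D} \<subseteq> {..<c}"
          using downsetD[OF assms(2), of r _ r c] by (auto simp: not_less[symmetric])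
        then have "len r \<le> card {..<c}" unfolding len_def by (intro card_mono) auto
        with c show False by simp
      qed
    qed
  qed
  have "antimono len"
  proof (rule antimonoI)
    fix r s :: nat assume rs: "r \<le> s"
    show "len s \<le> len r"
    proof (rule ccontr)
      assume "\<not> len s \<le> len r"
      then have "(s, len r) \<in> D" by (simp add: mem)
      then have "(r, len r) \<in> D" using downsetD[OF assms(2)] rs by blast
      then show False by (simp add: mem)
    qed
  qed
  with mem that show thesis by blast
qed

definition addable :: "(nat \<times> nat) set \<Rightarrow> (nat \<times> nat) set" where
  "addable D = {x. x \<notin> D \<and> downset (insert x D)}"

definition removable :: "(nat \<times> nat) set \<Rightarrow> (nat \<times> nat) set" where
  "removable D = {x \<in> D. downset (D - {x})}"

text \<open>Both kinds of corners are indexed by the rows \<open>r\<close> with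
  \<open>len (Suc r) < len r\<close>: the last cell of such a row is removable, and the next row can
  be extended. Row 0 can always be extended, which accounts for the extra one.\<close>

lemma card_addable:
  assumes "finite D" "downset D"
  shows "finite (addable D)" "card (addable D) = Suc (card (removable D))"
proof -
  obtain len where mem: "\<And>r c. (r, c) \<in> D \<longleftrightarrow> c < len r" and anti: "antimono len"
    using downset_rows[OF assms] by blast
  define R where "R = {r. len (Suc r) < len r}"
  have "R \<subseteq> fst ` D"
  proof
    fix r assume "r \<in> R"
    then have "(r, len (Suc r)) \<in> D" by (simp add: R_def mem)
    then show "r \<in> fst ` D" by force
  qed
  then have finR: "finite R" using assms(1) by (meson finite_imageI finite_subset)
  have rem: "removable D = (\<lambda>r. (r, len r - 1)) ` R"
  proof (rule Set.set_eqI, rule iffI)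
    fix x assume x: "x \<in> removable D"
    obtain r c where [simp]: "x = (r, c)" by (cases x)
    from x have c: "c < len r" and d: "downset (D - {(r, c)})" by (auto simp: removable_def mem)
    have "\<not> Suc c < len r" using downsetD[OF d, of r "Suc c" r c] by (auto simp: mem)
    moreover have "\<not> c < len (Suc r)" using downsetD[OF d, of "Suc r" c r c] by (auto simp: mem)
    ultimately show "x \<in> (\<lambda>r. (r, len r - 1)) ` R" using c by (auto simp: R_def)
  next
    fix x assume "x \<in> (\<lambda>r. (r, len r - 1)) ` R"
    then obtain r where r: "len (Suc r) < len r" and x: "x = (r, len r - 1)" by (auto simp: R_def)
    have "(r', c') \<noteq> x" if "(a, b) \<in> D - {x}" "r' \<le> a" "c' \<le> b" for a b r' c'
    proof
      assume eq: "(r', c') = x"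
      have b: "b < len a" "(a, b) \<noteq> (r, len r - 1)" using that(1) x by (auto simp: mem)
      have "len r \<le> b + 1" "r \<le> a" using eq that x r by auto
      then show False
      proof (cases "a = r")
        case True
        then have "b \<noteq> len r - 1" "b < len r" using b by auto
        then show ?thesis using \<open>len r \<le> b + 1\<close> by linarith
      next
        case False
        then have "len a \<le> len (Suc r)" using antimonoD[OF anti, of "Suc r" a] \<open>r \<le> a\<close> by simp
        then show ?thesis using b(1) \<open>len r \<le> b + 1\<close> r by linarith
      qed
    qed
    then have "downset (D - {x})"
      unfolding downset_def by (metis DiffD1 DiffI assms(2) downsetD singletonD)
    then show "x \<in> removable D" using r x by (auto simp: removable_def mem)
  qed
  have add: "addable D = insert (0, len 0) ((\<lambda>r. (Suc r, len (Suc r))) ` R)"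
  proof (rule Set.set_eqI, rule iffI)
    fix x assume x: "x \<in> addable D"
    obtain r c where [simp]: "x = (r, c)" by (cases x)
    from x have c: "len r \<le> c" and d: "downset (insert (r, c) D)" by (auto simp: addable_def mem)
    have "c = len r" using downsetD[OF d, of r c r "len r"] c by (auto simp: mem)
    moreover have "len (Suc r') < len r'" if "r = Suc r'" for r'
      using downsetD[OF d, of r c r' c] c that \<open>c = len r\<close> by (auto simp: mem)
    ultimately show "x \<in> insert (0, len 0) ((\<lambda>r. (Suc r, len (Suc r))) ` R)"
      by (cases r) (auto simp: R_def)
  next
    fix x assume "x \<in> insert (0, len 0) ((\<lambda>r. (Suc r, len (Suc r))) ` R)"
    then obtain r where x: "x = (r, len r)" and r: "\<And>r'. r = Suc r' \<Longrightarrow> len r < len r'"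
      by (auto simp: R_def)
    have "(r', c') \<in> insert x D" if le: "r' \<le> r" "c' \<le> len r" for r' c'
    proof (cases "r' = r")
      case True then show ?thesis using that x by (auto simp: mem)
    next
      case False
      then obtain s where s: "r = Suc s" "r' \<le> s" using le by (cases r) auto
      then have "len r < len s" "len s \<le> len r'" using r antimonoD[OF anti, of r' s] by simp_all
      then show ?thesis using that by (auto simp: mem)
    qed
    then have "downset (insert x D)"
      unfolding downset_def using downsetD[OF assms(2)] x by (metis Pair_inject insertE insertI2)
    then show "x \<in> addable D" using x by (auto simp: addable_def mem)
  qed
  show "finite (addable D)" using finR by (simp add: add)
  have "card (removable D) = card R" unfolding rem by (rule card_image) (auto simp: inj_on_def)
  moreover have "card ((\<lambda>r. (Suc r, len (Suc r))) ` R) = card R" by (rule card_image) (auto simp: inj_on_def)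
  ultimately show "card (addable D) = Suc (card (removable D))"
    unfolding add using finR by (subst card_insert_disjoint) auto
qed

section \<open>Young's lattice and the sum of squares\<close>

text \<open>The number of standard tableaux of shape \<open>D\<close>, by deleting the cell of the
  largest entry.\<close>

fun num_growth :: "nat \<Rightarrow> (nat \<times> nat) set \<Rightarrow> nat" where
  "num_growth 0 D = (if D = {} then 1 else 0)"
| "num_growth (Suc n) D = (\<Sum>x\<in>removable D. num_growth n (D - {x}))"

definition diagrams :: "nat \<Rightarrow> (nat \<times> nat) set set" where
  "diagrams n = {D. finite D \<and> downset D \<and> card D = n}"

lemma diagrams_removable:
  assumes "D \<in> diagrams (Suc n)" "x \<in> removable D"
  shows "D - {x} \<in> diagrams n"
  using assms by (auto simp: diagrams_def removable_def)

lemma diagrams_addable: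
  assumes "D \<in> diagrams n" "x \<in> addable D"
  shows "insert x D \<in> diagrams (Suc n)"
  using assms by (auto simp: diagrams_def addable_def)

lemma finite_removable: "finite D \<Longrightarrow> finite (removable D)"
  by (simp add: removable_def)

text \<open>The off-diagonal part of the commutation relation of Young's lattice: adding one cell
  and deleting a different one can be done in either order, because unions and intersections of
  downsets are downsets.\<close>

lemma addable_removable_swap:
  assumes "downset D"
  shows "(x \<in> addable D \<and> y \<in> removable (insert x D) \<and> y \<noteq> x) \<longleftrightarrow>
    (y \<in> removable D \<and> x \<in> addable (D - {y}) \<and> x \<noteq> y)"
proof (cases "x \<noteq> y")
  case ne: True
  have i: "insert x D - {y} = insert x (D - {y})" using ne by auto
  show ?thesis
  proof
    assume a: "x \<in> addable D \<and> y \<in> removable (insert x D) \<and> y \<noteq> x"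
    have "D \<inter> (insert x D - {y}) = D - {y}" using a by (auto simp: addable_def)
    then have "downset (D - {y})"
      using downset_Int[OF assms, of "insert x D - {y}"] a by (auto simp: removable_def)
    then show "y \<in> removable D \<and> x \<in> addable (D - {y}) \<and> x \<noteq> y"
      using a i by (auto simp: addable_def removable_def)
  next
    assume a: "y \<in> removable D \<and> x \<in> addable (D - {y}) \<and> x \<noteq> y"
    have "D \<union> insert x (D - {y}) = insert x D" by auto
    then have "downset (insert x D)"
      using downset_Un[OF assms, of "insert x (D - {y})"] a by (auto simp: addable_def)
    then show "x \<in> addable D \<and> y \<in> removable (insert x D) \<and> y \<noteq> x"
      using a i by (auto simp: addable_def removable_def)
  qed
qed auto

text \<open>The relation DU - UD = I, applied to the counts. Splitting off \<open>y = x\<close>, the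
  remaining up-down paths are also the down-up paths that do not return, and the induction
  hypothesis evaluates these after the returning ones are added. What is left over is the surplus of
  one addable over the removable cells.\<close>

lemma sum_num_growth_addable:
  "D \<in> diagrams n \<Longrightarrow> (\<Sum>x\<in>addable D. num_growth (Suc n) (insert x D)) = Suc n * num_growth n D"
proof (induction n arbitrary: D)
  case 0
  then have [simp]: "D = {}" by (auto simp: diagrams_def)
  have "addable {} = {(0, 0)}"
    by (auto simp: addable_def downset_def)
  moreover have "removable {(0, 0)} = {(0, 0)}" by (auto simp: removable_def)
  ultimately show ?case by simp
next
  case (Suc n)
  have D: "finite D" "downset D" "card D = Suc n" using Suc.prems by (auto simp: diagrams_def)
  let ?f = num_growth
  let ?N = "Suc n"
  have finA: "finite (addable D)" using card_addable[OF D(1,2)] by simp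
  have finR: "finite (removable D)" using D by (simp add: finite_removable)
  have xr: "x \<in> removable (insert x D)" if "x \<in> addable D" for x
    using that D by (auto simp: addable_def removable_def)
  have "(\<Sum>x\<in>addable D. ?f (Suc ?N) (insert x D)) =
      (\<Sum>x\<in>addable D. ?f ?N D + (\<Sum>y\<in>removable (insert x D) - {x}. ?f ?N (insert x D - {y})))"
  proof (rule sum.cong)
    fix x assume x: "x \<in> addable D"
    then have "insert x D - {x} = D" by (auto simp: addable_def)
    then show "?f (Suc ?N) (insert x D) = ?f ?N D + (\<Sum>y\<in>removable (insert x D) - {x}. ?f ?N (insert x D - {y}))"
      using xr[OF x] D by (simp add: sum.remove[of _ x] finite_removable del: num_growth.simps(2)
          add: num_growth.simps(2)[of ?N])
  qed simp
  also have "\<dots> = card (addable D) * ?f ?N D +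
      (\<Sum>x\<in>addable D. \<Sum>y\<in>removable (insert x D) - {x}. ?f ?N (insert x D - {y}))"
    by (simp add: sum.distrib del: num_growth.simps)
  also have "(\<Sum>x\<in>addable D. \<Sum>y\<in>removable (insert x D) - {x}. ?f ?N (insert x D - {y})) =
      (\<Sum>(x, y)\<in>(SIGMA x:addable D. removable (insert x D) - {x}). ?f ?N (insert x D - {y}))"
    using finA D by (subst sum.Sigma) (auto simp: finite_removable)
  also have "\<dots> = (\<Sum>(y, x)\<in>(SIGMA y:removable D. addable (D - {y}) - {y}). ?f ?N (insert x D - {y}))"
    using addable_removable_swap[OF D(2)]
    by (intro sum.reindex_bij_witness[of _ "\<lambda>(y, x). (x, y)" "\<lambda>(x, y). (y, x)"]) fastforce+
  also have "\<dots> = (\<Sum>y\<in>removable D. \<Sum>x\<in>addable (D - {y}) - {y}. ?f ?N (insert x D - {y}))"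
    using finR D by (subst sum.Sigma) (auto simp: card_addable removable_def)
  finally have 1: "(\<Sum>x\<in>addable D. ?f (Suc ?N) (insert x D)) = card (addable D) * ?f ?N D +
     (\<Sum>y\<in>removable D. \<Sum>x\<in>addable (D - {y}) - {y}. ?f ?N (insert x D - {y}))" .
  have 2: "(\<Sum>x\<in>addable (D - {y}) - {y}. ?f ?N (insert x D - {y})) + ?f ?N D = Suc n * ?f n (D - {y})"
    if y: "y \<in> removable D" for y
  proof -
    have ya: "y \<in> addable (D - {y})" "insert y (D - {y}) = D"
      using y D by (auto simp: addable_def removable_def insert_absorb)
    have "(\<Sum>x\<in>addable (D - {y}) - {y}. ?f ?N (insert x D - {y})) =
        (\<Sum>x\<in>addable (D - {y}) - {y}. ?f ?N (insert x (D - {y})))"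
      by (intro sum.cong) (auto intro!: arg_cong[of _ _ "?f ?N"] simp del: num_growth.simps)
    moreover have "\<dots> + ?f ?N D = (\<Sum>x\<in>addable (D - {y}). ?f ?N (insert x (D - {y})))"
      using ya D y by (subst sum.remove[of _ y]) (auto simp: card_addable removable_def simp del: num_growth.simps)
    ultimately show ?thesis
      using Suc.IH[OF diagrams_removable[OF Suc.prems y]] by (simp del: num_growth.simps)
  qed
  have "(\<Sum>y\<in>removable D. \<Sum>x\<in>addable (D - {y}) - {y}. ?f ?N (insert x D - {y})) + card (removable D) * ?f ?N D
      = (\<Sum>y\<in>removable D. Suc n * ?f n (D - {y}))"
  proof -
    have "(\<Sum>y\<in>removable D. Suc n * ?f n (D - {y})) =
        (\<Sum>y\<in>removable D. (\<Sum>x\<in>addable (D - {y}) - {y}. ?f ?N (insert x D - {y})) + ?f ?N D)"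
      using 2 by (intro sum.cong) simp_all
    then show ?thesis by (simp add: sum.distrib del: num_growth.simps)
  qed
  also have "\<dots> = Suc n * ?f ?N D" by (simp add: sum_distrib_left del: mult_Suc)
  finally show ?case unfolding 1 using card_addable[OF D(1,2)] by (simp add: algebra_simps del: num_growth.simps)
qed

lemma finite_diagrams: "finite (diagrams n)"
proof -
  have "D \<subseteq> {..<n} \<times> {..<n}" if "D \<in> diagrams n" for D
  proof
    fix x assume x: "x \<in> D"
    obtain r c where [simp]: "x = (r, c)" by (cases x)
    have D: "finite D" "downset D" "card D = n" using that by (auto simp: diagrams_def)
    have "(\<lambda>i. (i, c)) ` {..r} \<subseteq> D" "(\<lambda>i. (r, i)) ` {..c} \<subseteq> D"
      using x downsetD[OF D(2)] by auto
    then have "card ((\<lambda>i. (i, c)) ` {..r}) \<le> n" "card ((\<lambda>i. (r, i)) ` {..c}) \<le> n"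
      using D by (auto intro: card_mono)
    then show "x \<in> {..<n} \<times> {..<n}" by (auto simp: card_image inj_on_def)
  qed
  then have "diagrams n \<subseteq> Pow ({..<n} \<times> {..<n})" by blast
  then show ?thesis by (rule finite_subset) simp
qed

text \<open>Up and down moves are adjoint: expanding one factor by its last cell and regrouping by
  the smaller diagram turns the sum into the up-sum just computed.\<close>

lemma sum_num_growth_square: "(\<Sum>D\<in>diagrams n. num_growth n D * num_growth n D) = fact n"
proof (induction n)
  case 0
  have "diagrams 0 = {{}}" by (auto simp: diagrams_def)
  then show ?case by simp
next
  case (Suc n)
  let ?f = num_growth
  have "(\<Sum>D\<in>diagrams (Suc n). ?f (Suc n) D * ?f (Suc n) D) =
     (\<Sum>D\<in>diagrams (Suc n). \<Sum>x\<in>removable D. ?f (Suc n) D * ?f n (D - {x}))"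
    by (simp add: sum_distrib_left)
  also have "\<dots> = (\<Sum>(D, x)\<in>(SIGMA D:diagrams (Suc n). removable D). ?f (Suc n) D * ?f n (D - {x}))"
    by (subst sum.Sigma[OF finite_diagrams]) (auto simp: finite_removable diagrams_def)
  also have "\<dots> = (\<Sum>(D, x)\<in>(SIGMA D:diagrams n. addable D). ?f (Suc n) (insert x D) * ?f n D)"
  proof (rule sum.reindex_bij_witness[of _ "\<lambda>(D, x). (insert x D, x)" "\<lambda>(D, x). (D - {x}, x)"], goal_cases)
    case (1 a) then show ?case by (auto simp: removable_def insert_absorb)
  next
    case (2 a) then show ?case
      by (auto simp: diagrams_removable) (auto simp: removable_def addable_def diagrams_def insert_absorb)
  next
    case (3 b) then show ?case by (auto simp: addable_def)
  next
    case (4 b) then show ?case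
      by (auto simp: diagrams_addable) (auto simp: removable_def addable_def diagrams_def)
  next
    case (5 a) then show ?case by (auto simp: removable_def insert_absorb simp del: num_growth.simps)
  qed
  also have "\<dots> = (\<Sum>D\<in>diagrams n. \<Sum>x\<in>addable D. ?f (Suc n) (insert x D) * ?f n D)"
    by (subst sum.Sigma[OF finite_diagrams]) (auto simp: card_addable diagrams_def)
  also have "\<dots> = (\<Sum>D\<in>diagrams n. Suc n * ?f n D * ?f n D)"
    by (intro sum.cong refl) (simp only: sum_num_growth_addable sum_distrib_right[symmetric])
  also have "\<dots> = Suc n * fact n" by (simp only: Suc.IH[symmetric] sum_distrib_left mult.assoc)
  finally show ?case by simp
qed

section \<open>Standard tableaux as growth sequences of diagrams\<close>

definition growth :: "nat \<Rightarrow> (nat \<Rightarrow> nat \<times> nat) \<Rightarrow> bool" where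
  "growth n P \<longleftrightarrow> inj_on P {1..n} \<and> (\<forall>k\<le>n. downset (P ` {1..k}))"

text \<open>Extensional functions, so that the cardinality counts sequences on \<open>{1..n}\<close>
  and not their arbitrary continuations.\<close>

definition growths :: "nat \<Rightarrow> (nat \<times> nat) set \<Rightarrow> (nat \<Rightarrow> nat \<times> nat) set" where
  "growths n D = {P \<in> {1..n} \<rightarrow>\<^sub>E UNIV. growth n P \<and> P ` {1..n} = D}"

lemma card_growths: "D \<in> diagrams n \<Longrightarrow> finite (growths n D) \<and> card (growths n D) = num_growth n D"
proof (induction n arbitrary: D)
  case 0
  then have "D = {}" by (auto simp: diagrams_def)
  then have "growths 0 D = {\<lambda>x. undefined}" by (auto simp: growths_def growth_def PiE_def extensional_def)
  then show ?case using \<open>D = {}\<close> by simp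
next
  case (Suc n)
  have D: "finite D" "downset D" using Suc.prems by (auto simp: diagrams_def)
  have a: "{1..Suc n} = insert (Suc n) {1..n}" by auto
  let ?ext = "\<lambda>(x, P). P(Suc n := x)"
  have eq: "growths (Suc n) D = ?ext ` (SIGMA x:removable D. growths n (D - {x}))"
  proof (rule Set.set_eqI, rule iffI)
    fix P assume P: "P \<in> growths (Suc n) D"
    let ?x = "P (Suc n)" and ?Q = "P(Suc n := undefined)"
    have g: "inj_on P {1..Suc n}" "\<And>k. k \<le> Suc n \<Longrightarrow> downset (P ` {1..k})" "P ` {1..Suc n} = D"
      "P \<in> extensional {1..Suc n}"
      using P by (auto simp: growths_def growth_def PiE_def)
    have x: "?x \<notin> P ` {1..n}"
    proof
      assume "?x \<in> P ` {1..n}"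
      then obtain i where "i \<in> {1..n}" "P (Suc n) = P i" by auto
      then show False using inj_onD[OF g(1), of "Suc n" i] by auto
    qed
    have im: "D - {?x} = P ` {1..n}" using x g(3) unfolding a by auto
    have im': "?Q ` {1..k} = P ` {1..k}" if "k \<le> n" for k using that by (auto intro!: image_cong)
    have "?x \<in> removable D" using im g(2)[of n] g(3) by (auto simp: removable_def)
    moreover have "?Q \<in> growths n (D - {?x})"
      unfolding growths_def growth_def
    proof (intro CollectI conjI allI impI)
      show "?Q \<in> {1..n} \<rightarrow>\<^sub>E UNIV" using g(4) by (auto simp: PiE_def extensional_def)
      show "inj_on ?Q {1..n}" using g(1) by (auto simp: inj_on_def)
    qed (use g(2) im im' in auto)
    moreover have "P = ?ext (?x, ?Q)" by auto
    ultimately show "P \<in> ?ext ` (SIGMA x:removable D. growths n (D - {x}))" by blast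
  next
    fix P assume "P \<in> ?ext ` (SIGMA x:removable D. growths n (D - {x}))"
    then obtain x Q where x: "x \<in> removable D" and Q: "Q \<in> growths n (D - {x})" and P: "P = Q(Suc n := x)"
      by auto
    have im': "P ` {1..k} = Q ` {1..k}" if "k \<le> n" for k using that P by (auto intro!: image_cong)
    have "P ` {1..Suc n} = insert (P (Suc n)) (P ` {1..n})" unfolding a by (rule image_insert)
    then have "P ` {1..Suc n} = insert x (Q ` {1..n})" using im'[of n] P by simp
    then have im: "P ` {1..Suc n} = D"
      using x Q by (auto simp: growths_def removable_def)
    have inj: "inj_on P {1..Suc n}"
    proof -
      have "P (Suc n) \<notin> P ` {1..n}" using Q P im'[of n] by (simp add: growths_def)
      moreover have "inj_on P {1..n} \<longleftrightarrow> inj_on Q {1..n}" by (rule inj_on_cong) (simp add: P)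
      moreover have "inj_on Q {1..n}" using Q by (simp add: growths_def growth_def)
      ultimately show ?thesis unfolding a by (simp add: inj_on_insert)
    qed
    have "downset (P ` {1..k})" if k: "k \<le> Suc n" for k
    proof (cases "k = Suc n")
      case True then show ?thesis using im D by simp
    next
      case False
      then have "k \<le> n" using k by simp
      then show ?thesis using im'[of k] Q by (simp add: growths_def growth_def)
    qed
    moreover have "P \<in> {1..Suc n} \<rightarrow>\<^sub>E UNIV" using Q P by (auto simp: growths_def PiE_def extensional_def)
    ultimately show "P \<in> growths (Suc n) D" using im inj by (auto simp: growths_def growth_def)
  qed
  have inj: "inj_on ?ext (SIGMA x:removable D. growths n (D - {x}))"
  proof (rule inj_onI)
    fix u v assume uv: "u \<in> (SIGMA x:removable D. growths n (D - {x}))"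
      "v \<in> (SIGMA x:removable D. growths n (D - {x}))" "?ext u = ?ext v"
    obtain x P y Q where [simp]: "u = (x, P)" "v = (y, Q)" by (metis surj_pair)
    have eq: "P(Suc n := x) = Q(Suc n := y)" using uv(3) by simp
    have "P (Suc n) = undefined" "Q (Suc n) = undefined"
      using uv by (auto simp: growths_def PiE_def extensional_def)
    then show "u = v" using eq by simp (metis fun_upd_same fun_upd_triv fun_upd_upd)
  qed
  have f: "finite (SIGMA x:removable D. growths n (D - {x}))"
    using D Suc.IH diagrams_removable[OF Suc.prems] by (auto simp: finite_removable)
  then show ?case unfolding eq
    using D Suc.IH[OF diagrams_removable[OF Suc.prems]]
    by (simp add: card_image[OF inj] finite_removable)
qed

definition pos :: "nat list list \<Rightarrow> nat \<Rightarrow> nat \<times> nat" where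
  "pos T i = (row_of T i, col_of T i)"

definition cells :: "nat list list \<Rightarrow> (nat \<times> nat) set" where
  "cells T = {(r, c). r < length T \<and> c < length (T ! r)}"

lemma SYT_entry:
  assumes "T \<in> SYT n" "r < length T" "c < length (T ! r)"
  shows "pos T (T ! r ! c) = (r, c)" "T ! r ! c \<in> {1..n}"
proof -
  have T: "[] \<notin> set T" "distinct (concat T)" "set (concat T) = {1..n}"
    using assms(1) by (auto simp: SYT_def)
  have dT: "distinct T" and dr: "\<And>R. R \<in> set T \<Longrightarrow> distinct R"
    and dis: "\<And>R S. R \<in> set T \<Longrightarrow> S \<in> set T \<Longrightarrow> R \<noteq> S \<Longrightarrow> set R \<inter> set S = {}"
    using T(1,2) by (auto simp: distinct_concat_iff removeAll_id)
  let ?x = "T ! r ! c"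
  have uniq: "s = r" if "s < length T" "?x \<in> set (T ! s)" for s
  proof (rule ccontr)
    assume "s \<noteq> r"
    then have "T ! s \<noteq> T ! r" using dT that(1) assms(2) by (simp add: nth_eq_iff_index_eq)
    then have "set (T ! s) \<inter> set (T ! r) = {}" using that(1) assms(2) by (intro dis) auto
    then show False using that(2) assms(3) by (meson disjoint_iff nth_mem)
  qed
  have row: "row_of T ?x = r"
    unfolding row_of_def using uniq assms(2,3) by (intro the_equality) auto
  have "col_of T ?x = c"
    unfolding col_of_def row
  proof (rule the_equality)
    show "c < length (T ! r) \<and> T ! r ! c = T ! r ! c" using assms by simp
    fix d assume "d < length (T ! r) \<and> T ! r ! d = ?x"
    moreover have "distinct (T ! r)" using dr[of "T ! r"] assms by simp
    ultimately show "d = c" using nth_eq_iff_index_eq[of "T ! r" d c] assms(3) by blast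
  qed
  with row show "pos T ?x = (r, c)" by (simp add: pos_def)
  have "?x \<in> set (concat T)" using assms by (auto intro!: bexI[of _ "T ! r"])
  with T(3) show "?x \<in> {1..n}" by simp
qed

lemma SYT_pos:
  assumes "T \<in> SYT n" "i \<in> {1..n}"
  shows "pos T i \<in> cells T" "T ! row_of T i ! col_of T i = i"
proof -
  have "i \<in> set (concat T)" using assms by (auto simp: SYT_def)
  then obtain r c where "r < length T" "c < length (T ! r)" "T ! r ! c = i"
    by (auto simp: in_set_conv_nth)
  moreover from this SYT_entry(1)[OF assms(1), of r c] have "pos T i = (r, c)" by simp
  ultimately show "pos T i \<in> cells T" "T ! row_of T i ! col_of T i = i"
    by (auto simp: cells_def pos_def)
qed

lemma bij_betw_pos: assumes T: "T \<in> SYT n" shows "bij_betw (pos T) {1..n} (cells T)"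
proof (rule bij_betw_byWitness[where f' = "\<lambda>(r, c). T ! r ! c"])
  show "\<forall>i\<in>{1..n}. (case pos T i of (r, c) \<Rightarrow> T ! r ! c) = i"
    using SYT_pos(2)[OF T] by (simp add: pos_def)
  show "\<forall>x\<in>cells T. pos T (case x of (r, c) \<Rightarrow> T ! r ! c) = x"
    using SYT_entry(1)[OF T] by (simp add: cells_def split_beta)
  show "pos T ` {1..n} \<subseteq> cells T" using SYT_pos(1)[OF T] by blast
  show "(\<lambda>(r, c). T ! r ! c) ` cells T \<subseteq> {1..n}"
    using SYT_entry(2)[OF T] by (fastforce simp: cells_def)
qed

lemma SYT_less:
  assumes T: "T \<in> SYT n" and s: "s < length T" "d < length (T ! s)" and rc: "r \<le> s" "c \<le> d"
  shows "c < length (T ! r)" "T ! r ! c \<le> T ! s ! d"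
proof -
  have T': "sorted_wrt (\<ge>) (shape T)" "\<And>R. R \<in> set T \<Longrightarrow> sorted_wrt (<) R"
    "\<And>r c. Suc r < length T \<Longrightarrow> c < length (T ! Suc r) \<Longrightarrow> T ! r ! c < T ! Suc r ! c"
    using T by (auto simp: SYT_def)
  have len: "length (T ! b) \<le> length (T ! a)" if "a \<le> b" "b < length T" for a b
  proof (cases "a = b")
    case False
    then show ?thesis using sorted_wrt_nth_less[OF T'(1), of a b] that by (auto simp: shape_def)
  qed simp
  show c: "c < length (T ! r)" using len[of r s] s rc by simp
  have col: "r + k < length T \<Longrightarrow> c < length (T ! (r + k)) \<Longrightarrow> T ! r ! c \<le> T ! (r + k) ! c" for k
  proof (induction k)
    case (Suc k)
    then have "c < length (T ! (r + k))" using len[of "r + k" "r + Suc k"] by simp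
    then show ?case using Suc T'(3)[of "r + k" c] by simp
  qed simp
  have "T ! r ! c \<le> T ! s ! c" using col[of "s - r"] rc s by simp
  also have "\<dots> \<le> T ! s ! d"
    using sorted_wrt_nth_less[OF T'(2)[of "T ! s"], of c d] rc s by (cases "c = d") auto
  finally show "T ! r ! c \<le> T ! s ! d" .
qed

lemma growth_pos: assumes T: "T \<in> SYT n" shows "growth n (pos T)"
  unfolding growth_def
proof (intro conjI allI impI)
  show "inj_on (pos T) {1..n}" using bij_betw_pos[OF T] by (rule bij_betw_imp_inj_on)
  fix k assume k: "k \<le> n"
  show "downset (pos T ` {1..k})"
    unfolding downset_def
  proof (intro allI impI)
    fix s d r c assume "(s, d) \<in> pos T ` {1..k}" and rc: "r \<le> s" "c \<le> d"
    then obtain i where i: "i \<in> {1..k}" "pos T i = (s, d)" by auto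
    have sd: "s < length T" "d < length (T ! s)" "T ! s ! d = i"
      using SYT_pos[OF T, of i] i k by (auto simp: cells_def pos_def)
    have "T ! r ! c \<in> {1..k}" "pos T (T ! r ! c) = (r, c)"
      using SYT_less[OF T sd(1,2) rc] SYT_entry[OF T, of r c] sd i rc by auto
    then show "(r, c) \<in> pos T ` {1..k}" by (metis image_eqI)
  qed
qed

lemma cells_eq_iff_shape:
  assumes "T \<in> SYT n" "S \<in> SYT m" "cells T = cells S"
  shows "shape T = shape S"
proof -
  have ne: "[] \<notin> set T" "[] \<notin> set S" using assms by (auto simp: SYT_def)
  have mem: "r < length T \<and> c < length (T ! r) \<longleftrightarrow> r < length S \<and> c < length (S ! r)" for r c
    using assms(3) by (auto simp: cells_def)
  have "r < length T \<longleftrightarrow> r < length S" for r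
    using mem[of r 0] ne by (metis length_greater_0_conv nth_mem)
  then have l: "length T = length S" by (metis linorder_neqE_nat less_irrefl)
  have "length (T ! r) = length (S ! r)" if "r < length T" for r
    using mem[of r] that l by (metis linorder_neqE_nat less_irrefl)
  then show ?thesis using l by (simp add: shape_def list_eq_iff_nth_eq)
qed

lemma cells_shape: "cells T = {(r, c). r < length (shape T) \<and> c < shape T ! r}"
  by (auto simp: cells_def shape_def)

lemma shape_cells: "shape T = shape S \<Longrightarrow> cells T = cells S"
  by (simp add: cells_shape)

text \<open>The entry of a cell is the time at which the cell is added. A cell weakly to the
  southwest has to be present earlier, which makes rows and columns increase.\<close>

lemma SYT_of_growth:
  assumes P: "growth n P"
  obtains T where "T \<in> SYT n" "\<And>i. i \<in> {1..n} \<Longrightarrow> pos T i = P i" "cells T = P ` {1..n}"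
proof -
  let ?D = "P ` {1..n}"
  have inj: "inj_on P {1..n}" and dn: "\<And>k. k \<le> n \<Longrightarrow> downset (P ` {1..k})"
    using P by (auto simp: growth_def)
  obtain len where mem: "\<And>r c. (r, c) \<in> ?D \<longleftrightarrow> c < len r" and anti: "antimono len"
    using downset_rows[of ?D] dn[of n] by auto
  have ex0: "\<exists>r. len r = 0"
  proof -
    have "\<exists>r. r \<notin> fst ` ?D" by (rule ex_new_if_finite) auto
    then obtain r where "r \<notin> fst ` ?D" by blast
    then have "(r, 0) \<notin> ?D" by (metis fst_conv image_eqI)
    then show ?thesis unfolding mem by auto
  qed
  \<comment> \<open>The number of nonempty rows, so that the list of rows contains no
    \<open>[]\<close>.\<close>
  define R where "R = (LEAST r. len r = 0)"
  have R: "0 < len r \<longleftrightarrow> r < R" for r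
  proof -
    have "len R = 0" unfolding R_def using ex0 by (rule LeastI_ex)
    then have "len r = 0" if "R \<le> r" using antimonoD[OF anti that] by simp
    moreover have "len r \<noteq> 0" if "r < R" using not_less_Least that unfolding R_def by blast
    ultimately show ?thesis by (metis not_less not_gr0)
  qed
  define q where "q = inv_into {1..n} P"
  have q: "q (r, c) \<in> {1..n}" "P (q (r, c)) = (r, c)" if "c < len r" for r c
  proof -
    have "(r, c) \<in> ?D" using that mem by simp
    then show "q (r, c) \<in> {1..n}" "P (q (r, c)) = (r, c)"
      unfolding q_def by (rule inv_into_into, rule f_inv_into_f)
  qed
  have qP: "q (P i) = i" if "i \<in> {1..n}" for i
    unfolding q_def by (rule inv_into_f_f[OF inj that])
  have q_less: "q (r', c') < q (r, c)" if "c < len r" "r' \<le> r" "c' \<le> c" "(r', c') \<noteq> (r, c)" for r c r' c'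
  proof -
    let ?k = "q (r, c)"
    have "(r, c) \<in> P ` {1..?k}" using q[OF that(1)] by (metis atLeastAtMost_iff image_eqI order_refl)
    then have "(r', c') \<in> P ` {1..?k}"
      using downsetD[OF dn[of ?k]] q[OF that(1)] that by auto
    then obtain i where i: "i \<in> {1..?k}" "P i = (r', c')" by auto
    then have "q (r', c') = i" using qP[of i] q[OF that(1)] by auto
    moreover have "i \<noteq> ?k" using i q[OF that(1)] that(4) by auto
    ultimately show ?thesis using i by auto
  qed
  define T where "T = map (\<lambda>r. map (\<lambda>c. q (r, c)) [0..<len r]) [0..<R]"
  have lenT: "length T = R" "\<And>r. r < R \<Longrightarrow> length (T ! r) = len r"
    and nthT: "\<And>r c. r < R \<Longrightarrow> c < len r \<Longrightarrow> T ! r ! c = q (r, c)"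
    by (auto simp: T_def)
  have inR: "r < R" if "c < len r" for r c using that R[of r] by simp
  have rowsR: "R' \<in> set T \<longleftrightarrow> (\<exists>r<R. R' = map (\<lambda>c. q (r, c)) [0..<len r])" for R'
    by (auto simp: T_def)
  have setc: "set (concat T) = {1..n}"
  proof
    show "set (concat T) \<subseteq> {1..n}" using q(1) by (auto simp: T_def)
    show "{1..n} \<subseteq> set (concat T)"
    proof
      fix i assume i: "i \<in> {1..n}"
      obtain r c where rc: "P i = (r, c)" by fastforce
      then have c: "c < len r" using i mem by (metis image_eqI)
      moreover have "i = q (r, c)" using qP[OF i] rc by simp
      moreover have "T ! r ! c \<in> set (concat T)"
        using inR[OF c] c lenT by (auto intro!: bexI[of _ "T ! r"])
      ultimately show "i \<in> set (concat T)" using nthT[OF inR[OF c] c] by simp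
    qed
  qed
  have qinj: "(r, c) = (r', c')" if "q (r, c) = q (r', c')" "c < len r" "c' < len r'" for r c r' c'
    using q(2)[of c r] q(2)[of c' r'] that by metis
  have T: "T \<in> SYT n"
    unfolding SYT_def
  proof (intro CollectI conjI ballI allI impI)
    show "[] \<notin> set T" using R lenT by (metis in_set_conv_nth less_irrefl list.size(3))
    show "sorted_wrt (\<ge>) (shape T)"
      unfolding sorted_wrt_iff_nth_less
    proof (intro allI impI)
      fix i j assume ij: "i < j" "j < length (shape T)"
      have "len j \<le> len i" using antimonoD[OF anti, of i j] ij by simp
      then show "shape T ! j \<le> shape T ! i" using ij by (simp add: shape_def lenT)
    qed
    show "distinct (concat T)"
    proof (rule distinct_concat)
      show "distinct T"
      proof (rule distinct_conv_nth[THEN iffD2], intro allI impI notI)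
        fix i j assume ij: "i < length T" "j < length T" "i \<noteq> j" "T ! i = T ! j"
        then have "0 < len i" "0 < len j" using R[of i] R[of j] lenT(1) by auto
        then have "q (i, 0) = q (j, 0)" using ij nthT[of i 0] nthT[of j 0] lenT(1) by simp
        then show False using qinj[of i 0 j 0] ij(3) \<open>0 < len i\<close> \<open>0 < len j\<close> by simp
      qed
      show "distinct ys" if ys: "ys \<in> set T" for ys
      proof -
        obtain r where "ys = map (\<lambda>c. q (r, c)) [0..<len r]" using ys unfolding rowsR by blast
        moreover have "inj_on (\<lambda>c. q (r, c)) {0..<len r}"
        proof (rule inj_onI)
          fix i j assume "i \<in> {0..<len r}" "j \<in> {0..<len r}" "q (r, i) = q (r, j)"
          then show "i = j" using qinj[of r i r j] by simp
        qed
        ultimately show ?thesis by (simp add: distinct_map)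
      qed
      show "set ys \<inter> set zs = {}" if yz: "ys \<in> set T" "zs \<in> set T" "ys \<noteq> zs" for ys zs
      proof (rule ccontr)
        assume "set ys \<inter> set zs \<noteq> {}"
        then obtain x where x: "x \<in> set ys" "x \<in> set zs" by auto
        obtain r r' where r: "ys = map (\<lambda>c. q (r, c)) [0..<len r]" "zs = map (\<lambda>c. q (r', c)) [0..<len r']"
          using yz(1,2) unfolding rowsR by blast
        then obtain c c' where c: "c < len r" "c' < len r'" "q (r, c) = q (r', c')" using x by auto
        then have "r = r'" using qinj[OF c(3,1,2)] by simp
        then show False using r yz(3) by simp
      qed
    qed
    show "set (concat T) = {1..n}" by (rule setc)
    show "sorted_wrt (<) R'" if R': "R' \<in> set T" for R'
    proof -
      obtain r where r: "R' = map (\<lambda>c. q (r, c)) [0..<len r]" using R' unfolding rowsR by blast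
      have "q (r, i) < q (r, j)" if "i < j" "j < len r" for i j
        using q_less[OF that(2), of r i] that(1) by simp
      then show ?thesis unfolding r sorted_wrt_iff_nth_less by simp
    qed
    show "T ! r ! c < T ! Suc r ! c" if "Suc r < length T" "c < length (T ! Suc r)" for r c
    proof -
      have c: "c < len (Suc r)" "c < len r" using that lenT antimonoD[OF anti, of r "Suc r"] by auto
      then show ?thesis using q_less[OF c(1), of r c] nthT that lenT by simp
    qed
  qed
  have pT: "pos T i = P i" if i: "i \<in> {1..n}" for i
  proof -
    obtain r c where rc: "P i = (r, c)" by fastforce
    then have c: "c < len r" using i mem by (metis image_eqI)
    have "T ! r ! c = i" using nthT[OF inR[OF c] c] qP[OF i] rc by simp
    then show ?thesis using SYT_entry(1)[OF T, of r c] inR[OF c] lenT c rc by simp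
  qed
  have "cells T = ?D"
  proof (rule Set.set_eqI)
    fix x :: "nat \<times> nat"
    obtain r c where [simp]: "x = (r, c)" by (cases x)
    show "x \<in> cells T \<longleftrightarrow> x \<in> ?D"
      using mem[of r c] inR[of c r] lenT(2)[of r] lenT(1) by (auto simp: cells_def simp del: image_iff)
  qed
  from that[OF T pT this] show thesis .
qed

text \<open>Pairs of growth sequences with a common final diagram inject into pairs of tableaux of
  equal shape, so the sum of squares bounds the latter from below.\<close>

lemma card_SYT_pairs:
  "finite {(T, S). T \<in> SYT n \<and> S \<in> SYT n \<and> shape T = shape S}"
  "fact n \<le> card {(T, S). T \<in> SYT n \<and> S \<in> SYT n \<and> shape T = shape S}"
proof -
  let ?Z = "{(T, S). T \<in> SYT n \<and> S \<in> SYT n \<and> shape T = shape S}"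
  have "SYT n \<subseteq> {T. set T \<subseteq> {R. set R \<subseteq> {1..n} \<and> length R \<le> n} \<and> length T \<le> n}"
  proof
    fix T assume T: "T \<in> SYT n"
    then have T': "[] \<notin> set T" "distinct (concat T)" "set (concat T) = {1..n}" by (auto simp: SYT_def)
    then have len: "length (concat T) = n" using distinct_card[of "concat T"] by simp
    have "length T \<le> length (concat T)" if "[] \<notin> set T" for T :: "nat list list"
      using that 
    proof (induction T)
      case (Cons R T)
      then have "0 < length R" by auto
      then have "Suc 0 \<le> length R" by (rule Suc_leI)
      moreover have "length T \<le> length (concat T)" using Cons by simp
      ultimately show ?case by simp
    qed simp
    moreover have "length R \<le> length (concat T)" if "R \<in> set T" for R
      using member_le_sum_list[of "length R" "map length T"] that by (simp add: length_concat)
    ultimately show "T \<in> {T. set T \<subseteq> {R. set R \<subseteq> {1..n} \<and> length R \<le> n} \<and> length T \<le> n}"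
      using T' len by auto
  qed
  moreover have "finite {R::nat list. set R \<subseteq> {1..n} \<and> length R \<le> n}"
    by (intro finite_lists_length_le) simp
  then have "finite {T. set T \<subseteq> {R. set R \<subseteq> {1..n} \<and> length R \<le> n} \<and> length T \<le> n}"
    by (rule finite_lists_length_le)
  ultimately have "finite (SYT n)" by (rule finite_subset)
  then have "finite (SYT n \<times> SYT n)" by simp
  then show fin: "finite ?Z" by (rule rev_finite_subset) auto
  let ?G = "SIGMA D:diagrams n. growths n D \<times> growths n D"
  define t where "t P = (SOME T. T \<in> SYT n \<and> (\<forall>i\<in>{1..n}. pos T i = P i) \<and> cells T = P ` {1..n})" for P
  have t: "t P \<in> SYT n" "\<And>i. i \<in> {1..n} \<Longrightarrow> pos (t P) i = P i" "cells (t P) = P ` {1..n}" if g: "growth n P" for P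
  proof -
    obtain T where "T \<in> SYT n \<and> (\<forall>i\<in>{1..n}. pos T i = P i) \<and> cells T = P ` {1..n}"
      using SYT_of_growth[OF g] by metis
    then have "t P \<in> SYT n \<and> (\<forall>i\<in>{1..n}. pos (t P) i = P i) \<and> cells (t P) = P ` {1..n}"
      unfolding t_def by (rule someI)
    then show "t P \<in> SYT n" "\<And>i. i \<in> {1..n} \<Longrightarrow> pos (t P) i = P i" "cells (t P) = P ` {1..n}" by auto
  qed
  have "card ?G = (\<Sum>D\<in>diagrams n. card (growths n D \<times> growths n D))"
    by (rule card_SigmaI) (auto simp: finite_diagrams card_growths)
  also have "\<dots> = fact n"
    unfolding sum_num_growth_square[symmetric] by (intro sum.cong) (auto simp: card_growths card_cartesian_product)
  finally have "fact n = card ?G" by simp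
  also have "\<dots> \<le> card ?Z"
  proof (rule card_inj_on_le[OF _ _ fin])
    show "inj_on (\<lambda>(D, P, Q). (t P, t Q)) ?G"
    proof (rule inj_onI, clarsimp)
      fix D P Q D' P' Q'
      assume a: "P \<in> growths n D" "Q \<in> growths n D" "P' \<in> growths n D'" "Q' \<in> growths n D'"
        "t P = t P'" "t Q = t Q'"
      have eq: "P = P'" if "t P = t P'" "P \<in> growths n D" "P' \<in> growths n D'" for P P' D D'
      proof (rule PiE_ext[of _ "{1..n}" "\<lambda>_. UNIV"])
        show "P \<in> {1..n} \<rightarrow>\<^sub>E UNIV" "P' \<in> {1..n} \<rightarrow>\<^sub>E UNIV" using that by (auto simp: growths_def)
        fix i assume "i \<in> {1..n}"
        then show "P i = P' i" using t(2)[of P i] t(2)[of P' i] that by (auto simp: growths_def)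
      qed
      have "P = P'" using a eq[of P P' D D'] by simp
      moreover have "Q = Q'" using a eq[of Q Q' D D'] by simp
      moreover have "D = D'" using a(1,3) \<open>P = P'\<close> unfolding growths_def by blast
      ultimately show "D = D' \<and> P = P' \<and> Q = Q'" by simp
    qed
    show "(\<lambda>(D, P, Q). (t P, t Q)) ` ?G \<subseteq> ?Z"
    proof
      fix u assume "u \<in> (\<lambda>(D, P, Q). (t P, t Q)) ` ?G"
      then obtain D P Q where u: "u = (t P, t Q)" and PQ: "P \<in> growths n D" "Q \<in> growths n D" by auto
      then have g: "growth n P" "growth n Q" and "P ` {1..n} = Q ` {1..n}" unfolding growths_def by blast+
      then have "cells (t P) = cells (t Q)" using t(3)[OF g(1)] t(3)[OF g(2)] by (simp only:)
      then show "u \<in> ?Z"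
        using t(1)[OF g(1)] t(1)[OF g(2)] cells_eq_iff_shape[of "t P" n "t Q" n] u by blast
    qed
  qed
  finally show "fact n \<le> card ?Z" .
qed

section \<open>Dominance of tableaux\<close>

text \<open>Layer cake: a sum of natural numbers is the sum, over all thresholds, of the number of
  arguments whose value exceeds the threshold.\<close>

lemma sum_le_of_card_less:
  fixes f g :: "'a \<Rightarrow> nat"
  assumes fin: "finite I" and le: "\<And>j. card {i \<in> I. f i < j} \<le> card {i \<in> I. g i < j}"
  shows "sum g I \<le> sum f I"
proof -
  define J where "J = sum f I + sum g I"
  have bound: "f i \<le> J" "g i \<le> J" if "i \<in> I" for i
    unfolding J_def using member_le_sum[OF that, of f] member_le_sum[OF that, of g] fin by simp_all
  have eq: "sum h I = (\<Sum>j<J. card I - card {i \<in> I. h i < Suc j})" if h: "\<And>i. i \<in> I \<Longrightarrow> h i \<le> J" for h :: "'a \<Rightarrow> nat"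
  proof -
    have "sum h I = (\<Sum>i\<in>I. \<Sum>j<J. if j < h i then 1 else 0)"
    proof (rule sum.cong)
      fix i assume "i \<in> I"
      then have "{..<J} \<inter> {j. j < h i} = {..<h i}" using h[of i] by auto
      then show "h i = (\<Sum>j<J. if j < h i then 1 else 0)" by (simp add: sum.If_cases)
    qed simp
    also have "\<dots> = (\<Sum>j<J. \<Sum>i\<in>I. if j < h i then 1 else 0)" by (rule sum.swap)
    also have "\<dots> = (\<Sum>j<J. card I - card {i \<in> I. h i < Suc j})"
    proof (rule sum.cong)
      fix j
      have "I \<inter> {i. j < h i} = I - {i \<in> I. h i < Suc j}" by auto
      then show "(\<Sum>i\<in>I. if j < h i then 1 else 0) = card I - card {i \<in> I. h i < Suc j}"
        using fin by (simp add: sum.If_cases card_Diff_subset)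
    qed simp
    finally show ?thesis .
  qed
  have "(\<Sum>j<J. card I - card {i \<in> I. g i < Suc j}) \<le> (\<Sum>j<J. card I - card {i \<in> I. f i < Suc j})"
    using le by (intro sum_mono diff_le_mono2) simp
  then show ?thesis using eq[of f] eq[of g] bound by simp
qed

section \<open>The dominance order and its linearisation\<close>

text \<open>Dominance of tableaux, imposed on all restrictions to \<open>{1..k}\<close> at once;
  \<open>P'\<close> is the larger one, with more entries in the low rows.\<close>

definition dominated :: "nat \<Rightarrow> (nat \<Rightarrow> nat \<times> nat) \<Rightarrow> (nat \<Rightarrow> nat \<times> nat) \<Rightarrow> bool" where
  "dominated n P P' \<longleftrightarrow>
    (\<forall>k\<le>n. \<forall>j. card {i \<in> {1..k}. fst (P i) < j} \<le> card {i \<in> {1..k}. fst (P' i) < j})"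

text \<open>A number that drops whenever a growth sequence is replaced by a different one dominating
  it; equality of weights together with dominance means equality. It serves as a component of a
  lexicographic key.\<close>

definition row_weight :: "nat \<Rightarrow> (nat \<Rightarrow> nat \<times> nat) \<Rightarrow> nat" where
  "row_weight n P = (\<Sum>k\<in>{1..n}. \<Sum>i\<in>{1..k}. fst (P i))"

lemma dominated_row_weight:
  assumes "dominated n P P'"
  shows "row_weight n P' \<le> row_weight n P"
  unfolding row_weight_def
proof (rule sum_mono)
  fix k assume "k \<in> {1..n}"
  then show "(\<Sum>i\<in>{1..k}. fst (P' i)) \<le> (\<Sum>i\<in>{1..k}. fst (P i))"
    using assms by (intro sum_le_of_card_less) (auto simp: dominated_def)
qed

lemma dominated_row_eq:
  assumes dom: "dominated n P P'" and eq: "row_weight n P' = row_weight n P" and i: "i \<in> {1..n}"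
  shows "fst (P i) = fst (P' i)"
proof -
  have le: "(\<Sum>i\<in>{1..k}. fst (P' i)) \<le> (\<Sum>i\<in>{1..k}. fst (P i))" if "k \<in> {1..n}" for k
    using dom that by (intro sum_le_of_card_less) (auto simp: dominated_def)
  have "(\<Sum>i\<in>{1..k}. fst (P' i)) = (\<Sum>i\<in>{1..k}. fst (P i))" if k: "k \<in> {1..n}" for k
  proof (rule ccontr)
    assume "(\<Sum>i\<in>{1..k}. fst (P' i)) \<noteq> (\<Sum>i\<in>{1..k}. fst (P i))"
    then have "(\<Sum>i\<in>{1..k}. fst (P' i)) < (\<Sum>i\<in>{1..k}. fst (P i))" using le[OF k] by simp
    then have "row_weight n P' < row_weight n P"
      unfolding row_weight_def using k le by (intro sum_strict_mono_ex1) auto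
    with eq show False by simp
  qed
  then have e: "(\<Sum>i\<in>{1..k}. fst (P' i)) = (\<Sum>i\<in>{1..k}. fst (P i))" if "k \<le> n" for k
    using that by (cases "k = 0") auto
  obtain k where k: "i = Suc k" "k \<le> n" using i by (cases i) auto
  have "{1..Suc k} = insert (Suc k) {1..k}" by auto
  then show ?thesis using e[of "Suc k"] e[of k] k i by simp
qed

text \<open>Each row is filled from left to right, so the column of an entry is the number of
  earlier entries in its row. Hence the rows alone determine the growth sequence.\<close>

lemma growth_col:
  assumes P: "growth n P" and i: "i \<in> {1..n}"
  shows "snd (P i) = card {j \<in> {1..<i}. fst (P j) = fst (P i)}"
proof -
  obtain r c where rc: "P i = (r, c)" by fastforce
  have inj: "inj_on P {1..n}" and d: "\<And>k. k \<le> n \<Longrightarrow> downset (P ` {1..k})" using P by (auto simp: growth_def)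
  have uniq: "x = i" if "x \<in> {1..i}" "P x = (r, c)" for x
    using inj_onD[OF inj, of x i] that i rc by auto
  have "bij_betw (\<lambda>j. snd (P j)) {j \<in> {1..<i}. fst (P j) = r} {..<c}"
    unfolding bij_betw_def
  proof
    show "inj_on (\<lambda>j. snd (P j)) {j \<in> {1..<i}. fst (P j) = r}"
      using i by (intro inj_onI inj_onD[OF inj]) (auto simp: prod_eq_iff)
    show "(\<lambda>j. snd (P j)) ` {j \<in> {1..<i}. fst (P j) = r} = {..<c}"
    proof (rule subset_antisym; rule subsetI)
      fix d' assume "d' \<in> (\<lambda>j. snd (P j)) ` {j \<in> {1..<i}. fst (P j) = r}"
      then obtain j where j: "j \<in> {1..<i}" "P j = (r, d')" by force
      have "(r, d') \<in> P ` {1..i - 1}" using j by (intro image_eqI[of _ _ j]) auto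
      show "d' \<in> {..<c}"
      proof (rule ccontr)
        assume "d' \<notin> {..<c}"
        then have "(r, c) \<in> P ` {1..i - 1}"
          using downsetD[OF d[of "i - 1"] \<open>(r, d') \<in> P ` {1..i - 1}\<close>, of r c] i by auto
        then obtain x where x: "x \<in> {1..i - 1}" "P x = (r, c)" by auto
        then have "x \<in> {1..i}" "x \<noteq> i" using i by auto
        with uniq[of x] x(2) show False by simp
      qed
    next
      fix d' assume d': "d' \<in> {..<c}"
      have "(r, c) \<in> P ` {1..i}" using rc i by (intro image_eqI[of _ _ i]) auto
      then have "(r, d') \<in> P ` {1..i}" using downsetD[OF d[of i], of r c r d'] d' i by auto
      then obtain x where x: "x \<in> {1..i}" "P x = (r, d')" by auto
      then have "x \<noteq> i" using rc d' by auto
      then show "d' \<in> (\<lambda>j. snd (P j)) ` {j \<in> {1..<i}. fst (P j) = r}"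
        using x by (intro image_eqI[of _ _ x]) auto
    qed
  qed
  from bij_betw_same_card[OF this] show ?thesis using rc by simp
qed

lemma growth_eq_of_rows:
  assumes "growth n P" "growth n P'" "\<And>i. i \<in> {1..n} \<Longrightarrow> fst (P i) = fst (P' i)" "i \<in> {1..n}"
  shows "P i = P' i"
proof -
  have "{j \<in> {1..<i}. fst (P j) = fst (P i)} = {j \<in> {1..<i}. fst (P' j) = fst (P' i)}"
    using assms(3,4) by auto
  then show ?thesis
    using growth_col[OF assms(1,4)] growth_col[OF assms(2,4)] assms(3)[OF assms(4)]
    by (simp add: prod_eq_iff)
qed

lemma dominated_eq:
  assumes "growth n P" "growth n P'" "dominated n P P'" "row_weight n P' = row_weight n P" "i \<in> {1..n}"
  shows "P i = P' i"
proof (rule growth_eq_of_rows[OF assms(1,2) _ assms(5)])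
  fix j assume "j \<in> {1..n}"
  then show "fst (P j) = fst (P' j)" by (rule dominated_row_eq[OF assms(3,4)])
qed

text \<open>Count inside each column of \<open>P'\<close>. If the column reaches row
  \<open>j\<close>, then \<open>P'\<close> has entries of it in all rows below \<open>j\<close>,
  whereas \<open>P\<close> has at most one per row. Otherwise every entry of the column lies below
  row \<open>j\<close> in \<open>P'\<close> anyway.\<close>

lemma dominated_of_rows_cols:
  assumes P': "growth n P'"
    and rc: "\<And>x y. x \<in> {1..n} \<Longrightarrow> y \<in> {1..n} \<Longrightarrow> x \<noteq> y \<Longrightarrow> fst (P x) = fst (P y) \<Longrightarrow> snd (P' x) \<noteq> snd (P' y)"
  shows "dominated n P P'"
  unfolding dominated_def
proof (intro allI impI)
  fix k j assume k: "k \<le> n"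
  have inj: "inj_on P' {1..n}" and d: "downset (P' ` {1..k})" using P' k by (auto simp: growth_def)
  define X where "X = {i \<in> {1..k}. fst (P i) < j}"
  define Y where "Y = {i \<in> {1..k}. fst (P' i) < j}"
  define C where "C = (\<lambda>i. snd (P' i)) ` {1..k}"
  have fin: "finite X" "finite Y" "finite C" by (auto simp: X_def Y_def C_def)
  have col: "card {i \<in> X. snd (P' i) = c} \<le> card {i \<in> Y. snd (P' i) = c}" for c
  proof (cases "\<exists>i\<in>{1..k}. snd (P' i) = c \<and> j \<le> fst (P' i)")
    case True
    then obtain i where i: "i \<in> {1..k}" "snd (P' i) = c" "j \<le> fst (P' i)" by blast
    then have i': "(fst (P' i), c) \<in> P' ` {1..k}" by (metis image_eqI prod.collapse)
    have "inj_on (\<lambda>i. fst (P i)) {i \<in> X. snd (P' i) = c}"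
    proof (rule inj_onI, rule ccontr)
      fix x y assume "x \<in> {i \<in> X. snd (P' i) = c}" "y \<in> {i \<in> X. snd (P' i) = c}" "fst (P x) = fst (P y)" "x \<noteq> y"
      then show False using rc[of x y] k by (auto simp: X_def)
    qed
    then have "card {i \<in> X. snd (P' i) = c} = card ((\<lambda>i. fst (P i)) ` {i \<in> X. snd (P' i) = c})"
      by (rule card_image[symmetric])
    also have "\<dots> \<le> card {..<j}" by (rule card_mono) (auto simp: X_def)
    also have "\<dots> \<le> card ((\<lambda>i. fst (P' i)) ` {i \<in> Y. snd (P' i) = c})"
    proof (rule card_mono)
      show "{..<j} \<subseteq> (\<lambda>i. fst (P' i)) ` {i \<in> Y. snd (P' i) = c}"
      proof
        fix r assume r: "r \<in> {..<j}"
        then have "(r, c) \<in> P' ` {1..k}" using downsetD[OF d i', of r c] i by auto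
        then obtain x where "x \<in> {1..k}" "P' x = (r, c)" by auto
        then show "r \<in> (\<lambda>i. fst (P' i)) ` {i \<in> Y. snd (P' i) = c}"
          using r by (intro image_eqI[of _ _ x]) (auto simp: Y_def)
      qed
    qed (use fin in simp)
    also have "\<dots> \<le> card {i \<in> Y. snd (P' i) = c}" by (rule card_image_le) (use fin in simp)
    finally show ?thesis .
  next
    case False
    then show ?thesis using fin by (intro card_mono) (auto simp: X_def Y_def not_le)
  qed
  have part: "card Z = (\<Sum>c\<in>C. card {i \<in> Z. snd (P' i) = c})" if "Z \<subseteq> {1..k}" for Z
  proof -
    have "finite Z" using that by (rule finite_subset) simp
    moreover have "(\<lambda>i. snd (P' i)) ` Z \<subseteq> C" using that unfolding C_def by (rule image_mono)
    ultimately show ?thesis using sum.group[of Z C "\<lambda>i. snd (P' i)" "\<lambda>_. 1::nat"] fin(3) by simp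
  qed
  have "X \<subseteq> {1..k}" "Y \<subseteq> {1..k}" by (auto simp: X_def Y_def)
  then have "card X \<le> card Y"
    unfolding part[OF \<open>X \<subseteq> {1..k}\<close>] part[OF \<open>Y \<subseteq> {1..k}\<close>] by (intro sum_mono col)
  then show "card {i \<in> {1..k}. fst (P i) < j} \<le> card {i \<in> {1..k}. fst (P' i) < j}"
    by (simp add: X_def Y_def)
qed

section \<open>Comparing arrangements with the same content\<close>

text \<open>Values of \<open>a\<close> smaller than \<open>a k\<close> occur only before
  \<open>k\<close>, so just the level block of \<open>a k\<close> matters. Within it
  \<open>f\<close> is weakly decreasing: once a value below \<open>j\<close> has appeared, all later
  ones in the block are below \<open>j\<close> too. The initial segment therefore receives the
  smallest possible share, and any other arrangement \<open>u\<close> of the same content gives it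
  at least as much.\<close>

lemma block_card_le:
  fixes a :: "nat \<Rightarrow> int" and f :: "nat \<Rightarrow> nat" and g :: "nat \<Rightarrow> nat"
  assumes mono: "\<And>i i'. i \<in> {1..n} \<Longrightarrow> i' \<in> {1..n} \<Longrightarrow> i \<le> i' \<Longrightarrow> a i \<le> a i'"
    and dec: "\<And>i i'. i \<in> {1..n} \<Longrightarrow> i' \<in> {1..n} \<Longrightarrow> i \<le> i' \<Longrightarrow> a i = a i' \<Longrightarrow> f i' \<le> f i"
    and u: "bij_betw u {1..n} {1..n}"
    and eq: "\<And>B. card {x \<in> {1..n}. g x < j \<and> B (a (u x))} = card {i \<in> {1..n}. f i < j \<and> B (a i)}"
    and k: "k \<le> n"
  shows "card {i \<in> {1..k}. f i < j} \<le> card {x \<in> {1..n}. u x \<le> k \<and> g x < j}"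
proof (cases "k = 0")
  case False
  then have kn: "k \<in> {1..n}" using k by simp
  define t where "t = a k"
  have ux: "u x \<in> {1..n}" if "x \<in> {1..n}" for x using u that by (auto simp: bij_betw_def)
  have lt: "i \<le> k" if "i \<in> {1..n}" "a i < t" for i
    using mono[of k i] that kn by (force simp: t_def)
  have "{i \<in> {1..k}. f i < j} = {i \<in> {1..n}. f i < j \<and> a i < t} \<union> {i \<in> {1..k}. f i < j \<and> a i = t}" (is "?A = ?A1 \<union> ?A2")
    using mono[of _ k] lt k kn by (force simp: t_def)
  then have A: "card ?A = card ?A1 + card ?A2" by (simp add: card_Un_disjoint disjoint_iff)
  have "{x \<in> {1..n}. u x \<le> k \<and> g x < j} =
      {x \<in> {1..n}. g x < j \<and> a (u x) < t} \<union> {x \<in> {1..n}. u x \<le> k \<and> g x < j \<and> a (u x) = t}" (is "?B = ?B1 \<union> ?B2")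
    using mono[of _ k] lt ux kn by (force simp: t_def)
  then have B: "card ?B = card ?B1 + card ?B2" by (simp add: card_Un_disjoint disjoint_iff)
  have "card ?A2 \<le> card ?B2"
  proof (cases "?A2 = {}")
    case False
    then obtain i where i: "i \<in> {1..k}" "f i < j" "a i = t" by auto
    let ?L = "{i \<in> {1..n}. k < i \<and> a i = t}"
    let ?U = "{x \<in> {1..n}. k < u x \<and> a (u x) = t}"
    have late: "f i' < j" if "i' \<in> ?L" for i' using dec[of i i'] i that k by auto
    have "{i \<in> {1..n}. f i < j \<and> a i = t} = ?A2 \<union> ?L" using late k by auto
    then have 1: "card {i \<in> {1..n}. f i < j \<and> a i = t} = card ?A2 + card ?L"
      by (simp add: card_Un_disjoint disjoint_iff)
    have "card {x \<in> {1..n}. g x < j \<and> a (u x) = t} \<le> card (?B2 \<union> ?U)"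
      by (rule card_mono) auto
    also have "\<dots> \<le> card ?B2 + card ?U" by (rule card_Un_le)
    also have "card ?U = card ?L"
    proof (rule bij_betw_same_card[of u])
      show "bij_betw u ?U ?L"
        unfolding bij_betw_def
      proof
        show "inj_on u ?U" using u by (auto simp: bij_betw_def intro: inj_on_subset)
        show "u ` ?U = ?L"
        proof (rule subset_antisym; rule subsetI)
          fix y assume "y \<in> u ` ?U" then show "y \<in> ?L" using ux by auto
        next
          fix y assume y: "y \<in> ?L"
          then have "y \<in> u ` {1..n}" using u by (auto simp: bij_betw_def)
          then obtain x where "x \<in> {1..n}" "y = u x" by auto
          then show "y \<in> u ` ?U" using y by auto
        qed
      qed
    qed
    finally show ?thesis using 1 eq[of "\<lambda>v. v = t"] by simp
  next
    case True
    then show ?thesis by (simp only: card.empty le0)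
  qed
  then show ?thesis using A B eq[of "\<lambda>v. v < t"] by simp
qed simp

lemma downset_swap:
  assumes "downset ((\<lambda>i. (f i, g i)) ` A)"
  shows "downset ((\<lambda>i. (g i, f i)) ` A)"
proof -
  have "(c, r) \<in> (\<lambda>i. (g i, f i)) ` A \<longleftrightarrow> (r, c) \<in> (\<lambda>i. (f i, g i)) ` A" for r c by auto
  then show ?thesis using assms unfolding downset_def by blast
qed

text \<open>A form of the Gale--Ryser inequality: a set of cells whose columns are at least as far to the
  left as those of a Young diagram has its rows at least as high up.\<close>

lemma rows_of_cols_le:
  fixes f g :: "nat \<Rightarrow> nat" and f' g' :: "'a \<Rightarrow> nat"
  assumes inj: "inj_on (\<lambda>i. (f i, g i)) {1..k}" and d: "downset ((\<lambda>i. (f i, g i)) ` {1..k})"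
    and Y: "finite Y" "card Y = k" "inj_on (\<lambda>x. (f' x, g' x)) Y"
    and cols: "\<And>j. card {i \<in> {1..k}. g i < j} \<le> card {x \<in> Y. g' x < j}"
  shows "card {x \<in> Y. f' x < j} \<le> card {i \<in> {1..k}. f i < j}"
proof (cases "j = 0")
  case False
  let ?D = "(\<lambda>i. (f i, g i)) ` {1..k}"
  obtain len where mem: "\<And>r c. (r, c) \<in> ?D \<longleftrightarrow> c < len r" and anti: "antimono len"
    using downset_rows[OF _ d] by auto
  \<comment> \<open>\<open>m\<close> is the length of the shortest among the first \<open>j\<close>
    rows. These rows contain a full \<open>j\<close> by \<open>m\<close> rectangle, and every cell
    in a column from \<open>m\<close> on lies in them. So the count is exact for the diagram, while
    for \<open>Y\<close> the same decomposition is only an upper bound.\<close>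
  define m where "m = len (j - 1)"
  have m: "c < len r" if "c < m" "r < j" for r c
  proof -
    have "r \<le> j - 1" using that by simp
    from antimonoD[OF anti this] that show ?thesis by (simp add: m_def)
  qed
  have hi: "f i < j" if "i \<in> {1..k}" "m \<le> g i" for i
  proof (rule ccontr)
    assume "\<not> f i < j"
    have "(f i, g i) \<in> ?D" using that by auto
    then have "g i < len (f i)" using mem by simp
    also have "\<dots> \<le> m" using antimonoD[OF anti, of "j - 1" "f i"] \<open>\<not> f i < j\<close> by (simp add: m_def)
    finally show False using that by simp
  qed
  have "{i \<in> {1..k}. f i < j} = {i \<in> {1..k}. f i < j \<and> g i < m} \<union> {i \<in> {1..k}. m \<le> g i}"
    using hi by auto
  then have "card {i \<in> {1..k}. f i < j} = card ({i \<in> {1..k}. f i < j \<and> g i < m} \<union> {i \<in> {1..k}. m \<le> g i})" by simp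
  also have "\<dots> = card {i \<in> {1..k}. f i < j \<and> g i < m} + card {i \<in> {1..k}. m \<le> g i}"
    by (rule card_Un_disjoint) auto
  also have "card {i \<in> {1..k}. f i < j \<and> g i < m} = card ((\<lambda>i. (f i, g i)) ` {i \<in> {1..k}. f i < j \<and> g i < m})"
    by (rule card_image[symmetric]) (rule inj_on_subset[OF inj], auto)
  also have "(\<lambda>i. (f i, g i)) ` {i \<in> {1..k}. f i < j \<and> g i < m} = {..<j} \<times> {..<m}"
  proof (rule subset_antisym; rule subsetI)
    fix z assume z: "z \<in> {..<j} \<times> {..<m}"
    obtain r c where rc: "z = (r, c)" by (cases z)
    then have "z \<in> ?D" using mem m z by simp
    then show "z \<in> (\<lambda>i. (f i, g i)) ` {i \<in> {1..k}. f i < j \<and> g i < m}" using rc z by auto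
  qed auto
  finally have 1: "card {i \<in> {1..k}. f i < j} = j * m + card {i \<in> {1..k}. m \<le> g i}"
    by (simp add: card_cartesian_product)
  have e2: "{i \<in> {1..k}. m \<le> g i} = {1..k} - {i \<in> {1..k}. g i < m}" by auto
  have 2: "card {i \<in> {1..k}. m \<le> g i} = k - card {i \<in> {1..k}. g i < m}"
    unfolding e2 by (subst card_Diff_subset) auto
  have e3: "{x \<in> Y. m \<le> g' x} = Y - {x \<in> Y. g' x < m}" by auto
  have 3: "card {x \<in> Y. m \<le> g' x} = k - card {x \<in> Y. g' x < m}"
    unfolding e3 using Y(1,2) by (subst card_Diff_subset) auto
  have "card {x \<in> Y. f' x < j} \<le> card ({x \<in> Y. f' x < j \<and> g' x < m} \<union> {x \<in> Y. m \<le> g' x})"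
    by (rule card_mono) (use Y in auto)
  also have "\<dots> \<le> card {x \<in> Y. f' x < j \<and> g' x < m} + card {x \<in> Y. m \<le> g' x}" by (rule card_Un_le)
  also have "card {x \<in> Y. f' x < j \<and> g' x < m} = card ((\<lambda>x. (f' x, g' x)) ` {x \<in> Y. f' x < j \<and> g' x < m})"
    by (rule card_image[symmetric]) (rule inj_on_subset[OF Y(3)], auto)
  also have "\<dots> \<le> card ({..<j} \<times> {..<m})" by (rule card_mono) auto
  finally show ?thesis using 1 2 3 cols[of m] by (simp add: card_cartesian_product)
qed simp

text \<open>Passing from \<open>k\<close> to \<open>k + 1\<close> adds exactly the one
  \<open>x\<close> with \<open>u x = Suc k\<close> to the left-hand set, so the difference of the
  counts compares a single pair of values for every threshold.\<close>

lemma eq_of_card_less: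
  fixes f g :: "nat \<Rightarrow> nat"
  assumes u: "bij_betw u {1..n} {1..n}"
    and eq: "\<And>k j. k \<le> n \<Longrightarrow> card {x \<in> {1..n}. u x \<le> k \<and> g x < j} = card {i \<in> {1..k}. f i < j}"
    and x: "x \<in> {1..n}"
  shows "g x = f (u x)"
proof -
  have ux: "u x \<in> {1..n}" using u x by (auto simp: bij_betw_def)
  then obtain k where k: "u x = Suc k" "Suc k \<le> n" by (cases "u x") auto
  have uniq: "y = x" if "y \<in> {1..n}" "u y = Suc k" for y
    using inj_onD[OF bij_betw_imp_inj_on[OF u], of y x] that x k by simp
  have iff: "g x < j \<longleftrightarrow> f (Suc k) < j" for j
  proof -
    have card_if: "card (S \<union> (if b then {z} else {})) = card S + (if b then 1 else 0)"
      if "finite S" "z \<notin> S" for S :: "nat set" and b z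
      using that by simp
    have e1: "{y \<in> {1..n}. u y \<le> Suc k \<and> g y < j} = {y \<in> {1..n}. u y \<le> k \<and> g y < j} \<union> (if g x < j then {x} else {})"
    proof (rule Set.set_eqI)
      fix y
      show "y \<in> {y \<in> {1..n}. u y \<le> Suc k \<and> g y < j} \<longleftrightarrow>
          y \<in> {y \<in> {1..n}. u y \<le> k \<and> g y < j} \<union> (if g x < j then {x} else {})"
        using uniq[of y] k x by (cases "y = x") (auto simp: le_Suc_eq)
    qed
    have 1: "card {y \<in> {1..n}. u y \<le> Suc k \<and> g y < j} = card {y \<in> {1..n}. u y \<le> k \<and> g y < j} + (if g x < j then 1 else 0)"
      unfolding e1 by (rule card_if) (use k in auto)
    have e2: "{i \<in> {1..Suc k}. f i < j} = {i \<in> {1..k}. f i < j} \<union> (if f (Suc k) < j then {Suc k} else {})"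
      by (auto simp: le_Suc_eq)
    have 2: "card {i \<in> {1..Suc k}. f i < j} = card {i \<in> {1..k}. f i < j} + (if f (Suc k) < j then 1 else 0)"
      unfolding e2 by (rule card_if) auto
    have "k \<le> n" using k by simp
    have "(if g x < j then 1 else 0) = (if f (Suc k) < j then 1 else (0::nat))"
      using 1 2 eq[OF k(2), of j] eq[OF \<open>k \<le> n\<close>, of j] by linarith
    then show ?thesis by (simp split: if_splits)
  qed
  have "\<not> g x < f (Suc k)" "\<not> f (Suc k) < g x" using iff[of "g x"] iff[of "f (Suc k)"] by simp_all
  then show ?thesis using k by simp
qed

lemma growthD:
  assumes "growth n P" "k \<le> n"
  shows "inj_on (\<lambda>i. (fst (P i), snd (P i))) {1..k}" "downset ((\<lambda>i. (fst (P i), snd (P i))) ` {1..k})"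
proof -
  have "inj_on P {1..n}" "downset (P ` {1..k})" using assms by (auto simp: growth_def)
  moreover from this(1) have "inj_on P {1..k}" by (rule inj_on_subset) (use assms in auto)
  ultimately show "inj_on (\<lambda>i. (fst (P i), snd (P i))) {1..k}"
    "downset ((\<lambda>i. (fst (P i), snd (P i))) ` {1..k})" by simp_all
qed

text \<open>A sandwich on the preimage of \<open>{1..k}\<close> under \<open>u\<close>. The blocks
  of \<open>a\<close> put at least as many cells of \<open>Q\<close> as of \<open>P\<close> into the
  low rows; the blocks of \<open>c\<close> do the same for the columns of \<open>Q\<close> and
  \<open>P'\<close>; and the Gale--Ryser estimate converts the column statement into an upper bound
  for the rows of \<open>Q\<close> by those of \<open>P'\<close>. If \<open>P\<close> and
  \<open>P'\<close> agree, everything is an equality and \<open>Q\<close> is \<open>P'\<close> read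
  along \<open>u\<close>.\<close>

lemma contents_dominated:
  fixes a c :: "nat \<Rightarrow> int"
  assumes P': "growth n P'" and Q: "inj_on Q {1..n}" and u: "bij_betw u {1..n} {1..n}"
    and a: "\<And>i i'. i \<in> {1..n} \<Longrightarrow> i' \<in> {1..n} \<Longrightarrow> i \<le> i' \<Longrightarrow> a i \<le> a i'"
      "\<And>i i'. i \<in> {1..n} \<Longrightarrow> i' \<in> {1..n} \<Longrightarrow> i \<le> i' \<Longrightarrow> a i = a i' \<Longrightarrow> fst (P i') \<le> fst (P i)"
    and c: "\<And>i i'. i \<in> {1..n} \<Longrightarrow> i' \<in> {1..n} \<Longrightarrow> i \<le> i' \<Longrightarrow> c i \<le> c i'"
      "\<And>i i'. i \<in> {1..n} \<Longrightarrow> i' \<in> {1..n} \<Longrightarrow> i \<le> i' \<Longrightarrow> c i = c i' \<Longrightarrow> snd (P' i') \<le> snd (P' i)"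
    and rows: "\<And>j B. card {x \<in> {1..n}. fst (Q x) < j \<and> B (a (u x))} = card {i \<in> {1..n}. fst (P i) < j \<and> B (a i)}"
    and cols: "\<And>j B. card {x \<in> {1..n}. snd (Q x) < j \<and> B (c (u x))} = card {i \<in> {1..n}. snd (P' i) < j \<and> B (c i)}"
  shows "dominated n P P'"
    and "(\<And>i. i \<in> {1..n} \<Longrightarrow> P i = P' i) \<Longrightarrow> x \<in> {1..n} \<Longrightarrow> Q x = P' (u x)"
proof -
  define Y where "Y k = {x \<in> {1..n}. u x \<le> k}" for k
  have YB: "{x \<in> Y k. B x} = {x \<in> {1..n}. u x \<le> k \<and> B x}" for k B by (auto simp: Y_def)
  have Y: "finite (Y k)" "card (Y k) = k" "inj_on (\<lambda>x. (fst (Q x), snd (Q x))) (Y k)"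
    "inj_on (\<lambda>x. (snd (Q x), fst (Q x))) (Y k)" if "k \<le> n" for k
  proof -
    show "finite (Y k)" by (simp add: Y_def)
    have "u ` Y k = {1..k}"
    proof (rule subset_antisym; rule subsetI)
      fix y assume "y \<in> u ` Y k" then show "y \<in> {1..k}" using u by (auto simp: Y_def bij_betw_def)
    next
      fix y assume y: "y \<in> {1..k}"
      then have "y \<in> u ` {1..n}" using u that by (auto simp: bij_betw_def)
      then obtain x where "x \<in> {1..n}" "y = u x" by auto
      then show "y \<in> u ` Y k" using y by (auto simp: Y_def)
    qed
    moreover have "inj_on u (Y k)" using u by (auto simp: Y_def bij_betw_def intro: inj_on_subset)
    ultimately show "card (Y k) = k" by (metis card_atLeastAtMost card_image diff_Suc_1)
    show "inj_on (\<lambda>x. (fst (Q x), snd (Q x))) (Y k)" 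
      by (intro inj_onI inj_onD[OF Q]) (auto simp: Y_def)
    show "inj_on (\<lambda>x. (snd (Q x), fst (Q x))) (Y k)" 
      by (intro inj_onI inj_onD[OF Q]) (auto simp: Y_def prod_eq_iff)
  qed
  have 1: "card {i \<in> {1..k}. fst (P i) < j} \<le> card {x \<in> Y k. fst (Q x) < j}" if "k \<le> n" for k j
    unfolding YB by (rule block_card_le[where a = a, OF a u rows that]) auto
  have 2: "card {i \<in> {1..k}. snd (P' i) < j} \<le> card {x \<in> Y k. snd (Q x) < j}" if "k \<le> n" for k j
    unfolding YB by (rule block_card_le[where a = c, OF c u cols that]) auto
  have 3: "card {x \<in> Y k. fst (Q x) < j} \<le> card {i \<in> {1..k}. fst (P' i) < j}" if "k \<le> n" for k j
    by (rule rows_of_cols_le[OF growthD[OF P' that] Y(1-3)[OF that] 2[OF that]])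
  show "dominated n P P'"
    unfolding dominated_def using 1 3 order_trans by blast
  assume e: "\<And>i. i \<in> {1..n} \<Longrightarrow> P i = P' i" and x: "x \<in> {1..n}"
  have e': "{i \<in> {1..k}. fst (P i) < j} = {i \<in> {1..k}. fst (P' i) < j}" if "k \<le> n" for k j
  proof (rule Collect_cong)
    fix i show "(i \<in> {1..k} \<and> fst (P i) < j) = (i \<in> {1..k} \<and> fst (P' i) < j)"
      using e[of i] that by (cases "i \<in> {1..k}") auto
  qed
  have 4: "card {x \<in> Y k. fst (Q x) < j} = card {i \<in> {1..k}. fst (P' i) < j}" if "k \<le> n" for k j
    using 1[OF that, of j] 3[OF that, of j] unfolding e'[OF that] by simp
  have inj': "inj_on (\<lambda>i. (snd (P' i), fst (P' i))) {1..k}" if "k \<le> n" for k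
    by (intro inj_onI inj_onD[OF growthD(1)[OF P' that]]) auto
  \<comment> \<open>The row counts now agree, so the same estimate applies with rows and columns
    exchanged.\<close>
  have 5: "card {x \<in> Y k. snd (Q x) < j} \<le> card {i \<in> {1..k}. snd (P' i) < j}" if "k \<le> n" for k j
    by (rule rows_of_cols_le[OF inj'[OF that] downset_swap[OF growthD(2)[OF P' that]] Y(1,2,4)[OF that]])
      (simp add: 4[OF that])
  have 6: "card {x \<in> Y k. snd (Q x) < j} = card {i \<in> {1..k}. snd (P' i) < j}" if "k \<le> n" for k j
    using 2[OF that, of j] 5[OF that, of j] by simp
  have "fst (Q x) = fst (P' (u x))"
    by (rule eq_of_card_less[OF u _ x]) (use 4 in \<open>simp add: YB\<close>)
  moreover have "snd (Q x) = snd (P' (u x))"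
    by (rule eq_of_card_less[OF u _ x]) (use 6 in \<open>simp add: YB\<close>)
  ultimately show "Q x = P' (u x)" by (simp add: prod_eq_iff)
qed

section \<open>The two kinds of cocharge steps\<close>

text \<open>Were \<open>i + 1\<close> strictly north and strictly east of \<open>i\<close>, the cell
  in the row of \<open>i\<close> and the column of \<open>i + 1\<close> would be occupied before
  \<open>i\<close>. Being further east in that row, it would force the cell of \<open>i\<close> to
  be occupied earlier as well.\<close>

lemma growth_step:
  assumes P: "growth n P" and i: "1 \<le> i" "Suc i \<le> n"
    and nSE: "\<not> (fst (P (Suc i)) \<le> fst (P i) \<and> snd (P (Suc i)) \<ge> snd (P i))"
  shows "snd (P (Suc i)) \<le> snd (P i)"
proof (rule ccontr)
  assume c: "\<not> snd (P (Suc i)) \<le> snd (P i)"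
  then have r: "fst (P i) < fst (P (Suc i))" using nSE by simp
  have inj: "inj_on P {1..n}" and d: "\<And>k. k \<le> n \<Longrightarrow> downset (P ` {1..k})" using P by (auto simp: growth_def)
  have "P (Suc i) \<in> P ` {1..Suc i}" by simp
  then have "(fst (P i), snd (P (Suc i))) \<in> P ` {1..Suc i}"
    using downsetD[OF d[of "Suc i"], of "fst (P (Suc i))" "snd (P (Suc i))"] r i by simp
  then obtain x where x: "x \<in> {1..Suc i}" "P x = (fst (P i), snd (P (Suc i)))" by auto
  have "x \<noteq> Suc i" using arg_cong[OF x(2), of fst] r by (metis fst_conv less_irrefl)
  moreover have "x \<noteq> i" using arg_cong[OF x(2), of snd] c by (metis snd_conv order_refl)
  ultimately
  have "x \<in> {1..i - 1}" using x(1) by auto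
  then have *: "(fst (P i), snd (P (Suc i))) \<in> P ` {1..i - 1}" using x by (metis image_eqI)
  have "(fst (P i), snd (P i)) \<in> P ` {1..i - 1}"
    by (rule downsetD[OF d *]) (use i c in simp_all)
  then obtain y where y: "y \<in> {1..i - 1}" "P y = P i" by auto
  then have "y \<in> {1..n}" "y \<noteq> i" using i by auto
  then show False using inj_onD[OF inj y(2)] i by simp
qed

text \<open>At each step exactly one of the cocharge and its complement in \<open>i\<close> stays
  constant. The first case never moves up, the second never moves right; these become the two block
  structures needed for the sandwich.\<close>

lemma cocharge_step:
  assumes T: "T \<in> SYT n" and i: "1 \<le> i" "Suc i \<le> n"
  shows "cocharge T (Suc i) = cocharge T i \<and> fst (pos T (Suc i)) \<le> fst (pos T i) \<or>
    cocharge T (Suc i) = Suc (cocharge T i) \<and> snd (pos T (Suc i)) \<le> snd (pos T i)"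
proof -
  obtain l where l: "i = Suc l" using i by (cases i) auto
  show ?thesis
  proof (cases "weakly_SE T (Suc i) i")
    case True
    then show ?thesis unfolding l by (simp add: weakly_SE_def pos_def)
  next
    case False
    then have "snd (pos T (Suc i)) \<le> snd (pos T i)"
      using growth_step[OF growth_pos[OF T] i] by (auto simp: weakly_SE_def pos_def)
    then show ?thesis using False unfolding l by simp
  qed
qed

lemma block_from_steps:
  fixes a :: "nat \<Rightarrow> int" and f :: "nat \<Rightarrow> nat"
  assumes step: "\<And>i. 1 \<le> i \<Longrightarrow> Suc i \<le> n \<Longrightarrow> a i \<le> a (Suc i) \<and> (a (Suc i) = a i \<longrightarrow> f (Suc i) \<le> f i)"
    and i: "1 \<le> i" "i \<le> i'" "i' \<le> n"
  shows "a i \<le> a i' \<and> (a i = a i' \<longrightarrow> f i' \<le> f i)"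
  using i(2,3)
proof (induction i' rule: dec_induct)
  case (step m)
  have "a i \<le> a m \<and> (a i = a m \<longrightarrow> f m \<le> f i)" using step by simp
  moreover have "a m \<le> a (Suc m) \<and> (a (Suc m) = a m \<longrightarrow> f (Suc m) \<le> f m)"
    using assms(1)[of m] step i by simp
  ultimately show ?case by auto
qed simp

section \<open>Polynomials acting on antisymmetric coefficients\<close>

abbreviation lkp :: "('a \<Rightarrow>\<^sub>0 'b::zero) \<Rightarrow> 'a \<Rightarrow> 'b" where "lkp \<equiv> Poly_Mapping.lookup"

text \<open>Monomials without a factor \<open>x\<^sub>i y\<^sub>i\<close> are encoded by integer exponents, a negative one
  belonging to \<open>y\<^sub>i\<close>. All other monomials act as zero on the determinant.\<close>

definition mon :: "nat \<Rightarrow> (nat \<Rightarrow> int) \<Rightarrow> monom" where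
  "mon n e = (\<Sum>i\<in>{1..n}. Poly_Mapping.single (Xvar i) (nat (e i)) + Poly_Mapping.single (Yvar i) (nat (- e i)))"

lemma lookup_mon [simp]:
  "lkp (mon n e) (Xvar i) = (if i \<in> {1..n} then nat (e i) else 0)"
  "lkp (mon n e) (Yvar i) = (if i \<in> {1..n} then nat (- e i) else 0)"
  by (simp_all add: mon_def lookup_sum lookup_add lookup_single when_def)

lemma vars_set: "set (xvars n @ yvars n) = Xvar ` {1..n} \<union> Yvar ` {1..n}"
  by (auto simp: xvars_def yvars_def)

lemma keys_mon: "Poly_Mapping.keys (mon n e) \<subseteq> set (xvars n @ yvars n)"
proof
  fix v assume "v \<in> Poly_Mapping.keys (mon n e)"
  then show "v \<in> set (xvars n @ yvars n)"
    unfolding vars_set by (cases v) (auto simp: in_keys_iff split: if_splits)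
qed

lemma monom_eqI:
  assumes "\<And>i. lkp a (Xvar i) = lkp b (Xvar i)" "\<And>i. lkp a (Yvar i) = lkp b (Yvar i)"
  shows "a = b"
proof (rule poly_mapping_eqI)
  fix v show "lkp a v = lkp b v" using assms by (cases v) auto
qed

lemma mon_cong: "(\<And>i. i \<in> {1..n} \<Longrightarrow> e i = e' i) \<Longrightarrow> mon n e = mon n e'"
  by (intro monom_eqI) auto

text \<open>If a product of two such monomials is of the same kind, no index receives both an
  \<open>x\<close> and a \<open>y\<close>; hence the signs agree and the integer exponents simply
  add.\<close>

lemma mon_add_eqD:
  assumes "mon n a + mon n c = mon n b" "i \<in> {1..n}"
  shows "a i + c i = b i" "0 \<le> a i \<and> 0 \<le> c i \<or> a i \<le> 0 \<and> c i \<le> 0"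
proof -
  have "nat (a i) + nat (c i) = nat (b i)" "nat (- a i) + nat (- c i) = nat (- b i)"
    using arg_cong[OF assms(1), of "\<lambda>m. lkp m (Xvar i)"] arg_cong[OF assms(1), of "\<lambda>m. lkp m (Yvar i)"] assms(2)
    by (simp_all add: lookup_add)
  then show "a i + c i = b i" "0 \<le> a i \<and> 0 \<le> c i \<or> a i \<le> 0 \<and> c i \<le> 0" by linarith+
qed

lemma mon_eqD:
  assumes "mon n a = mon n b" "i \<in> {1..n}"
  shows "a i = b i"
proof -
  have "mon n a + mon n (\<lambda>_. 0) = mon n b"
    using assms(1) by (intro monom_eqI) (simp_all add: lookup_add)
  from mon_add_eqD(1)[OF this assms(2)] show ?thesis by simp
qed

lemma mon_add:
  assumes "\<And>i. i \<in> {1..n} \<Longrightarrow> 0 \<le> a i \<and> 0 \<le> c i \<or> a i \<le> 0 \<and> c i \<le> 0"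
  shows "mon n a + mon n c = mon n (\<lambda>i. a i + c i)"
proof -
  have "nat (a i) + nat (c i) = nat (a i + c i) \<and> nat (- a i) + nat (- c i) = nat (- (a i + c i))"
    if "i \<in> {1..n}" for i
    using assms[OF that] by linarith
  then show ?thesis by (intro monom_eqI) (auto simp: lookup_add)
qed

text \<open>Divisors of a monomial without mixed factors have none either; dividing moves each
  exponent towards 0 without crossing it.\<close>

lemma add_eq_monD:
  assumes "a + b = mon n \<beta>"
  obtains e where "b = mon n e" "\<And>i. i \<in> {1..n} \<Longrightarrow> 0 \<le> e i \<and> e i \<le> \<beta> i \<or> \<beta> i \<le> e i \<and> e i \<le> 0"
proof
  define e where "e i = int (lkp b (Xvar i)) - int (lkp b (Yvar i))" for i
  have *: "lkp a v + lkp b v = lkp (mon n \<beta>) v" for v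
    using arg_cong[OF assms, of "\<lambda>m. lkp m v"] by (simp add: lookup_add)
  have X: "lkp a (Xvar i) + lkp b (Xvar i) = (if i \<in> {1..n} then nat (\<beta> i) else 0)"
    and Y: "lkp a (Yvar i) + lkp b (Yvar i) = (if i \<in> {1..n} then nat (- \<beta> i) else 0)" for i
    using *[of "Xvar i"] *[of "Yvar i"] by simp_all
  show "b = mon n e"
  proof (rule monom_eqI)
    fix i
    show "lkp b (Xvar i) = lkp (mon n e) (Xvar i)" "lkp b (Yvar i) = lkp (mon n e) (Yvar i)"
      using X[of i] Y[of i] by (auto simp: e_def split: if_splits)
  qed
  fix i assume "i \<in> {1..n}"
  then show "0 \<le> e i \<and> e i \<le> \<beta> i \<or> \<beta> i \<le> e i \<and> e i \<le> 0"
    using X[of i] Y[of i] by (simp add: e_def) linarith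
qed

definition permvar :: "(nat \<Rightarrow> nat) \<Rightarrow> xyvar \<Rightarrow> xyvar" where
  "permvar w v = (case v of Xvar i \<Rightarrow> Xvar (w i) | Yvar i \<Rightarrow> Yvar (w i))"

lemma permvar_simps [simp]: "permvar w (Xvar i) = Xvar (w i)" "permvar w (Yvar i) = Yvar (w i)"
  by (simp_all add: permvar_def)

definition permmon :: "(nat \<Rightarrow> nat) \<Rightarrow> monom \<Rightarrow> monom" where
  "permmon w b = Poly_Mapping.map_key (permvar w) b"

lemma inj_permvar:
  assumes "w permutes A" shows "inj (permvar w)"
proof (rule injI)
  fix u v assume "permvar w u = permvar w v"
  then show "u = v" using permutes_inj[OF assms] by (cases u; cases v) (auto dest: injD)
qed

lemma lookup_permmon:
  assumes "w permutes A" shows "lkp (permmon w b) v = lkp b (permvar w v)"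
  unfolding permmon_def by (simp add: Poly_Mapping.map_key.rep_eq[OF inj_permvar[OF assms]])

lemma permmon_add: "w permutes A \<Longrightarrow> permmon w (a + b) = permmon w a + permmon w b"
  by (rule poly_mapping_eqI) (simp add: lookup_permmon lookup_add)

lemma permmon_mon:
  assumes "w permutes {1..n}" shows "permmon w (mon n e) = mon n (\<lambda>i. e (w i))"
  using permutes_in_image[OF assms] by (intro monom_eqI) (simp_all add: lookup_permmon[OF assms])

lemma permmon_inv:
  assumes w: "w permutes A"
  shows "permmon w (permmon (inv_into UNIV w) b) = b" "permmon (inv_into UNIV w) (permmon w b) = b"
  by (intro monom_eqI; simp add: lookup_permmon[OF w] lookup_permmon[OF permutes_inv[OF w]] permutes_inverses[OF w])+

section \<open>The shift action, antisymmetry and symmetric operators\<close>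

text \<open>The differential operator stripped of its factorials: the monomial \<open>a\<close>
  makes the coefficient at \<open>b\<close> read the one at \<open>a + b\<close>.\<close>

definition act :: "xypoly \<Rightarrow> (monom \<Rightarrow> complex) \<Rightarrow> monom \<Rightarrow> complex" where
  "act P \<phi> b = (\<Sum>a\<in>Poly_Mapping.keys P. lkp P a * \<phi> (a + b))"

lemma act_superset:
  assumes "finite A" "Poly_Mapping.keys P \<subseteq> A"
  shows "act P \<phi> b = (\<Sum>a\<in>A. lkp P a * \<phi> (a + b))"
  unfolding act_def using assms by (intro sum.mono_neutral_left) (auto simp: in_keys_iff)

lemma act_add: "act (P + Q) \<phi> b = act P \<phi> b + act Q \<phi> b"
proof -
  let ?A = "Poly_Mapping.keys P \<union> Poly_Mapping.keys Q"
  have "Poly_Mapping.keys (P + Q) \<subseteq> ?A" by (rule Poly_Mapping.keys_add)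
  then show ?thesis
    by (simp add: act_superset[of ?A] lookup_add algebra_simps sum.distrib)
qed

lemma act_0 [simp]: "act 0 \<phi> b = 0"
  by (simp add: act_def)

lemma act_sum: "act (sum P A) \<phi> b = (\<Sum>i\<in>A. act (P i) \<phi> b)"
  by (induction A rule: infinite_finite_induct) (simp_all add: act_add)

lemma act_single: "act (Poly_Mapping.single a c) \<phi> b = c * \<phi> (a + b)"
  by (simp add: act_def)

lemma act_const: "act (const c) \<phi> b = c * \<phi> b"
  by (simp add: const_def act_single)

lemma act_1 [simp]: "act 1 \<phi> = \<phi>"
  using act_const[of 1 \<phi>] by (simp add: const_simps fun_eq_iff)

lemma act_mult: "act (P * Q) \<phi> = act P (act Q \<phi>)"
proof
  fix b
  have "P * Q = (\<Sum>a\<in>Poly_Mapping.keys P. \<Sum>c\<in>Poly_Mapping.keys Q.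
      Poly_Mapping.single (a + c) (lkp P a * lkp Q c))"
    by (subst (1) sum_of_monoms[of P, symmetric], subst (1) sum_of_monoms[of Q, symmetric])
      (simp add: sum_product mult_single)
  then have "act (P * Q) \<phi> b = (\<Sum>a\<in>Poly_Mapping.keys P. \<Sum>c\<in>Poly_Mapping.keys Q.
      lkp P a * lkp Q c * \<phi> (a + c + b))"
    by (simp add: act_sum act_single)
  also have "\<dots> = act P (act Q \<phi>) b"
    unfolding act_def by (simp add: sum_distrib_left mult.assoc add_ac)
  finally show "act (P * Q) \<phi> b = act P (act Q \<phi>) b" .
qed

lemma act_const_mult: "act (const c * P) \<phi> b = c * act P \<phi> b"
  by (simp add: act_mult act_const)

lemma act_uminus: "act (- P) \<phi> b = - act P \<phi> b"
  using act_add[of P "- P" \<phi> b] by (simp add: eq_neg_iff_add_eq_0 add.commute)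

lemma act_diff: "act (P - Q) \<phi> b = act P \<phi> b - act Q \<phi> b"
  using act_add[of P "- Q" \<phi> b] by (simp add: act_uminus)

definition antisym_fun :: "nat \<Rightarrow> (monom \<Rightarrow> complex) \<Rightarrow> bool" where
  "antisym_fun n \<phi> \<longleftrightarrow> (\<forall>w b. w permutes {1..n} \<longrightarrow> \<phi> (permmon w b) = of_int (sign w) * \<phi> b)"

text \<open>Symmetry expressed by its effect on antisymmetric functions, the form in which it is
  applied. Closure under products is then immediate from the multiplicativity of the action.\<close>

definition symm :: "nat \<Rightarrow> xypoly \<Rightarrow> bool" where
  "symm n s \<longleftrightarrow> s \<in> carrier (xy_ring n) \<and> (\<forall>\<phi>. antisym_fun n \<phi> \<longrightarrow> antisym_fun n (act s \<phi>))"

lemma antisym_funD: "antisym_fun n \<phi> \<Longrightarrow> w permutes {1..n} \<Longrightarrow> \<phi> (permmon w b) = of_int (sign w) * \<phi> b"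
  by (simp add: antisym_fun_def)

lemma antisym_fun_mon:
  "antisym_fun n \<phi> \<Longrightarrow> w permutes {1..n} \<Longrightarrow> \<phi> (mon n (\<lambda>i. e (w i))) = of_int (sign w) * \<phi> (mon n e)"
  using antisym_funD[of n \<phi> w "mon n e"] by (simp add: permmon_mon)

lemma antisym_fun_eq_0:
  assumes "antisym_fun n \<phi>" "i \<in> {1..n}" "j \<in> {1..n}" "i \<noteq> j" "e i = e j"
  shows "\<phi> (mon n e) = 0"
proof -
  have w: "transpose i j permutes {1..n}" by (rule permutes_swap_id[OF assms(2,3)])
  have "(\<lambda>k. e (transpose i j k)) = e"
    using assms(5) by (auto simp: transpose_def)
  then have "\<phi> (mon n e) = - \<phi> (mon n e)"
    using antisym_fun_mon[OF assms(1) w, of e] assms(4) by (simp add: sign_swap_id)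
  then show ?thesis by simp
qed

lemma symmD: "symm n s \<Longrightarrow> antisym_fun n \<phi> \<Longrightarrow> antisym_fun n (act s \<phi>)"
  by (simp add: symm_def)

lemma symm_carrier: "symm n s \<Longrightarrow> s \<in> carrier (xy_ring n)"
  by (simp add: symm_def)

lemma symm_const: "symm n (const c)"
  by (simp add: symm_def antisym_fun_def act_const)

lemma symm_0: "symm n 0" using symm_const[of n 0] by (simp add: const_simps)
lemma symm_1: "symm n 1" using symm_const[of n 1] by (simp add: const_simps)

lemma symm_add: "symm n s \<Longrightarrow> symm n t \<Longrightarrow> symm n (s + t)"
  by (simp add: symm_def antisym_fun_def act_add xy_ring_closed distrib_left)

lemma symm_mult: "symm n s \<Longrightarrow> symm n t \<Longrightarrow> symm n (s * t)"
  by (simp add: symm_def act_mult xy_ring_closed)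

lemma symm_uminus: "symm n s \<Longrightarrow> symm n (- s)"
  using xy_ring_closed(3)[of s n s] by (simp add: symm_def antisym_fun_def act_uminus)

lemma symm_diff: "symm n s \<Longrightarrow> symm n t \<Longrightarrow> symm n (s - t)"
  using symm_add[of n s "- t"] symm_uminus[of n t] by simp

lemma symm_sum: "(\<And>i. i \<in> A \<Longrightarrow> symm n (f i)) \<Longrightarrow> symm n (sum f A)"
  by (induction A rule: infinite_finite_induct) (simp_all add: symm_0 symm_add)

lemma symm_prod_list: "(\<And>s. s \<in> set xs \<Longrightarrow> symm n s) \<Longrightarrow> symm n (prod_list xs)"
  by (induction xs) (simp_all add: symm_1 symm_mult)

lemma symm_monom_sum:
  assumes fin: "finite A" and A: "\<And>a. a \<in> A \<Longrightarrow> Poly_Mapping.keys a \<subseteq> set (xvars n @ yvars n)"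
    and perm: "\<And>w a. w permutes {1..n} \<Longrightarrow> a \<in> A \<Longrightarrow> permmon w a \<in> A"
  shows "symm n (\<Sum>a\<in>A. Poly_Mapping.single a 1)"
  unfolding symm_def
proof (intro conjI allI impI)
  have "Poly_Mapping.keys (\<Sum>a\<in>A. Poly_Mapping.single a (1::complex)) \<subseteq> A"
    by (auto simp: in_keys_iff lookup_sum lookup_single when_def fin split: if_splits)
  then show "(\<Sum>a\<in>A. Poly_Mapping.single a 1) \<in> carrier (xy_ring n)"
    using A unfolding carrier_xy_ring by blast
  fix \<phi> assume \<phi>: "antisym_fun n \<phi>"
  show "antisym_fun n (act (\<Sum>a\<in>A. Poly_Mapping.single a 1) \<phi>)"
    unfolding antisym_fun_def
  proof (intro allI impI)
    fix w b assume w: "w permutes {1..n}"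
    have "(\<Sum>a\<in>A. \<phi> (a + permmon w b)) = (\<Sum>a\<in>A. \<phi> (permmon w (a + b)))"
    proof (rule sum.reindex_bij_witness[of _ "permmon w" "permmon (inv_into UNIV w)"])
      fix a assume "a \<in> A"
      then show "permmon (inv_into UNIV w) a \<in> A" "permmon w a \<in> A"
        using perm w permutes_inv[OF w] by auto
      show "permmon w (permmon (inv_into UNIV w) a) = a" "permmon (inv_into UNIV w) (permmon w a) = a"
        by (rule permmon_inv[OF w])+
      show "\<phi> (permmon w (permmon (inv_into UNIV w) a + b)) = \<phi> (a + permmon w b)"
        by (simp add: permmon_add[OF w] permmon_inv[OF w])
    qed
    then show "act (\<Sum>a\<in>A. Poly_Mapping.single a 1) \<phi> (permmon w b) =
        of_int (sign w) * act (\<Sum>a\<in>A. Poly_Mapping.single a 1) \<phi> b"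
      by (simp add: act_sum act_single antisym_funD[OF \<phi> w] sum_distrib_left)
  qed
qed

section \<open>The determinant as an antisymmetric function\<close>

text \<open>The coefficient function of a determinant whose entries are powers with the integer
  exponents \<open>\<alpha>\<close>, negative ones being powers of the \<open>y\<close>
  variables.\<close>

definition eps :: "nat \<Rightarrow> (nat \<Rightarrow> int) \<Rightarrow> monom \<Rightarrow> complex" where
  "eps n \<alpha> b = (\<Sum>w | w permutes {1..n}. if b = mon n (\<lambda>i. \<alpha> (w i)) then of_int (sign w) else 0)"

lemma antisym_eps: "antisym_fun n (eps n \<alpha>)"
  unfolding antisym_fun_def
proof (intro allI impI)
  fix w b assume w: "w permutes {1..n}"
  let ?P = "{w. w permutes {1..n}}"
  have "eps n \<alpha> (permmon w b) = (\<Sum>v\<in>?P. if permmon w b = mon n (\<lambda>i. \<alpha> ((v \<circ> w) i)) then of_int (sign (v \<circ> w)) else 0)"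
    unfolding eps_def by (rule sum_permutations_compose_right[OF w])
  also have "\<dots> = (\<Sum>v\<in>?P. of_int (sign w) * (if b = mon n (\<lambda>i. \<alpha> (v i)) then of_int (sign v) else 0))"
  proof (rule sum.cong)
    fix v assume v: "v \<in> ?P"
    have "mon n (\<lambda>i. \<alpha> ((v \<circ> w) i)) = permmon w (mon n (\<lambda>i. \<alpha> (v i)))" by (simp add: permmon_mon[OF w])
    moreover have "permmon w b = permmon w c \<longleftrightarrow> b = c" for c by (metis permmon_inv(2)[OF w])
    moreover have "sign (v \<circ> w) = sign v * sign w"
      using v w by (intro sign_compose) (auto intro: permutation_permutes[THEN iffD2])
    ultimately show "(if permmon w b = mon n (\<lambda>i. \<alpha> ((v \<circ> w) i)) then of_int (sign (v \<circ> w)) else 0) =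
        of_int (sign w) * (if b = mon n (\<lambda>i. \<alpha> (v i)) then of_int (sign v) else (0::complex))"
      by (simp add: mult.commute)
  qed simp
  finally show "eps n \<alpha> (permmon w b) = of_int (sign w) * eps n \<alpha> b"
    by (simp add: eps_def sum_distrib_left)
qed

lemma eps_neq_0D:
  assumes "eps n \<alpha> b \<noteq> 0"
  shows "\<exists>w. w permutes {1..n} \<and> b = mon n (\<lambda>i. \<alpha> (w i))"
proof (rule ccontr)
  assume "\<not> ?thesis"
  then have "eps n \<alpha> b = 0" unfolding eps_def by (intro sum.neutral) auto
  with assms show False by simp
qed

lemma eps_mon_perm:
  assumes inj: "inj_on \<alpha> {1..n}" and w: "w permutes {1..n}"
  shows "eps n \<alpha> (mon n (\<lambda>i. \<alpha> (w i))) = of_int (sign w)"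
proof -
  have "mon n (\<lambda>i. \<alpha> (w i)) = mon n (\<lambda>i. \<alpha> (v i)) \<longleftrightarrow> v = w" if v: "v permutes {1..n}" for v
  proof
    assume eq: "mon n (\<lambda>i. \<alpha> (w i)) = mon n (\<lambda>i. \<alpha> (v i))"
    show "v = w"
    proof
      fix i show "v i = w i"
      proof (cases "i \<in> {1..n}")
        case True
        then have "\<alpha> (w i) = \<alpha> (v i)" using mon_eqD[OF eq] by simp
        then show ?thesis using inj_onD[OF inj] permutes_in_image[OF v] permutes_in_image[OF w] True by metis
      next
        case False
        then show ?thesis using permutes_not_in[OF v] permutes_not_in[OF w] by metis
      qed
    qed
  qed simp
  then have "eps n \<alpha> (mon n (\<lambda>i. \<alpha> (w i))) = (\<Sum>v | v permutes {1..n}. if v = w then of_int (sign v) else 0)"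
    unfolding eps_def by (intro sum.cong) auto
  also have "\<dots> = of_int (sign w)" using w by (simp add: finite_permutations)
  finally show ?thesis .
qed

lemma act_eps_neq_0D:
  assumes "act P (eps n \<alpha>) b \<noteq> 0"
  obtains a w where "a \<in> Poly_Mapping.keys P" "w permutes {1..n}" "a + b = mon n (\<lambda>i. \<alpha> (w i))"
proof -
  obtain a where "a \<in> Poly_Mapping.keys P" "lkp P a * eps n \<alpha> (a + b) \<noteq> 0"
    using assms unfolding act_def by (meson sum.not_neutral_contains_not_neutral)
  with eps_neq_0D[of n \<alpha> "a + b"] that show thesis by auto
qed

lemma prod_single_1:
  "finite A \<Longrightarrow> (\<Prod>i\<in>A. Poly_Mapping.single (f i) (1::complex)) = Poly_Mapping.single (\<Sum>i\<in>A. f i) 1"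
  by (induction A rule: finite_induct) (simp_all add: mult_single)

lemma var_power: "var v ^ k = Poly_Mapping.single (Poly_Mapping.single v k) 1"
  by (induction k) (simp_all add: var_def mult_single single_add[symmetric])

lemma lookup_hollow_det:
  assumes \<alpha>: "\<And>i. i < n \<Longrightarrow> hollow \<gamma> ! i = (nat (\<alpha> (Suc i)), nat (- \<alpha> (Suc i)))"
  shows "lkp (hollow_det n \<gamma>) b = eps n \<alpha> b"
proof -
  let ?A = "mat n n (\<lambda>(i, j). var (Xvar (Suc j)) ^ fst (hollow \<gamma> ! i) * var (Yvar (Suc j)) ^ snd (hollow \<gamma> ! i))"
  \<comment> \<open>Transports a permutation of the matrix indices \<open>0..<n\<close> to the
    variable indices \<open>1..n\<close>.\<close>
  let ?g = "\<lambda>p x. if x \<in> {1..n} then Suc (p (inv_into {0..<n} Suc x)) else x"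
  have bij: "bij_betw Suc {0..<n} {1..n}" by (auto simp: bij_betw_def image_Suc_atLeastLessThan)
  have inv: "inv_into {0..<n} Suc x = x - 1" if "x \<in> {1..n}" for x
    by (rule inv_into_f_eq) (use that in auto)
  have "hollow_det n \<gamma> = det (transpose_mat ?A)"
    unfolding hollow_det_def by (rule det_transpose[of _ n, symmetric]) simp
  also have "\<dots> = (\<Sum>p | p permutes {0..<n}. signof p * (\<Prod>i = 0..<n. transpose_mat ?A $$ (i, p i)))"
    by (rule det_def'[of _ n]) simp
  also have "\<dots> = (\<Sum>p | p permutes {0..<n}. of_int (sign (?g p)) * Poly_Mapping.single (mon n (\<lambda>i. \<alpha> (?g p i))) 1)"
  proof (rule sum.cong)
    fix p assume "p \<in> {p. p permutes {0..<n}}"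
    then have p: "p permutes {0..<n}" by simp
    have pi: "p i < n" if "i < n" for i using permutes_in_image[OF p, of i] that by simp
    have "?g p = map_permutation {0..<n} Suc p"
      using bij by (auto simp: map_permutation_def restrict_id_def bij_betw_def fun_eq_iff)
    then have s: "sign (?g p) = sign p" using sign_map_permutation[of Suc "{0..<n}" p] p by simp
    have "(\<Prod>i = 0..<n. transpose_mat ?A $$ (i, p i)) =
        (\<Prod>i = 0..<n. Poly_Mapping.single (Poly_Mapping.single (Xvar (Suc i)) (nat (\<alpha> (Suc (p i)))) +
           Poly_Mapping.single (Yvar (Suc i)) (nat (- \<alpha> (Suc (p i))))) 1)"
      by (rule prod.cong) (auto simp: pi \<alpha> var_power mult_single)
    also have "\<dots> = Poly_Mapping.single (\<Sum>i = 0..<n. Poly_Mapping.single (Xvar (Suc i)) (nat (\<alpha> (Suc (p i)))) +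
           Poly_Mapping.single (Yvar (Suc i)) (nat (- \<alpha> (Suc (p i))))) 1"
      by (rule prod_single_1) simp
    also have "(\<Sum>i = 0..<n. Poly_Mapping.single (Xvar (Suc i)) (nat (\<alpha> (Suc (p i)))) +
           Poly_Mapping.single (Yvar (Suc i)) (nat (- \<alpha> (Suc (p i))))) = mon n (\<lambda>i. \<alpha> (?g p i))"
      unfolding mon_def
      by (rule sum.reindex_bij_witness[of _ "\<lambda>i. i - 1" Suc]) (auto simp: inv)
    finally show "signof p * (\<Prod>i = 0..<n. transpose_mat ?A $$ (i, p i)) =
        of_int (sign (?g p)) * Poly_Mapping.single (mon n (\<lambda>i. \<alpha> (?g p i))) 1"
      using s by simp
  qed simp
  also have "\<dots> = (\<Sum>w | w permutes {1..n}. of_int (sign w) * Poly_Mapping.single (mon n (\<lambda>i. \<alpha> (w i))) 1)"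
    by (rule sum.reindex_bij_betw[OF bij_betw_permutations[OF bij]])
  also have "\<dots> = (\<Sum>w | w permutes {1..n}. Poly_Mapping.single (mon n (\<lambda>i. \<alpha> (w i))) (of_int (sign w)))"
    by (intro sum.cong refl) (auto simp: sign_def single_uminus)
  finally show ?thesis
    by (simp add: lookup_sum lookup_single when_def eps_def eq_commute[of b])
qed

lemma lookup_pdiff_pow:
  "lkp ((pdiff v ^^ k) f) b = (fact (lkp b v + k) / fact (lkp b v)) * lkp f (b + Poly_Mapping.single v k)"
proof (induction k arbitrary: b)
  case (Suc k)
  have "b + Poly_Mapping.single v 1 + Poly_Mapping.single v k = b + Poly_Mapping.single v (Suc k)"
    by (simp add: add.assoc flip: single_add)
  then show ?case
    using of_nat_neq_0[of "lkp b v", where ?'a = complex]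
    by (simp add: lookup_pdiff Suc lookup_add)
qed simp

lemma lookup_foldr_pdiff:
  "distinct vs \<Longrightarrow> lkp (foldr (\<lambda>v. pdiff v ^^ e v) vs f) b =
    (\<Prod>v\<in>set vs. fact (lkp b v + e v) / fact (lkp b v)) * lkp f (b + (\<Sum>v\<in>set vs. Poly_Mapping.single v (e v)))"
proof (induction vs arbitrary: b)
  case (Cons v vs)
  have "(\<Prod>u\<in>set vs. fact (lkp (b + Poly_Mapping.single v (e v)) u + e u) / fact (lkp (b + Poly_Mapping.single v (e v)) u))
    = (\<Prod>u\<in>set vs. fact (lkp b u + e u) / fact (lkp b u) :: complex)"
    using Cons.prems by (intro prod.cong) (auto simp: lookup_add lookup_single when_def)
  then show ?case using Cons by (simp add: lookup_pdiff_pow add.assoc)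
qed simp

lemma distinct_vars: "distinct (xvars n @ yvars n)"
  by (auto simp: xvars_def yvars_def distinct_map inj_on_def)

lemma sum_single_lookup:
  assumes "finite V" "Poly_Mapping.keys a \<subseteq> V"
  shows "(\<Sum>v\<in>V. Poly_Mapping.single v (lkp a v)) = a"
  by (rule poly_mapping_eqI) (use assms in \<open>auto simp: lookup_sum lookup_single when_def in_keys_iff\<close>)

text \<open>Differentiation by the monomial \<open>a\<close> scales the coefficient at
  \<open>a + b\<close> by \<open>F (a + b) / F b\<close>, with \<open>F\<close> the product of the
  factorials of all exponents. On the support of the determinant the numerator is constant, because
  the exponents there are rearrangements of \<open>\<alpha>\<close>. So derivative and shift differ
  by a nonzero factor that depends on \<open>b\<close> alone.\<close>

lemma hollow_ideal_iff:
  assumes \<alpha>: "\<And>i. i < n \<Longrightarrow> hollow \<gamma> ! i = (nat (\<alpha> (Suc i)), nat (- \<alpha> (Suc i)))"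
  shows "P \<in> hollow_ideal n \<gamma> \<longleftrightarrow> P \<in> carrier (xy_ring n) \<and> (\<forall>b. act P (eps n \<alpha>) b = 0)"
proof (cases "P \<in> carrier (xy_ring n)")
  case True
  let ?V = "set (xvars n @ yvars n)"
  have hd: "lkp (hollow_det n \<gamma>) c = eps n \<alpha> c" for c by (rule lookup_hollow_det) (rule \<alpha>)
  define F where "F b = (\<Prod>v\<in>?V. fact (lkp b v) :: complex)" for b :: monom
  have F0: "F b \<noteq> 0" for b by (simp add: F_def)
  have Fperm: "F (mon n (\<lambda>i. \<alpha> (w i))) = F (mon n \<alpha>)" if w: "w permutes {1..n}" for w
  proof -
    have split: "F b = (\<Prod>i\<in>{1..n}. fact (lkp b (Xvar i)) * fact (lkp b (Yvar i)))" for b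
    proof -
      have "F b = (\<Prod>v\<in>Xvar ` {1..n}. fact (lkp b v)) * (\<Prod>v\<in>Yvar ` {1..n}. fact (lkp b v))"
        unfolding F_def vars_set by (rule prod.union_disjoint) auto
      then show ?thesis by (simp add: prod.reindex inj_on_def prod.distrib)
    qed
    have "(\<Prod>i\<in>{1..n}. fact (nat (\<alpha> (w i))) * fact (nat (- \<alpha> (w i))) :: complex) =
        (\<Prod>i\<in>{1..n}. fact (nat (\<alpha> i)) * fact (nat (- \<alpha> i)))"
      using prod.permute[OF w, of "\<lambda>i. fact (nat (\<alpha> i)) * fact (nat (- \<alpha> i)) :: complex"] by (simp add: o_def)
    then show ?thesis unfolding split by simp
  qed
  have "lkp (diffop n P (hollow_det n \<gamma>)) b = F (mon n \<alpha>) / F b * act P (eps n \<alpha>) b" for b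
  proof -
    have "lkp P a * lkp (monom_diff n a (hollow_det n \<gamma>)) b = F (mon n \<alpha>) / F b * (lkp P a * eps n \<alpha> (a + b))"
      if a: "a \<in> Poly_Mapping.keys P" for a
    proof -
      have ka: "Poly_Mapping.keys a \<subseteq> ?V" using True a by (simp add: carrier_xy_ring)
      have "lkp (monom_diff n a (hollow_det n \<gamma>)) b =
          (\<Prod>v\<in>?V. fact (lkp b v + lkp a v) / fact (lkp b v)) * eps n \<alpha> (b + a)"
        unfolding monom_diff_def lookup_foldr_pdiff[OF distinct_vars] hd
        by (subst sum_single_lookup[OF _ ka]) simp_all
      also have "(\<Prod>v\<in>?V. fact (lkp b v + lkp a v) / fact (lkp b v)) = F (a + b) / F b"
        by (simp add: F_def prod_dividef lookup_add add.commute)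
      also have "F (a + b) / F b * eps n \<alpha> (b + a) = F (mon n \<alpha>) / F b * eps n \<alpha> (a + b)"
        using eps_neq_0D[of n \<alpha> "a + b"] Fperm by (cases "eps n \<alpha> (a + b) = 0") (auto simp: add.commute)
      finally show ?thesis by simp
    qed
    then show ?thesis
      unfolding diffop_def lookup_sum lookup_const_mult act_def sum_distrib_left by (intro sum.cong) auto
  qed
  then have "diffop n P (hollow_det n \<gamma>) = 0 \<longleftrightarrow> (\<forall>b. act P (eps n \<alpha>) b = 0)"
    using F0 by (auto simp: poly_mapping_eq_iff fun_eq_iff)
  then show ?thesis using True by (simp add: hollow_ideal_def)
qed (simp add: hollow_ideal_def)

section \<open>The Pieri rule\<close>

definition compositions :: "nat \<Rightarrow> nat \<Rightarrow> (nat \<Rightarrow> nat) set" where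
  "compositions M r = {\<beta>. (\<forall>i. i \<notin> {1..M} \<longrightarrow> \<beta> i = 0) \<and> (\<Sum>i\<in>{1..M}. \<beta> i) = r}"

lemma finite_compositions: "finite (compositions M r)"
proof -
  have "\<beta> \<in> {f. (\<forall>i. (i \<in> {1..M} \<longrightarrow> f i \<in> {..r}) \<and> (i \<notin> {1..M} \<longrightarrow> f i = 0))}" if "\<beta> \<in> compositions M r" for \<beta>
    using that member_le_sum[of _ "{1..M}" \<beta>] by (auto simp: compositions_def)
  then have "compositions M r \<subseteq> {f. (\<forall>i. (i \<in> {1..M} \<longrightarrow> f i \<in> {..r}) \<and> (i \<notin> {1..M} \<longrightarrow> f i = 0))}" by blast
  then show ?thesis by (rule finite_subset) (intro finite_set_of_finite_funs; simp)
qed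

text \<open>The shift action of \<open>h_r\<close> on the exponents of \<open>M\<close> variables of
  one side.\<close>

definition hstep :: "nat \<Rightarrow> nat \<Rightarrow> ((nat \<Rightarrow> nat) \<Rightarrow> complex) \<Rightarrow> (nat \<Rightarrow> nat) \<Rightarrow> complex" where
  "hstep M r F v = (\<Sum>\<beta>\<in>compositions M r. F (\<lambda>i. v i + \<beta> i))"

text \<open>Adjacent transpositions are enough, as the cancellation in the Pieri rule only exchanges
  neighbours.\<close>

definition adj_antisym :: "nat \<Rightarrow> ((nat \<Rightarrow> nat) \<Rightarrow> complex) \<Rightarrow> bool" where
  "adj_antisym M F \<longleftrightarrow> (\<forall>i v. 1 \<le> i \<longrightarrow> i < M \<longrightarrow> F (\<lambda>k. v (transpose i (Suc i) k)) = - F v)"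

lemma adj_antisymD:
  "adj_antisym M F \<Longrightarrow> 1 \<le> i \<Longrightarrow> i < M \<Longrightarrow> F (\<lambda>k. v (transpose i (Suc i) k)) = - F v"
  by (simp add: adj_antisym_def)

lemma compositions_transpose:
  assumes "\<beta> \<in> compositions M r" "1 \<le> i" "i < M"
  shows "(\<lambda>k. \<beta> (transpose i (Suc i) k)) \<in> compositions M r"
proof -
  have t: "transpose i (Suc i) permutes {1..M}" using assms by (intro permutes_swap_id) auto
  have "(\<Sum>k\<in>{1..M}. \<beta> (transpose i (Suc i) k)) = (\<Sum>k\<in>{1..M}. \<beta> k)"
    using sum.permute[OF t, of \<beta>] by (simp add: o_def)
  then show ?thesis using assms permutes_in_image[OF t] unfolding compositions_def by blast
qed

lemma adj_antisym_hstep: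
  assumes "adj_antisym M F" shows "adj_antisym M (hstep M r F)"
  unfolding adj_antisym_def
proof (intro allI impI)
  fix i v assume i: "1 \<le> i" "i < M"
  let ?t = "transpose i (Suc i)"
  have "hstep M r F (\<lambda>k. v (?t k)) = (\<Sum>\<beta>\<in>compositions M r. F (\<lambda>k. (\<lambda>i. v i + \<beta> i) (?t k)))"
    unfolding hstep_def
    by (rule sum.reindex_bij_witness[of _ "\<lambda>\<beta> k. \<beta> (?t k)" "\<lambda>\<beta> k. \<beta> (?t k)"])
      (auto intro: compositions_transpose i)
  also have "\<dots> = (\<Sum>\<beta>\<in>compositions M r. - F (\<lambda>i. v i + \<beta> i))"
  proof (rule sum.cong)
    fix \<beta>
    show "F (\<lambda>k. (\<lambda>i. v i + \<beta> i) (?t k)) = - F (\<lambda>i. v i + \<beta> i)"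
      using adj_antisymD[OF assms i, of "\<lambda>i. v i + \<beta> i"] by simp
  qed simp
  finally show "hstep M r F (\<lambda>k. v (?t k)) = - hstep M r F v" by (simp add: hstep_def sum_negf)
qed

lemma strict_upto:
  fixes v :: "nat \<Rightarrow> 'a::order"
  assumes "\<And>i. 1 \<le> i \<Longrightarrow> i < M \<Longrightarrow> v i < v (Suc i)" "1 \<le> i" "i < j" "j \<le> M"
  shows "v i < v j"
  using assms(3,4)
proof (induction j)
  case (Suc j)
  show ?case
  proof (cases "i = j")
    case True then show ?thesis using assms(1)[of i] assms(2) Suc by simp
  next
    case False
    then have "v i < v j" using Suc by simp
    also have "v j < v (Suc j)" using assms(1)[of j] assms(2) Suc by simp
    finally show ?thesis .
  qed
qed simp

text \<open>The terms in which some \<open>v i + \<beta> i\<close> reaches \<open>v (i + 1)\<close> cancel in pairs: exchange the new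
  values at the first such \<open>i\<close> and at \<open>i + 1\<close>.\<close>

lemma hstep_interlacing:
  assumes F: "adj_antisym M F" and v: "\<And>i. 1 \<le> i \<Longrightarrow> i < M \<Longrightarrow> v i < v (Suc i)"
  shows "hstep M r F v =
    (\<Sum>\<beta>\<in>{\<beta> \<in> compositions M r. \<forall>i. 1 \<le> i \<longrightarrow> i < M \<longrightarrow> v i + \<beta> i < v (Suc i)}. F (\<lambda>i. v i + \<beta> i))"
    (is "_ = sum _ ?G")
proof -
  define bad where "bad \<beta> i \<longleftrightarrow> 1 \<le> i \<and> i < M \<and> v (Suc i) \<le> v i + \<beta> i" for \<beta> i
  define B where "B = {\<beta> \<in> compositions M r. \<exists>i. bad \<beta> i}"
  define m where "m \<beta> = (LEAST i. bad \<beta> i)" for \<beta>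
  \<comment> \<open>The exchange of values, rewritten for the increments. Both truncated differences
    are exact, since \<open>v\<close> is strict and the index is bad. Indices before
    \<open>m \<beta>\<close> keep their increments and hence their status, so the first bad index is
    preserved and \<open>\<tau>\<close> is an involution.\<close>
  define \<tau> where "\<tau> \<beta> = (let i = m \<beta> in \<beta>(i := v (Suc i) + \<beta> (Suc i) - v i, Suc i := v i + \<beta> i - v (Suc i)))" for \<beta>
  have m: "bad \<beta> (m \<beta>)" "\<And>i. i < m \<beta> \<Longrightarrow> \<not> bad \<beta> i" if "\<beta> \<in> B" for \<beta>
  proof -
    have "\<exists>i. bad \<beta> i" using that by (simp add: B_def)
    then show "bad \<beta> (m \<beta>)" unfolding m_def by (rule LeastI_ex)
    show "\<not> bad \<beta> i" if "i < m \<beta>" for i using not_less_Least[OF that[unfolded m_def]] .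
  qed
  have tau_values: "v (m \<beta>) + \<tau> \<beta> (m \<beta>) = v (Suc (m \<beta>)) + \<beta> (Suc (m \<beta>))"
    "v (Suc (m \<beta>)) + \<tau> \<beta> (Suc (m \<beta>)) = v (m \<beta>) + \<beta> (m \<beta>)"
    "\<And>k. k \<noteq> m \<beta> \<Longrightarrow> k \<noteq> Suc (m \<beta>) \<Longrightarrow> \<tau> \<beta> k = \<beta> k" if b: "\<beta> \<in> B" for \<beta>
    using m(1)[OF b] v[of "m \<beta>"] by (auto simp: \<tau>_def Let_def bad_def)
  have tauB: "\<tau> \<beta> \<in> B" and mtau: "m (\<tau> \<beta>) = m \<beta>" if b: "\<beta> \<in> B" for \<beta>
  proof -
    let ?i = "m \<beta>"
    have i: "1 \<le> ?i" "?i < M" "v (Suc ?i) \<le> v ?i + \<beta> ?i" using m(1)[OF b] by (auto simp: bad_def)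
    have badtau: "bad (\<tau> \<beta>) ?i" using tau_values(1)[OF b] i by (simp add: bad_def)
    have before: "\<not> bad (\<tau> \<beta>) k" if "k < ?i" for k
      using m(2)[OF b that] tau_values(3)[OF b, of k] that by (simp add: bad_def)
    have "(\<Sum>k\<in>{1..M}. \<tau> \<beta> k) = (\<Sum>k\<in>{1..M}. \<beta> k)"
    proof -
      have split: "(\<Sum>k\<in>{1..M}. g k) = g ?i + (g (Suc ?i) + (\<Sum>k\<in>{1..M} - {?i} - {Suc ?i}. g k))" for g :: "nat \<Rightarrow> nat"
        using i by (subst sum.remove[of _ ?i]) (simp_all add: sum.remove[of _ "Suc ?i"])
      have "(\<Sum>k\<in>{1..M} - {?i} - {Suc ?i}. \<tau> \<beta> k) = (\<Sum>k\<in>{1..M} - {?i} - {Suc ?i}. \<beta> k)"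
        using tau_values(3)[OF b] by (intro sum.cong) auto
      then show ?thesis using tau_values(1,2)[OF b] unfolding split[of "\<tau> \<beta>"] split[of \<beta>] by linarith
    qed
    then have "\<tau> \<beta> \<in> compositions M r"
      using b i tau_values(3)[OF b] by (auto simp: B_def compositions_def)
    then show "\<tau> \<beta> \<in> B" using badtau by (auto simp: B_def)
    show "m (\<tau> \<beta>) = ?i"
      unfolding m_def[of "\<tau> \<beta>"] using badtau before by (intro Least_equality) (auto simp: not_less[symmetric])
  qed
  have tautau: "\<tau> (\<tau> \<beta>) = \<beta>" if b: "\<beta> \<in> B" for \<beta>
  proof
    fix k
    note t = tau_values[OF tauB[OF b], unfolded mtau[OF b]] tau_values[OF b]
    show "\<tau> (\<tau> \<beta>) k = \<beta> k"
    proof (cases "k = m \<beta> \<or> k = Suc (m \<beta>)")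
      case True then show ?thesis using t(1,2,4,5) by auto
    next
      case False then show ?thesis using t(3)[of k] t(6)[of k] by simp
    qed
  qed
  have Ftau: "F (\<lambda>i. v i + \<tau> \<beta> i) = - F (\<lambda>i. v i + \<beta> i)" if b: "\<beta> \<in> B" for \<beta>
  proof -
    have "(\<lambda>i. v i + \<tau> \<beta> i) = (\<lambda>k. (\<lambda>i. v i + \<beta> i) (transpose (m \<beta>) (Suc (m \<beta>)) k))"
      using tau_values[OF b] by (auto simp: transpose_def fun_eq_iff)
    then show ?thesis
      using adj_antisymD[OF F, of "m \<beta>" "\<lambda>i. v i + \<beta> i"] m(1)[OF b] by (simp add: bad_def)
  qed
  have "(\<Sum>\<beta>\<in>B. F (\<lambda>i. v i + \<beta> i)) = (\<Sum>\<beta>\<in>B. - F (\<lambda>i. v i + \<beta> i))"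
    by (rule sum.reindex_bij_witness[of _ \<tau> \<tau>]) (auto simp: tautau tauB Ftau)
  then have 0: "(\<Sum>\<beta>\<in>B. F (\<lambda>i. v i + \<beta> i)) = 0" by (simp add: sum_negf)
  have "compositions M r = ?G \<union> B" "?G \<inter> B = {}" by (auto simp: B_def bad_def not_less)
  moreover have "finite ?G" "finite B" using finite_compositions[of M r] by (auto simp: B_def)
  ultimately have "hstep M r F v = sum (\<lambda>\<beta>. F (\<lambda>i. v i + \<beta> i)) ?G + (\<Sum>\<beta>\<in>B. F (\<lambda>i. v i + \<beta> i))"
    unfolding hstep_def by (metis (no_types, lifting) sum.union_disjoint)
  with 0 show ?thesis by simp
qed

section \<open>Iterated Pieri rule on a contiguous block\<close>

text \<open>On strict vectors \<open>F\<close> lives at the single point \<open>a\<close>, whose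
  last \<open>l\<close> entries are consecutive. Each factor removes a horizontal strip, and a
  consecutive entry cannot move before its lower neighbour has. This unlocks the entries one by one
  from below and ties every factor to a position.\<close>

locale horizontal_strips =
  fixes M l :: nat and a :: "nat \<Rightarrow> nat" and F :: "(nat \<Rightarrow> nat) \<Rightarrow> complex" and q :: "nat list"
  assumes lM: "l \<le> M" and a: "\<And>i. 1 \<le> i \<Longrightarrow> i < M \<Longrightarrow> a i < a (Suc i)"
    and contiguous: "\<And>i. M - l < i \<Longrightarrow> i < M \<Longrightarrow> a (Suc i) = Suc (a i)"
    and F: "adj_antisym M F"
    and supp: "\<And>v i. (\<And>i. 1 \<le> i \<Longrightarrow> i < M \<Longrightarrow> v i < v (Suc i)) \<Longrightarrow> F v \<noteq> 0 \<Longrightarrow> i \<in> {1..M} \<Longrightarrow> v i = a i"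
    and cong: "\<And>v v'. (\<And>i. i \<in> {1..M} \<Longrightarrow> v i = v' i) \<Longrightarrow> F v = F v'"
    and q: "length q = l"
begin

abbreviation "hsteps j \<equiv> fold (hstep M) (take j q) F"

lemma hsteps_antisym: "j \<le> l \<Longrightarrow> adj_antisym M (hsteps j)"
proof (induction j)
  case (Suc j)
  then show ?case using q by (simp add: take_Suc_conv_app_nth adj_antisym_hstep)
qed (simp add: F)

lemma hsteps_Suc:
  assumes "j < l" "\<And>i. 1 \<le> i \<Longrightarrow> i < M \<Longrightarrow> v i < v (Suc i)"
  shows "hsteps (Suc j) v = (\<Sum>\<beta>\<in>{\<beta> \<in> compositions M (q ! j). \<forall>i. 1 \<le> i \<longrightarrow> i < M \<longrightarrow> v i + \<beta> i < v (Suc i)}.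
    hsteps j (\<lambda>i. v i + \<beta> i))"
proof -
  have "adj_antisym M (hsteps j)" using assms(1) by (intro hsteps_antisym) simp
  from hstep_interlacing[of M "hsteps j" v "q ! j", OF this assms(2)] show ?thesis
    using assms(1) q by (simp add: take_Suc_conv_app_nth)
qed

text \<open>After \<open>j\<close> factors the entries above position \<open>M - l + j\<close> are
  still blocked by their lower neighbours. Hence the losses beyond position \<open>M - l + s\<close>
  come only from the factors with index at least \<open>s\<close>, which gives the bound on tail
  sums.\<close>

lemma hsteps_support:
  assumes "j \<le> l" "\<And>i. 1 \<le> i \<Longrightarrow> i < M \<Longrightarrow> v i < v (Suc i)" "hsteps j v \<noteq> 0"
  shows "(\<forall>i\<in>{1..M}. v i \<le> a i) \<and> (\<forall>i. M - l + j < i \<longrightarrow> i \<le> M \<longrightarrow> v i = a i) \<and>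
    (\<forall>s. (\<Sum>i\<in>{M - l + s<..M}. a i - v i) \<le> (\<Sum>t\<in>{s..<j}. q ! t)) \<and>
    (\<Sum>i\<in>{1..M}. a i - v i) = (\<Sum>t<j. q ! t)"
  using assms
proof (induction j arbitrary: v)
  case 0
  have "v i = a i" if "i \<in> {1..M}" for i using supp[of v i] 0 that by simp
  then show ?case by simp
next
  case (Suc j)
  have "\<exists>\<beta>\<in>{\<beta> \<in> compositions M (q ! j). \<forall>i. 1 \<le> i \<longrightarrow> i < M \<longrightarrow> v i + \<beta> i < v (Suc i)}. hsteps j (\<lambda>i. v i + \<beta> i) \<noteq> 0"
    using Suc.prems(3) hsteps_Suc[of j v] Suc.prems(1,2) by (metis (no_types, lifting) Suc_le_eq sum.neutral)
  then obtain \<beta> where \<beta>: "\<beta> \<in> compositions M (q ! j)"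
    and inter: "\<And>i. 1 \<le> i \<Longrightarrow> i < M \<Longrightarrow> v i + \<beta> i < v (Suc i)"
    and nz: "hsteps j (\<lambda>i. v i + \<beta> i) \<noteq> 0" by blast
  have strict: "v i + \<beta> i < v (Suc i) + \<beta> (Suc i)" if "1 \<le> i" "i < M" for i
    using inter[OF that] by simp
  from Suc.IH[of "\<lambda>i. v i + \<beta> i"] Suc.prems(1) strict nz
  have le: "\<And>i. i \<in> {1..M} \<Longrightarrow> v i + \<beta> i \<le> a i" and eq: "\<And>i. M - l + j < i \<Longrightarrow> i \<le> M \<Longrightarrow> v i + \<beta> i = a i"
    and tail: "\<And>s. (\<Sum>i\<in>{M - l + s<..M}. a i - (v i + \<beta> i)) \<le> (\<Sum>t\<in>{s..<j}. q ! t)"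
    and tot: "(\<Sum>i\<in>{1..M}. a i - (v i + \<beta> i)) = (\<Sum>t<j. q ! t)"
    by auto
  have eq': "v i = a i" if i: "M - l + Suc j < i" "i \<le> M" for i
  proof -
    obtain k where k: "i = Suc k" using i by (cases i) auto
    have "v k + \<beta> k = a k" "a (Suc k) = Suc (a k)" "v k + \<beta> k < v (Suc k)"
      using eq[of k] contiguous[of k] inter[of k] i k by auto
    moreover have "v i \<le> a i" using le[of i] i by auto
    ultimately show ?thesis using k by simp
  qed
  have split: "(\<Sum>i\<in>A. a i - v i) = (\<Sum>i\<in>A. a i - (v i + \<beta> i)) + (\<Sum>i\<in>A. \<beta> i)" if "A \<subseteq> {1..M}" for A
    unfolding sum.distrib[symmetric]
  proof (rule sum.cong)
    fix i assume "i \<in> A"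
    then show "a i - v i = a i - (v i + \<beta> i) + \<beta> i" using le[of i] that by auto
  qed simp
  have sb: "(\<Sum>i\<in>{1..M}. \<beta> i) = q ! j" using \<beta> by (simp add: compositions_def)
  have "(\<Sum>i\<in>{M - l + s<..M}. a i - v i) \<le> (\<Sum>t\<in>{s..<Suc j}. q ! t)" for s
  proof (cases "s \<le> j")
    case True
    have "(\<Sum>i\<in>{M - l + s<..M}. \<beta> i) \<le> q ! j"
      unfolding sb[symmetric] by (rule sum_mono2) auto
    moreover have "{s..<Suc j} = insert j {s..<j}" using True by auto
    moreover have "{M - l + s<..M} \<subseteq> {1..M}" by auto
    ultimately show ?thesis using split[of "{M - l + s<..M}"] tail[of s] by simp
  next
    case False
    then have "a i - v i = 0" if "i \<in> {M - l + s<..M}" for i using eq'[of i] that by auto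
    then show ?thesis by simp
  qed
  moreover have "(\<Sum>i\<in>{1..M}. a i - v i) = (\<Sum>t<Suc j. q ! t)"
    using split[of "{1..M}"] tot sb by simp
  moreover have "v i \<le> a i" if "i \<in> {1..M}" for i using le[OF that] by simp
  ultimately show ?case using eq' by blast
qed

text \<open>When every unlocked position loses exactly the size of the factor that unlocked it, the
  blocking leaves only one chain of strips, and the coefficient is passed on unchanged.\<close>

lemma hsteps_diagonal:
  assumes "j \<le> l" "\<And>i. 1 \<le> i \<Longrightarrow> i < M \<Longrightarrow> v i < v (Suc i)"
    "\<And>i. i \<in> {1..M} \<Longrightarrow> v i + (if M - l < i \<and> i \<le> M - l + j then q ! (i - (M - l) - 1) else 0) = a i"
  shows "hsteps j v = F a"
  using assms
proof (induction j arbitrary: v)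
  case 0
  have "F v = F a"
  proof (rule cong)
    fix i assume "i \<in> {1..M}"
    from 0(3)[OF this] show "v i = a i" by (auto split: if_splits)
  qed
  then show ?case by simp
next
  case (Suc j)
  let ?G = "{\<beta> \<in> compositions M (q ! j). \<forall>i. 1 \<le> i \<longrightarrow> i < M \<longrightarrow> v i + \<beta> i < v (Suc i)}"
  let ?i = "M - l + Suc j"
  \<comment> \<open>The whole of the last factor is spent at the position it has just unlocked. Any
    other strip would have to fill this position too, and that already exhausts its size.\<close>
  define \<beta>0 where "\<beta>0 i = (if i = ?i then q ! j else 0)" for i
  have iM: "?i \<in> {1..M}" using Suc.prems(1) lM by auto
  have vi: "v ?i + q ! j = a ?i" using Suc.prems(3)[OF iM] by simp
  have "v i + \<beta>0 i < v (Suc i)" if i: "1 \<le> i" "i < M" for i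
  proof (cases "i = ?i")
    case True
    then have "v (Suc i) = a (Suc i)" using Suc.prems(3)[of "Suc i"] i by simp
    then show ?thesis using True vi a[OF i] by (simp add: \<beta>0_def)
  next
    case False
    then show ?thesis using Suc.prems(2)[OF i] by (simp add: \<beta>0_def)
  qed
  moreover have "\<beta>0 \<in> compositions M (q ! j)"
    using iM unfolding compositions_def by (auto simp: \<beta>0_def sum.delta')
  ultimately have \<beta>0: "\<beta>0 \<in> ?G" by blast
  have "hsteps j (\<lambda>i. v i + \<beta> i) = 0" if b: "\<beta> \<in> ?G" "\<beta> \<noteq> \<beta>0" for \<beta>
  proof (rule ccontr)
    assume nz: "hsteps j (\<lambda>i. v i + \<beta> i) \<noteq> 0"
    have inter: "\<And>i. 1 \<le> i \<Longrightarrow> i < M \<Longrightarrow> v i + \<beta> i < v (Suc i)" using b by blast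
    have "v i + \<beta> i < v (Suc i) + \<beta> (Suc i)" if "1 \<le> i" "i < M" for i
      using inter[OF that] by simp
    from hsteps_support[of j "\<lambda>i. v i + \<beta> i", OF Suc_leD[OF Suc.prems(1)] this nz]
    have full: "\<forall>i. M - l + j < i \<longrightarrow> i \<le> M \<longrightarrow> v i + \<beta> i = a i" by simp
    have "v ?i + \<beta> ?i = a ?i" using full[rule_format, of ?i] iM by simp
    then have bi: "\<beta> ?i = q ! j" using vi by simp
    have "(\<Sum>i\<in>{1..M}. \<beta> i) = q ! j" "\<And>i. i \<notin> {1..M} \<Longrightarrow> \<beta> i = 0" using b by (auto simp: compositions_def)
    then have "(\<Sum>i\<in>{1..M} - {?i}. \<beta> i) = 0" using iM bi by (subst (asm) sum.remove[of _ ?i]) auto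
    then have "\<beta> i = 0" if "i \<noteq> ?i" for i using that \<open>\<And>i. i \<notin> {1..M} \<Longrightarrow> \<beta> i = 0\<close>[of i]
      by (cases "i \<in> {1..M}") auto
    then have "\<beta> = \<beta>0" using bi by (auto simp: \<beta>0_def fun_eq_iff)
    with b show False by simp
  qed
  then have "hsteps (Suc j) v = (\<Sum>\<beta>\<in>{\<beta>0}. hsteps j (\<lambda>i. v i + \<beta> i))"
    using hsteps_Suc[of j v] Suc.prems(1,2) \<beta>0 finite_compositions[of M "q ! j"]
    by (subst (asm) sum.mono_neutral_right[of ?G "{\<beta>0}"]) auto
  also have "\<dots> = hsteps j (\<lambda>i. v i + \<beta>0 i)" by simp
  also have "\<dots> = F a"
  proof (rule Suc.IH)
    show "v i + \<beta>0 i < v (Suc i) + \<beta>0 (Suc i)" if "1 \<le> i" "i < M" for i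
      using \<open>\<And>i. 1 \<le> i \<Longrightarrow> i < M \<Longrightarrow> v i + \<beta>0 i < v (Suc i)\<close>[OF that] by simp
    show "v i + \<beta>0 i + (if M - l < i \<and> i \<le> M - l + j then q ! (i - (M - l) - 1) else 0) = a i" if i: "i \<in> {1..M}" for i
      using Suc.prems(3)[OF i] by (auto simp: \<beta>0_def)
  qed (use Suc.prems(1) in simp)
  finally show ?case .
qed

end

text \<open>Collapses the comparison of all tail sums into one number. For lists comparable in that
  sense, equal weights force equal lists.\<close>

definition tail_weight :: "nat list \<Rightarrow> nat" where
  "tail_weight q = (\<Sum>s<length q. \<Sum>t\<in>{s..<length q}. q ! t)"

lemma tail_weight_mono:
  assumes "length r = length q" "\<And>s. (\<Sum>t\<in>{s..<length q}. r ! t) \<le> (\<Sum>t\<in>{s..<length q}. q ! t)"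
  shows "tail_weight r \<le> tail_weight q \<and> (tail_weight r = tail_weight q \<longrightarrow> r = q)"
proof (intro conjI impI)
  show "tail_weight r \<le> tail_weight q" unfolding tail_weight_def assms(1) by (intro sum_mono assms(2))
  assume eq: "tail_weight r = tail_weight q"
  have e: "(\<Sum>t\<in>{s..<length q}. r ! t) = (\<Sum>t\<in>{s..<length q}. q ! t)" if "s \<le> length q" for s
  proof (rule ccontr)
    assume ne: "(\<Sum>t\<in>{s..<length q}. r ! t) \<noteq> (\<Sum>t\<in>{s..<length q}. q ! t)"
    then have "s < length q" using that by (cases "s = length q") auto
    moreover have "(\<Sum>t\<in>{s..<length q}. r ! t) < (\<Sum>t\<in>{s..<length q}. q ! t)" using ne assms(2)[of s] by simp
    ultimately have "tail_weight r < tail_weight q"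
      unfolding tail_weight_def assms(1) using assms(2) by (intro sum_strict_mono_ex1) auto
    with eq show False by simp
  qed
  show "r = q"
  proof (rule nth_equalityI)
    fix i assume "i < length r"
    then have i: "i < length q" using assms(1) by simp
    then have "{i..<length q} = insert i {Suc i..<length q}" by auto
    then show "r ! i = q ! i" using e[of i] e[of "Suc i"] i by simp
  qed (rule assms(1))
qed

section \<open>Straightening into descent monomials\<close>

lemma sum_less_of_exchange:
  fixes h :: "'a \<Rightarrow> int"
  assumes fin: "finite A" "finite B" and card: "card A = card B" "A \<noteq> B"
    and less: "\<And>x y. x \<in> A - B \<Longrightarrow> y \<in> B - A \<Longrightarrow> h y < h x"
  shows "sum h B < sum h A"
proof -
  have cd: "card (A - B) = card (B - A)"
    using fin card(1) by (simp add: card_Diff_subset_Int Int_commute)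
  have AB: "A - B \<noteq> {}"
  proof
    assume e: "A - B = {}"
    then have "card (B - A) = 0" using cd by (simp only: card.empty)
    then have "B - A = {}" using fin by simp
    with e card(2) show False by blast
  qed
  then have "card (A - B) \<noteq> 0" using fin(1) by simp
  then have BA: "B - A \<noteq> {}" unfolding cd by (metis card.empty)
  obtain f where f: "bij_betw f (B - A) (A - B)"
    using finite_same_card_bij[of "B - A" "A - B"] fin cd by auto
  have "sum h (B - A) < sum (h \<circ> f) (B - A)"
  proof (rule sum_strict_mono)
    show "finite (B - A)" "B - A \<noteq> {}" using fin BA by auto
    fix y assume y: "y \<in> B - A"
    then have "f y \<in> A - B" using f by (auto simp: bij_betw_def)
    from less[OF this y] show "h y < (h \<circ> f) y" by simp
  qed
  also have "sum (h \<circ> f) (B - A) = sum h (A - B)" using sum.reindex_bij_betw[OF f, of h] by simp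
  finally have "sum h (B - A) < sum h (A - B)" .
  moreover have "sum h B = sum h (B \<inter> A) + sum h (B - A)" "sum h A = sum h (A \<inter> B) + sum h (A - B)"
    using fin by (simp_all add: sum.Int_Diff)
  ultimately show ?thesis by (simp add: Int_commute)
qed

lemma positive_set_sum:
  fixes P :: "int set"
  assumes "finite P" "\<And>x. x \<in> P \<Longrightarrow> 0 < x"
  shows "\<Sum>{1..int (card P)} \<le> \<Sum>P" and "\<Sum>P \<le> \<Sum>{1..int (card P)} \<Longrightarrow> P = {1..int (card P)}"
proof -
  let ?K = "{1..int (card P)}"
  have "\<Sum>?K < \<Sum>P" if "P \<noteq> ?K"
  proof (rule sum_less_of_exchange)
    fix x y assume "x \<in> P - ?K" "y \<in> ?K - P"
    then show "y < x" using assms(2)[of x] by auto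
  qed (use assms that in auto)
  then show "\<Sum>?K \<le> \<Sum>P" "\<Sum>P \<le> \<Sum>?K \<Longrightarrow> P = ?K" by force+
qed

lemma sorting_permutation:
  fixes h :: "nat \<Rightarrow> int"
  assumes inj: "inj_on h {1..n}"
  obtains u where "u permutes {1..n}" "\<And>i j. i \<in> {1..n} \<Longrightarrow> j \<in> {1..n} \<Longrightarrow> i < j \<Longrightarrow> h (u i) < h (u j)"
proof -
  define rk where "rk i = (if i \<in> {1..n} then card {j \<in> {1..n}. h j \<le> h i} else i)" for i
  have less: "rk i < rk j" if "i \<in> {1..n}" "j \<in> {1..n}" "h i < h j" for i j
  proof -
    have "card {k \<in> {1..n}. h k \<le> h i} < card {k \<in> {1..n}. h k \<le> h j}"
    proof (rule psubset_card_mono)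
      have "j \<in> {k \<in> {1..n}. h k \<le> h j}" "j \<notin> {k \<in> {1..n}. h k \<le> h i}" using that by auto
      moreover have "{k \<in> {1..n}. h k \<le> h i} \<subseteq> {k \<in> {1..n}. h k \<le> h j}" using that by auto
      ultimately show "{k \<in> {1..n}. h k \<le> h i} \<subset> {k \<in> {1..n}. h k \<le> h j}" by blast
    qed simp
    then show ?thesis using that by (simp add: rk_def)
  qed
  have inj_rk: "inj_on rk {1..n}"
  proof (rule inj_onI)
    fix i j assume ij: "i \<in> {1..n}" "j \<in> {1..n}" "rk i = rk j"
    then have "h i = h j" using less[of i j] less[of j i] by (metis less_irrefl linorder_neqE)
    then show "i = j" using inj_onD[OF inj] ij by blast
  qed
  have sub: "rk ` {1..n} \<subseteq> {1..n}"
  proof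
    fix y assume "y \<in> rk ` {1..n}"
    then obtain i where i: "i \<in> {1..n}" "y = rk i" by auto
    have "card {j \<in> {1..n}. h j \<le> h i} \<le> card {1..n}" by (rule card_mono) auto
    moreover have "0 < card {j \<in> {1..n}. h j \<le> h i}" using i by (auto simp: card_gt_0_iff)
    ultimately show "y \<in> {1..n}" using i by (simp add: rk_def)
  qed
  have "rk ` {1..n} = {1..n}" by (rule card_subset_eq) (use sub card_image[OF inj_rk] in simp_all)
  then have rk: "rk permutes {1..n}"
    using inj_rk by (intro bij_imp_permutes) (auto simp: bij_betw_def rk_def)
  let ?u = "inv_into UNIV rk"
  show thesis
  proof (rule that[of ?u])
    show u: "?u permutes {1..n}" by (rule permutes_inv[OF rk])
    fix i j assume ij: "i \<in> {1..n}" "j \<in> {1..n}" "i < j"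
    have uij: "?u i \<in> {1..n}" "?u j \<in> {1..n}" using ij permutes_in_image[OF u] by blast+
    show "h (?u i) < h (?u j)"
    proof (rule ccontr)
      assume "\<not> h (?u i) < h (?u j)"
      then have "rk (?u j) \<le> rk (?u i)"
      proof (cases "h (?u i) = h (?u j)")
        case True
        then have "?u i = ?u j" using inj_onD[OF inj _ uij] by simp
        then show ?thesis by simp
      next
        case False
        then show ?thesis using less[OF uij(2,1)] \<open>\<not> h (?u i) < h (?u j)\<close> by simp
      qed
      then show False using ij permutes_inverses(1)[OF rk] by simp
    qed
  qed
qed

text \<open>The elementary symmetric polynomial of degree \<open>l\<close> in the \<open>x\<close>
  variables for \<open>\<sigma> = 1\<close>, in the \<open>y\<close> variables for
  \<open>\<sigma> = - 1\<close>.\<close>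

definition elementary :: "nat \<Rightarrow> int \<Rightarrow> nat \<Rightarrow> xypoly" where
  "elementary n \<sigma> l = (\<Sum>E | E \<subseteq> {1..n} \<and> card E = l. Poly_Mapping.single (mon n (\<lambda>i. if i \<in> E then \<sigma> else 0)) 1)"

lemma symm_elementary:
  assumes \<sigma>: "\<sigma> \<noteq> 0" shows "symm n (elementary n \<sigma> l)"
proof -
  have inj: "inj_on (\<lambda>E. mon n (\<lambda>i. if i \<in> E then \<sigma> else 0)) {E. E \<subseteq> {1..n} \<and> card E = l}"
  proof (rule inj_onI)
    fix E E' assume E: "E \<in> {E. E \<subseteq> {1..n} \<and> card E = l}" "E' \<in> {E. E \<subseteq> {1..n} \<and> card E = l}"
      and eq: "mon n (\<lambda>i. if i \<in> E then \<sigma> else 0) = mon n (\<lambda>i. if i \<in> E' then \<sigma> else 0)"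
    have "i \<in> E \<longleftrightarrow> i \<in> E'" if "i \<in> {1..n}" for i
      using mon_eqD[OF eq that] \<sigma> by (auto split: if_splits)
    then show "E = E'" using E by blast
  qed
  have "symm n (\<Sum>a\<in>(\<lambda>E. mon n (\<lambda>i. if i \<in> E then \<sigma> else 0)) ` {E. E \<subseteq> {1..n} \<and> card E = l}. Poly_Mapping.single a 1)"
proof (rule symm_monom_sum)
  show "finite ((\<lambda>E. mon n (\<lambda>i. if i \<in> E then \<sigma> else 0)) ` {E. E \<subseteq> {1..n} \<and> card E = l})" by simp
  fix a assume "a \<in> (\<lambda>E. mon n (\<lambda>i. if i \<in> E then \<sigma> else 0)) ` {E. E \<subseteq> {1..n} \<and> card E = l}"
  then obtain E where E: "E \<subseteq> {1..n}" "card E = l" "a = mon n (\<lambda>i. if i \<in> E then \<sigma> else 0)" by auto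
  then show "Poly_Mapping.keys a \<subseteq> set (xvars n @ yvars n)" using keys_mon by blast
  fix w assume w: "w permutes {1..n}"
  have "permmon w a = mon n (\<lambda>i. if i \<in> w -` E then \<sigma> else 0)" using E by (simp add: permmon_mon[OF w])
  moreover have "w -` E \<subseteq> {1..n}" using E permutes_in_image[OF w] by auto
  moreover have "card (w -` E) = l"
    using E card_vimage_inj[OF permutes_inj[OF w], of E] permutes_surj[OF w] by auto
  ultimately show "permmon w a \<in> (\<lambda>E. mon n (\<lambda>i. if i \<in> E then \<sigma> else 0)) ` {E. E \<subseteq> {1..n} \<and> card E = l}"
    by blast
qed
  then show ?thesis unfolding elementary_def by (simp only: sum.reindex[OF inj] o_def)
qed

section \<open>Descents of a permutation\<close>

text \<open>The exponent profile of a Garsia--Stanton descent monomial: constant on the ascending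
  runs of \<open>u\<close>, increased by one at each descent.\<close>

definition descents_upto :: "(nat \<Rightarrow> nat) \<Rightarrow> nat \<Rightarrow> nat" where
  "descents_upto u j = card {k \<in> {1..<j}. u (Suc k) < u k}"

lemma descents_upto_Suc:
  "1 \<le> j \<Longrightarrow> descents_upto u (Suc j) = descents_upto u j + (if u (Suc j) < u j then 1 else 0)"
proof -
  assume j: "1 \<le> j"
  have "{k \<in> {1..<Suc j}. u (Suc k) < u k} = {k \<in> {1..<j}. u (Suc k) < u k} \<union> (if u (Suc j) < u j then {j} else {})"
    using j by (auto simp: less_Suc_eq)
  then show ?thesis by (auto simp: descents_upto_def)
qed

lemma descents_upto_mono: "i \<le> j \<Longrightarrow> descents_upto u i \<le> descents_upto u j"
  unfolding descents_upto_def by (rule card_mono) auto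

lemma descents_upto_eqD:
  assumes "descents_upto u i = descents_upto u j" "1 \<le> i" "i < j" "inj u"
  shows "u i < u j"
  using assms(3,1)
proof (induction j)
  case (Suc j)
  have step: "u j < u (Suc j)" if "descents_upto u j = descents_upto u (Suc j)" "1 \<le> j"
    using descents_upto_Suc[of j u] that injD[OF assms(4), of j "Suc j"] by (cases "u j" "u (Suc j)" rule: linorder_cases) auto
  show ?case
  proof (cases "i = j")
    case True
    then show ?thesis using step Suc.prems assms(2) by simp
  next
    case False
    then have ij: "i < j" using Suc.prems by simp
    have "descents_upto u i \<le> descents_upto u j" "descents_upto u j \<le> descents_upto u (Suc j)"
      using ij by (auto intro: descents_upto_mono)
    then have eq: "descents_upto u i = descents_upto u j" "descents_upto u j = descents_upto u (Suc j)"
      using Suc.prems by simp_all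
    show ?thesis using Suc.IH[OF ij eq(1)] step[OF eq(2)] ij assms(2) by simp
  qed
qed simp

lemma descents_upto_diff_le: "1 \<le> i \<Longrightarrow> i \<le> j \<Longrightarrow> descents_upto u j \<le> descents_upto u i + (j - i)"
proof (induction j)
  case (Suc j)
  then show ?case by (cases "i = Suc j") (auto simp: descents_upto_Suc)
qed simp

section \<open>Exponents reachable from the determinant\<close>

text \<open>\<open>N\<close> marks the exponent 0. Strictness places \<open>N - 1\<close> negative
  exponents, those of \<open>y\<close> variables, before it and \<open>n - N\<close> positive ones
  after it.\<close>

locale exponents =
  fixes n N :: nat and \<alpha> :: "nat \<Rightarrow> int"
  assumes N: "1 \<le> N" "N \<le> n" and \<alpha>N: "\<alpha> N = 0"
    and \<alpha>_strict: "\<And>i. 1 \<le> i \<Longrightarrow> i < n \<Longrightarrow> \<alpha> i < \<alpha> (Suc i)"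
begin

text \<open>The hook without holes and with the same numbers of positive and negative exponents: the
  cheapest pattern of distinct exponents with these signs.\<close>

definition \<rho> :: "nat \<Rightarrow> int" where "\<rho> i = int i - int N"

abbreviation "\<Delta> \<equiv> eps n \<alpha>"

definition degree :: "(nat \<Rightarrow> int) \<Rightarrow> int" where "degree e = (\<Sum>i\<in>{1..n}. \<bar>e i\<bar>)"

lemma \<alpha>_less: "1 \<le> i \<Longrightarrow> i < j \<Longrightarrow> j \<le> n \<Longrightarrow> \<alpha> i < \<alpha> j"
proof (induction j)
  case (Suc j)
  then show ?case using \<alpha>_strict[of j] by (cases "i = j") (auto intro: less_trans)
qed simp

lemma \<alpha>_pos_iff:
  assumes "i \<in> {1..n}" shows "0 < \<alpha> i \<longleftrightarrow> N < i"
proof (cases i N rule: linorder_cases)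
  case less then show ?thesis using \<alpha>_less[of i N] \<alpha>N N assms by simp
next
  case equal then show ?thesis using \<alpha>N by simp
next
  case greater then show ?thesis using \<alpha>_less[of N i] \<alpha>N N assms by simp
qed

lemma \<alpha>_neg_iff:
  assumes "i \<in> {1..n}" shows "\<alpha> i < 0 \<longleftrightarrow> i < N"
proof (cases i N rule: linorder_cases)
  case less then show ?thesis using \<alpha>_less[of i N] \<alpha>N N assms by simp
next
  case equal then show ?thesis using \<alpha>N by simp
next
  case greater then show ?thesis using \<alpha>_less[of N i] \<alpha>N N assms by simp
qed

lemma inj_\<alpha>: "inj_on \<alpha> {1..n}"
proof (rule inj_onI)
  fix i j assume ij: "i \<in> {1..n}" "j \<in> {1..n}" "\<alpha> i = \<alpha> j"
  then show "i = j" using \<alpha>_less[of i j] \<alpha>_less[of j i] by (cases i j rule: linorder_cases) simp_all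
qed

lemma inj_\<rho>: "inj_on \<rho> A"
  by (auto simp: inj_on_def \<rho>_def)

lemma card_preimage_perm:
  assumes "w permutes {1..n}" shows "card {i \<in> {1..n}. P (w i)} = card {i \<in> {1..n}. P i}"
proof (rule bij_betw_same_card[of w])
  show "bij_betw w {i \<in> {1..n}. P (w i)} {i \<in> {1..n}. P i}"
    unfolding bij_betw_def
  proof
    show "inj_on w {i \<in> {1..n}. P (w i)}" using permutes_inj[OF assms] by (rule inj_on_subset) simp
    show "w ` {i \<in> {1..n}. P (w i)} = {i \<in> {1..n}. P i}"
    proof (rule subset_antisym; rule subsetI)
      fix y assume "y \<in> w ` {i \<in> {1..n}. P (w i)}"
      then show "y \<in> {i \<in> {1..n}. P i}" using permutes_in_image[OF assms] by auto
    next
      fix y assume y: "y \<in> {i \<in> {1..n}. P i}"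
      then have "y \<in> w ` {1..n}" using permutes_image[OF assms] by simp
      then show "y \<in> w ` {i \<in> {1..n}. P (w i)}" using y by auto
    qed
  qed
qed

lemma act_\<Delta>_bound:
  assumes "act P \<Delta> b \<noteq> 0"
  obtains e w where "b = mon n e" "w permutes {1..n}"
    "\<And>i. i \<in> {1..n} \<Longrightarrow> 0 \<le> e i \<and> e i \<le> \<alpha> (w i) \<or> \<alpha> (w i) \<le> e i \<and> e i \<le> 0"
proof -
  obtain a w where "w permutes {1..n}" "a + b = mon n (\<lambda>i. \<alpha> (w i))"
    using act_eps_neq_0D[OF assms] by metis
  with add_eq_monD[of a b n "\<lambda>i. \<alpha> (w i)"] that show thesis by metis
qed

lemma act_\<Delta>_mon_bound:
  assumes "act P \<Delta> (mon n e) \<noteq> 0"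
  obtains w where "w permutes {1..n}"
    "\<And>i. i \<in> {1..n} \<Longrightarrow> 0 \<le> e i \<and> e i \<le> \<alpha> (w i) \<or> \<alpha> (w i) \<le> e i \<and> e i \<le> 0"
proof -
  obtain e' w where *: "mon n e = mon n e'" "w permutes {1..n}"
    "\<And>i. i \<in> {1..n} \<Longrightarrow> 0 \<le> e' i \<and> e' i \<le> \<alpha> (w i) \<or> \<alpha> (w i) \<le> e' i \<and> e' i \<le> 0"
    using act_\<Delta>_bound[OF assms] by metis
  show thesis
  proof (rule that[OF *(2)])
    fix i assume i: "i \<in> {1..n}"
    then show "0 \<le> e i \<and> e i \<le> \<alpha> (w i) \<or> \<alpha> (w i) \<le> e i \<and> e i \<le> 0"
      using *(3)[OF i] mon_eqD[OF *(1) i] by simp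
  qed
qed

lemma card_pos_neg:
  assumes w: "w permutes {1..n}"
    and b: "\<And>i. i \<in> {1..n} \<Longrightarrow> 0 \<le> e i \<and> e i \<le> \<alpha> (w i) \<or> \<alpha> (w i) \<le> e i \<and> e i \<le> 0"
  shows "card {i \<in> {1..n}. 0 < e i} \<le> n - N" "card {i \<in> {1..n}. e i < 0} \<le> N - 1"
proof -
  have "card {i \<in> {1..n}. 0 < e i} \<le> card {i \<in> {1..n}. 0 < \<alpha> (w i)}"
    by (rule card_mono) (use b in force)+
  also have "\<dots> = card {i \<in> {1..n}. 0 < \<alpha> i}" by (rule card_preimage_perm[OF w])
  also have "{i \<in> {1..n}. 0 < \<alpha> i} = {N<..n}" using \<alpha>_pos_iff N by auto
  finally show "card {i \<in> {1..n}. 0 < e i} \<le> n - N" by simp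
  have "card {i \<in> {1..n}. e i < 0} \<le> card {i \<in> {1..n}. \<alpha> (w i) < 0}"
    by (rule card_mono) (use b in force)+
  also have "\<dots> = card {i \<in> {1..n}. \<alpha> i < 0}" by (rule card_preimage_perm[OF w])
  also have "{i \<in> {1..n}. \<alpha> i < 0} = {1..<N}" using \<alpha>_neg_iff N by auto
  finally show "card {i \<in> {1..n}. e i < 0} \<le> N - 1" by simp
qed

lemma act_\<Delta>_card:
  assumes "act P \<Delta> (mon n e) \<noteq> 0"
  shows "card {i \<in> {1..n}. 0 < e i} \<le> n - N" "card {i \<in> {1..n}. e i < 0} \<le> N - 1"
proof -
  obtain w where w: "w permutes {1..n}"
    "\<And>i. i \<in> {1..n} \<Longrightarrow> 0 \<le> e i \<and> e i \<le> \<alpha> (w i) \<or> \<alpha> (w i) \<le> e i \<and> e i \<le> 0"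
    using act_\<Delta>_mon_bound[OF assms] by blast
  show "card {i \<in> {1..n}. 0 < e i} \<le> n - N" by (rule card_pos_neg(1)[OF w])
  show "card {i \<in> {1..n}. e i < 0} \<le> N - 1" by (rule card_pos_neg(2)[OF w])
qed

text \<open>Distinctness allows the exponent 0 only once, so both sign bounds are attained. Distinct
  positive integers of a given number have the least sum only if they form an initial segment, so
  the degree bound fixes the absolute values on both sides.\<close>

lemma distinct_exponents_low_degree:
  assumes inj: "inj_on e {1..n}" and deg: "degree e \<le> degree \<rho>"
    and pos: "card {i \<in> {1..n}. 0 < e i} \<le> n - N" and neg: "card {i \<in> {1..n}. e i < 0} \<le> N - 1"
  obtains u where "u permutes {1..n}" "\<And>i. i \<in> {1..n} \<Longrightarrow> e i = \<rho> (u i)"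
proof -
  let ?R = "e ` {1..n}"
  define P where "P = {x \<in> ?R. 0 < x}"
  define M where "M = uminus ` {x \<in> ?R. x < 0}"
  have fin: "finite P" "finite M" by (auto simp: P_def M_def)
  have cP: "card P = card {i \<in> {1..n}. 0 < e i}"
  proof -
    have "P = e ` {i \<in> {1..n}. 0 < e i}" by (auto simp: P_def)
    moreover have "card (e ` {i \<in> {1..n}. 0 < e i}) = card {i \<in> {1..n}. 0 < e i}"
      by (rule card_image, rule inj_on_subset[OF inj]) auto
    ultimately show ?thesis by (simp only:)
  qed
  have cM: "card M = card {i \<in> {1..n}. e i < 0}"
  proof -
    have "M = (\<lambda>i. - e i) ` {i \<in> {1..n}. e i < 0}" by (auto simp: M_def image_image)
    moreover have "inj_on (\<lambda>i. - e i) {i \<in> {1..n}. e i < 0}"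
      by (intro inj_onI inj_onD[OF inj]) auto
    ultimately show ?thesis by (simp only: card_image)
  qed
  have cR: "card ?R = n" using card_image[OF inj] by simp
  have "?R \<subseteq> P \<union> uminus ` M \<union> {0}" by (auto simp: P_def M_def image_image)
  then have "card ?R \<le> card (P \<union> uminus ` M \<union> {0})" by (rule card_mono[rotated]) (use fin in simp)
  then have "n \<le> card (P \<union> uminus ` M \<union> {0})" by (simp only: cR)
  also have "\<dots> \<le> card P + card (uminus ` M) + 1"
    using card_Un_le[of "P \<union> uminus ` M" "{0}"] card_Un_le[of P "uminus ` M"] by simp
  also have "card (uminus ` M) = card M" by (simp add: card_image)
  finally have "n \<le> card P + card M + 1" .
  then have c: "card P = n - N" "card M = N - 1" using pos neg cP cM N by linarith+
  have degR: "degree e = \<Sum>P + \<Sum>M"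
  proof -
    have "degree e = (\<Sum>x\<in>?R. \<bar>x\<bar>)" unfolding degree_def by (simp only: sum.reindex[OF inj] o_def)
    also have "\<dots> = (\<Sum>x\<in>P \<union> {x \<in> ?R. x < 0}. \<bar>x\<bar>)"
      by (rule sum.mono_neutral_right) (auto simp: P_def)
    also have "\<dots> = (\<Sum>x\<in>P. \<bar>x\<bar>) + (\<Sum>x\<in>{x \<in> ?R. x < 0}. \<bar>x\<bar>)"
      by (rule sum.union_disjoint) (auto simp: P_def)
    also have "(\<Sum>x\<in>P. \<bar>x\<bar>) = \<Sum>P" by (rule sum.cong) (auto simp: P_def)
    also have "(\<Sum>x\<in>{x \<in> ?R. x < 0}. \<bar>x\<bar>) = \<Sum>M"
      unfolding M_def by (subst sum.reindex) (auto intro: sum.cong)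
    finally show ?thesis .
  qed
  have deg\<rho>: "degree \<rho> = \<Sum>{1..int (n - N)} + \<Sum>{1..int (N - 1)}"
  proof -
    have eq: "{1..n} = {1..<N} \<union> {N<..n} \<union> {N}" using N by auto
    have "degree \<rho> = (\<Sum>i\<in>{1..<N} \<union> {N<..n} \<union> {N}. \<bar>\<rho> i\<bar>)" by (simp only: degree_def eq)
    also have "\<dots> = (\<Sum>i\<in>{1..<N} \<union> {N<..n}. \<bar>\<rho> i\<bar>) + (\<Sum>i\<in>{N}. \<bar>\<rho> i\<bar>)"
      by (rule sum.union_disjoint) auto
    also have "(\<Sum>i\<in>{N}. \<bar>\<rho> i\<bar>) = 0" by (simp add: \<rho>_def)
    also have "(\<Sum>i\<in>{1..<N} \<union> {N<..n}. \<bar>\<rho> i\<bar>) = (\<Sum>i\<in>{1..<N}. \<bar>\<rho> i\<bar>) + (\<Sum>i\<in>{N<..n}. \<bar>\<rho> i\<bar>)"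
      by (rule sum.union_disjoint) auto
    also have "(\<Sum>i\<in>{1..<N}. \<bar>\<rho> i\<bar>) = \<Sum>{1..int (N - 1)}"
      by (rule sum.reindex_bij_witness[of _ "\<lambda>x. nat (int N - x)" "\<lambda>i. int N - int i"]) (use N in \<open>auto simp: \<rho>_def\<close>)
    also have "(\<Sum>i\<in>{N<..n}. \<bar>\<rho> i\<bar>) = \<Sum>{1..int (n - N)}"
      by (rule sum.reindex_bij_witness[of _ "\<lambda>x. nat (int N + x)" "\<lambda>i. int i - int N"]) (use N in \<open>auto simp: \<rho>_def\<close>)
    finally show ?thesis by simp
  qed
  have posPM: "0 < x" if "x \<in> P \<union> M" for x using that by (auto simp: P_def M_def)
  have PM: "P = {1..int (n - N)}" "M = {1..int (N - 1)}"
    using positive_set_sum[of P] positive_set_sum[of M] fin posPM c deg degR deg\<rho> by auto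
  define u where "u i = (if i \<in> {1..n} then nat (e i + int N) else i)" for i
  have range: "1 - int N \<le> e i \<and> e i \<le> int n - int N" if i: "i \<in> {1..n}" for i
  proof (cases "e i" "0::int" rule: linorder_cases)
    case less
    then have "- e i \<in> M" using i by (auto simp: M_def)
    then show ?thesis using PM N less by auto
  next
    case greater
    then have "e i \<in> P" using i by (auto simp: P_def)
    then show ?thesis using PM N greater by auto
  qed (use N in auto)
  have inju: "inj_on u {1..n}"
  proof (rule inj_onI)
    fix i j assume ij: "i \<in> {1..n}" "j \<in> {1..n}" "u i = u j"
    then have "e i = e j" using range[of i] range[of j] by (simp add: u_def eq_nat_nat_iff)
    then show "i = j" using inj_onD[OF inj] ij by blast
  qed
  have "u ` {1..n} \<subseteq> {1..n}"
  proof
    fix y assume "y \<in> u ` {1..n}"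
    then obtain i where i: "i \<in> {1..n}" "y = u i" by auto
    then show "y \<in> {1..n}" using range[OF i(1)] by (simp add: u_def) linarith
  qed
  moreover have "card (u ` {1..n}) = card {1..n}" by (rule card_image[OF inju])
  ultimately have "u ` {1..n} = {1..n}" by (intro card_subset_eq) simp_all
  then have "u permutes {1..n}" using inju by (intro bij_imp_permutes) (auto simp: bij_betw_def u_def)
  moreover have "e i = \<rho> (u i)" if i: "i \<in> {1..n}" for i
    using range[OF i] i by (simp add: u_def \<rho>_def)
  ultimately show thesis by (rule that)
qed

text \<open>The result of a symmetric operator is antisymmetric and hence supported on distinct
  exponents; in this range of degrees only rearrangements of \<open>\<rho>\<close> qualify. All
  symmetric operators therefore act on \<open>\<Delta>\<close> alike up to a scalar, the coefficient
  at \<open>\<rho>\<close>.\<close>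

lemma symm_act_low_degree:
  assumes s: "symm n s" and deg: "degree e \<le> degree \<rho>"
  shows "act s \<Delta> (mon n e) = eps n \<rho> (mon n e) * act s \<Delta> (mon n \<rho>)"
proof (cases "\<exists>w. w permutes {1..n} \<and> mon n e = mon n (\<lambda>i. \<rho> (w i))")
  case True
  then obtain w where w: "w permutes {1..n}" "mon n e = mon n (\<lambda>i. \<rho> (w i))" by blast
  then show ?thesis
    using antisym_fun_mon[OF symmD[OF s antisym_eps[of n \<alpha>]] w(1), of \<rho>] eps_mon_perm[OF inj_\<rho> w(1)] by simp
next
  case False
  then have "eps n \<rho> (mon n e) = 0" using eps_neq_0D by blast
  moreover have "act s \<Delta> (mon n e) = 0"
  proof (rule ccontr)
    assume nz: "act s \<Delta> (mon n e) \<noteq> 0"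
    then have "inj_on e {1..n}"
      using antisym_fun_eq_0[OF symmD[OF s antisym_eps[of n \<alpha>]]] unfolding inj_on_def by blast
    then obtain u where u: "u permutes {1..n}" "\<And>i. i \<in> {1..n} \<Longrightarrow> e i = \<rho> (u i)"
      using distinct_exponents_low_degree deg act_\<Delta>_card[OF nz] by blast
    then have "mon n e = mon n (\<lambda>i. \<rho> (u i))" by (intro mon_cong) auto
    with u False show False by blast
  qed
  ultimately show ?thesis by simp
qed

text \<open>Normalised at position \<open>N\<close>: the variable \<open>u N\<close> gets exponent
  0, earlier ones get powers of \<open>y\<close> and later ones powers of \<open>x\<close>.\<close>

definition descent_exp :: "(nat \<Rightarrow> nat) \<Rightarrow> nat \<Rightarrow> int" where
  "descent_exp u i = int (descents_upto u (inv_into UNIV u i)) - int (descents_upto u N)"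

text \<open>The descent count changes by at most one per position, so at distance d from
  \<open>N\<close> it differs by at most d. This brings descent monomials into the range where
  symmetric operators act as scalars.\<close>

lemma degree_descent_exp:
  assumes u: "u permutes {1..n}" shows "degree (descent_exp u) \<le> degree \<rho>"
proof -
  have "degree (descent_exp u) \<le> (\<Sum>i\<in>{1..n}. \<bar>\<rho> (inv_into UNIV u i)\<bar>)"
    unfolding degree_def
  proof (rule sum_mono)
    fix i assume "i \<in> {1..n}"
    then have j: "inv_into UNIV u i \<in> {1..n}" using permutes_in_image[OF permutes_inv[OF u]] by blast
    let ?j = "inv_into UNIV u i"
    show "\<bar>descent_exp u i\<bar> \<le> \<bar>\<rho> ?j\<bar>"
      using descents_upto_diff_le[of ?j N u] descents_upto_diff_le[of N ?j u]
        descents_upto_mono[of ?j N u] descents_upto_mono[of N ?j u] j N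
      by (cases "?j \<le> N") (auto simp: descent_exp_def \<rho>_def)
  qed
  also have "\<dots> = degree \<rho>"
    unfolding degree_def using sum.permute[OF permutes_inv[OF u], of "\<lambda>i. \<bar>\<rho> i\<bar>"] by (simp add: o_def)
  finally show ?thesis .
qed

section \<open>The straightening algorithm\<close>

definition descent_span :: "xypoly set" where
  "descent_span = {P. \<exists>s. (\<forall>u. symm n (s u)) \<and>
     (\<forall>c. act (P - (\<Sum>u | u permutes {1..n}. s u * Poly_Mapping.single (mon n (descent_exp u)) 1)) \<Delta> c = 0)}"

lemma descent_span_annihilator: "(\<And>c. act P \<Delta> c = 0) \<Longrightarrow> P \<in> descent_span"
  unfolding descent_span_def by (auto intro!: exI[of _ "\<lambda>_. 0"] symm_0)

lemma descent_span_add: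
  assumes "P \<in> descent_span" "Q \<in> descent_span" shows "P + Q \<in> descent_span"
proof -
  let ?b = "\<lambda>u. Poly_Mapping.single (mon n (descent_exp u)) (1::complex)"
  let ?S = "\<lambda>s. \<Sum>u | u permutes {1..n}. s u * ?b u"
  obtain s t where s: "\<And>u. symm n (s u)" "\<And>c. act (P - ?S s) \<Delta> c = 0"
    and t: "\<And>u. symm n (t u)" "\<And>c. act (Q - ?S t) \<Delta> c = 0"
    using assms unfolding descent_span_def by blast
  have "P + Q - ?S (\<lambda>u. s u + t u) = (P - ?S s) + (Q - ?S t)"
    by (simp add: distrib_right sum.distrib)
  then have "act (P + Q - ?S (\<lambda>u. s u + t u)) \<Delta> c = 0" for c by (simp only: act_add s t) simp
  then show ?thesis
    unfolding descent_span_def using symm_add[OF s(1) t(1)]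
    by (intro CollectI exI[of _ "\<lambda>u. s u + t u"] conjI allI)
qed

lemma descent_span_mult:
  assumes r: "symm n r" and "P \<in> descent_span" shows "r * P \<in> descent_span"
proof -
  let ?b = "\<lambda>u. Poly_Mapping.single (mon n (descent_exp u)) (1::complex)"
  let ?S = "\<lambda>s. \<Sum>u | u permutes {1..n}. s u * ?b u"
  obtain s where s: "\<And>u. symm n (s u)" "\<And>c. act (P - ?S s) \<Delta> c = 0"
    using assms unfolding descent_span_def by blast
  have "r * P - ?S (\<lambda>u. r * s u) = r * (P - ?S s)"
    by (simp add: right_diff_distrib sum_distrib_left mult.assoc)
  moreover have "act (P - ?S s) \<Delta> = (\<lambda>_. 0)" using s(2) by (simp add: fun_eq_iff)
  ultimately have "act (r * P - ?S (\<lambda>u. r * s u)) \<Delta> c = 0" for c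
    by (simp add: act_mult) (simp add: act_def)
  then show ?thesis
    unfolding descent_span_def using symm_mult[OF r s(1)]
    by (intro CollectI exI[of _ "\<lambda>u. r * s u"] conjI allI)
qed

lemma descent_span_diff:
  assumes "P \<in> descent_span" "Q \<in> descent_span" shows "P - Q \<in> descent_span"
proof -
  have "const (- 1) * Q \<in> descent_span" by (rule descent_span_mult[OF symm_const assms(2)])
  moreover have "const (- 1) * Q = - Q"
    by (rule poly_mapping_eqI) (simp add: lookup_const_mult)
  ultimately show ?thesis using descent_span_add[OF assms(1)] by (metis uminus_add_conv_diff add.commute)
qed

lemma descent_span_sum: "(\<And>i. i \<in> A \<Longrightarrow> f i \<in> descent_span) \<Longrightarrow> sum f A \<in> descent_span"
  by (induction A rule: infinite_finite_induct) (auto intro: descent_span_add descent_span_annihilator)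

text \<open>The weight \<open>n + 1\<close> makes the height increase with every exponent moving away from 0, with ties
  broken by the index of the variable.\<close>

definition height :: "(nat \<Rightarrow> int) \<Rightarrow> nat" where
  "height e = nat (\<Sum>i\<in>{1..n}. int (Suc n) * (e i)\<^sup>2 + int i * e i)"

lemma height_term_nonneg:
  assumes i: "i \<in> {1..n}" shows "0 \<le> int (Suc n) * x\<^sup>2 + int i * x"
proof -
  have x: "\<bar>x\<bar> \<le> x\<^sup>2"
  proof (cases "x = 0")
    case False
    then have "\<bar>x\<bar> * 1 \<le> \<bar>x\<bar> * \<bar>x\<bar>" by (intro mult_left_mono) auto
    then show ?thesis by (simp add: power2_eq_square)
  qed simp
  have "int i * \<bar>x\<bar> \<le> int (Suc n) * x\<^sup>2" using i x by (intro mult_mono) auto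
  moreover have "- (int i * \<bar>x\<bar>) \<le> int i * x" by (cases "0 \<le> x") auto
  ultimately show ?thesis by linarith
qed

lemma int_height: "int (height e) = (\<Sum>i\<in>{1..n}. int (Suc n) * (e i)\<^sup>2 + int i * e i)"
  unfolding height_def using height_term_nonneg by (intro nat_0_le sum_nonneg)

lemma height_shift:
  assumes E: "E \<subseteq> {1..n}" and \<sigma>: "\<sigma> = 1 \<or> \<sigma> = - 1"
  shows "int (height (\<lambda>i. e i + (if i \<in> E then \<sigma> else 0))) =
    int (height e) + (\<Sum>i\<in>E. \<sigma> * (2 * int (Suc n) * e i + int i)) + int (Suc n) * int (card E)"
proof -
  let ?K = "int (Suc n)"
  have fin: "finite E" using E by (rule finite_subset) simp
  have \<sigma>2: "\<sigma>\<^sup>2 = 1" using \<sigma> by auto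
  have "(\<Sum>i\<in>{1..n}. ?K * (e i + (if i \<in> E then \<sigma> else 0))\<^sup>2 + int i * (e i + (if i \<in> E then \<sigma> else 0))) =
      (\<Sum>i\<in>{1..n}. (?K * (e i)\<^sup>2 + int i * e i) + (if i \<in> E then \<sigma> * (2 * ?K * e i + int i) + ?K else 0))"
  proof (rule sum.cong)
    fix i
    have "?K * (e i + \<sigma>)\<^sup>2 = ?K * (e i)\<^sup>2 + \<sigma> * (2 * ?K * e i) + ?K * \<sigma>\<^sup>2"
      by (simp only: power2_sum) (simp only: algebra_simps)
    then show "?K * (e i + (if i \<in> E then \<sigma> else 0))\<^sup>2 + int i * (e i + (if i \<in> E then \<sigma> else 0)) =
        (?K * (e i)\<^sup>2 + int i * e i) + (if i \<in> E then \<sigma> * (2 * ?K * e i + int i) + ?K else 0)"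
      using \<sigma>2 by (simp add: distrib_left mult.commute)
  qed simp
  also have "\<dots> = (\<Sum>i\<in>{1..n}. ?K * (e i)\<^sup>2 + int i * e i) + (\<Sum>i\<in>E. \<sigma> * (2 * ?K * e i + int i) + ?K)"
    using E unfolding sum.distrib[of _ _ "{1..n}"] by (simp add: sum.If_cases Int_absorb1)
  also have "(\<Sum>i\<in>E. \<sigma> * (2 * ?K * e i + int i) + ?K) = (\<Sum>i\<in>E. \<sigma> * (2 * ?K * e i + int i)) + ?K * int (card E)"
    by (simp only: sum.distrib sum_constant mult.commute)
  finally show ?thesis unfolding int_height by simp
qed

text \<open>Take one unit off the exponents in \<open>Z\<close> and restore it by an elementary
  symmetric polynomial of degree \<open>card Z\<close>. The choice \<open>E = Z\<close> returns the
  monomial. By \<open>top\<close> any other choice that creates no factor \<open>x_i y_i\<close> has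
  smaller height, and a choice that creates one annihilates \<open>\<Delta>\<close>. The reduced
  monomial is lower as well, so induction covers all that remains.\<close>

lemma straighten_step:
  assumes \<sigma>: "\<sigma> = 1 \<or> \<sigma> = - 1" and Z: "Z \<subseteq> {1..n}" "Z \<noteq> {}" and eZ: "\<And>i. i \<in> Z \<Longrightarrow> 1 \<le> \<sigma> * e i"
    and top: "\<And>x y. x \<in> Z \<Longrightarrow> y \<in> {1..n} - Z \<Longrightarrow>
      \<sigma> * (2 * int (Suc n) * e y + int y) < \<sigma> * (2 * int (Suc n) * (e x - \<sigma>) + int x)"
    and IH: "\<And>e'. height e' < height e \<Longrightarrow> Poly_Mapping.single (mon n e') 1 \<in> descent_span"
  shows "Poly_Mapping.single (mon n e) 1 \<in> descent_span"
proof -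
  let ?K = "int (Suc n)"
  let ?m = "\<lambda>E. mon n (\<lambda>i. if i \<in> E then \<sigma> else 0)"
  define e' where "e' i = e i - (if i \<in> Z then \<sigma> else 0)" for i
  \<comment> \<open>Up to a common constant, the gain of height from giving the unit to variable
    \<open>i\<close>.\<close>
  define h where "h i = \<sigma> * (2 * ?K * e' i + int i)" for i
  let ?S = "{E. E \<subseteq> {1..n} \<and> card E = card Z}"
  have finZ: "finite Z" using Z(1) by (rule finite_subset) simp
  have finS: "finite ?S" by simp
  have ZS: "Z \<in> ?S" using Z by simp
  have shift: "int (height (\<lambda>i. e' i + (if i \<in> E then \<sigma> else 0))) = int (height e') + sum h E + ?K * int (card Z)"
    if "E \<in> ?S" for E
    using height_shift[of E \<sigma> e'] that \<sigma> by (simp add: h_def)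
  have e'Z: "(\<lambda>i. e' i + (if i \<in> Z then \<sigma> else 0)) = e" by (auto simp: e'_def)
  have "Poly_Mapping.single (mon n e') 1 \<in> descent_span"
  proof (rule IH)
    have pos: "0 < h i + ?K" if "i \<in> Z" for i
    proof -
      have i: "i \<in> {1..n}" using Z that by auto
      have "0 \<le> \<sigma> * e' i" using eZ[OF that] that \<sigma> by (auto simp: e'_def)
      then have "0 \<le> 2 * ?K * (\<sigma> * e' i)" by simp
      moreover have "h i = 2 * ?K * (\<sigma> * e' i) + \<sigma> * int i" unfolding h_def by (simp only: algebra_simps)
      moreover have "- ?K < \<sigma> * int i" using \<sigma> i by auto
      ultimately show ?thesis by linarith
    qed
    have "0 < (\<Sum>i\<in>Z. h i + ?K)" using Z(2) finZ pos by (intro sum_pos) auto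
    also have "\<dots> = sum h Z + ?K * int (card Z)" by (simp only: sum.distrib sum_constant mult.commute)
    finally show "height e' < height e" using shift[OF ZS] unfolding e'Z by linarith
  qed
  then have "elementary n \<sigma> (card Z) * Poly_Mapping.single (mon n e') 1 \<in> descent_span"
    using symm_elementary[of \<sigma>] \<sigma> by (intro descent_span_mult) auto
  also have "elementary n \<sigma> (card Z) * Poly_Mapping.single (mon n e') 1 =
      (\<Sum>E\<in>?S. Poly_Mapping.single (mon n e' + ?m E) 1)"
    by (simp add: elementary_def sum_distrib_right mult_single add.commute)
  also have "\<dots> = Poly_Mapping.single (mon n e' + ?m Z) 1 + (\<Sum>E\<in>?S - {Z}. Poly_Mapping.single (mon n e' + ?m E) 1)"
    by (rule sum.remove[OF finS ZS])
  finally have total: "Poly_Mapping.single (mon n e' + ?m Z) 1 +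
      (\<Sum>E\<in>?S - {Z}. Poly_Mapping.single (mon n e' + ?m E) 1) \<in> descent_span" .
  have add: "mon n e' + ?m E = mon n (\<lambda>i. e' i + (if i \<in> E then \<sigma> else 0))" if "\<And>i. i \<in> E \<Longrightarrow> 0 \<le> \<sigma> * e' i" for E
    by (rule mon_add) (use that \<sigma> in auto)
  have "Poly_Mapping.single (mon n e' + ?m E) 1 \<in> descent_span" if E: "E \<in> ?S - {Z}" for E
  proof (cases "\<forall>i\<in>E. 0 \<le> \<sigma> * e' i")
    case True
    have "sum h E < sum h Z"
    proof (rule sum_less_of_exchange)
      show "finite E" using E by (auto intro: finite_subset)
      fix x y assume "x \<in> Z - E" "y \<in> E - Z"
      then show "h y < h x" using top[of x y] E by (auto simp: h_def e'_def)
    qed (use E finZ in auto)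
    then have "height (\<lambda>i. e' i + (if i \<in> E then \<sigma> else 0)) < height e"
      using shift[OF ZS] shift[of E] E unfolding e'Z by simp
    then show ?thesis using IH add True by simp
  next
    case False
    then obtain i where i: "i \<in> E" "\<sigma> * e' i < 0" by auto
    then have i': "i \<in> {1..n}" using E by auto
    show ?thesis
    proof (rule descent_span_annihilator)
      fix c
      have "\<Delta> (mon n e' + ?m E + c) = 0"
      proof (rule ccontr)
        assume "\<Delta> (mon n e' + ?m E + c) \<noteq> 0"
        then obtain \<beta> where eq: "mon n e' + ?m E + c = mon n \<beta>" using eps_neq_0D by blast
        have "nat (e' i) + nat \<sigma> + lkp c (Xvar i) = nat (\<beta> i)"
          "nat (- e' i) + nat (- \<sigma>) + lkp c (Yvar i) = nat (- \<beta> i)"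
          using arg_cong[OF eq, of "\<lambda>m. lkp m (Xvar i)"] arg_cong[OF eq, of "\<lambda>m. lkp m (Yvar i)"] i i'
          by (simp_all add: lookup_add)
        then show False using \<sigma> i(2) by auto
      qed
      then show "act (Poly_Mapping.single (mon n e' + ?m E) 1) \<Delta> c = 0" by (simp add: act_single)
    qed
  qed
  then have "(\<Sum>E\<in>?S - {Z}. Poly_Mapping.single (mon n e' + ?m E) 1) \<in> descent_span"
    by (rule descent_span_sum)
  from descent_span_diff[OF total this]
  have "Poly_Mapping.single (mon n e' + ?m Z) 1 \<in> descent_span" by simp
  moreover have "0 \<le> \<sigma> * e' i" if "i \<in> Z" for i using eZ[OF that] that \<sigma> by (auto simp: e'_def)
  ultimately show ?thesis using add[of Z] unfolding e'Z by simp
qed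

text \<open>Sort the variables by exponent, ties by index. At each descent of the sorting
  permutation the exponent must rise, so the exponents exceed the descent profile by a weakly
  increasing amount \<open>\<kappa>\<close>. Where it is zero throughout, the monomial is a descent
  monomial; otherwise the positions with \<open>\<kappa>\<close> positive, or those with
  \<open>\<kappa>\<close> negative, form an end segment that can be straightened.\<close>

lemma mon_in_descent_span: "Poly_Mapping.single (mon n e) 1 \<in> descent_span"
proof (induction "height e" arbitrary: e rule: less_induct)
  case less
  show ?case
  proof (cases "\<forall>c. act (Poly_Mapping.single (mon n e) 1) \<Delta> c = 0")
    case True
    then show ?thesis by (intro descent_span_annihilator) simp
  next
    case False
    then obtain c where "\<Delta> (c + mon n e) \<noteq> 0" by (auto simp: act_single add.commute)
    then have nz: "act (Poly_Mapping.single c 1) \<Delta> (mon n e) \<noteq> 0" by (simp add: act_single)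
    note cards = act_\<Delta>_card[OF nz]
    let ?K = "int (Suc n)"
    \<comment> \<open>Compares exponents first and indices second, since indices differ by less than
      the weight \<open>2 * ?K\<close>.\<close>
    define h where "h i = 2 * ?K * e i + int i" for i
    have hlt: "e i < e j \<or> e i = e j \<and> i < j" if "h i < h j" "i \<in> {1..n}" "j \<in> {1..n}" for i j
    proof (rule ccontr)
      assume "\<not> ?thesis"
      then have "e j < e i \<or> e j = e i \<and> j \<le> i" by linarith
      moreover have False if "e j < e i"
      proof -
        have "2 * ?K * (e j + 1) \<le> 2 * ?K * e i" using that by (intro mult_left_mono) auto
        then show False using \<open>h i < h j\<close> \<open>j \<in> {1..n}\<close> by (simp add: h_def algebra_simps)
      qed
      ultimately show False using \<open>h i < h j\<close> by (auto simp: h_def)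
    qed
    have "inj_on h {1..n}"
    proof (rule inj_onI)
      fix i j assume ij: "i \<in> {1..n}" "j \<in> {1..n}" "h i = h j"
      have "(int i - int j) mod (2 * ?K) = 0"
      proof -
        have "int i - int j = 2 * ?K * (e j - e i)" using ij(3) by (simp only: h_def algebra_simps)
        then show ?thesis by simp
      qed
      then have "2 * ?K dvd int i - int j" by (simp add: dvd_eq_mod_eq_0)
      moreover have "\<bar>int i - int j\<bar> < 2 * ?K" using ij by auto
      ultimately show "i = j" using zdvd_not_zless[of "\<bar>int i - int j\<bar>" "2 * ?K"] by auto
    qed
    then obtain u where u: "u permutes {1..n}"
      and hu: "\<And>i j. i \<in> {1..n} \<Longrightarrow> j \<in> {1..n} \<Longrightarrow> i < j \<Longrightarrow> h (u i) < h (u j)"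
      using sorting_permutation by metis
    have uin: "u j \<in> {1..n}" if "j \<in> {1..n}" for j using permutes_in_image[OF u] that by blast
    have inju: "inj u" by (rule permutes_inj[OF u])
    define f where "f j = e (u j)" for j
    have ord: "f i < f j \<or> f i = f j \<and> u i < u j" if "i \<in> {1..n}" "j \<in> {1..n}" "i < j" for i j
      using hlt[OF hu[OF that] uin uin] that by (simp add: f_def)
    have fmono: "f i \<le> f j" if "i \<in> {1..n}" "j \<in> {1..n}" "i \<le> j" for i j
      using ord[of i j] that by (cases "i = j") auto
    \<comment> \<open>A nonzero value here would give more than \<open>n - N\<close> positive or
      more than \<open>N - 1\<close> negative exponents, and no shift of \<open>\<Delta>\<close>
      would see the monomial.\<close>
    have fN: "f N = 0"
    proof (rule antisym)
      have Nn: "N \<in> {1..n}" using N by simp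
      show "f N \<le> 0"
      proof (rule ccontr)
        assume "\<not> f N \<le> 0"
        have "u ` {N..n} \<subseteq> {i \<in> {1..n}. 0 < e i}"
        proof (rule image_subsetI)
          fix j assume j: "j \<in> {N..n}"
          then have "j \<in> {1..n}" "f N \<le> f j" using fmono[of N j] N by simp_all
          then show "u j \<in> {i \<in> {1..n}. 0 < e i}" using uin[of j] \<open>\<not> f N \<le> 0\<close> by (simp add: f_def)
        qed
        then have "card (u ` {N..n}) \<le> card {i \<in> {1..n}. 0 < e i}" by (rule card_mono[rotated]) simp
        moreover have "card (u ` {N..n}) = n - N + 1"
          using N by (subst card_image) (auto intro: inj_on_subset[OF inju])
        ultimately show False using cards(1) by simp
      qed
      show "0 \<le> f N"
      proof (rule ccontr)
        assume "\<not> 0 \<le> f N"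
        have "u ` {1..N} \<subseteq> {i \<in> {1..n}. e i < 0}"
        proof (rule image_subsetI)
          fix j assume j: "j \<in> {1..N}"
          then have "j \<in> {1..n}" "f j \<le> f N" using fmono[of j N] N by simp_all
          then show "u j \<in> {i \<in> {1..n}. e i < 0}" using uin[of j] \<open>\<not> 0 \<le> f N\<close> by (simp add: f_def)
        qed
        then have "card (u ` {1..N}) \<le> card {i \<in> {1..n}. e i < 0}" by (rule card_mono[rotated]) simp
        moreover have "card (u ` {1..N}) = N"
          by (subst card_image) (auto intro: inj_on_subset[OF inju])
        ultimately show False using cards(2) N by simp
      qed
    qed
    let ?\<pi> = "\<lambda>j. int (descents_upto u j)"
    define \<kappa> where "\<kappa> j = f j - (?\<pi> j - ?\<pi> N)" for j
    have \<kappa>N: "\<kappa> N = 0" by (simp add: \<kappa>_def fN)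
    have \<kappa>_Suc: "\<kappa> j \<le> \<kappa> (Suc j)" if j: "1 \<le> j" "j < n" for j
      using ord[of j "Suc j"] j descents_upto_Suc[of j u] by (auto simp: \<kappa>_def)
    have \<kappa>_mono: "\<kappa> i \<le> \<kappa> j" if "1 \<le> i" "i \<le> j" "j \<le> n" for i j
      using that(2,3)
    proof (induction j rule: dec_induct)
      case (step m)
      then show ?case using \<kappa>_Suc[of m] that(1) by simp
    qed simp
    have \<pi>_mono: "?\<pi> i \<le> ?\<pi> j" if "i \<le> j" for i j using descents_upto_mono[OF that] by simp
    \<comment> \<open>Across a jump of \<open>\<kappa>\<close> the order survives lowering the
      larger exponent by one. Either the exponents differ by at least two, or no descent lies in
      between and the index decides.\<close>
    have low: "h (u k) + 2 * ?K < h (u j)" if jk: "1 \<le> k" "k < j" "j \<le> n" "\<kappa> k < \<kappa> j" for j k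
    proof -
      have ujk: "u j \<in> {1..n}" "u k \<in> {1..n}" using uin jk by auto
      have e1: "f k + 1 \<le> f j" and e2: "f k + 1 = f j \<Longrightarrow> ?\<pi> k = ?\<pi> j"
        using \<pi>_mono[of k j] jk by (auto simp: \<kappa>_def)
      show ?thesis
      proof (cases "f k + 1 = f j")
        case True
        then have "u k < u j" using descents_upto_eqD[of u k j] e2 jk inju by simp
        moreover have "h (u j) = 2 * ?K * (f k + 1) + int (u j)" using True by (simp add: h_def f_def)
        ultimately show ?thesis by (simp add: h_def f_def algebra_simps)
      next
        case False
        then have "2 * ?K * (f k + 2) \<le> 2 * ?K * f j" using e1 by (intro mult_left_mono) auto
        moreover have "int (u k) < ?K" using ujk by simp
        ultimately show ?thesis by (simp add: h_def f_def algebra_simps)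
      qed
    qed
    have uinv: "\<exists>j\<in>{1..n}. x = u j" if "x \<in> {1..n}" for x
      using permutes_image[OF u] that by auto
    consider (pos) j where "j \<in> {1..n}" "0 < \<kappa> j" | (neg) j where "j \<in> {1..n}" "\<kappa> j < 0" | (zero) "\<forall>j\<in>{1..n}. \<kappa> j = 0"
      by (metis linorder_neqE)
    then show ?thesis
    proof cases
      case pos
      let ?Z = "u ` {j \<in> {1..n}. 0 < \<kappa> j}"
      show ?thesis
      proof (rule straighten_step[of 1 ?Z])
        show "?Z \<subseteq> {1..n}" using uin by blast
        show "?Z \<noteq> {}" using pos by auto
        fix x assume "x \<in> ?Z"
        then obtain j where j: "j \<in> {1..n}" "0 < \<kappa> j" "x = u j" by auto
        then have "N < j" using \<kappa>_mono[of j N] \<kappa>N N by (cases "N < j") auto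
        then show "1 \<le> 1 * e x" using j \<pi>_mono[of N j] by (simp add: \<kappa>_def f_def)
        fix y assume y: "y \<in> {1..n} - ?Z"
        then obtain k where k: "k \<in> {1..n}" "y = u k" using uinv by blast
        then have "\<kappa> k \<le> 0" using y by (auto simp: not_less)
        then have "k < j" using \<kappa>_mono[of j k] j k by (cases "k < j") auto
        then have "h y + 2 * ?K < h x" using low[of k j] \<open>\<kappa> k \<le> 0\<close> j k by auto
        then show "1 * (2 * ?K * e y + int y) < 1 * (2 * ?K * (e x - 1) + int x)"
          by (simp add: h_def algebra_simps)
      qed (use less in auto)
    next
      case neg
      let ?Z = "u ` {j \<in> {1..n}. \<kappa> j < 0}"
      show ?thesis
      proof (rule straighten_step[of "- 1" ?Z])
        show "?Z \<subseteq> {1..n}" using uin by blast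
        show "?Z \<noteq> {}" using neg by auto
        fix x assume "x \<in> ?Z"
        then obtain j where j: "j \<in> {1..n}" "\<kappa> j < 0" "x = u j" by auto
        then have "j < N" using \<kappa>_mono[of N j] \<kappa>N N by (cases "j < N") auto
        then show "1 \<le> - 1 * e x" using j \<pi>_mono[of j N] by (simp add: \<kappa>_def f_def)
        fix y assume y: "y \<in> {1..n} - ?Z"
        then obtain k where k: "k \<in> {1..n}" "y = u k" using uinv by blast
        then have "0 \<le> \<kappa> k" using y by (auto simp: not_less)
        then have "j < k" using \<kappa>_mono[of k j] j k by (cases "j < k") auto
        then have "h x + 2 * ?K < h y" using low[of j k] \<open>0 \<le> \<kappa> k\<close> j k by auto
        then show "- 1 * (2 * ?K * e y + int y) < - 1 * (2 * ?K * (e x - - 1) + int x)"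
          by (simp add: h_def algebra_simps)
      qed (use less in auto)
    next
      case zero
      have "mon n e = mon n (descent_exp u)"
      proof (rule mon_cong)
        fix i assume "i \<in> {1..n}"
        then obtain j where j: "j \<in> {1..n}" "i = u j" using uinv by blast
        then show "e i = descent_exp u i"
          using zero inju by (simp add: \<kappa>_def f_def descent_exp_def)
      qed
      then have eq: "Poly_Mapping.single (mon n e) 1 - (\<Sum>v | v permutes {1..n}.
          (if v = u then 1 else 0) * Poly_Mapping.single (mon n (descent_exp v)) 1) = (0::xypoly)"
        using u by (simp add: finite_permutations if_distrib[of "\<lambda>s. s * _"] cong: if_cong)
      have "act (Poly_Mapping.single (mon n e) 1 - (\<Sum>v | v permutes {1..n}.
          (if v = u then 1 else 0) * Poly_Mapping.single (mon n (descent_exp v)) 1)) \<Delta> c = 0" for c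
        unfolding eq by simp
      then show ?thesis
        unfolding descent_span_def
        by (intro CollectI exI[of _ "\<lambda>v. if v = u then 1 else 0"] conjI allI) (auto simp: symm_0 symm_1)
    qed
  qed
qed

lemma descent_span_UNIV: "P \<in> descent_span" if P: "P \<in> carrier (xy_ring n)"
proof -
  have "Poly_Mapping.single a c \<in> descent_span" for a c
  proof (cases "\<exists>e. a = mon n e")
    case True
    then obtain e where "a = mon n e" by blast
    then have "Poly_Mapping.single a c = const c * Poly_Mapping.single (mon n e) 1"
      by (simp add: const_def mult_single)
    then show ?thesis using descent_span_mult[OF symm_const mon_in_descent_span] by simp
  next
    case False
    have "\<Delta> (b + a) = 0" for b
    proof (rule ccontr)
      assume "\<Delta> (b + a) \<noteq> 0"
      then obtain \<beta> where "b + a = mon n \<beta>" using eps_neq_0D by blast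
      from add_eq_monD[OF this] False show False by metis
    qed
    then show ?thesis by (intro descent_span_annihilator) (simp add: act_single add.commute)
  qed
  then show ?thesis by (subst sum_of_monoms[of P, symmetric]) (intro descent_span_sum)
qed

text \<open>Expand the monomial \<open>c\<close> into descent monomials with symmetric coefficients.
  Each product of \<open>s\<close> with a coefficient acts on these low degrees through its value at
  \<open>\<rho>\<close>, which vanishes by assumption. So values at \<open>\<rho>\<close>, taken
  over all symmetric multiples, detect whether \<open>s\<close> kills
  \<open>\<Delta>\<close>.\<close>

lemma act_\<Delta>_eq_0I:
  assumes s: "symm n s" and 0: "\<And>s'. symm n s' \<Longrightarrow> act (s * s') \<Delta> (mon n \<rho>) = 0"
  shows "act s \<Delta> c = 0"
proof (cases "\<exists>e. c = mon n e")
  case True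
  then obtain e where c: "c = mon n e" by blast
  let ?b = "\<lambda>u. Poly_Mapping.single (mon n (descent_exp u)) (1::complex)"
  let ?P = "{u. u permutes {1..n}}"
  obtain t where t: "\<And>u. symm n (t u)" "\<And>c'. act (Poly_Mapping.single c 1 - (\<Sum>u\<in>?P. t u * ?b u)) \<Delta> c' = 0"
    using mon_in_descent_span[of e] unfolding descent_span_def c by blast
  let ?D = "Poly_Mapping.single c 1 - (\<Sum>u\<in>?P. t u * ?b u)"
  \<comment> \<open>Reading the coefficient at \<open>c\<close> amounts to multiplying by the
    monomial \<open>c\<close> and reading the constant coefficient.\<close>
  have "act s \<Delta> c = act (Poly_Mapping.single c 1 * s) \<Delta> 0"
    by (simp add: act_mult act_single)
  also have "Poly_Mapping.single c 1 * s = s * ?D + (\<Sum>u\<in>?P. ?b u * (s * t u))"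
    by (simp add: right_diff_distrib sum_distrib_left mult_ac)
  also have "act \<dots> \<Delta> 0 = act (s * ?D) \<Delta> 0 + (\<Sum>u\<in>?P. act (s * t u) \<Delta> (mon n (descent_exp u)))"
    by (simp add: act_add act_sum act_mult act_single)
  also have "act (s * ?D) \<Delta> 0 = 0"
  proof -
    have "act ?D \<Delta> = (\<lambda>_. 0)" using t(2) by (simp add: fun_eq_iff)
    then show ?thesis by (simp only: act_mult) (simp add: act_def)
  qed
  also have "(\<Sum>u\<in>?P. act (s * t u) \<Delta> (mon n (descent_exp u))) = 0"
  proof (rule sum.neutral, rule ballI)
    fix u assume "u \<in> ?P"
    then have "degree (descent_exp u) \<le> degree \<rho>" by (simp add: degree_descent_exp)
    from symm_act_low_degree[OF symm_mult[OF s t(1)] this, of u] 0[OF t(1), of u]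
    show "act (s * t u) \<Delta> (mon n (descent_exp u)) = 0" by simp
  qed
  finally show ?thesis by simp
next
  case False
  then show ?thesis using act_\<Delta>_bound[of s c] by metis
qed

end

section \<open>Hollow exponents\<close>

locale hollow_params =
  fixes m1 m2 k1 k2 p1 p2 :: nat
  assumes m_pos: "1 \<le> m1" "1 \<le> m2" and k_pos: "1 \<le> k1" "1 \<le> k2"
begin

text \<open>The sign \<open>\<sigma> = 1\<close> stands for the \<open>x\<close> side and \<open>\<sigma> = - 1\<close> for the \<open>y\<close> side; \<open>arm \<sigma> j\<close> is the
  \<open>j\<close>-th nonzero exponent on that side.\<close>

definition mm :: "int \<Rightarrow> nat" where "mm \<sigma> = (if \<sigma> = 1 then m1 else m2)"
definition kk :: "int \<Rightarrow> nat" where "kk \<sigma> = (if \<sigma> = 1 then k1 else k2)"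
definition pp :: "int \<Rightarrow> nat" where "pp \<sigma> = (if \<sigma> = 1 then p1 else p2)"

definition dim :: nat where "dim = m1 + p1 + m2 + p2 + 1"
definition piv :: nat where "piv = m2 + p2 + 1"

definition arm :: "int \<Rightarrow> nat \<Rightarrow> nat" where
  "arm \<sigma> j = j + (if mm \<sigma> \<le> j then kk \<sigma> - 1 else 0)"

definition alpha :: "nat \<Rightarrow> int" where
  "alpha i = (if piv \<le> i then int (arm 1 (i - piv)) else - int (arm (- 1) (piv - i)))"

lemma mm_pos: "1 \<le> mm \<sigma>" and kk_pos: "1 \<le> kk \<sigma>"
  using m_pos k_pos by (auto simp: mm_def kk_def)

lemma arm_less: "i < j \<Longrightarrow> arm \<sigma> i < arm \<sigma> j"
  by (auto simp: arm_def)

lemma arm_ge: "j \<le> arm \<sigma> j"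
  by (simp add: arm_def)

lemma arm_0 [simp]: "arm \<sigma> 0 = 0"
  using mm_pos[of \<sigma>] by (simp add: arm_def)

sublocale exponents dim piv alpha
proof
  show "1 \<le> piv" "piv \<le> dim" by (auto simp: piv_def dim_def)
  show "alpha piv = 0" by (simp add: alpha_def)
  fix i assume i: "1 \<le> i" "i < dim"
  show "alpha i < alpha (Suc i)"
  proof (cases "piv \<le> i")
    case True
    then show ?thesis using arm_less[of "i - piv" "Suc i - piv" 1] by (auto simp: alpha_def)
  next
    case False
    then show ?thesis
      using arm_less[of "piv - Suc i" "piv - i" "- 1"] arm_less[of 0 "piv - i" "- 1"]
      by (cases "piv = Suc i") (auto simp: alpha_def)
  qed
qed

text \<open>The list runs from the outermost \<open>y\<close> exponent through 0 to the outermost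
  \<open>x\<close> exponent. The four cases are the outer \<open>y\<close> block, the inner
  \<open>y\<close> block with 0, the inner \<open>x\<close> block and the outer \<open>x\<close>
  block.\<close>

lemma hollow_nth:
  assumes i: "i < dim"
  shows "hollow ((m1, m2), (k1, k2), (p1, p2)) ! i = (nat (alpha (Suc i)), nat (- alpha (Suc i)))"
proof -
  note p = m_pos k_pos
  consider "i \<le> p2" | "p2 < i" "i < p2 + 1 + m2" | "p2 + m2 < i" "i < p2 + m2 + m1" | "p2 + m2 + m1 \<le> i"
    by linarith
  then show ?thesis
  proof cases
    case 1
    then have "hollow ((m1, m2), (k1, k2), (p1, p2)) ! i = (0, m2 + k2 + p2 - Suc i)"
      using p by (simp add: nth_append rev_nth)
    moreover have "alpha (Suc i) = - int (m2 + k2 + p2 - Suc i)"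
    proof -
      have "m2 \<le> m2 + p2 - i" using 1 by simp
      then show ?thesis using 1 p by (simp add: alpha_def piv_def arm_def mm_def kk_def)
    qed
    ultimately show ?thesis by simp
  next
    case 2
    then have "hollow ((m1, m2), (k1, k2), (p1, p2)) ! i = (0, m2 + p2 - i)"
      using p by (auto simp: nth_append rev_nth)
    moreover have "alpha (Suc i) = - int (m2 + p2 - i)"
      using 2 p by (auto simp: alpha_def piv_def arm_def mm_def kk_def)
    ultimately show ?thesis by simp
  next
    case 3
    then have "hollow ((m1, m2), (k1, k2), (p1, p2)) ! i = (i - m2 - p2, 0)"
      using p by (auto simp: nth_append)
    moreover have "alpha (Suc i) = int (i - m2 - p2)"
      using 3 p by (auto simp: alpha_def piv_def arm_def mm_def kk_def)
    ultimately show ?thesis by simp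
  next
    case 4
    then have "hollow ((m1, m2), (k1, k2), (p1, p2)) ! i = (i - m2 - p2 + k1 - 1, 0)"
      using p i by (auto simp: nth_append dim_def)
    moreover have "alpha (Suc i) = int (i - m2 - p2 + k1 - 1)"
      using 4 p by (auto simp: alpha_def piv_def arm_def mm_def kk_def)
    ultimately show ?thesis by simp
  qed
qed

lemma mem_hollow_ideal:
  "P \<in> hollow_ideal dim ((m1, m2), (k1, k2), (p1, p2)) \<longleftrightarrow>
    P \<in> carrier (xy_ring dim) \<and> (\<forall>b. act P \<Delta> b = 0)"
  by (rule hollow_ideal_iff) (rule hollow_nth)

section \<open>One arm of the diagram at a time\<close>

definition xv :: "int \<Rightarrow> nat \<Rightarrow> xyvar" where "xv \<sigma> i = (if \<sigma> = 1 then Xvar i else Yvar i)"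
definition vars :: "int \<Rightarrow> xyvar set" where "vars \<sigma> = xv \<sigma> ` {1..dim}"

lemma vars_eq: "vars 1 = set (xvars dim)" "vars (- 1) = set (yvars dim)"
  by (auto simp: vars_def xv_def xvars_def yvars_def)

lemma inj_xv: "inj_on (xv \<sigma>) A"
  by (auto simp: xv_def inj_on_def)

lemma lookup_mon_xv:
  "\<sigma> = 1 \<or> \<sigma> = - 1 \<Longrightarrow> lkp (mon dim e) (xv \<sigma> i) = (if i \<in> {1..dim} then nat (\<sigma> * e i) else 0)"
  by (auto simp: xv_def)

lemma monom_eqI_xv:
  assumes "\<sigma> = 1 \<or> \<sigma> = - 1" "\<And>i. lkp a (xv \<sigma> i) = lkp b (xv \<sigma> i)" "\<And>i. lkp a (xv (- \<sigma>) i) = lkp b (xv (- \<sigma>) i)"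
  shows "a = b"
  using assms by (intro monom_eqI) (auto simp: xv_def)

text \<open>Coordinates along one arm, counted from \<open>piv\<close> outwards;
  \<open>place\<close> and \<open>dist\<close> are inverse to each other on it.\<close>

definition side :: "int \<Rightarrow> nat \<Rightarrow> bool" where "side \<sigma> i \<longleftrightarrow> 0 < \<sigma> * (int i - int piv)"
definition dist :: "int \<Rightarrow> nat \<Rightarrow> nat" where "dist \<sigma> i = nat (\<sigma> * (int i - int piv))"
definition place :: "int \<Rightarrow> nat \<Rightarrow> nat" where "place \<sigma> j = nat (int piv + \<sigma> * int j)"
definition len :: "int \<Rightarrow> nat" where "len \<sigma> = mm \<sigma> + pp \<sigma>"

lemma place:
  assumes "\<sigma> = 1 \<or> \<sigma> = - 1" "j \<in> {1..len \<sigma>}"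
  shows "place \<sigma> j \<in> {1..dim}" "side \<sigma> (place \<sigma> j)" "dist \<sigma> (place \<sigma> j) = j"
  using assms by (auto simp: place_def side_def dist_def len_def mm_def pp_def dim_def piv_def)

lemma dist:
  assumes "\<sigma> = 1 \<or> \<sigma> = - 1" "i \<in> {1..dim}" "side \<sigma> i"
  shows "dist \<sigma> i \<in> {1..len \<sigma>}" "place \<sigma> (dist \<sigma> i) = i"
  using assms by (auto simp: place_def side_def dist_def len_def mm_def pp_def dim_def piv_def)

lemma side_cases:
  assumes "\<sigma> = 1 \<or> \<sigma> = - 1"
  obtains "side \<sigma> i" "\<not> side (- \<sigma>) i" "i \<noteq> piv" | "i = piv" "\<not> side \<sigma> i" "\<not> side (- \<sigma>) i"
    | "side (- \<sigma>) i" "\<not> side \<sigma> i" "i \<noteq> piv"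
  using assms by (cases "int i" "int piv" rule: linorder_cases) (auto simp: side_def)

lemma alpha_side:
  assumes "\<sigma> = 1 \<or> \<sigma> = - 1" "side \<sigma> i"
  shows "alpha i = \<sigma> * int (arm \<sigma> (dist \<sigma> i))"
proof -
  have "nat (int i - int piv) = i - piv" "nat (int piv - int i) = piv - i" by simp_all
  then show ?thesis using assms by (auto simp: alpha_def side_def dist_def)
qed

text \<open>Varies the exponents on one arm with everything else frozen, so that the one-sided Pieri
  rule applies.\<close>

definition comb :: "int \<Rightarrow> (nat \<Rightarrow> int) \<Rightarrow> (nat \<Rightarrow> nat) \<Rightarrow> nat \<Rightarrow> int" where
  "comb \<sigma> e v i = (if side \<sigma> i then \<sigma> * int (v (dist \<sigma> i)) else e i)"

lemma comb_place: "\<sigma> = 1 \<or> \<sigma> = - 1 \<Longrightarrow> j \<in> {1..len \<sigma>} \<Longrightarrow> comb \<sigma> e v (place \<sigma> j) = \<sigma> * int (v j)"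
  by (simp only: comb_def place if_True)

lemma place_eq_iff:
  "\<sigma> = 1 \<or> \<sigma> = - 1 \<Longrightarrow> i \<in> {1..len \<sigma>} \<Longrightarrow> j \<in> {1..len \<sigma>} \<Longrightarrow> place \<sigma> i = place \<sigma> j \<longleftrightarrow> i = j"
  by (metis place(3))

lemma complete_hom_set:
  assumes \<sigma>: "\<sigma> = 1 \<or> \<sigma> = - 1"
  shows "{a. Poly_Mapping.keys a \<subseteq> vars \<sigma> \<and> (\<Sum>v\<in>vars \<sigma>. lkp a v) = r} =
    (\<lambda>\<beta>. mon dim (\<lambda>i. \<sigma> * int (\<beta> i))) ` compositions dim r" (is "?A = _")
proof (rule Set.set_eqI, rule iffI)
  fix a assume a: "a \<in> ?A"
  define \<beta> where "\<beta> i = (if i \<in> {1..dim} then lkp a (xv \<sigma> i) else 0)" for i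
  have s: "(\<Sum>i\<in>{1..dim}. lkp a (xv \<sigma> i)) = r"
    using a by (simp add: vars_def sum.reindex[OF inj_xv])
  have "(\<Sum>i\<in>{1..dim}. \<beta> i) = (\<Sum>i\<in>{1..dim}. lkp a (xv \<sigma> i))" by (rule sum.cong) (auto simp: \<beta>_def)
  then have "\<beta> \<in> compositions dim r" using s by (auto simp: compositions_def \<beta>_def)
  moreover have "a = mon dim (\<lambda>i. \<sigma> * int (\<beta> i))"
  proof (rule monom_eqI_xv[OF \<sigma>])
    have \<sigma>2: "- \<sigma> = 1 \<or> - \<sigma> = - 1" using \<sigma> by auto
    have out: "lkp a v = 0" if "v \<notin> vars \<sigma>" for v using a that by (auto simp: in_keys_iff)
    have \<sigma>\<sigma>: "\<sigma> * (\<sigma> * x) = x" for x using \<sigma> by auto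
    show "lkp a (xv \<sigma> i) = lkp (mon dim (\<lambda>i. \<sigma> * int (\<beta> i))) (xv \<sigma> i)" for i
    proof (cases "i \<in> {1..dim}")
      case True
      then show ?thesis unfolding lookup_mon_xv[OF \<sigma>] \<sigma>\<sigma> by (simp add: \<beta>_def)
    next
      case False
      then have "xv \<sigma> i \<notin> vars \<sigma>" by (simp add: vars_def inj_image_mem_iff inj_xv)
      then show ?thesis using False out by (subst lookup_mon_xv[OF \<sigma>]) auto
    qed
    show "lkp a (xv (- \<sigma>) i) = lkp (mon dim (\<lambda>i. \<sigma> * int (\<beta> i))) (xv (- \<sigma>) i)" for i
    proof -
      have "xv (- \<sigma>) i \<notin> vars \<sigma>" using \<sigma> by (auto simp: vars_def xv_def)
      then have "lkp a (xv (- \<sigma>) i) = 0" by (rule out)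
      moreover have "nat (- \<sigma> * (\<sigma> * int (\<beta> i))) = 0" using \<sigma> by auto
      ultimately show ?thesis unfolding lookup_mon_xv[OF \<sigma>2] by simp
    qed
  qed
  ultimately show "a \<in> (\<lambda>\<beta>. mon dim (\<lambda>i. \<sigma> * int (\<beta> i))) ` compositions dim r" by blast
next
  fix a assume "a \<in> (\<lambda>\<beta>. mon dim (\<lambda>i. \<sigma> * int (\<beta> i))) ` compositions dim r"
  then obtain \<beta> where \<beta>: "\<beta> \<in> compositions dim r" "a = mon dim (\<lambda>i. \<sigma> * int (\<beta> i))" by auto
  have \<sigma>\<sigma>: "\<sigma> * (\<sigma> * x) = x" for x using \<sigma> by auto
  have "(\<Sum>v\<in>vars \<sigma>. lkp a v) = (\<Sum>i\<in>{1..dim}. \<beta> i)"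
    unfolding vars_def sum.reindex[OF inj_xv] o_def \<beta>(2) lookup_mon_xv[OF \<sigma>] \<sigma>\<sigma>
    by (rule sum.cong) auto
  moreover have "Poly_Mapping.keys a \<subseteq> vars \<sigma>"
  proof
    fix v assume v: "v \<in> Poly_Mapping.keys a"
    show "v \<in> vars \<sigma>"
    proof (cases v)
      case (Xvar i)
      then show ?thesis using v \<sigma> by (auto simp: \<beta>(2) in_keys_iff vars_def xv_def split: if_splits)
    next
      case (Yvar i)
      then show ?thesis using v \<sigma> by (auto simp: \<beta>(2) in_keys_iff vars_def xv_def split: if_splits)
    qed
  qed
  ultimately show "a \<in> ?A" using \<beta> by (simp add: compositions_def)
qed

lemma finite_complete_hom_set:
  assumes \<sigma>: "\<sigma> = 1 \<or> \<sigma> = - 1"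
  shows "finite {a. Poly_Mapping.keys a \<subseteq> vars \<sigma> \<and> (\<Sum>v\<in>vars \<sigma>. lkp a v) = (r::nat)}"
  unfolding complete_hom_set[OF \<sigma>] by (rule finite_imageI[OF finite_compositions])

lemma vars_subset: "\<sigma> = 1 \<or> \<sigma> = - 1 \<Longrightarrow> vars \<sigma> \<subseteq> set (xvars dim @ yvars dim)"
  using vars_eq by auto

lemma symm_complete_hom:
  assumes \<sigma>: "\<sigma> = 1 \<or> \<sigma> = - 1" shows "symm dim (complete_hom (vars \<sigma>) r)"
  unfolding complete_hom_def
proof (rule symm_monom_sum[OF finite_complete_hom_set[OF \<sigma>]])
  fix a assume a: "a \<in> {a. Poly_Mapping.keys a \<subseteq> vars \<sigma> \<and> (\<Sum>v\<in>vars \<sigma>. lkp a v) = r}"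
  then show "Poly_Mapping.keys a \<subseteq> set (xvars dim @ yvars dim)" using vars_subset[OF \<sigma>] by blast
  fix w assume w: "w permutes {1..dim}"
  obtain \<beta> where \<beta>: "\<beta> \<in> compositions dim r" "a = mon dim (\<lambda>i. \<sigma> * int (\<beta> i))"
    using a unfolding complete_hom_set[OF \<sigma>] by blast
  have \<beta>w: "(\<lambda>i. \<beta> (w i)) \<in> compositions dim r"
  proof -
    have "\<beta> (w i) = 0" if "i \<notin> {1..dim}" for i
      using permutes_not_in[OF w that] \<beta>(1) that by (simp add: compositions_def)
    moreover have "(\<Sum>i\<in>{1..dim}. \<beta> (w i)) = r"
      using \<beta>(1) sum.permute[OF w, of \<beta>] by (simp add: compositions_def o_def)
    ultimately show ?thesis unfolding compositions_def by blast
  qed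
  have pw: "permmon w a = mon dim (\<lambda>i. \<sigma> * int (\<beta> (w i)))" by (simp add: \<beta>(2) permmon_mon[OF w])
  show "permmon w a \<in> {a. Poly_Mapping.keys a \<subseteq> vars \<sigma> \<and> (\<Sum>v\<in>vars \<sigma>. lkp a v) = r}"
    unfolding complete_hom_set[OF \<sigma>] pw by (rule imageI[OF \<beta>w])
qed

lemma symm_complete_hom_prod: "\<sigma> = 1 \<or> \<sigma> = - 1 \<Longrightarrow> symm dim (complete_hom_prod (vars \<sigma>) q)"
  unfolding complete_hom_prod_def by (rule symm_prod_list) (auto intro: symm_complete_hom)

lemma act_complete_hom:
  "\<sigma> = 1 \<or> \<sigma> = - 1 \<Longrightarrow> act (complete_hom (vars \<sigma>) r) \<phi> b =
    (\<Sum>a\<in>{a. Poly_Mapping.keys a \<subseteq> vars \<sigma> \<and> (\<Sum>v\<in>vars \<sigma>. lkp a v) = r}. \<phi> (a + b))"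
  by (simp add: complete_hom_def act_sum act_single)

text \<open>The polynomial involves all \<open>dim\<close> variables of its kind, but only those on
  the arm contribute. A monomial touching the other arm creates a factor \<open>x_i y_i\<close>. One
  touching \<open>piv\<close> produces more nonzero exponents of this sign than the arm is long,
  which no shift of \<open>\<Delta>\<close> supports.\<close>

lemma act_complete_hom_hstep:
  assumes \<sigma>: "\<sigma> = 1 \<or> \<sigma> = - 1" and v: "\<And>j. j \<in> {1..len \<sigma>} \<Longrightarrow> 0 < v j"
    and e: "e piv = 0" "\<And>i. i \<in> {1..dim} \<Longrightarrow> side (- \<sigma>) i \<Longrightarrow> \<sigma> * e i < 0"
  shows "act (complete_hom (vars \<sigma>) r) (act P \<Delta>) (mon dim (comb \<sigma> e v)) =
    hstep (len \<sigma>) r (\<lambda>v. act P \<Delta> (mon dim (comb \<sigma> e v))) v"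
proof -
  let ?A = "{a. Poly_Mapping.keys a \<subseteq> vars \<sigma> \<and> (\<Sum>v\<in>vars \<sigma>. lkp a v) = r}"
  let ?emb = "\<lambda>\<beta>. mon dim (comb \<sigma> (\<lambda>_. 0) \<beta>)"
  let ?C = "compositions (len \<sigma>) r"
  let ?\<phi> = "act P \<Delta>"
  have \<sigma>\<sigma>: "\<sigma> * (\<sigma> * x) = x" for x using \<sigma> by auto
  have \<sigma>2: "- \<sigma> = 1 \<or> - \<sigma> = - 1" using \<sigma> by auto
  have full: "?emb \<beta> = mon dim (\<lambda>i. \<sigma> * int (if side \<sigma> i then \<beta> (dist \<sigma> i) else 0))" for \<beta>
    by (rule mon_cong) (auto simp: comb_def)
  have reindex: "(\<Sum>i\<in>{1..dim}. if side \<sigma> i then \<beta> (dist \<sigma> i) else 0) = (\<Sum>j\<in>{1..len \<sigma>}. \<beta> j)" for \<beta> :: "nat \<Rightarrow> nat"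
  proof -
    have "(\<Sum>i\<in>{1..dim}. if side \<sigma> i then \<beta> (dist \<sigma> i) else 0) = (\<Sum>i\<in>{i \<in> {1..dim}. side \<sigma> i}. \<beta> (dist \<sigma> i))"
      by (simp add: sum.If_cases Int_def)
    also have "\<dots> = (\<Sum>j\<in>{1..len \<sigma>}. \<beta> j)"
      by (rule sum.reindex_bij_witness[of _ "place \<sigma>" "dist \<sigma>"]) (use place[OF \<sigma>] dist[OF \<sigma>] in auto)
    finally show ?thesis .
  qed
  have embA: "?emb \<beta> \<in> ?A" if \<beta>: "\<beta> \<in> ?C" for \<beta>
  proof -
    let ?\<gamma> = "\<lambda>i. if i \<in> {1..dim} \<and> side \<sigma> i then \<beta> (dist \<sigma> i) else 0"
    have \<gamma>: "?\<gamma> \<in> compositions dim r"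
    proof -
      have "(\<Sum>i\<in>{1..dim}. if i \<in> {1..dim} \<and> side \<sigma> i then \<beta> (dist \<sigma> i) else 0) = (\<Sum>i\<in>{1..dim}. if side \<sigma> i then \<beta> (dist \<sigma> i) else 0)"
        by (rule sum.cong) auto
      then show ?thesis using \<beta> reindex[of \<beta>] by (auto simp: compositions_def)
    qed
    have emb: "?emb \<beta> = mon dim (\<lambda>i. \<sigma> * int (?\<gamma> i))"
      by (rule mon_cong) (auto simp: comb_def)
    show ?thesis unfolding complete_hom_set[OF \<sigma>] emb by (rule imageI[OF \<gamma>])
  qed
  have inj: "inj_on ?emb ?C"
  proof (rule inj_onI)
    fix \<beta> \<beta>' assume b: "\<beta> \<in> ?C" "\<beta>' \<in> ?C" "?emb \<beta> = ?emb \<beta>'"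
    show "\<beta> = \<beta>'"
    proof
      fix j show "\<beta> j = \<beta>' j"
      proof (cases "j \<in> {1..len \<sigma>}")
        case True
        then show ?thesis using mon_eqD[OF b(3) place(1)[OF \<sigma> True]] place[OF \<sigma> True] \<sigma> by (auto simp: comb_def)
      next
        case False
        then show ?thesis using b by (simp add: compositions_def)
      qed
    qed
  qed
  have zero: "?\<phi> (a + mon dim (comb \<sigma> e v)) = 0" if a: "a \<in> ?A - ?emb ` ?C" for a
  proof (rule ccontr)
    assume nz: "?\<phi> (a + mon dim (comb \<sigma> e v)) \<noteq> 0"
    obtain \<beta> where \<beta>: "\<beta> \<in> compositions dim r" "a = mon dim (\<lambda>i. \<sigma> * int (\<beta> i))"
      using a unfolding complete_hom_set[OF \<sigma>] by blast
    have "\<exists>i\<in>{1..dim}. \<not> side \<sigma> i \<and> 0 < \<beta> i"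
    proof (rule ccontr)
      assume no: "\<not> ?thesis"
      define \<beta>' where "\<beta>' j = (if j \<in> {1..len \<sigma>} then \<beta> (place \<sigma> j) else 0)" for j
      have eq: "\<beta> i = (if side \<sigma> i then \<beta>' (dist \<sigma> i) else 0)" if "i \<in> {1..dim}" for i
        using no that dist[OF \<sigma> that] by (auto simp: \<beta>'_def)
      have "(\<Sum>i\<in>{1..dim}. \<beta> i) = (\<Sum>i\<in>{1..dim}. if side \<sigma> i then \<beta>' (dist \<sigma> i) else 0)"
        by (rule sum.cong) (use eq in auto)
      then have "\<beta>' \<in> ?C" using \<beta>(1) reindex[of \<beta>'] by (auto simp: compositions_def \<beta>'_def)
      moreover have "a = ?emb \<beta>'" unfolding \<beta>(2) full by (rule mon_cong) (simp add: eq)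
      ultimately show False using a by blast
    qed
    then obtain i where i: "i \<in> {1..dim}" "\<not> side \<sigma> i" "0 < \<beta> i" by blast
    obtain e' w where e': "a + mon dim (comb \<sigma> e v) = mon dim e'" "w permutes {1..dim}"
      "\<And>i. i \<in> {1..dim} \<Longrightarrow> 0 \<le> e' i \<and> e' i \<le> alpha (w i) \<or> alpha (w i) \<le> e' i \<and> e' i \<le> 0"
      using act_\<Delta>_bound[OF nz] by metis
    have sum_eq: "\<sigma> * int (\<beta> k) + comb \<sigma> e v k = e' k"
      and signs: "0 \<le> \<sigma> * int (\<beta> k) \<and> 0 \<le> comb \<sigma> e v k \<or> \<sigma> * int (\<beta> k) \<le> 0 \<and> comb \<sigma> e v k \<le> 0"
      if "k \<in> {1..dim}" for k
      using mon_add_eqD[OF e'(1)[unfolded \<beta>(2)] that] by simp_all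
    show False
    proof (cases rule: side_cases[OF \<sigma>, of i])
      case 1 then show False using i by simp
    next
      case 3
      then have "\<sigma> * comb \<sigma> e v i < 0" using e(2)[OF i(1)] by (simp add: comb_def)
      then show False using signs[OF i(1)] i(3) \<sigma> by auto
    next
      case 2
      have "{place \<sigma> j | j. j \<in> {1..len \<sigma>}} \<union> {piv} \<subseteq> {k \<in> {1..dim}. 0 < \<sigma> * e' k}"
      proof
        fix k assume "k \<in> {place \<sigma> j | j. j \<in> {1..len \<sigma>}} \<union> {piv}"
        then consider j where "j \<in> {1..len \<sigma>}" "k = place \<sigma> j" | "k = piv" by blast
        then show "k \<in> {k \<in> {1..dim}. 0 < \<sigma> * e' k}"
        proof cases
          case (1 j)
          then have k: "k \<in> {1..dim}" "comb \<sigma> e v k = \<sigma> * int (v j)" using place[OF \<sigma> 1(1)] by (auto simp: comb_def)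
          have "\<sigma> * e' k = int (\<beta> k) + int (v j)" using sum_eq[OF k(1)] k(2) \<sigma> by auto
          then show ?thesis using k(1) v[OF 1(1)] by simp
        next
          case 2
          then have "\<sigma> * e' k = int (\<beta> k)" using sum_eq[OF i(1)] \<open>i = piv\<close> \<open>\<not> side \<sigma> i\<close> e(1) \<sigma> by (auto simp: comb_def)
          then show ?thesis using i 2 \<open>i = piv\<close> by simp
        qed
      qed
      then have "card ({place \<sigma> j | j. j \<in> {1..len \<sigma>}} \<union> {piv}) \<le> card {k \<in> {1..dim}. 0 < \<sigma> * e' k}"
        by (rule card_mono[rotated]) simp
      moreover have "card ({place \<sigma> j | j. j \<in> {1..len \<sigma>}} \<union> {piv}) = Suc (len \<sigma>)"
      proof -
        have im: "{place \<sigma> j | j. j \<in> {1..len \<sigma>}} = place \<sigma> ` {1..len \<sigma>}" by auto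
        have "inj_on (place \<sigma>) {1..len \<sigma>}" using place(3)[OF \<sigma>] by (rule inj_on_inverseI)
        then have "card (place \<sigma> ` {1..len \<sigma>}) = len \<sigma>" by (simp add: card_image)
        moreover have "piv \<notin> place \<sigma> ` {1..len \<sigma>}"
        proof
          assume "piv \<in> place \<sigma> ` {1..len \<sigma>}"
          then obtain j where "j \<in> {1..len \<sigma>}" "piv = place \<sigma> j" by blast
          then have "side \<sigma> piv" using place(2)[OF \<sigma>, of j] by simp
          then show False by (simp add: side_def)
        qed
        ultimately show ?thesis unfolding im by simp
      qed
      moreover have "card {k \<in> {1..dim}. 0 < \<sigma> * e' k} \<le> len \<sigma>"
        using card_pos_neg[OF e'(2,3)] \<sigma> by (auto simp: len_def mm_def pp_def dim_def piv_def)
      ultimately show False by simp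
    qed
  qed
  have "act (complete_hom (vars \<sigma>) r) ?\<phi> (mon dim (comb \<sigma> e v)) = (\<Sum>a\<in>?A. ?\<phi> (a + mon dim (comb \<sigma> e v)))"
    by (rule act_complete_hom[OF \<sigma>])
  also have "\<dots> = (\<Sum>a\<in>?emb ` ?C. ?\<phi> (a + mon dim (comb \<sigma> e v)))"
    by (rule sum.mono_neutral_right[OF finite_complete_hom_set[OF \<sigma>]]) (use embA zero in blast)+
  also have "\<dots> = (\<Sum>\<beta>\<in>?C. ?\<phi> (?emb \<beta> + mon dim (comb \<sigma> e v)))"
    by (simp only: sum.reindex[OF inj] o_def)
  also have "\<dots> = (\<Sum>\<beta>\<in>?C. ?\<phi> (mon dim (comb \<sigma> e (\<lambda>j. v j + \<beta> j))))"
  proof (rule sum.cong)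
    fix \<beta>
    have "?emb \<beta> + mon dim (comb \<sigma> e v) = mon dim (\<lambda>i. comb \<sigma> (\<lambda>_. 0) \<beta> i + comb \<sigma> e v i)"
      by (rule mon_add) (use \<sigma> in \<open>auto simp: comb_def\<close>)
    also have "\<dots> = mon dim (comb \<sigma> e (\<lambda>j. v j + \<beta> j))"
      by (rule mon_cong) (auto simp: comb_def algebra_simps)
    finally show "?\<phi> (?emb \<beta> + mon dim (comb \<sigma> e v)) = ?\<phi> (mon dim (comb \<sigma> e (\<lambda>j. v j + \<beta> j)))" by simp
  qed simp
  finally show ?thesis by (simp add: hstep_def)
qed

text \<open>The factors commute, so they may be arranged with the first entry of \<open>q\<close>
  acting first, the order in which the strips are peeled off.\<close>

lemma act_complete_hom_prod:
  "act (complete_hom_prod V q) \<phi> = fold (\<lambda>r. act (complete_hom V r)) q \<phi>"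
proof -
  have "complete_hom_prod V q = prod_list (map (complete_hom V) (rev q))"
    by (simp add: complete_hom_prod_def prod_list.rev flip: rev_map)
  moreover have "act (prod_list (map (complete_hom V) xs)) \<phi> = foldr (\<lambda>r. act (complete_hom V r)) xs \<phi>" for xs
    by (induction xs) (simp_all add: act_mult)
  ultimately show ?thesis by (simp add: foldr_conv_fold)
qed

lemma fold_act_symm:
  "\<exists>P'. fold (\<lambda>r. act (complete_hom V r)) q (act P \<phi>) = act P' \<phi>"
  using act_mult[of "complete_hom_prod V q" P \<phi>] by (metis act_complete_hom_prod)

lemma act_complete_hom_prod_hsteps:
  assumes \<sigma>: "\<sigma> = 1 \<or> \<sigma> = - 1" and v: "\<And>j. j \<in> {1..len \<sigma>} \<Longrightarrow> 0 < v j"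
    and e: "e piv = 0" "\<And>i. i \<in> {1..dim} \<Longrightarrow> side (- \<sigma>) i \<Longrightarrow> \<sigma> * e i < 0"
  shows "fold (\<lambda>r. act (complete_hom (vars \<sigma>) r)) q (act P \<Delta>) (mon dim (comb \<sigma> e v)) =
    fold (hstep (len \<sigma>)) q (\<lambda>v. act P \<Delta> (mon dim (comb \<sigma> e v))) v"
  using v
proof (induction q arbitrary: v rule: rev_induct)
  case (snoc r q)
  obtain P' where P': "fold (\<lambda>r. act (complete_hom (vars \<sigma>) r)) q (act P \<Delta>) = act P' \<Delta>"
    using fold_act_symm by blast
  have "fold (\<lambda>r. act (complete_hom (vars \<sigma>) r)) (q @ [r]) (act P \<Delta>) (mon dim (comb \<sigma> e v)) =
      hstep (len \<sigma>) r (\<lambda>v. act P' \<Delta> (mon dim (comb \<sigma> e v))) v"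
    using act_complete_hom_hstep[of \<sigma> v e r P', OF \<sigma> snoc.prems e] by (simp add: P')
  also have "\<dots> = hstep (len \<sigma>) r (fold (hstep (len \<sigma>)) q (\<lambda>v. act P \<Delta> (mon dim (comb \<sigma> e v)))) v"
  proof -
    have "act P' \<Delta> (mon dim (comb \<sigma> e (\<lambda>i. v i + \<beta> i))) =
        fold (hstep (len \<sigma>)) q (\<lambda>v. act P \<Delta> (mon dim (comb \<sigma> e v))) (\<lambda>i. v i + \<beta> i)" for \<beta>
    proof -
      have "0 < v j + \<beta> j" if "j \<in> {1..len \<sigma>}" for j using snoc.prems[OF that] by simp
      from snoc.IH[of "\<lambda>j. v j + \<beta> j", OF this] show ?thesis unfolding P' .
    qed
    then show ?thesis by (simp only: hstep_def)
  qed
  finally show ?case by simp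
qed simp

lemma strict_bij_eq_id:
  fixes f :: "nat \<Rightarrow> nat"
  assumes strict: "\<And>i. 1 \<le> i \<Longrightarrow> i < M \<Longrightarrow> f i < f (Suc i)" and range: "\<And>i. i \<in> {1..M} \<Longrightarrow> f i \<in> {1..M}"
    and i: "i \<in> {1..M}"
  shows "f i = i"
proof (rule antisym)
  have up: "j \<le> f j" if "1 \<le> j" "j \<le> M" for j
    using that
  proof (induction j rule: nat_induct_at_least)
    case base then show ?case using range[of 1] by simp
  next
    case (Suc j) then show ?case using strict[of j] by simp
  qed
  show "i \<le> f i" using up i by simp
  have "f i + (M - i) \<le> f M" if "i \<in> {1..M}" for i
  proof -
    have "k \<le> M - i \<Longrightarrow> f i + k \<le> f (i + k)" for k
    proof (induction k)
      case (Suc k)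
      have "f (i + k) < f (Suc (i + k))" using Suc.prems that by (intro strict) auto
      then show ?case using Suc by simp
    qed simp
    from this[of "M - i"] that show ?thesis by simp
  qed
  from this[OF i] range[of M] i show "f i \<le> i" by auto
qed

section \<open>Sliding the outer cells inward\<close>

text \<open>Only the \<open>pp \<sigma> + 1\<close> cells beyond the hole, those with
  \<open>mm \<sigma> \<le> j\<close>, can slide, and \<open>r\<close> lists by how much. Lists in
  \<open>QQ \<sigma>\<close> are weakly decreasing with entries at most
  \<open>kk \<sigma> - 1\<close>, which keeps the cells distinct and inside the hole.\<close>

definition gap :: "int \<Rightarrow> nat list \<Rightarrow> nat \<Rightarrow> nat" where
  "gap \<sigma> r j = (if mm \<sigma> \<le> j \<and> j \<le> len \<sigma> then r ! (j - mm \<sigma>) else 0)"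

definition QQ :: "int \<Rightarrow> nat list set" where "QQ \<sigma> = Qset (kk \<sigma> - 1) (pp \<sigma> + 1)"

lemma QQ_D:
  assumes "r \<in> QQ \<sigma>"
  shows "length r = pp \<sigma> + 1" "\<And>t. t < pp \<sigma> + 1 \<Longrightarrow> r ! t \<le> kk \<sigma> - 1"
    "\<And>t. Suc t < pp \<sigma> + 1 \<Longrightarrow> r ! Suc t \<le> r ! t"
proof -
  have r: "length r = pp \<sigma> + 1" "sorted_wrt (\<ge>) r" "\<forall>x\<in>set r. x \<le> kk \<sigma> - 1"
    using assms by (auto simp: QQ_def Qset_def)
  show "length r = pp \<sigma> + 1" by (rule r(1))
  show "r ! t \<le> kk \<sigma> - 1" if "t < pp \<sigma> + 1" for t using r that by (auto intro: nth_mem)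
  show "r ! Suc t \<le> r ! t" if "Suc t < pp \<sigma> + 1" for t
    using sorted_wrt_nth_less[OF r(2), of t "Suc t"] that r(1) by simp
qed

lemma gap_arm:
  assumes r: "r \<in> QQ \<sigma>"
  shows "\<And>j. 1 \<le> j \<Longrightarrow> j \<le> len \<sigma> \<Longrightarrow> gap \<sigma> r j < arm \<sigma> j"
    and "\<And>j. 1 \<le> j \<Longrightarrow> j < len \<sigma> \<Longrightarrow> arm \<sigma> j - gap \<sigma> r j < arm \<sigma> (Suc j) - gap \<sigma> r (Suc j)"
proof -
  note q = QQ_D[OF r] and p = mm_pos[of \<sigma>] kk_pos[of \<sigma>]
  show "gap \<sigma> r j < arm \<sigma> j" if "1 \<le> j" "j \<le> len \<sigma>" for j
  proof (cases "mm \<sigma> \<le> j")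
    case True
    then have "r ! (j - mm \<sigma>) \<le> kk \<sigma> - 1" using q(2)[of "j - mm \<sigma>"] that by (simp add: len_def)
    then show ?thesis using True that p by (simp add: gap_def arm_def)
  next
    case False
    then show ?thesis using that by (simp add: gap_def arm_def)
  qed
  show "arm \<sigma> j - gap \<sigma> r j < arm \<sigma> (Suc j) - gap \<sigma> r (Suc j)" if j: "1 \<le> j" "j < len \<sigma>" for j
  proof -
    consider "Suc j < mm \<sigma>" | "Suc j = mm \<sigma>" | "mm \<sigma> \<le> j" by linarith
    then show ?thesis
    proof cases
      case 1 then show ?thesis by (simp add: gap_def arm_def)
    next
      case 2 then show ?thesis using q(2)[of 0] j p by (auto simp: gap_def arm_def)
    next
      case 3
      then have "r ! Suc (j - mm \<sigma>) \<le> r ! (j - mm \<sigma>)" "r ! (j - mm \<sigma>) \<le> kk \<sigma> - 1"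
        using q(3)[of "j - mm \<sigma>"] q(2)[of "j - mm \<sigma>"] j by (auto simp: len_def)
      then show ?thesis using 3 j p by (auto simp: gap_def arm_def Suc_diff_le)
    qed
  qed
qed

lemma sum_gap_tail:
  assumes "r \<in> QQ \<sigma>"
  shows "(\<Sum>j\<in>{mm \<sigma> - 1 + s<..len \<sigma>}. gap \<sigma> r j) = (\<Sum>t\<in>{s..<length r}. r ! t)"
  by (rule sum.reindex_bij_witness[of _ "\<lambda>t. t + mm \<sigma>" "\<lambda>j. j - mm \<sigma>"])
    (use mm_pos[of \<sigma>] QQ_D(1)[OF assms] in \<open>auto simp: gap_def len_def\<close>)

text \<open>\<open>R\<close> acts on the other side only, so the exponents on the side \<open>\<sigma>\<close> have to be raised to the full
  \<open>arm \<sigma>\<close> by the complete homogeneous polynomials alone.\<close>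

lemma complete_hom_prod_triangular:
  assumes \<sigma>: "\<sigma> = 1 \<or> \<sigma> = - 1" and R: "symm dim R" "\<And>a. a \<in> Poly_Mapping.keys R \<Longrightarrow> Poly_Mapping.keys a \<subseteq> vars (- \<sigma>)"
    and e: "e piv = 0" "\<And>i. i \<in> {1..dim} \<Longrightarrow> side (- \<sigma>) i \<Longrightarrow> \<sigma> * e i < 0"
    and q: "q \<in> QQ \<sigma>" and r: "r \<in> QQ \<sigma>"
  shows "act (complete_hom_prod (vars \<sigma>) q * R) \<Delta> (mon dim (comb \<sigma> e (\<lambda>j. arm \<sigma> j - gap \<sigma> r j))) \<noteq> 0 \<Longrightarrow>
      tail_weight r \<le> tail_weight q \<and> (tail_weight r = tail_weight q \<longrightarrow> r = q)"
    and "act (complete_hom_prod (vars \<sigma>) q * R) \<Delta> (mon dim (comb \<sigma> e (\<lambda>j. arm \<sigma> j - gap \<sigma> q j))) =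
      act R \<Delta> (mon dim (comb \<sigma> e (arm \<sigma>)))"
proof -
  let ?M = "len \<sigma>" and ?l = "pp \<sigma> + 1"
  define F where "F v = act R \<Delta> (mon dim (comb \<sigma> e v))" for v
  \<comment> \<open>The first position to be unlocked is \<open>mm \<sigma>\<close>, the innermost
    cell beyond the hole.\<close>
  have Ml: "?M - ?l = mm \<sigma> - 1" "?l \<le> ?M" using mm_pos[of \<sigma>] by (auto simp: len_def)
  have \<sigma>\<sigma>: "\<sigma> * (\<sigma> * x) = x" for x using \<sigma> by auto
  have 1: "arm \<sigma> i < arm \<sigma> (Suc i)" if "1 \<le> i" "i < ?M" for i by (rule arm_less) simp
  have 2: "arm \<sigma> (Suc i) = Suc (arm \<sigma> i)" if "?M - ?l < i" "i < ?M" for i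
    using that unfolding Ml by (simp add: arm_def)
  have 3: "adj_antisym ?M F"
    unfolding adj_antisym_def
  proof (intro allI impI)
    fix i v assume i: "1 \<le> i" "i < ?M"
    let ?t = "transpose (place \<sigma> i) (place \<sigma> (Suc i))"
    have pl: "place \<sigma> i \<in> {1..dim}" "place \<sigma> (Suc i) \<in> {1..dim}" using place(1)[OF \<sigma>] i by auto
    have ii: "i \<in> {1..?M}" "Suc i \<in> {1..?M}" using i by auto
    have ne: "place \<sigma> i \<noteq> place \<sigma> (Suc i)" using place_eq_iff[OF \<sigma> ii] by simp
    have t: "?t permutes {1..dim}" by (rule permutes_swap_id[OF pl])
    have "mon dim (comb \<sigma> e (\<lambda>k. v (transpose i (Suc i) k))) = mon dim (\<lambda>k. comb \<sigma> e v (?t k))"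
    proof (rule mon_cong)
      fix k assume k: "k \<in> {1..dim}"
      show "comb \<sigma> e (\<lambda>k. v (transpose i (Suc i) k)) k = comb \<sigma> e v (?t k)"
      proof (cases "side \<sigma> k")
        case False
        then have "k \<noteq> place \<sigma> i" "k \<noteq> place \<sigma> (Suc i)" using place(2)[OF \<sigma> ii(1)] place(2)[OF \<sigma> ii(2)] by blast+
        then show ?thesis using False by (simp add: comb_def)
      next
        case True
        obtain j where j: "j \<in> {1..?M}" "k = place \<sigma> j" using dist[OF \<sigma> k True] by metis
        have tj: "transpose i (Suc i) j \<in> {1..?M}" using i j(1) by (auto simp: transpose_def)
        have "?t k = place \<sigma> (transpose i (Suc i) j)"
          unfolding j(2) transpose_def using place_eq_iff[OF \<sigma> j(1) ii(1)] place_eq_iff[OF \<sigma> j(1) ii(2)] by simp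
        then show ?thesis
          unfolding j(2) using comb_place[OF \<sigma> j(1)] comb_place[OF \<sigma> tj] by simp
      qed
    qed
    then show "F (\<lambda>k. v (transpose i (Suc i) k)) = - F v"
      using antisym_fun_mon[OF symmD[OF R(1) antisym_eps] t, of alpha "comb \<sigma> e v"] ne
      by (simp add: F_def sign_swap_id)
  qed
  \<comment> \<open>\<open>R\<close> leaves the exponents of this side untouched, so they are values
    of \<open>alpha\<close>. They are positive, since a 0 would occur twice (at \<open>piv\<close>
    as well), and strictly increasing, so they run through the whole arm in order.\<close>
  have 4: "v j = arm \<sigma> j" if v: "\<And>i. 1 \<le> i \<Longrightarrow> i < ?M \<Longrightarrow> v i < v (Suc i)" and nz: "F v \<noteq> 0" and j: "j \<in> {1..?M}" for v j
  proof -
    obtain a w where a: "a \<in> Poly_Mapping.keys R" and w: "w permutes {1..dim}"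
      and eq: "a + mon dim (comb \<sigma> e v) = mon dim (\<lambda>i. alpha (w i))"
      using act_eps_neq_0D[OF nz[unfolded F_def]] by metis
    have look: "nat (\<sigma> * comb \<sigma> e v i) = nat (\<sigma> * alpha (w i))" if i: "i \<in> {1..dim}" for i
    proof -
      have "xv \<sigma> i \<notin> vars (- \<sigma>)" using \<sigma> by (auto simp: vars_def xv_def)
      then have "lkp a (xv \<sigma> i) = 0" using R(2)[OF a] by (auto simp: in_keys_iff)
      then show ?thesis
        using arg_cong[OF eq, of "\<lambda>m. lkp m (xv \<sigma> i)"] i unfolding lookup_add lookup_mon_xv[OF \<sigma>] by simp
    qed
    have win: "w i \<in> {1..dim}" if "i \<in> {1..dim}" for i using permutes_in_image[OF w] that by blast
    have alpha_side_iff: "0 < \<sigma> * alpha i \<longleftrightarrow> side \<sigma> i" if "i \<in> {1..dim}" for i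
      using \<alpha>_pos_iff[OF that] \<alpha>_neg_iff[OF that] \<sigma> by (auto simp: side_def)
    have vpos: "0 < v i" if i: "i \<in> {1..?M}" for i
    proof (rule ccontr)
      assume "\<not> 0 < v i"
      then have "comb \<sigma> e v (place \<sigma> i) = comb \<sigma> e v piv"
        using place(2,3)[OF \<sigma> i] e(1) by (simp add: comb_def side_def)
      moreover have "place \<sigma> i \<noteq> piv" using place(2)[OF \<sigma> i] by (auto simp: side_def)
      ultimately have "F v = 0"
        unfolding F_def using place(1)[OF \<sigma> i] N
        by (intro antisym_fun_eq_0[OF symmD[OF R(1) antisym_eps[of dim alpha]], of "place \<sigma> i" piv]) auto
      with nz show False by simp
    qed
    define f where "f i = dist \<sigma> (w (place \<sigma> i))" for i
    have f: "f i \<in> {1..?M}" "v i = arm \<sigma> (f i)" if i: "i \<in> {1..?M}" for i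
    proof -
      note pl = place[OF \<sigma> i]
      have "nat (\<sigma> * alpha (w (place \<sigma> i))) = v i"
        using look[OF pl(1)] pl(2,3) by (simp add: comb_def \<sigma>\<sigma>)
      then have sd: "side \<sigma> (w (place \<sigma> i))"
        using alpha_side_iff[OF win[OF pl(1)]] vpos[OF i] by linarith
      then show "f i \<in> {1..?M}" unfolding f_def by (intro dist(1)[OF \<sigma> win[OF pl(1)]])
      show "v i = arm \<sigma> (f i)"
        using \<open>nat (\<sigma> * alpha (w (place \<sigma> i))) = v i\<close> alpha_side[OF \<sigma> sd] by (simp add: \<sigma>\<sigma> f_def)
    qed
    have "f i < f (Suc i)" if i: "1 \<le> i" "i < ?M" for i
    proof (rule ccontr)
      assume "\<not> f i < f (Suc i)"
      then have "arm \<sigma> (f (Suc i)) \<le> arm \<sigma> (f i)"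
        using arm_less[of "f (Suc i)" "f i" \<sigma>] by (cases "f i = f (Suc i)") auto
      then show False using v[OF i] f(2)[of i] f(2)[of "Suc i"] i by simp
    qed
    then have "f j = j" using strict_bij_eq_id[of ?M f j] f(1) j by blast
    then show ?thesis using f(2)[OF j] by simp
  qed
  have 5: "F v = F v'" if vv: "\<And>i. i \<in> {1..?M} \<Longrightarrow> v i = v' i" for v v'
  proof -
    have "mon dim (comb \<sigma> e v) = mon dim (comb \<sigma> e v')"
      by (rule mon_cong) (use vv dist(1)[OF \<sigma>] in \<open>auto simp: comb_def\<close>)
    then show ?thesis by (simp add: F_def)
  qed
  interpret strips: horizontal_strips ?M ?l "arm \<sigma>" F q
  proof
    show "?l \<le> ?M" by (rule Ml(2))
    show "arm \<sigma> i < arm \<sigma> (Suc i)" if "1 \<le> i" "i < ?M" for i using that by (rule 1)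
    show "arm \<sigma> (Suc i) = Suc (arm \<sigma> i)" if "?M - ?l < i" "i < ?M" for i using that by (rule 2)
    show "adj_antisym ?M F" by (rule 3)
    show "v i = arm \<sigma> i" if "\<And>i. 1 \<le> i \<Longrightarrow> i < ?M \<Longrightarrow> v i < v (Suc i)" "F v \<noteq> 0" "i \<in> {1..?M}" for v i
      using that by (rule 4)
    show "F v = F v'" if "\<And>i. i \<in> {1..?M} \<Longrightarrow> v i = v' i" for v v' using that by (rule 5)
    show "length q = ?l" by (rule QQ_D(1)[OF q])
  qed
  have fold_eq: "act (complete_hom_prod (vars \<sigma>) q * R) \<Delta> (mon dim (comb \<sigma> e (\<lambda>j. arm \<sigma> j - gap \<sigma> s j))) =
      fold (hstep ?M) q F (\<lambda>j. arm \<sigma> j - gap \<sigma> s j)" if s: "s \<in> QQ \<sigma>" for s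
    unfolding act_mult act_complete_hom_prod F_def
  proof (rule act_complete_hom_prod_hsteps[OF \<sigma>])
    show "0 < arm \<sigma> j - gap \<sigma> s j" if "j \<in> {1..?M}" for j using gap_arm(1)[OF s, of j] that by simp
  qed (use e in auto)
  have take_q: "take ?l q = q" using QQ_D(1)[OF q] by simp
  show "act (complete_hom_prod (vars \<sigma>) q * R) \<Delta> (mon dim (comb \<sigma> e (\<lambda>j. arm \<sigma> j - gap \<sigma> q j))) =
      act R \<Delta> (mon dim (comb \<sigma> e (arm \<sigma>)))"
  proof -
    have "fold (hstep ?M) (take ?l q) F (\<lambda>j. arm \<sigma> j - gap \<sigma> q j) = F (arm \<sigma>)"
    proof (rule strips.hsteps_diagonal[OF order_refl])
      show "arm \<sigma> i - gap \<sigma> q i < arm \<sigma> (Suc i) - gap \<sigma> q (Suc i)" if "1 \<le> i" "i < ?M" for i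
        by (rule gap_arm(2)[OF q that])
      fix i assume i: "i \<in> {1..?M}"
      have "(?M - ?l < i \<and> i \<le> ?M - ?l + ?l) \<longleftrightarrow> (mm \<sigma> \<le> i \<and> i \<le> ?M)" "i - (?M - ?l) - 1 = i - mm \<sigma>"
        using Ml mm_pos[of \<sigma>] by auto
      then have "(if ?M - ?l < i \<and> i \<le> ?M - ?l + ?l then q ! (i - (?M - ?l) - 1) else 0) = gap \<sigma> q i"
        by (simp add: gap_def)
      then show "arm \<sigma> i - gap \<sigma> q i + (if ?M - ?l < i \<and> i \<le> ?M - ?l + ?l then q ! (i - (?M - ?l) - 1) else 0) = arm \<sigma> i"
        using gap_arm(1)[OF q, of i] i by simp
    qed
    then show ?thesis unfolding fold_eq[OF q] take_q by (simp add: F_def)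
  qed
  assume nz: "act (complete_hom_prod (vars \<sigma>) q * R) \<Delta> (mon dim (comb \<sigma> e (\<lambda>j. arm \<sigma> j - gap \<sigma> r j))) \<noteq> 0"
  have "fold (hstep ?M) (take ?l q) F (\<lambda>j. arm \<sigma> j - gap \<sigma> r j) \<noteq> 0"
    using nz unfolding fold_eq[OF r] take_q .
  from strips.hsteps_support[OF order_refl gap_arm(2)[OF r] this]
  have tails: "(\<Sum>i\<in>{?M - ?l + s<..?M}. arm \<sigma> i - (arm \<sigma> i - gap \<sigma> r i)) \<le> (\<Sum>t\<in>{s..<?l}. q ! t)" for s
    by blast
  have "(\<Sum>t\<in>{s..<length q}. r ! t) \<le> (\<Sum>t\<in>{s..<length q}. q ! t)" for s
  proof -
    have "(\<Sum>t\<in>{s..<length q}. r ! t) = (\<Sum>i\<in>{?M - ?l + s<..?M}. gap \<sigma> r i)"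
      using sum_gap_tail[OF r, of s] QQ_D(1)[OF q] QQ_D(1)[OF r] Ml(1) by simp
    also have "\<dots> = (\<Sum>i\<in>{?M - ?l + s<..?M}. arm \<sigma> i - (arm \<sigma> i - gap \<sigma> r i))"
      by (rule sum.cong) (use gap_arm(1)[OF r] in \<open>auto simp: less_imp_le\<close>)
    finally show ?thesis using tails[of s] QQ_D(1)[OF q] by simp
  qed
  then show "tail_weight r \<le> tail_weight q \<and> (tail_weight r = tail_weight q \<longrightarrow> r = q)"
    using tail_weight_mono[of r q] QQ_D(1)[OF q] QQ_D(1)[OF r] by simp
qed

end

section \<open>Triangular linear systems\<close>

text \<open>For an index \<open>j\<close> of least weight, \<open>K j\<close> vanishes at every
  other index. The remaining system can be solved first and the coefficient of \<open>j\<close>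
  adjusted last without disturbing it.\<close>

lemma triangular_solve:
  fixes K :: "'a \<Rightarrow> 'a \<Rightarrow> complex" and m :: "'a \<Rightarrow> nat"
  assumes "finite J"
    and tri: "\<And>j i. j \<in> J \<Longrightarrow> i \<in> J \<Longrightarrow> K j i \<noteq> 0 \<Longrightarrow> i = j \<or> m i < m j"
    and diag: "\<And>j. j \<in> J \<Longrightarrow> K j j \<noteq> 0"
  shows "\<exists>c. \<forall>i\<in>J. (\<Sum>j\<in>J. c j * K j i) = y i"
  using assms
proof (induction "card J" arbitrary: J)
  case 0
  then show ?case by simp
next
  case (Suc n J)
  then have "J \<noteq> {}" by auto
  then obtain j where j: "j \<in> J" and min: "\<And>i. i \<in> J \<Longrightarrow> m j \<le> m i"
    using ex_min_if_finite[of "m ` J"] Suc.prems(1) by (metis (no_types, lifting) finite_imageI image_iff image_is_empty not_le)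
  have "\<exists>c. \<forall>i\<in>J - {j}. (\<Sum>k\<in>J - {j}. c k * K k i) = y i"
    by (rule Suc.hyps(1)) (use Suc.hyps(2) Suc.prems j in auto)
  then obtain c where c: "\<And>i. i \<in> J - {j} \<Longrightarrow> (\<Sum>k\<in>J - {j}. c k * K k i) = y i" by blast
  define c' where "c' = c(j := (y j - (\<Sum>k\<in>J - {j}. c k * K k j)) / K j j)"
  have split: "(\<Sum>k\<in>J. c' k * K k i) = c' j * K j i + (\<Sum>k\<in>J - {j}. c k * K k i)" for i
  proof -
    have "(\<Sum>k\<in>J - {j}. c' k * K k i) = (\<Sum>k\<in>J - {j}. c k * K k i)"
      by (rule sum.cong) (auto simp: c'_def)
    then show ?thesis using sum.remove[OF Suc.prems(1) j, of "\<lambda>k. c' k * K k i"] by simp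
  qed
  have "(\<Sum>k\<in>J. c' k * K k i) = y i" if i: "i \<in> J" for i
  proof (cases "i = j")
    case True
    then show ?thesis unfolding split using Suc.prems(3)[OF j] by (simp add: c'_def)
  next
    case False
    have "K j i = 0" using Suc.prems(2)[OF j i] min[OF i] False by force
    then show ?thesis unfolding split using c[of i] i False by simp
  qed
  then show ?case by blast
qed

text \<open>Test at an index of largest weight among those with nonzero coefficient: triangularity
  removes all other terms.\<close>

lemma triangular_independent:
  fixes K :: "'a \<Rightarrow> 'b \<Rightarrow> complex" and m :: "'a \<Rightarrow> 'c::linorder"
  assumes J: "finite J"
    and tri: "\<And>j i. j \<in> J \<Longrightarrow> i \<in> J \<Longrightarrow> m j \<le> m i \<Longrightarrow> K j (f i) \<noteq> 0 \<Longrightarrow> j = i"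
    and diag: "\<And>j. j \<in> J \<Longrightarrow> K j (f j) \<noteq> 0"
    and zero: "\<And>i. i \<in> J \<Longrightarrow> (\<Sum>j\<in>J. c j * K j (f i)) = 0"
    and j: "j \<in> J"
  shows "c j = 0"
proof (rule ccontr)
  assume "c j \<noteq> 0"
  let ?S = "{j \<in> J. c j \<noteq> 0}"
  have "finite (m ` ?S)" "m ` ?S \<noteq> {}" using J j \<open>c j \<noteq> 0\<close> by auto
  then have "Max (m ` ?S) \<in> m ` ?S" by (rule Max_in)
  then obtain i where i: "i \<in> J" "c i \<noteq> 0" "m i = Max (m ` ?S)" by auto
  have max: "m k \<le> m i" if "k \<in> ?S" for k
    unfolding i(3) using that J by (intro Max_ge) auto
  have "(\<Sum>k\<in>J. c k * K k (f i)) = c i * K i (f i) + (\<Sum>k\<in>J - {i}. c k * K k (f i))"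
    by (rule sum.remove[OF J i(1)])
  also have "(\<Sum>k\<in>J - {i}. c k * K k (f i)) = 0"
  proof (rule sum.neutral, rule ballI)
    fix k assume k: "k \<in> J - {i}"
    show "c k * K k (f i) = 0"
    proof (cases "c k = 0")
      case False
      then have "m k \<le> m i" using max k by simp
      then have "K k (f i) = 0" using tri[of k i] k i(1) by blast
      then show ?thesis by simp
    qed simp
  qed
  finally show False using zero[OF i(1)] diag[OF i(1)] i(2) by simp
qed

section \<open>Symmetric polynomials modulo the annihilator\<close>

context hollow_params begin

definition xcoord :: "nat list \<Rightarrow> nat \<Rightarrow> nat" where "xcoord r j = arm 1 j - gap 1 r j"
definition ycoord :: "nat list \<Rightarrow> nat \<Rightarrow> nat" where "ycoord r j = arm (- 1) j - gap (- 1) r j"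

text \<open>The exponents after the outer cells have slid inward by \<open>r\<close> on the
  \<open>x\<close> arm and by \<open>r'\<close> on the \<open>y\<close> arm.\<close>

definition grid :: "nat list \<Rightarrow> nat list \<Rightarrow> nat \<Rightarrow> int" where
  "grid r r' = comb 1 (comb (- 1) (\<lambda>_. 0) (ycoord r')) (xcoord r)"

definition hh :: "nat list \<Rightarrow> nat list \<Rightarrow> xypoly" where
  "hh q q' = complete_hom_prod (vars 1) q * complete_hom_prod (vars (- 1)) q'"

lemma not_both_sides: "\<not> (side 1 i \<and> side (- 1) i)" "\<not> side \<sigma> piv"
  by (auto simp: side_def)

lemma comb_swap: "comb 1 (comb (- 1) e v) u = comb (- 1) (comb 1 e u) v"
  using not_both_sides(1) by (auto simp: comb_def fun_eq_iff)

lemma grid_alt: "grid r r' = comb (- 1) (comb 1 (\<lambda>_. 0) (xcoord r)) (ycoord r')"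
  by (simp only: grid_def comb_swap)

lemma alpha_eq_comb: "alpha = comb (- 1) (comb 1 (\<lambda>_. 0) (arm 1)) (arm (- 1))"
proof
  fix i
  show "alpha i = comb (- 1) (comb 1 (\<lambda>_. 0) (arm 1)) (arm (- 1)) i"
  proof (rule side_cases[of 1 i])
    show "(1::int) = 1 \<or> (1::int) = - 1" by simp
  next
    assume "side 1 i" "\<not> side (- 1) i" "i \<noteq> piv"
    then show ?thesis using alpha_side[of 1 i] by (simp add: comb_def)
  next
    assume "i = piv" "\<not> side 1 i" "\<not> side (- 1) i"
    then show ?thesis using \<alpha>N by (simp add: comb_def)
  next
    assume "side (- 1) i" "\<not> side 1 i" "i \<noteq> piv"
    then show ?thesis using alpha_side[of "- 1" i] by (simp add: comb_def)
  qed
qed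

lemma comb_side_neg:
  assumes "side \<tau> i" "i \<in> {1..dim}" "\<tau> = 1 \<or> \<tau> = - 1" "\<And>j. j \<in> {1..len \<tau>} \<Longrightarrow> 0 < v j"
  shows "- \<tau> * comb \<tau> e v i < 0"
  using assms(4)[OF dist(1)[OF assms(3,2,1)]] assms(1,3) by (auto simp: comb_def)

lemma coord_pos:
  "r \<in> QQ 1 \<Longrightarrow> j \<in> {1..len 1} \<Longrightarrow> 0 < xcoord r j"
  "r \<in> QQ (- 1) \<Longrightarrow> j \<in> {1..len (- 1)} \<Longrightarrow> 0 < ycoord r j"
  "j \<in> {1..len \<sigma>} \<Longrightarrow> 0 < arm \<sigma> j"
  using gap_arm(1)[of r 1 j] gap_arm(1)[of r "- 1" j] arm_ge[of j \<sigma>] by (auto simp: xcoord_def ycoord_def)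

lemma keys_complete_hom:
  assumes \<sigma>: "\<sigma> = 1 \<or> \<sigma> = - 1" and "a \<in> Poly_Mapping.keys (complete_hom (vars \<sigma>) r)"
  shows "Poly_Mapping.keys a \<subseteq> vars \<sigma>"
proof -
  have "lkp (complete_hom (vars \<sigma>) r) a \<noteq> 0" using assms(2) by (simp add: in_keys_iff)
  then have "(\<Sum>b\<in>{b. Poly_Mapping.keys b \<subseteq> vars \<sigma> \<and> (\<Sum>v\<in>vars \<sigma>. lkp b v) = r}. lkp (Poly_Mapping.single b (1::complex)) a) \<noteq> 0"
    unfolding complete_hom_def lookup_sum .
  then obtain b where "b \<in> {b. Poly_Mapping.keys b \<subseteq> vars \<sigma> \<and> (\<Sum>v\<in>vars \<sigma>. lkp b v) = r}"
    "lkp (Poly_Mapping.single b (1::complex)) a \<noteq> 0"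
    by (meson sum.not_neutral_contains_not_neutral)
  then show ?thesis by (auto simp: lookup_single when_def split: if_splits)
qed

lemma keys_complete_hom_prod:
  assumes \<sigma>: "\<sigma> = 1 \<or> \<sigma> = - 1"
  shows "a \<in> Poly_Mapping.keys (complete_hom_prod (vars \<sigma>) q) \<Longrightarrow> Poly_Mapping.keys a \<subseteq> vars \<sigma>"
proof (induction q arbitrary: a)
  case Nil
  then show ?case by (simp add: complete_hom_prod_def)
next
  case (Cons r q)
  then have "a \<in> Poly_Mapping.keys (complete_hom (vars \<sigma>) r * complete_hom_prod (vars \<sigma>) q)"
    by (simp add: complete_hom_prod_def)
  then obtain b c where bc: "a = b + c" "b \<in> Poly_Mapping.keys (complete_hom (vars \<sigma>) r)"
    "c \<in> Poly_Mapping.keys (complete_hom_prod (vars \<sigma>) q)"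
    using keys_mult[of "complete_hom (vars \<sigma>) r" "complete_hom_prod (vars \<sigma>) q"] by blast
  then show ?case
    using keys_complete_hom[OF \<sigma> bc(2)] Cons.IH[OF bc(3)] Poly_Mapping.keys_add[of b c] by blast
qed

lemma symm_hh: "symm dim (hh q q')"
  unfolding hh_def by (intro symm_mult symm_complete_hom_prod) auto

text \<open>Each arm is treated with the complete homogeneous product of the other arm as the factor
  \<open>R\<close>; the two involve disjoint sets of variables. On the diagonal the arms are
  restored to full length one after the other, and the coefficient of \<open>\<Delta>\<close> at
  \<open>alpha\<close> is 1.\<close>

lemma hh_triangular:
  assumes q: "q \<in> QQ 1" "q' \<in> QQ (- 1)" and r: "r \<in> QQ 1" "r' \<in> QQ (- 1)"
  shows "act (hh q q') \<Delta> (mon dim (grid r r')) \<noteq> 0 \<Longrightarrow>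
      tail_weight r \<le> tail_weight q \<and> (tail_weight r = tail_weight q \<longrightarrow> r = q) \<and>
      tail_weight r' \<le> tail_weight q' \<and> (tail_weight r' = tail_weight q' \<longrightarrow> r' = q')"
    and "act (hh q q') \<Delta> (mon dim (grid q q')) = 1"
proof -
  have s1: "(1::int) = 1 \<or> (1::int) = - 1" and s2: "(- 1::int) = 1 \<or> (- 1::int) = - 1" by simp_all
  have X: "act (hh q q') \<Delta> (mon dim (grid r r')) \<noteq> 0 \<Longrightarrow>
      tail_weight r \<le> tail_weight q \<and> (tail_weight r = tail_weight q \<longrightarrow> r = q)"
    and X': "act (hh q q') \<Delta> (mon dim (grid q r')) =
      act (complete_hom_prod (vars (- 1)) q') \<Delta> (mon dim (comb 1 (comb (- 1) (\<lambda>_. 0) (ycoord r')) (arm 1)))"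
    if r': "r' \<in> QQ (- 1)" for r'
  proof -
    have R: "symm dim (complete_hom_prod (vars (- 1)) q')" by (rule symm_complete_hom_prod[OF s2])
    have keys: "Poly_Mapping.keys a \<subseteq> vars (- 1)" if "a \<in> Poly_Mapping.keys (complete_hom_prod (vars (- 1)) q')" for a
      by (rule keys_complete_hom_prod[OF s2 that])
    have e0: "comb (- 1) (\<lambda>_. 0) (ycoord r') piv = 0" using not_both_sides(2) by (simp add: comb_def)
    have e1: "1 * comb (- 1) (\<lambda>_. 0) (ycoord r') i < 0" if "i \<in> {1..dim}" "side (- 1) i" for i
      using comb_side_neg[OF that(2,1) s2, of "ycoord r'"] coord_pos(2)[OF r'] by simp
    note tri = complete_hom_prod_triangular[of 1 "complete_hom_prod (vars (- 1)) q'" "comb (- 1) (\<lambda>_. 0) (ycoord r')" q,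
        OF s1 R keys e0 e1 q(1)]
    show "tail_weight r \<le> tail_weight q \<and> (tail_weight r = tail_weight q \<longrightarrow> r = q)"
      if "act (hh q q') \<Delta> (mon dim (grid r r')) \<noteq> 0"
      by (rule tri(1)) (use that r(1) in \<open>simp_all add: hh_def grid_def xcoord_def[abs_def]\<close>)
    show "act (hh q q') \<Delta> (mon dim (grid q r')) =
      act (complete_hom_prod (vars (- 1)) q') \<Delta> (mon dim (comb 1 (comb (- 1) (\<lambda>_. 0) (ycoord r')) (arm 1)))"
      unfolding hh_def grid_def xcoord_def[abs_def] by (rule tri(2)) (use r(1) in simp_all)
  qed
  have Y: "act (hh q q') \<Delta> (mon dim (grid r r')) \<noteq> 0 \<Longrightarrow>
      tail_weight r' \<le> tail_weight q' \<and> (tail_weight r' = tail_weight q' \<longrightarrow> r' = q')"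
  proof -
    assume nz: "act (hh q q') \<Delta> (mon dim (grid r r')) \<noteq> 0"
    have R: "symm dim (complete_hom_prod (vars 1) q)" by (rule symm_complete_hom_prod[OF s1])
    have keys: "Poly_Mapping.keys a \<subseteq> vars (- (- 1))" if "a \<in> Poly_Mapping.keys (complete_hom_prod (vars 1) q)" for a
      using keys_complete_hom_prod[OF s1 that] by simp
    have e0: "comb 1 (\<lambda>_. 0) (xcoord r) piv = 0" using not_both_sides(2) by (simp add: comb_def)
    have e1: "- 1 * comb 1 (\<lambda>_. 0) (xcoord r) i < 0" if "i \<in> {1..dim}" "side (- (- 1)) i" for i
      using comb_side_neg[of 1 i "xcoord r"] that coord_pos(1)[OF r(1)] by simp
    note tri = complete_hom_prod_triangular(1)[of "- 1" "complete_hom_prod (vars 1) q" "comb 1 (\<lambda>_. 0) (xcoord r)" q' r',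
        OF s2 R keys e0 e1 q(2) r(2)]
    show ?thesis
      by (rule tri) (use nz in \<open>simp_all add: hh_def grid_alt ycoord_def[abs_def] mult.commute\<close>)
  qed
  show "act (hh q q') \<Delta> (mon dim (grid r r')) \<noteq> 0 \<Longrightarrow>
      tail_weight r \<le> tail_weight q \<and> (tail_weight r = tail_weight q \<longrightarrow> r = q) \<and>
      tail_weight r' \<le> tail_weight q' \<and> (tail_weight r' = tail_weight q' \<longrightarrow> r' = q')"
    using X[OF r(2)] Y by blast
  have e0: "comb 1 (\<lambda>_. 0) (arm 1) piv = 0" using not_both_sides(2) by (simp add: comb_def)
  have e1: "- 1 * comb 1 (\<lambda>_. 0) (arm 1) i < 0" if "i \<in> {1..dim}" "side (- (- 1)) i" for i
    using comb_side_neg[of 1 i "arm 1"] that coord_pos(3)[of _ 1] by simp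
  have "act (complete_hom_prod (vars (- 1)) q' * 1) \<Delta>
      (mon dim (comb (- 1) (comb 1 (\<lambda>_. 0) (arm 1)) (\<lambda>j. arm (- 1) j - gap (- 1) q' j))) =
      act 1 \<Delta> (mon dim (comb (- 1) (comb 1 (\<lambda>_. 0) (arm 1)) (arm (- 1))))"
    by (rule complete_hom_prod_triangular(2)[of "- 1" 1 "comb 1 (\<lambda>_. 0) (arm 1)" q' r'])
      (use symm_1 e0 e1 q(2) r(2) in auto)
  moreover have "comb 1 (comb (- 1) (\<lambda>_. 0) (ycoord q')) (arm 1) =
      comb (- 1) (comb 1 (\<lambda>_. 0) (arm 1)) (\<lambda>j. arm (- 1) j - gap (- 1) q' j)"
    by (simp only: comb_swap ycoord_def[abs_def])
  moreover have "\<Delta> (mon dim alpha) = 1"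
    using eps_mon_perm[OF inj_\<alpha> permutes_id] by (simp add: sign_id)
  ultimately show "act (hh q q') \<Delta> (mon dim (grid q q')) = 1"
    unfolding X'[OF q(2)] by (simp flip: alpha_eq_comb)
qed

lemma finite_QQ: "finite (QQ \<sigma>)"
proof -
  have "QQ \<sigma> \<subseteq> {q. set q \<subseteq> {..kk \<sigma> - 1} \<and> length q = pp \<sigma> + 1}" by (auto simp: QQ_def Qset_def)
  then show ?thesis by (rule finite_subset) (rule finite_lists_length_eq, simp)
qed

text \<open>Strictness makes the \<open>j\<close>-th exponent of the arm at least \<open>j\<close>
  in absolute value, and a pigeonhole argument makes it at most \<open>arm \<sigma> j\<close>. These
  bounds coincide on the inner cells and leave room \<open>kk \<sigma> - 1\<close> beyond the hole.
  There consecutive arm lengths differ by one, so strictness makes the deficits weakly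
  decreasing.\<close>

lemma sorted_exponents_grid_side:
  assumes \<sigma>: "\<sigma> = 1 \<or> \<sigma> = - 1"
    and strict: "\<And>i. 1 \<le> i \<Longrightarrow> i < dim \<Longrightarrow> e i < e (Suc i)" and e0: "e piv = 0"
    and w: "w permutes {1..dim}"
    and bound: "\<And>i. i \<in> {1..dim} \<Longrightarrow> 0 \<le> e i \<and> e i \<le> alpha (w i) \<or> alpha (w i) \<le> e i \<and> e i \<le> 0"
  obtains r where "r \<in> QQ \<sigma>" "\<And>i. i \<in> {1..dim} \<Longrightarrow> side \<sigma> i \<Longrightarrow> e i = \<sigma> * int (arm \<sigma> (dist \<sigma> i) - gap \<sigma> r (dist \<sigma> i))"
proof -
  have less: "e i < e j" if "1 \<le> i" "i < j" "j \<le> dim" for i j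
    by (rule strict_upto[of dim e]) (use strict that in auto)
  have esign: "0 < \<sigma> * e i" if "i \<in> {1..dim}" "side \<sigma> i" for i
    using less[of piv i] less[of i piv] e0 that \<sigma> N by (auto simp: side_def)
  define v where "v j = nat (\<sigma> * e (place \<sigma> j))" for j
  have ev: "\<sigma> * e (place \<sigma> j) = int (v j)" if "j \<in> {1..len \<sigma>}" for j
    using esign[OF place(1,2)[OF \<sigma> that]] by (simp add: v_def)
  have v_strict: "v j < v (Suc j)" if j: "1 \<le> j" "j < len \<sigma>" for j
  proof -
    have jj: "j \<in> {1..len \<sigma>}" "Suc j \<in> {1..len \<sigma>}" using j by auto
    have "\<sigma> * e (place \<sigma> j) < \<sigma> * e (place \<sigma> (Suc j))"
    proof (cases "\<sigma> = 1")
      case True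
      then have "place \<sigma> j < place \<sigma> (Suc j)" by (simp add: place_def)
      then show ?thesis using less[of "place \<sigma> j" "place \<sigma> (Suc j)"] place(1)[OF \<sigma> jj(1)] place(1)[OF \<sigma> jj(2)] True by simp
    next
      case False
      then have s: "\<sigma> = - 1" using \<sigma> by simp
      then have "place \<sigma> (Suc j) < place \<sigma> j" using place(1)[OF \<sigma> jj(2)] by (simp add: place_def) linarith
      then show ?thesis using less[of "place \<sigma> (Suc j)" "place \<sigma> j"] place(1)[OF \<sigma> jj(1)] place(1)[OF \<sigma> jj(2)] s by simp
    qed
    then show ?thesis using ev[OF jj(1)] ev[OF jj(2)] by simp
  qed
  have v_less: "v i < v j" if "1 \<le> i" "i < j" "j \<le> len \<sigma>" for i j
    by (rule strict_upto[of "len \<sigma>" v]) (use v_strict that in auto)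
  have v_pos: "0 < v j" if "j \<in> {1..len \<sigma>}" for j
    using ev[OF that] esign[OF place(1,2)[OF \<sigma> that]] by simp
  have v_ge: "j \<le> v j" if "1 \<le> j" "j \<le> len \<sigma>" for j
    using that
  proof (induction j rule: nat_induct_at_least)
    case base then show ?case using v_pos[of 1] by simp
  next
    case (Suc j) then show ?case using v_strict[of j] by simp
  qed
  text \<open>At least \<open>len \<sigma> - j + 1\<close> of the numbers \<open>arm \<sigma> 1, \<dots>\<close> are as large as \<open>v j\<close>.\<close>
  have v_le: "v j \<le> arm \<sigma> j" if j: "j \<in> {1..len \<sigma>}" for j
  proof (rule ccontr)
    assume "\<not> v j \<le> arm \<sigma> j"
    define f where "f i = dist \<sigma> (w (place \<sigma> i))" for i
    have big: "f i \<in> {j<..len \<sigma>}" if i: "i \<in> {j..len \<sigma>}" for i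
    proof -
      have i': "i \<in> {1..len \<sigma>}" using i j by auto
      note pl = place[OF \<sigma> i']
      have win: "w (place \<sigma> i) \<in> {1..dim}" using permutes_in_image[OF w] pl(1) by blast
      have "int (v i) \<le> \<sigma> * alpha (w (place \<sigma> i))"
        using bound[OF pl(1)] ev[OF i'] v_pos[OF i'] \<sigma> by auto
      moreover have "v j \<le> v i" using v_less[of j i] i j by (cases "i = j") auto
      ultimately have 1: "int (arm \<sigma> j) < \<sigma> * alpha (w (place \<sigma> i))" using \<open>\<not> v j \<le> arm \<sigma> j\<close> by linarith
      then have "side \<sigma> (w (place \<sigma> i))"
        using \<alpha>_pos_iff[OF win] \<alpha>_neg_iff[OF win] \<sigma> by (auto simp: side_def)
      then have "\<sigma> * alpha (w (place \<sigma> i)) = int (arm \<sigma> (f i))" "f i \<in> {1..len \<sigma>}"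
        using alpha_side[OF \<sigma>, of "w (place \<sigma> i)"] dist(1)[OF \<sigma> win] \<sigma> by (auto simp: f_def)
      moreover from this(1) 1 have "j < f i" using arm_less[of "f i" j \<sigma>] by (cases "f i" j rule: linorder_cases) auto
      ultimately show ?thesis by simp
    qed
    have "inj_on f {j..len \<sigma>}"
    proof (rule inj_onI)
      fix a b assume ab: "a \<in> {j..len \<sigma>}" "b \<in> {j..len \<sigma>}" "f a = f b"
      then have ab': "a \<in> {1..len \<sigma>}" "b \<in> {1..len \<sigma>}" using j by auto
      have "w (place \<sigma> c) = place \<sigma> (f c)" if c: "c \<in> {j..len \<sigma>}" for c
      proof -
        have c': "c \<in> {1..len \<sigma>}" using c j by auto
        have win: "w (place \<sigma> c) \<in> {1..dim}" using permutes_in_image[OF w] place(1)[OF \<sigma> c'] by blast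
        have "0 < f c" using big[OF c] by auto
        then have "side \<sigma> (w (place \<sigma> c))" by (simp add: f_def dist_def side_def)
        then show ?thesis using dist(2)[OF \<sigma> win] by (simp add: f_def)
      qed
      then have "w (place \<sigma> a) = w (place \<sigma> b)" using ab by simp
      then have "place \<sigma> a = place \<sigma> b" using permutes_inj[OF w] by (auto dest: injD)
      then show "a = b" using place_eq_iff[OF \<sigma> ab'] by simp
    qed
    then have "card {j..len \<sigma>} \<le> card {j<..len \<sigma>}"
      using big by (intro card_inj_on_le[of f]) auto
    then show False using j by (auto simp: Suc_diff_le)
  qed
  define r where "r = map (\<lambda>t. arm \<sigma> (mm \<sigma> + t) - v (mm \<sigma> + t)) [0..<pp \<sigma> + 1]"
  have r_nth: "r ! t = arm \<sigma> (mm \<sigma> + t) - v (mm \<sigma> + t)" if "t < pp \<sigma> + 1" for t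
    using that by (simp add: r_def del: upt_Suc)
  have gap_r: "gap \<sigma> r j = arm \<sigma> j - v j" if j: "j \<in> {1..len \<sigma>}" for j
  proof (cases "mm \<sigma> \<le> j")
    case True
    then have "j - mm \<sigma> < pp \<sigma> + 1" using j unfolding len_def by auto
    from r_nth[OF this] show ?thesis using True j by (simp add: gap_def)
  next
    case False
    then show ?thesis using v_ge[of j] j by (simp add: gap_def arm_def)
  qed
  have "r \<in> QQ \<sigma>"
    unfolding QQ_def Qset_def
  proof (intro CollectI conjI ballI)
    show "length r = pp \<sigma> + 1" by (simp add: r_def)
    show "sorted_wrt (\<ge>) r"
      unfolding sorted_wrt_iff_nth_less
    proof (intro allI impI)
      fix s t assume st: "s < t" "t < length r"
      then have st': "t < pp \<sigma> + 1" "s < pp \<sigma> + 1" by (auto simp: r_def)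
      have "v (mm \<sigma> + s) + (t - s) \<le> v (mm \<sigma> + t)"
      proof -
        have "k \<le> t - s \<Longrightarrow> v (mm \<sigma> + s) + k \<le> v (mm \<sigma> + s + k)" for k
        proof (induction k)
          case (Suc k)
          have "v (mm \<sigma> + s + k) < v (Suc (mm \<sigma> + s + k))"
            using Suc.prems st' mm_pos[of \<sigma>] by (intro v_strict) (auto simp: len_def)
          then show ?case using Suc by simp
        qed simp
        from this[of "t - s"] st show ?thesis by simp
      qed
      then show "r ! t \<le> r ! s" unfolding r_nth[OF st'(1)] r_nth[OF st'(2)] using st by (simp add: arm_def)
    qed
    fix x assume "x \<in> set r"
    then obtain t where t: "t < pp \<sigma> + 1" "x = r ! t" by (auto simp: in_set_conv_nth r_def simp del: upt_Suc)
    then show "x \<le> kk \<sigma> - 1"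
      using v_ge[of "mm \<sigma> + t"] mm_pos[of \<sigma>] by (simp add: r_nth arm_def len_def)
  qed
  moreover have "e i = \<sigma> * int (arm \<sigma> (dist \<sigma> i) - gap \<sigma> r (dist \<sigma> i))" if i: "i \<in> {1..dim}" "side \<sigma> i" for i
  proof -
    note d = dist[OF \<sigma> i]
    have "\<sigma> * e i = int (v (dist \<sigma> i))" using ev[OF d(1)] d(2) by simp
    moreover have "arm \<sigma> (dist \<sigma> i) - gap \<sigma> r (dist \<sigma> i) = v (dist \<sigma> i)" using gap_r[OF d(1)] v_le[OF d(1)] by simp
    ultimately show ?thesis using \<sigma> by auto
  qed
  ultimately show thesis by (rule that)
qed

text \<open>By antisymmetry the exponents of a nonzero coefficient are distinct and may be sorted.
  Counting signs puts 0 at \<open>piv\<close>, and then both arms are inward slides. So the grid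
  sees every nonzero symmetric operator.\<close>

lemma symm_act_grid:
  assumes s: "symm dim s" and 0: "\<And>r r'. r \<in> QQ 1 \<Longrightarrow> r' \<in> QQ (- 1) \<Longrightarrow> act s \<Delta> (mon dim (grid r r')) = 0"
  shows "act s \<Delta> c = 0"
proof (rule ccontr)
  assume nz: "act s \<Delta> c \<noteq> 0"
  have anti: "antisym_fun dim (act s \<Delta>)" by (rule symmD[OF s antisym_eps])
  obtain e w0 where c: "c = mon dim e" using act_\<Delta>_bound[OF nz] by metis
  have "inj_on e {1..dim}"
    using antisym_fun_eq_0[OF anti, of _ _ e] nz unfolding c inj_on_def by blast
  then obtain u where u: "u permutes {1..dim}"
    and sorted: "\<And>i j. i \<in> {1..dim} \<Longrightarrow> j \<in> {1..dim} \<Longrightarrow> i < j \<Longrightarrow> e (u i) < e (u j)"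
    using sorting_permutation by metis
  define f where "f i = e (u i)" for i
  have nzf: "act s \<Delta> (mon dim f) \<noteq> 0"
    using antisym_fun_mon[OF anti u, of e] nz unfolding c f_def by simp
  have strict: "f i < f (Suc i)" if "1 \<le> i" "i < dim" for i
    using sorted[of i "Suc i"] that by (simp add: f_def)
  have less: "f i < f j" if "1 \<le> i" "i < j" "j \<le> dim" for i j
    using sorted[of i j] that by (simp add: f_def)
  have f0: "f piv = 0"
  proof (rule antisym)
    show "f piv \<le> 0"
    proof (rule ccontr)
      assume "\<not> f piv \<le> 0"
      have "{piv..dim} \<subseteq> {i \<in> {1..dim}. 0 < f i}"
      proof
        fix i assume i: "i \<in> {piv..dim}"
        then have "f piv \<le> f i" using less[of piv i] N by (cases "i = piv") auto
        then show "i \<in> {i \<in> {1..dim}. 0 < f i}" using i N \<open>\<not> f piv \<le> 0\<close> by auto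
      qed
      then have "card {piv..dim} \<le> card {i \<in> {1..dim}. 0 < f i}" by (rule card_mono[rotated]) simp
      then show False using act_\<Delta>_card(1)[OF nzf] N by simp
    qed
    show "0 \<le> f piv"
    proof (rule ccontr)
      assume "\<not> 0 \<le> f piv"
      have "{1..piv} \<subseteq> {i \<in> {1..dim}. f i < 0}"
      proof
        fix i assume i: "i \<in> {1..piv}"
        then have "f i \<le> f piv" using less[of i piv] N by (cases "i = piv") auto
        then show "i \<in> {i \<in> {1..dim}. f i < 0}" using i N \<open>\<not> 0 \<le> f piv\<close> by auto
      qed
      then have "card {1..piv} \<le> card {i \<in> {1..dim}. f i < 0}" by (rule card_mono[rotated]) simp
      then show False using act_\<Delta>_card(2)[OF nzf] N by simp
    qed
  qed
  obtain w where w: "w permutes {1..dim}"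
    "\<And>i. i \<in> {1..dim} \<Longrightarrow> 0 \<le> f i \<and> f i \<le> alpha (w i) \<or> alpha (w i) \<le> f i \<and> f i \<le> 0"
    using act_\<Delta>_mon_bound[OF nzf] by metis
  have s1: "(1::int) = 1 \<or> (1::int) = - 1" and s2: "(- 1::int) = 1 \<or> (- 1::int) = - 1" by simp_all
  obtain r where r: "r \<in> QQ 1" "\<And>i. i \<in> {1..dim} \<Longrightarrow> side 1 i \<Longrightarrow> f i = 1 * int (arm 1 (dist 1 i) - gap 1 r (dist 1 i))"
    using sorted_exponents_grid_side[OF s1 strict f0 w] by blast
  obtain r' where r': "r' \<in> QQ (- 1)" "\<And>i. i \<in> {1..dim} \<Longrightarrow> side (- 1) i \<Longrightarrow>
      f i = - 1 * int (arm (- 1) (dist (- 1) i) - gap (- 1) r' (dist (- 1) i))"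
    using sorted_exponents_grid_side[OF s2 strict f0 w] by blast
  have "mon dim f = mon dim (grid r r')"
  proof (rule mon_cong)
    fix i assume i: "i \<in> {1..dim}"
    show "f i = grid r r' i"
    proof (rule side_cases[OF s1, of i])
      assume "side 1 i"
      then show ?thesis using r(2)[OF i] by (simp add: grid_def comb_def xcoord_def)
    next
      assume "i = piv" "\<not> side 1 i" "\<not> side (- 1) i"
      then show ?thesis using f0 by (simp add: grid_def comb_def)
    next
      assume "side (- 1) i" "\<not> side 1 i"
      then show ?thesis using r'(2)[OF i] by (simp add: grid_def comb_def ycoord_def)
    qed
  qed
  with nzf 0[OF r(1) r'(1)] show False by simp
qed

abbreviation "QP \<equiv> QQ 1 \<times> QQ (- 1)"

text \<open>The grid separates symmetric operators, and the values of the products on the grid form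
  a triangular matrix, so any prescribed values can be matched.\<close>

lemma hh_span:
  assumes s: "symm dim s"
  obtains c where "\<And>b. act (s - (\<Sum>z\<in>QP. const (c z) * hh (fst z) (snd z))) \<Delta> b = 0"
proof -
  define K where "K z y = act (hh (fst z) (snd z)) \<Delta> (mon dim (grid (fst y) (snd y)))" for z y
  define m where "m z = tail_weight (fst z) + tail_weight (snd z)" for z :: "nat list \<times> nat list"
  have fin: "finite QP" by (simp add: finite_QQ)
  have tri: "i = j \<or> m i < m j" if "j \<in> QP" "i \<in> QP" "K j i \<noteq> 0" for j i
  proof -
    have *: "tail_weight (fst i) \<le> tail_weight (fst j)" "tail_weight (fst i) = tail_weight (fst j) \<Longrightarrow> fst i = fst j"
      "tail_weight (snd i) \<le> tail_weight (snd j)" "tail_weight (snd i) = tail_weight (snd j) \<Longrightarrow> snd i = snd j"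
      using hh_triangular(1)[of "fst j" "snd j" "fst i" "snd i"] that by (auto simp: K_def mem_Times_iff)
    show ?thesis
    proof (cases "m i < m j")
      case False
      then have "tail_weight (fst i) = tail_weight (fst j)" "tail_weight (snd i) = tail_weight (snd j)"
        using *(1,3) by (auto simp: m_def)
      then show ?thesis using *(2,4) by (simp add: prod_eq_iff)
    qed simp
  qed
  have diag: "K j j \<noteq> 0" if "j \<in> QP" for j
    using hh_triangular(2)[of "fst j" "snd j" "fst j" "snd j"] that by (auto simp: K_def mem_Times_iff)
  obtain c where c: "\<forall>i\<in>QP. (\<Sum>j\<in>QP. c j * K j i) = act s \<Delta> (mon dim (grid (fst i) (snd i)))"
    using triangular_solve[of QP K m "\<lambda>i. act s \<Delta> (mon dim (grid (fst i) (snd i)))", OF fin tri diag] by blast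
  let ?d = "s - (\<Sum>z\<in>QP. const (c z) * hh (fst z) (snd z))"
  have "act ?d \<Delta> b = 0" for b
  proof (rule symm_act_grid)
    show "symm dim ?d" by (intro symm_diff s symm_sum symm_mult symm_const symm_hh)
    fix r r' assume r: "r \<in> QQ 1" "r' \<in> QQ (- 1)"
    then have "(\<Sum>j\<in>QP. c j * K j (r, r')) = act s \<Delta> (mon dim (grid r r'))" using c by force
    then show "act ?d \<Delta> (mon dim (grid r r')) = 0"
      by (simp add: act_diff act_sum act_const_mult K_def)
  qed
  then show thesis by (rule that)
qed

lemma hh_independent:
  assumes zero: "\<And>b. act (\<Sum>z\<in>QP. const (c z) * hh (fst z) (snd z)) \<Delta> b = 0" and z: "z \<in> QP"
  shows "c z = 0"
proof (rule triangular_independent[where J = QP and m = "\<lambda>z. tail_weight (fst z) + tail_weight (snd z)"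
      and f = "\<lambda>z. z" and K = "\<lambda>z y. act (hh (fst z) (snd z)) \<Delta> (mon dim (grid (fst y) (snd y)))"])
  show "finite QP" by (simp add: finite_QQ)
  show "z \<in> QP" by (rule z)
  show "act (hh (fst j) (snd j)) \<Delta> (mon dim (grid (fst j) (snd j))) \<noteq> 0" if "j \<in> QP" for j
    using hh_triangular(2)[of "fst j" "snd j" "fst j" "snd j"] that by (auto simp: mem_Times_iff)
  show "(\<Sum>j\<in>QP. c j * act (hh (fst j) (snd j)) \<Delta> (mon dim (grid (fst i) (snd i)))) = 0" for i
    using zero[of "mon dim (grid (fst i) (snd i))"] by (simp add: act_sum act_const_mult)
  fix j i assume ji: "j \<in> QP" "i \<in> QP"
    "tail_weight (fst j) + tail_weight (snd j) \<le> tail_weight (fst i) + tail_weight (snd i)"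
    "act (hh (fst j) (snd j)) \<Delta> (mon dim (grid (fst i) (snd i))) \<noteq> 0"
  have *: "tail_weight (fst i) \<le> tail_weight (fst j)" "tail_weight (fst i) = tail_weight (fst j) \<Longrightarrow> fst i = fst j"
      "tail_weight (snd i) \<le> tail_weight (snd j)" "tail_weight (snd i) = tail_weight (snd j) \<Longrightarrow> snd i = snd j"
    using hh_triangular(1)[of "fst j" "snd j" "fst i" "snd i"] ji by (auto simp: mem_Times_iff)
  then show "j = i" using ji(3) by (simp add: prod_eq_iff)
qed

lemma generators:
  assumes P: "P \<in> carrier (xy_ring dim)"
  obtains c where "\<And>b. act (P - (\<Sum>u | u permutes {1..dim}. \<Sum>z\<in>QP. const (c u z) *
    (hh (fst z) (snd z) * Poly_Mapping.single (mon dim (descent_exp u)) 1))) \<Delta> b = 0"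
proof -
  let ?b = "\<lambda>u. Poly_Mapping.single (mon dim (descent_exp u)) (1::complex)"
  let ?P = "{u. u permutes {1..dim}}"
  obtain s where s: "\<And>u. symm dim (s u)" "\<And>b. act (P - (\<Sum>u\<in>?P. s u * ?b u)) \<Delta> b = 0"
    using descent_span_UNIV[OF P] unfolding descent_span_def by blast
  have "\<exists>c. \<forall>b. act (s u - (\<Sum>z\<in>QP. const (c z) * hh (fst z) (snd z))) \<Delta> b = 0" for u
    using hh_span[OF s(1)[of u]] by blast
  then have "\<exists>c. \<forall>u. \<forall>b. act (s u - (\<Sum>z\<in>QP. const (c u z) * hh (fst z) (snd z))) \<Delta> b = 0"
    by (intro choice allI)
  then obtain c where c: "\<And>u b. act (s u - (\<Sum>z\<in>QP. const (c u z) * hh (fst z) (snd z))) \<Delta> b = 0" by blast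
  let ?h = "\<lambda>u. \<Sum>z\<in>QP. const (c u z) * hh (fst z) (snd z)"
  have eq: "P - (\<Sum>u\<in>?P. \<Sum>z\<in>QP. const (c u z) * (hh (fst z) (snd z) * ?b u)) =
      (P - (\<Sum>u\<in>?P. s u * ?b u)) + (\<Sum>u\<in>?P. ?b u * (s u - ?h u))"
    by (simp add: right_diff_distrib sum_subtractf sum_distrib_left mult_ac)
  show thesis
  proof (rule that[of c])
    fix b
    have "act (?b u * (s u - ?h u)) \<Delta> b = 0" for u
      by (simp only: act_mult act_single c mult_zero_right)
    then show "act (P - (\<Sum>u\<in>?P. \<Sum>z\<in>QP. const (c u z) * (hh (fst z) (snd z) * ?b u))) \<Delta> b = 0"
      unfolding eq act_add act_sum s(2) by simp
  qed
qed

end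

section \<open>Triangularity of the bipermanents\<close>

text \<open>The row group of a tableau for \<open>f = row_of T\<close>, the column group for
  \<open>f = col_of T\<close>.\<close>

definition stab :: "nat \<Rightarrow> (nat \<Rightarrow> nat) \<Rightarrow> (nat \<Rightarrow> nat) set" where
  "stab n f = {\<sigma>. \<sigma> permutes {1..n} \<and> (\<forall>i\<in>{1..n}. f (\<sigma> i) = f i)}"

lemma finite_stab: "finite (stab n f)"
  by (rule finite_subset[OF _ finite_permutations[of "{1..n}"]]) (auto simp: stab_def)

lemma id_in_stab: "(\<lambda>i. i) \<in> stab n f"
  using permutes_id by (simp add: stab_def id_def)

lemma stab_inv: "\<sigma> \<in> stab n f \<Longrightarrow> inv_into UNIV \<sigma> \<in> stab n f"
proof -
  assume "\<sigma> \<in> stab n f"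
  then have \<sigma>: "\<sigma> permutes {1..n}" "\<And>i. i \<in> {1..n} \<Longrightarrow> f (\<sigma> i) = f i" by (auto simp: stab_def)
  have "f (inv_into UNIV \<sigma> i) = f i" if "i \<in> {1..n}" for i
    using \<sigma>(2)[of "inv_into UNIV \<sigma> i"] permutes_in_image[OF permutes_inv[OF \<sigma>(1)], of i] that
    by (simp add: permutes_inverses(1)[OF \<sigma>(1)])
  then show ?thesis using permutes_inv[OF \<sigma>(1)] by (simp add: stab_def)
qed

lemma stab_transpose:
  assumes "\<sigma> \<in> stab n f" "x \<in> {1..n}" "y \<in> {1..n}" "f x = f y"
  shows "(\<lambda>i. \<sigma> (transpose x y i)) \<in> stab n f"
proof -
  have t: "transpose x y permutes {1..n}" by (rule permutes_swap_id[OF assms(2,3)])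
  have \<sigma>: "\<sigma> permutes {1..n}" "\<And>i. i \<in> {1..n} \<Longrightarrow> f (\<sigma> i) = f i" using assms(1) by (auto simp: stab_def)
  have "f (\<sigma> (transpose x y i)) = f i" if i: "i \<in> {1..n}" for i
  proof -
    have "transpose x y i \<in> {1..n}" using permutes_in_image[OF t] i by blast
    then have "f (\<sigma> (transpose x y i)) = f (transpose x y i)" by (rule \<sigma>(2))
    also have "\<dots> = f i" using assms(4) by (simp add: transpose_def)
    finally show ?thesis .
  qed
  moreover have "(\<lambda>i. \<sigma> (transpose x y i)) permutes {1..n}"
    using permutes_compose[OF t \<sigma>(1)] by (simp add: o_def)
  ultimately show ?thesis by (simp add: stab_def)
qed

lemma row_group_eq_stab:
  assumes T: "T \<in> SYT n" shows "row_group n T = stab n (row_of T)"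
proof -
  have row: "row_of T i = r" if ri: "r < length T" "i \<in> set (T ! r)" for i r
  proof -
    obtain c where "c < length (T ! r)" "i = T ! r ! c" using ri(2) by (auto simp: in_set_conv_nth)
    then show ?thesis using SYT_entry(1)[OF T ri(1), of c] by (simp add: pos_def)
  qed
  have mem: "row_of T i < length T \<and> i \<in> set (T ! row_of T i)" if "i \<in> {1..n}" for i
  proof -
    have "row_of T i < length T" "col_of T i < length (T ! row_of T i)" "T ! row_of T i ! col_of T i = i"
      using SYT_pos[OF T that] by (auto simp: cells_def pos_def)
    then show ?thesis by (metis nth_mem)
  qed
  have sub: "set (T ! r) \<subseteq> {1..n}" if "r < length T" for r
  proof -
    have "set (concat T) = {1..n}" using T by (simp add: SYT_def)
    then show ?thesis using that by auto
  qed
  show ?thesis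
  proof (rule Set.set_eqI, rule iffI)
    fix \<sigma> assume "\<sigma> \<in> row_group n T"
    then have \<sigma>: "\<sigma> permutes {1..n}" "\<And>R. R \<in> set T \<Longrightarrow> \<sigma> ` set R = set R" by (auto simp: row_group_def)
    have "row_of T (\<sigma> i) = row_of T i" if i: "i \<in> {1..n}" for i
    proof (rule row)
      show "row_of T i < length T" using mem[OF i] by simp
      then show "\<sigma> i \<in> set (T ! row_of T i)" using \<sigma>(2)[of "T ! row_of T i"] mem[OF i] by auto
    qed
    then show "\<sigma> \<in> stab n (row_of T)" using \<sigma>(1) by (simp add: stab_def)
  next
    fix \<sigma> assume "\<sigma> \<in> stab n (row_of T)"
    then have \<sigma>: "\<sigma> permutes {1..n}" "\<And>i. i \<in> {1..n} \<Longrightarrow> row_of T (\<sigma> i) = row_of T i" by (auto simp: stab_def)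
    have "\<sigma> ` set R = set R" if R: "R \<in> set T" for R
    proof -
      obtain r where r: "r < length T" "R = T ! r" using R by (auto simp: in_set_conv_nth)
      have "\<sigma> ` set R \<subseteq> set R"
      proof (rule image_subsetI)
        fix i assume i: "i \<in> set R"
        then have i': "i \<in> {1..n}" "row_of T i = r" using sub[OF r(1)] row[OF r(1)] r(2) by auto
        then have "\<sigma> i \<in> {1..n}" using permutes_in_image[OF \<sigma>(1)] by blast
        from mem[OF this] show "\<sigma> i \<in> set R" using \<sigma>(2)[OF i'(1)] i'(2) r(2) by simp
      qed
      moreover have "inj_on \<sigma> (set R)" using permutes_inj[OF \<sigma>(1)] by (rule inj_on_subset) simp
      ultimately show ?thesis by (intro endo_inj_surj) auto
    qed
    then show "\<sigma> \<in> row_group n T" using \<sigma>(1) by (simp add: row_group_def)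
  qed
qed

lemma SYT_eqI:
  assumes T: "T \<in> SYT n" and S: "S \<in> SYT n" and eq: "\<And>i. i \<in> {1..n} \<Longrightarrow> pos T i = pos S i"
  shows "T = S"
proof -
  have "cells T = cells S"
    using bij_betw_pos[OF T] bij_betw_pos[OF S] eq by (auto simp: bij_betw_def)
  then have sh: "shape T = shape S" by (rule cells_eq_iff_shape[OF T S])
  then have l: "length T = length S" by (metis length_map shape_def)
  show ?thesis
  proof (rule nth_equalityI[OF l])
    fix r assume r: "r < length T"
    have lr: "length (T ! r) = length (S ! r)"
      using arg_cong[OF sh, of "\<lambda>x. x ! r"] r l by (simp add: shape_def)
    show "T ! r = S ! r"
    proof (rule nth_equalityI[OF lr])
      fix c assume c: "c < length (T ! r)"
      note e = SYT_entry[OF T r c]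
      have "pos S (T ! r ! c) = (r, c)" using eq[OF e(2)] e(1) by simp
      then show "T ! r ! c = S ! r ! c" using SYT_pos(2)[OF S e(2)] by (simp add: pos_def)
    qed
  qed
qed

section \<open>Relabelling and rearrangement\<close>

text \<open>The permutation that carries labels of \<open>T\<close> to the labels of
  \<open>S\<close> in the same cells; outside \<open>{1..n}\<close> it is the identity, as
  \<open>permutes\<close> requires.\<close>

definition transfer :: "nat \<Rightarrow> nat list list \<Rightarrow> nat list list \<Rightarrow> nat \<Rightarrow> nat" where
  "transfer n T S i = (if i \<in> {1..n} then S ! row_of T i ! col_of T i else i)"

lemma transfer:
  assumes T: "T \<in> SYT n" and S: "S \<in> SYT n" and sh: "shape T = shape S"
  shows "i \<in> {1..n} \<Longrightarrow> pos S (transfer n T S i) = pos T i" "transfer n T S permutes {1..n}"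
proof -
  have c: "row_of T i < length S \<and> col_of T i < length (S ! row_of T i)" if "i \<in> {1..n}" for i
    using SYT_pos(1)[OF T that] shape_cells[OF sh] by (auto simp: cells_def pos_def)
  show p: "pos S (transfer n T S i) = pos T i" if i: "i \<in> {1..n}" for i
    using SYT_entry(1)[OF S, of "row_of T i" "col_of T i"] c[OF i] i by (simp add: transfer_def pos_def)
  have range: "transfer n T S i \<in> {1..n}" if i: "i \<in> {1..n}" for i
    using SYT_entry(2)[OF S, of "row_of T i" "col_of T i"] c[OF i] i by (simp add: transfer_def)
  have inj: "inj_on (transfer n T S) {1..n}"
  proof (rule inj_onI)
    fix i j assume ij: "i \<in> {1..n}" "j \<in> {1..n}" "transfer n T S i = transfer n T S j"
    then have "pos T i = pos T j" using p by metis
    then show "i = j" using bij_betw_pos[OF T] ij by (auto simp: bij_betw_def dest: inj_onD)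
  qed
  have "transfer n T S ` {1..n} = {1..n}"
    by (rule endo_inj_surj) (use range inj in auto)
  then show "transfer n T S permutes {1..n}"
    using inj by (intro bij_imp_permutes) (auto simp: bij_betw_def transfer_def)
qed

text \<open>Measured against the threshold \<open>a k\<close>, terms beyond \<open>k\<close> are
  nonnegative and all others nonpositive, so exchanging some of them cannot increase the tail sum.
  For \<open>k = 0\<close> and for \<open>k\<close> at least \<open>n\<close> both sides
  agree.\<close>

lemma tail_sum_rearrange:
  fixes a :: "nat \<Rightarrow> int"
  assumes mono: "\<And>i j. i \<in> {1..n} \<Longrightarrow> j \<in> {1..n} \<Longrightarrow> i \<le> j \<Longrightarrow> a i \<le> a j"
    and p: "p permutes {1..n}"
  shows "(\<Sum>j\<in>{Suc k..n}. a (p j)) \<le> (\<Sum>j\<in>{Suc k..n}. a j)"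
proof (cases "1 \<le> k \<and> k < n")
  case False
  have "(\<Sum>j\<in>{1..n}. a (p j)) = (\<Sum>j\<in>{1..n}. a j)"
    using sum.permute[OF p, of a] by (simp add: o_def)
  then show ?thesis using False by (cases "k = 0") auto
next
  case True
  let ?A = "{Suc k..n}" and ?P = "p ` {Suc k..n}"
  have inj: "inj_on p ?A" using permutes_inj[OF p] by (rule inj_on_subset) simp
  have sub: "?P \<subseteq> {1..n}"
  proof (rule image_subsetI)
    fix j assume "j \<in> ?A"
    then have "j \<in> {1..n}" by simp
    then show "p j \<in> {1..n}" using permutes_in_image[OF p] by blast
  qed
  have cP: "card ?P = card ?A" by (rule card_image[OF inj])
  have "(\<Sum>j\<in>?A. a (p j) - a k) = (\<Sum>x\<in>?P. a x - a k)" by (simp add: sum.reindex[OF inj])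
  also have "\<dots> = (\<Sum>x\<in>?P \<inter> ?A. a x - a k) + (\<Sum>x\<in>?P - ?A. a x - a k)" by (rule sum.Int_Diff) simp
  also have "(\<Sum>x\<in>?P - ?A. a x - a k) \<le> 0"
  proof (rule sum_nonpos)
    fix x assume "x \<in> ?P - ?A"
    then have "x \<in> {1..n}" "x \<le> k" using sub by auto
    then show "a x - a k \<le> 0" using mono[of x k] True by auto
  qed
  also have "(\<Sum>x\<in>?P \<inter> ?A. a x - a k) \<le> (\<Sum>x\<in>?A. a x - a k)"
  proof (rule sum_mono2)
    fix x assume "x \<in> ?A - ?P \<inter> ?A"
    then show "0 \<le> a x - a k" using mono[of k x] True by auto
  qed auto
  finally have "(\<Sum>j\<in>?A. a (p j) - a k) \<le> (\<Sum>x\<in>?A. a x - a k)" by simp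
  then show ?thesis by (simp add: sum_subtractf)
qed

text \<open>Among the rearrangements of a weakly increasing sequence it is largest for the sorted
  one, and reaching that maximum forces all values to agree.\<close>

definition tail_total :: "nat \<Rightarrow> (nat \<Rightarrow> int) \<Rightarrow> int" where
  "tail_total n a = (\<Sum>k<n. \<Sum>j\<in>{Suc k..n}. a j)"

lemma tail_total_eqD:
  assumes le: "\<And>k. (\<Sum>j\<in>{Suc k..n}. b j) \<le> (\<Sum>j\<in>{Suc k..n}. a j)"
    and eq: "tail_total n a \<le> tail_total n b" and j: "j \<in> {1..n}"
  shows "a j = b j"
proof -
  have e: "(\<Sum>j\<in>{Suc k..n}. b j) = (\<Sum>j\<in>{Suc k..n}. a j)" for k
  proof (cases "k < n")
    case True
    show ?thesis
    proof (rule ccontr)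
      assume "(\<Sum>j\<in>{Suc k..n}. b j) \<noteq> (\<Sum>j\<in>{Suc k..n}. a j)"
      then have "(\<Sum>j\<in>{Suc k..n}. b j) < (\<Sum>j\<in>{Suc k..n}. a j)" using le[of k] by simp
      then have "tail_total n b < tail_total n a"
        unfolding tail_total_def using le True by (intro sum_strict_mono_ex1) auto
      with eq show False by simp
    qed
  qed simp
  obtain k where k: "j = Suc k" "k < n" using j by (cases j) auto
  then have "{Suc k..n} = insert j {Suc j..n}" by auto
  then show ?thesis using e[of k] e[of j] by simp
qed

lemma tail_total_mono: "(\<And>k. (\<Sum>j\<in>{Suc k..n}. b j) \<le> (\<Sum>j\<in>{Suc k..n}. a j)) \<Longrightarrow> tail_total n b \<le> tail_total n a"
  unfolding tail_total_def by (rule sum_mono)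

lemma tail_total_add: "tail_total n (\<lambda>j. a j + b j) = tail_total n a + tail_total n b"
  by (simp add: tail_total_def sum.distrib)

section \<open>Pairing row sums with column sums\<close>

context exponents begin

text \<open>The exponents of a cocharge diagram in signed form, positive values being powers of
  \<open>x\<close>; \<open>cv\<close> is the part of \<open>\<rho>\<close> left to the dual
  side.\<close>

definition cc :: "nat list list \<Rightarrow> nat \<Rightarrow> int" where
  "cc S j = int (cocharge S j) - int (cocharge S N)"

definition cv :: "nat list list \<Rightarrow> nat \<Rightarrow> int" where "cv S j = \<rho> j - cc S j"

lemma cocharge_lipschitz:
  assumes S: "S \<in> SYT n" and ij: "1 \<le> i" "i \<le> j" "j \<le> n"
  shows "cocharge S i \<le> cocharge S j \<and> cocharge S j \<le> cocharge S i + (j - i)"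
  using ij(2,3)
proof (induction j rule: dec_induct)
  case (step m)
  then show ?case using cocharge_step[OF S, of m] ij(1) by auto
qed simp

text \<open>Cocharge grows by 0 or 1 per step, so relative to \<open>N\<close> neither it nor its
  complement changes to the wrong side. Hence the two monomials multiply without mixed factors and
  their degrees add up to that of \<open>\<rho>\<close>.\<close>

lemma cc_compatible:
  assumes S: "S \<in> SYT n" and j: "j \<in> {1..n}"
  shows "0 \<le> cc S j \<and> 0 \<le> cv S j \<or> cc S j \<le> 0 \<and> cv S j \<le> 0"
proof (cases "j \<le> N")
  case True
  then show ?thesis using cocharge_lipschitz[OF S, of j N] j N by (auto simp: cc_def cv_def \<rho>_def)
next
  case False
  then show ?thesis using cocharge_lipschitz[OF S, of N j] j N by (auto simp: cc_def cv_def \<rho>_def)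
qed

lemma degree_cc_cv: "S \<in> SYT n \<Longrightarrow> degree (cc S) + degree (cv S) = degree \<rho>"
proof -
  assume S: "S \<in> SYT n"
  have "\<bar>cc S j\<bar> + \<bar>cv S j\<bar> = \<bar>\<rho> j\<bar>" if "j \<in> {1..n}" for j
    using cc_compatible[OF S that] by (auto simp: cv_def)
  then show ?thesis unfolding degree_def sum.distrib[symmetric] by (rule sum.cong[OF refl])
qed

lemma degree_permute: "p permutes {1..n} \<Longrightarrow> degree (\<lambda>i. e (p i)) = degree e"
  using sum.permute[of p "{1..n}" "\<lambda>i. \<bar>e i\<bar>"] by (simp add: degree_def o_def)

text \<open>The dichotomy of the cocharge steps, chained together: along a level of
  \<open>cc\<close> the rows weakly descend, along a level of \<open>cv\<close> the columns weakly
  decrease.\<close>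

lemma blocks:
  assumes S: "S \<in> SYT n" and i: "i \<in> {1..n}" "i' \<in> {1..n}" "i \<le> i'"
  shows "cc S i \<le> cc S i'" "cc S i = cc S i' \<Longrightarrow> fst (pos S i') \<le> fst (pos S i)"
    "cv S i \<le> cv S i'" "cv S i = cv S i' \<Longrightarrow> snd (pos S i') \<le> snd (pos S i)"
proof -
  have "cc S i \<le> cc S i' \<and> (cc S i = cc S i' \<longrightarrow> fst (pos S i') \<le> fst (pos S i))"
  proof (rule block_from_steps[where n = n])
    fix j assume j: "1 \<le> j" "Suc j \<le> n"
    from cocharge_step[OF S j]
    show "cc S j \<le> cc S (Suc j) \<and> (cc S (Suc j) = cc S j \<longrightarrow> fst (pos S (Suc j)) \<le> fst (pos S j))"
      by (auto simp: cc_def)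
  qed (use i in auto)
  then show "cc S i \<le> cc S i'" "cc S i = cc S i' \<Longrightarrow> fst (pos S i') \<le> fst (pos S i)" by auto
  have "cv S i \<le> cv S i' \<and> (cv S i = cv S i' \<longrightarrow> snd (pos S i') \<le> snd (pos S i))"
  proof (rule block_from_steps[where n = n])
    fix j assume j: "1 \<le> j" "Suc j \<le> n"
    from cocharge_step[OF S j]
    show "cv S j \<le> cv S (Suc j) \<and> (cv S (Suc j) = cv S j \<longrightarrow> snd (pos S (Suc j)) \<le> snd (pos S j))"
      by (auto simp: cv_def cc_def \<rho>_def)
  qed (use i in auto)
  then show "cv S i \<le> cv S i'" "cv S i = cv S i' \<Longrightarrow> snd (pos S i') \<le> snd (pos S i)" by auto
qed

definition term_mon :: "nat list list \<times> nat list list \<Rightarrow> (nat \<Rightarrow> nat) \<Rightarrow> monom" where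
  "term_mon j \<sigma> = mon n (\<lambda>i. cc (snd j) (transfer n (fst j) (snd j) (\<sigma> i)))"

definition dual_mon :: "nat list list \<times> nat list list \<Rightarrow> (nat \<Rightarrow> nat) \<Rightarrow> monom" where
  "dual_mon j \<tau> = mon n (\<lambda>i. cv (snd j) (transfer n (fst j) (snd j) (\<tau> i)))"

text \<open>The sum over the column group carries no signs; the alternation is supplied by
  \<open>eps n \<rho>\<close>.\<close>

definition pairing :: "nat list list \<times> nat list list \<Rightarrow> nat list list \<times> nat list list \<Rightarrow> complex" where
  "pairing j j' = (\<Sum>\<sigma>\<in>stab n (row_of (fst j)). \<Sum>\<tau>\<in>stab n (col_of (fst j')). eps n \<rho> (term_mon j \<sigma> + dual_mon j' \<tau>))"

text \<open>The transposition of \<open>x\<close> and \<open>y\<close> lies in both groups.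
  Composing both summation variables with it permutes the terms and reverses the sign of
  each.\<close>

lemma pairing_eq_0:
  assumes xy: "x \<in> {1..n}" "y \<in> {1..n}" "x \<noteq> y" "row_of (fst j) x = row_of (fst j) y"
    "col_of (fst j') x = col_of (fst j') y"
  shows "pairing j j' = 0"
proof -
  let ?t = "transpose x y"
  have t: "?t permutes {1..n}" by (rule permutes_swap_id[OF xy(1,2)])
  let ?R = "stab n (row_of (fst j))" and ?C = "stab n (col_of (fst j'))"
  let ?E = "\<lambda>\<sigma> \<tau>. eps n \<rho> (term_mon j \<sigma> + dual_mon j' \<tau>)"
  have E: "?E (\<lambda>i. \<sigma> (?t i)) (\<lambda>i. \<tau> (?t i)) = - ?E \<sigma> \<tau>" for \<sigma> \<tau>
  proof -
    have "term_mon j (\<lambda>i. \<sigma> (?t i)) + dual_mon j' (\<lambda>i. \<tau> (?t i)) = permmon ?t (term_mon j \<sigma> + dual_mon j' \<tau>)"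
      by (simp add: term_mon_def dual_mon_def permmon_add[OF t] permmon_mon[OF t])
    then show ?thesis using antisym_funD[OF antisym_eps t, of \<rho>] xy(3) by (simp add: sign_swap_id)
  qed
  have "pairing j j' = (\<Sum>\<sigma>\<in>?R. \<Sum>\<tau>\<in>?C. ?E (\<lambda>i. \<sigma> (?t i)) \<tau>)"
    unfolding pairing_def
    by (rule sum.reindex_bij_witness[of _ "\<lambda>\<sigma> i. \<sigma> (?t i)" "\<lambda>\<sigma> i. \<sigma> (?t i)"])
      (auto intro: stab_transpose[OF _ xy(1,2,4)])
  also have "\<dots> = (\<Sum>\<sigma>\<in>?R. \<Sum>\<tau>\<in>?C. ?E (\<lambda>i. \<sigma> (?t i)) (\<lambda>i. \<tau> (?t i)))"
  proof (rule sum.cong[OF refl])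
    fix \<sigma>
    show "(\<Sum>\<tau>\<in>?C. ?E (\<lambda>i. \<sigma> (?t i)) \<tau>) = (\<Sum>\<tau>\<in>?C. ?E (\<lambda>i. \<sigma> (?t i)) (\<lambda>i. \<tau> (?t i)))"
      by (rule sum.reindex_bij_witness[of _ "\<lambda>\<sigma> i. \<sigma> (?t i)" "\<lambda>\<sigma> i. \<sigma> (?t i)"])
        (auto intro: stab_transpose[OF _ xy(1,2,5)])
  qed
  also have "\<dots> = - pairing j j'" by (simp only: E sum_negf pairing_def)
  finally show ?thesis by simp
qed

lemma pairing_dominated:
  assumes "T' \<in> SYT n" "pairing (T, S) (T', S') \<noteq> 0"
  shows "dominated n (pos T) (pos T')"
proof (rule dominated_of_rows_cols[OF growth_pos[OF assms(1)]])
  fix x y assume "x \<in> {1..n}" "y \<in> {1..n}" "x \<noteq> y" "fst (pos T x) = fst (pos T y)"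
  then show "snd (pos T' x) \<noteq> snd (pos T' y)"
    using pairing_eq_0[of x y "(T, S)" "(T', S')"] assms(2) by (auto simp: pos_def)
qed

definition pairs :: "(nat list list \<times> nat list list) set" where
  "pairs = {(T, S). T \<in> SYT n \<and> S \<in> SYT n \<and> shape T = shape S}"

text \<open>A nonzero term writes a rearrangement of \<open>\<rho>\<close> as a sum of
  rearrangements of \<open>cc S\<close> and \<open>cv S'\<close> with agreeing signs. Absolute
  values give equality of degrees. Each summand's tails are bounded by those of its sorted version,
  which compares the tail totals; if these coincide, both summands are already sorted along
  \<open>u\<close>.\<close>

lemma pair_term:
  assumes j: "(T, S) \<in> pairs" and j': "(T', S') \<in> pairs"
    and \<sigma>: "\<sigma> \<in> stab n (row_of T)" and \<tau>: "\<tau> \<in> stab n (col_of T')"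
    and nz: "eps n \<rho> (term_mon (T, S) \<sigma> + dual_mon (T', S') \<tau>) \<noteq> 0"
  obtains u where "u permutes {1..n}" "eps n \<rho> (term_mon (T, S) \<sigma> + dual_mon (T', S') \<tau>) = of_int (sign u)"
    "degree (cc S) = degree (cc S')" "tail_total n (cc S') \<le> tail_total n (cc S)"
    "tail_total n (cc S) \<le> tail_total n (cc S') \<Longrightarrow>
      (\<forall>i\<in>{1..n}. cc S i = cc S' i \<and> cc S (transfer n T S (\<sigma> i)) = cc S (u i) \<and> cv S' (transfer n T' S' (\<tau> i)) = cv S' (u i))"
proof -
  have SYTs: "T \<in> SYT n" "S \<in> SYT n" "shape T = shape S" "T' \<in> SYT n" "S' \<in> SYT n" "shape T' = shape S'"
    using j j' by (auto simp: pairs_def)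
  let ?A = "\<lambda>i. cc S (transfer n T S (\<sigma> i))" and ?C = "\<lambda>i. cv S' (transfer n T' S' (\<tau> i))"
  have perm: "\<sigma> permutes {1..n}" "\<tau> permutes {1..n}" using \<sigma> \<tau> by (auto simp: stab_def)
  obtain u where u: "u permutes {1..n}" "mon n ?A + mon n ?C = mon n (\<lambda>i. \<rho> (u i))"
    using eps_neq_0D[OF nz] by (auto simp: term_mon_def dual_mon_def)
  have sum: "?A i + ?C i = \<rho> (u i)" and sgn: "0 \<le> ?A i \<and> 0 \<le> ?C i \<or> ?A i \<le> 0 \<and> ?C i \<le> 0" if "i \<in> {1..n}" for i
    using mon_add_eqD[OF u(2) that] by auto
  have p: "(\<lambda>i. transfer n T S (\<sigma> i)) permutes {1..n}" "(\<lambda>i. transfer n T' S' (\<tau> i)) permutes {1..n}"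
    using permutes_compose[OF perm(1) transfer(2)[OF SYTs(1-3)]] permutes_compose[OF perm(2) transfer(2)[OF SYTs(4-6)]]
    by (simp_all add: o_def)
  have "degree ?A + degree ?C = degree (\<lambda>i. \<rho> (u i))"
    unfolding degree_def sum.distrib[symmetric]
  proof (rule sum.cong[OF refl])
    fix i assume i: "i \<in> {1..n}"
    show "\<bar>?A i\<bar> + \<bar>?C i\<bar> = \<bar>\<rho> (u i)\<bar>" using sum[OF i] sgn[OF i] by linarith
  qed
  then have deg: "degree (cc S) = degree (cc S')"
    using degree_permute[OF p(1), of "cc S"] degree_permute[OF p(2), of "cv S'"] degree_permute[OF u(1), of \<rho>]
      degree_cc_cv[OF SYTs(5)] by simp
  \<comment> \<open>Reads all indices in the order of \<open>\<rho>\<close>, in which the two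
    rearranged summands add up to \<open>\<rho>\<close> itself.\<close>
  let ?v = "inv_into UNIV u"
  have v: "?v permutes {1..n}" by (rule permutes_inv[OF u(1)])
  let ?p = "\<lambda>i. transfer n T S (\<sigma> (?v i))" and ?q = "\<lambda>i. transfer n T' S' (\<tau> (?v i))"
  have pq: "?p permutes {1..n}" "?q permutes {1..n}"
    using permutes_compose[OF v p(1)] permutes_compose[OF v p(2)] by (simp_all add: o_def)
  have tailA: "(\<Sum>j\<in>{Suc k..n}. cc S (?p j)) \<le> (\<Sum>j\<in>{Suc k..n}. cc S j)" for k
    by (rule tail_sum_rearrange[OF blocks(1)[OF SYTs(2)] pq(1)])
  have tailC: "(\<Sum>j\<in>{Suc k..n}. cv S' (?q j)) \<le> (\<Sum>j\<in>{Suc k..n}. cv S' j)" for k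
    by (rule tail_sum_rearrange[OF blocks(3)[OF SYTs(5)] pq(2)])
  have "cc S (?p j) + cv S' (?q j) = \<rho> j" if "j \<in> {1..n}" for j
    using sum[of "?v j"] permutes_in_image[OF v, of j] that permutes_inverses(1)[OF u(1)] by simp
  then have "tail_total n (\<lambda>j. cc S (?p j) + cv S' (?q j)) = tail_total n \<rho>"
    unfolding tail_total_def by (intro sum.cong refl) auto
  then have t1: "tail_total n (\<lambda>j. cc S (?p j)) + tail_total n (\<lambda>j. cv S' (?q j)) = tail_total n \<rho>"
    by (simp add: tail_total_add)
  have t2: "tail_total n (cc S') + tail_total n (cv S') = tail_total n \<rho>"
    unfolding tail_total_add[symmetric] by (simp add: cv_def)
  note tm = tail_total_mono[OF tailA] tail_total_mono[OF tailC]
  show thesis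
  proof (rule that[OF u(1) _ deg])
    show "eps n \<rho> (term_mon (T, S) \<sigma> + dual_mon (T', S') \<tau>) = of_int (sign u)"
      unfolding term_mon_def dual_mon_def fst_conv snd_conv u(2) by (rule eps_mon_perm[OF inj_\<rho> u(1)])
    show "tail_total n (cc S') \<le> tail_total n (cc S)" using t1 t2 tm by linarith
    assume le: "tail_total n (cc S) \<le> tail_total n (cc S')"
    have eA: "cc S j = cc S (?p j)" if "j \<in> {1..n}" for j
      by (rule tail_total_eqD[OF tailA _ that]) (use t1 t2 tm le in linarith)
    have eC: "cv S' j = cv S' (?q j)" if "j \<in> {1..n}" for j
      by (rule tail_total_eqD[OF tailC _ that]) (use t1 t2 tm le in linarith)
    show "\<forall>i\<in>{1..n}. cc S i = cc S' i \<and> ?A i = cc S (u i) \<and> ?C i = cv S' (u i)"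
    proof (intro ballI conjI)
      fix i assume i: "i \<in> {1..n}"
      have ui: "u i \<in> {1..n}" using permutes_in_image[OF u(1)] i by blast
      show "?A i = cc S (u i)" using eA[OF ui] by (simp add: permutes_inverses(2)[OF u(1)])
      show "?C i = cv S' (u i)" using eC[OF ui] by (simp add: permutes_inverses(2)[OF u(1)])
      show "cc S i = cc S' i"
        using \<open>\<And>j. j \<in> {1..n} \<Longrightarrow> cc S (?p j) + cv S' (?q j) = \<rho> j\<close>[OF i] eA[OF i] eC[OF i] by (simp add: cv_def)
    qed
  qed
qed

text \<open>A permutation preserving \<open>f\<close> does not change which content lies in which
  row or column, so the content may be counted in \<open>S\<close>.\<close>

lemma card_stab_transfer:
  assumes T: "T \<in> SYT n" "S \<in> SYT n" "shape T = shape S" and \<sigma>: "\<sigma> \<in> stab n f"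
    and f: "\<And>x. x \<in> {1..n} \<Longrightarrow> f x = g (transfer n T S x)"
  shows "card {x \<in> {1..n}. f x < j \<and> B (a (transfer n T S (\<sigma> x)))} = card {i \<in> {1..n}. g i < j \<and> B (a i)}"
proof -
  have \<sigma>': "\<sigma> permutes {1..n}" "\<And>x. x \<in> {1..n} \<Longrightarrow> f (\<sigma> x) = f x" using \<sigma> by (auto simp: stab_def)
  have p: "(\<lambda>x. transfer n T S (\<sigma> x)) permutes {1..n}"
    using permutes_compose[OF \<sigma>'(1) transfer(2)[OF T]] by (simp add: o_def)
  have "f x = g (transfer n T S (\<sigma> x))" if "x \<in> {1..n}" for x
    using f[of "\<sigma> x"] \<sigma>'(2)[OF that] permutes_in_image[OF \<sigma>'(1), of x] that by simp
  then have "{x \<in> {1..n}. f x < j \<and> B (a (transfer n T S (\<sigma> x)))} =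
      {x \<in> {1..n}. g (transfer n T S (\<sigma> x)) < j \<and> B (a (transfer n T S (\<sigma> x)))}" by auto
  then show ?thesis using card_preimage_perm[OF p, of "\<lambda>i. g i < j \<and> B (a i)"] by simp
qed

text \<open>With a common first tableau, the rows of \<open>T\<close> hold the content
  \<open>cc\<close> of \<open>S\<close> and its columns the content \<open>cv\<close> of
  \<open>S'\<close>, both read along the same \<open>u\<close>. This is the situation of the
  sandwich.\<close>

lemma pair_term_same:
  assumes j: "(T, S) \<in> pairs" and j': "(T, S') \<in> pairs"
    and \<sigma>: "\<sigma> \<in> stab n (row_of T)" and \<tau>: "\<tau> \<in> stab n (col_of T)"
    and u: "u permutes {1..n}"
    and content: "\<forall>i\<in>{1..n}. cc S i = cc S' i \<and> cc S (transfer n T S (\<sigma> i)) = cc S (u i) \<and> cv S' (transfer n T S' (\<tau> i)) = cv S' (u i)"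
  shows "dominated n (pos S) (pos S')" and "S = S' \<Longrightarrow> u = transfer n T S"
proof -
  have SYTs: "T \<in> SYT n" "S \<in> SYT n" "shape T = shape S" "S' \<in> SYT n" "shape T = shape S'"
    using j j' by (auto simp: pairs_def)
  have ub: "bij_betw u {1..n} {1..n}" by (rule permutes_imp_bij[OF u])
  have Q: "inj_on (pos T) {1..n}" using bij_betw_pos[OF SYTs(1)] by (rule bij_betw_imp_inj_on)
  have row_transfer: "row_of T x = row_of S (transfer n T S x)" if "x \<in> {1..n}" for x
    using transfer(1)[OF SYTs(1-3) that] by (simp add: pos_def)
  have col_transfer: "col_of T x = col_of S' (transfer n T S' x)" if "x \<in> {1..n}" for x
    using transfer(1)[OF SYTs(1,4,5) that] by (simp add: pos_def)
  have rows: "card {x \<in> {1..n}. fst (pos T x) < j \<and> B (cc S (u x))} = card {i \<in> {1..n}. fst (pos S i) < j \<and> B (cc S i)}" for j B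
  proof -
    have "{x \<in> {1..n}. fst (pos T x) < j \<and> B (cc S (u x))} = {x \<in> {1..n}. row_of T x < j \<and> B (cc S (transfer n T S (\<sigma> x)))}"
      using content by (auto simp: pos_def)
    then show ?thesis using card_stab_transfer[OF SYTs(1-3) \<sigma> row_transfer, of j B "cc S"] by (simp add: pos_def)
  qed
  have cols: "card {x \<in> {1..n}. snd (pos T x) < j \<and> B (cv S' (u x))} = card {i \<in> {1..n}. snd (pos S' i) < j \<and> B (cv S' i)}" for j B
  proof -
    have "{x \<in> {1..n}. snd (pos T x) < j \<and> B (cv S' (u x))} = {x \<in> {1..n}. col_of T x < j \<and> B (cv S' (transfer n T S' (\<tau> x)))}"
      using content by (auto simp: pos_def)
    then show ?thesis using card_stab_transfer[OF SYTs(1,4,5) \<tau> col_transfer, of j B "cv S'"] by (simp add: pos_def)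
  qed
  note cd = contents_dominated[where a = "cc S" and c = "cv S'" and P = "pos S" and P' = "pos S'" and Q = "pos T",
      OF growth_pos[OF SYTs(4)] Q ub blocks(1,2)[OF SYTs(2)] blocks(3,4)[OF SYTs(4)] rows cols]
  show "dominated n (pos S) (pos S')" by (rule cd(1)) simp_all
  assume eq: "S = S'"
  have "u x = transfer n T S x" for x
  proof (cases "x \<in> {1..n}")
    case True
    have "pos T x = pos S' (u x)" by (rule cd(2)) (simp_all add: eq True[simplified])
    then have "pos S (u x) = pos S (transfer n T S x)" using transfer(1)[OF SYTs(1-3) True] eq by simp
    moreover have "u x \<in> {1..n}" "transfer n T S x \<in> {1..n}"
      using permutes_in_image[OF u] permutes_in_image[OF transfer(2)[OF SYTs(1-3)]] True by blast+
    ultimately show ?thesis using inj_onD[OF bij_betw_imp_inj_on[OF bij_betw_pos[OF SYTs(2)]]] by blast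
  next
    case False
    then show ?thesis using permutes_not_in[OF u] permutes_not_in[OF transfer(2)[OF SYTs(1-3)]] by simp
  qed
  then show "u = transfer n T S" by blast
qed

text \<open>The components follow the order in which a nonzero pairing forces them to agree: degree,
  content, first tableau by dominance, second tableau by dominance. The last comparison becomes
  available only once the first tableaux coincide.\<close>

definition key :: "nat list list \<times> nat list list \<Rightarrow> int \<times> int \<times> nat \<times> nat" where
  "key j = (degree (cc (snd j)), tail_total n (cc (snd j)), row_weight n (pos (fst j)), row_weight n (pos (snd j)))"

text \<open>A nonzero pairing yields the reverse inequality for each component in turn, so the
  assumed lexicographic inequality turns them into equalities, which determine first
  \<open>T\<close> and then \<open>S\<close>.\<close>

lemma pairing_triangular:
  assumes j: "j \<in> pairs" and j': "j' \<in> pairs" and le: "key j \<le> key j'" and nz: "pairing j j' \<noteq> 0"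
  shows "j = j'"
proof -
  obtain T S T' S' where [simp]: "j = (T, S)" "j' = (T', S')" by (metis surj_pair)
  have SYTs: "T \<in> SYT n" "S \<in> SYT n" "T' \<in> SYT n" "S' \<in> SYT n"
    using j j' by (auto simp: pairs_def)
  obtain \<sigma> where \<sigma>: "\<sigma> \<in> stab n (row_of T)"
    and "(\<Sum>\<tau>\<in>stab n (col_of T'). eps n \<rho> (term_mon (T, S) \<sigma> + dual_mon (T', S') \<tau>)) \<noteq> 0"
    using nz unfolding pairing_def by (auto elim: sum.not_neutral_contains_not_neutral)
  then obtain \<tau> where \<tau>: "\<tau> \<in> stab n (col_of T')" and nzt: "eps n \<rho> (term_mon (T, S) \<sigma> + dual_mon (T', S') \<tau>) \<noteq> 0"
    by (auto elim: sum.not_neutral_contains_not_neutral)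
  obtain u where u: "u permutes {1..n}" "degree (cc S) = degree (cc S')" "tail_total n (cc S') \<le> tail_total n (cc S)"
    "tail_total n (cc S) \<le> tail_total n (cc S') \<Longrightarrow>
      (\<forall>i\<in>{1..n}. cc S i = cc S' i \<and> cc S (transfer n T S (\<sigma> i)) = cc S (u i) \<and> cv S' (transfer n T' S' (\<tau> i)) = cv S' (u i))"
    using pair_term[OF j[simplified] j'[simplified] \<sigma> \<tau> nzt] by metis
  have tt: "tail_total n (cc S) \<le> tail_total n (cc S')" using le u(2) by (auto simp: key_def)
  then have tt': "tail_total n (cc S) = tail_total n (cc S')" using u(3) by simp
  have domT: "dominated n (pos T) (pos T')" using pairing_dominated[OF SYTs(3)] nz by simp
  have rT: "row_weight n (pos T) \<le> row_weight n (pos T')" using le u(2) tt' by (auto simp: key_def)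
  then have rT': "row_weight n (pos T') = row_weight n (pos T)" using dominated_row_weight[OF domT] by simp
  have TT: "T = T'"
    by (rule SYT_eqI[OF SYTs(1,3)]) (rule dominated_eq[OF growth_pos[OF SYTs(1)] growth_pos[OF SYTs(3)] domT rT'])
  have domS: "dominated n (pos S) (pos S')"
    by (rule pair_term_same(1)[of T S S' \<sigma> \<tau> u]) (use j j' \<sigma> \<tau> u(1) u(4)[OF tt] TT in auto)
  have rS: "row_weight n (pos S) \<le> row_weight n (pos S')" using le u(2) tt' rT' by (auto simp: key_def)
  then have rS': "row_weight n (pos S') = row_weight n (pos S)" using dominated_row_weight[OF domS] by simp
  have "S = S'"
    by (rule SYT_eqI[OF SYTs(2,4)]) (rule dominated_eq[OF growth_pos[OF SYTs(2)] growth_pos[OF SYTs(4)] domS rS'])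
  with TT show ?thesis by simp
qed

text \<open>No cancellation can occur: a nonzero term has \<open>u\<close> equal to the relabelling
  from \<open>T\<close> to \<open>S\<close>, so all nonzero terms share one sign, and the pair of
  identities contributes such a term.\<close>

lemma pairing_diagonal:
  assumes j: "j \<in> pairs" shows "pairing j j \<noteq> 0"
proof -
  obtain T S where [simp]: "j = (T, S)" by (metis surj_pair)
  have SYTs: "T \<in> SYT n" "S \<in> SYT n" "shape T = shape S" using j by (auto simp: pairs_def)
  let ?\<theta> = "transfer n T S"
  let ?Z = "stab n (row_of T) \<times> stab n (col_of T)"
  let ?E = "\<lambda>z. eps n \<rho> (term_mon j (fst z) + dual_mon j (snd z))"
  have \<theta>: "?\<theta> permutes {1..n}" by (rule transfer(2)[OF SYTs])
  have val: "?E z = of_int (sign ?\<theta>)" if z: "z \<in> ?Z" "?E z \<noteq> 0" for z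
  proof -
    have st: "fst z \<in> stab n (row_of T)" "snd z \<in> stab n (col_of T)" using z by auto
    obtain u where u: "u permutes {1..n}" "?E z = of_int (sign u)"
      "\<forall>i\<in>{1..n}. cc S i = cc S i \<and> cc S (?\<theta> (fst z i)) = cc S (u i) \<and> cv S (?\<theta> (snd z i)) = cv S (u i)"
      using pair_term[OF j[simplified] j[simplified] st] z(2) by (metis \<open>j = (T, S)\<close> order_refl)
    have "u = ?\<theta>" by (rule pair_term_same(2)[OF j[simplified] j[simplified] st u(1,3) refl])
    then show ?thesis using u(2) by simp
  qed
  have id: "?E (\<lambda>i. i, \<lambda>i. i) = of_int (sign ?\<theta>)"
  proof -
    have "term_mon j (\<lambda>i. i) + dual_mon j (\<lambda>i. i) = mon n (\<lambda>i. cc S (?\<theta> i) + cv S (?\<theta> i))"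
      unfolding term_mon_def dual_mon_def \<open>j = (T, S)\<close> fst_conv snd_conv
    proof (rule mon_add)
      fix i assume "i \<in> {1..n}"
      then have "?\<theta> i \<in> {1..n}" using permutes_in_image[OF \<theta>] by blast
      from cc_compatible[OF SYTs(2) this]
      show "0 \<le> cc S (?\<theta> i) \<and> 0 \<le> cv S (?\<theta> i) \<or> cc S (?\<theta> i) \<le> 0 \<and> cv S (?\<theta> i) \<le> 0" .
    qed
    also have "\<dots> = mon n (\<lambda>i. \<rho> (?\<theta> i))" by (rule mon_cong) (simp add: cv_def)
    finally show ?thesis using eps_mon_perm[OF inj_\<rho> \<theta>] by simp
  qed
  let ?G = "{z \<in> ?Z. ?E z \<noteq> 0}"
  have fin: "finite ?Z" by (simp add: finite_stab)
  have "pairing j j = (\<Sum>z\<in>?Z. ?E z)"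
    unfolding pairing_def sum.cartesian_product by (simp add: case_prod_beta)
  also have "\<dots> = (\<Sum>z\<in>?G. ?E z)" by (rule sum.mono_neutral_right) (use fin in auto)
  also have "\<dots> = (\<Sum>z\<in>?G. of_int (sign ?\<theta>))" by (rule sum.cong) (use val in auto)
  also have "\<dots> = of_nat (card ?G) * of_int (sign ?\<theta>)" by simp
  finally have eq: "pairing j j = of_nat (card ?G) * of_int (sign ?\<theta>)" .
  have "(\<lambda>i. i, \<lambda>i. i) \<in> ?G" using id by (simp add: id_in_stab)
  then have "card ?G \<noteq> 0" using fin by auto
  then show ?thesis unfolding eq by simp
qed

text \<open>Extends the scalar action to products of two monomials; if these contain a factor
  \<open>x_i y_i\<close>, both sides vanish.\<close>

lemma symm_act_low_degree_add:
  assumes s: "symm n s" and deg: "degree a + degree c \<le> degree \<rho>"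
  shows "act s \<Delta> (mon n a + mon n c) = eps n \<rho> (mon n a + mon n c) * act s \<Delta> (mon n \<rho>)"
proof (cases "\<exists>e. mon n a + mon n c = mon n e")
  case True
  then obtain e where e: "mon n a + mon n c = mon n e" by blast
  have "degree e \<le> degree a + degree c"
    unfolding degree_def sum.distrib[symmetric]
  proof (rule sum_mono)
    fix i assume "i \<in> {1..n}"
    from mon_add_eqD(1)[OF e this] show "\<bar>e i\<bar> \<le> \<bar>a i\<bar> + \<bar>c i\<bar>" by linarith
  qed
  then show ?thesis unfolding e using deg by (intro symm_act_low_degree[OF s]) simp
next
  case False
  then have "eps n \<rho> (mon n a + mon n c) = 0" using eps_neq_0D by blast
  moreover have "act s \<Delta> (mon n a + mon n c) = 0" using False act_\<Delta>_bound by metis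
  ultimately show ?thesis by simp
qed

section \<open>Independence over the symmetric polynomials\<close>

definition bip :: "nat list list \<times> nat list list \<Rightarrow> xypoly" where
  "bip j = (\<Sum>\<sigma>\<in>stab n (row_of (fst j)). Poly_Mapping.single (term_mon j \<sigma>) 1)"

lemma finite_pairs: "finite pairs"
  unfolding pairs_def by (rule card_SYT_pairs(1))

text \<open>Among the indices whose coefficient does not kill \<open>\<Delta>\<close>, choose
  \<open>i\<close> with largest key, multiply the relation by an arbitrary symmetric
  \<open>s'\<close> and pair with the column sum of \<open>i\<close>. Triangularity leaves only the
  term of \<open>i\<close>, so \<open>s i * s'\<close> has value 0 at \<open>\<rho>\<close>. As
  \<open>s'\<close> was arbitrary, \<open>s i\<close> kills \<open>\<Delta>\<close>.\<close>

lemma bip_independent: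
  assumes s: "\<And>j. j \<in> pairs \<Longrightarrow> symm n (s j)"
    and zero: "\<And>b. act (\<Sum>j\<in>pairs. s j * bip j) \<Delta> b = 0" and j: "j \<in> pairs"
  shows "act (s j) \<Delta> b = 0"
proof (rule ccontr)
  assume "act (s j) \<Delta> b \<noteq> 0"
  let ?X = "{j \<in> pairs. \<exists>b. act (s j) \<Delta> b \<noteq> 0}"
  have "j \<in> ?X" using j \<open>act (s j) \<Delta> b \<noteq> 0\<close> by blast
  then have ne: "key ` ?X \<noteq> {}" by blast
  have "finite (key ` ?X)" using finite_pairs by simp
  then have "Max (key ` ?X) \<in> key ` ?X" using ne by (rule Max_in)
  then obtain i where "i \<in> ?X" and i3: "Max (key ` ?X) = key i" by (rule imageE)
  then have i: "i \<in> pairs" "\<exists>b. act (s i) \<Delta> b \<noteq> 0" "key i = Max (key ` ?X)" by simp_all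
  have max: "key k \<le> key i" if "k \<in> ?X" for k
    unfolding i(3) using that finite_pairs by (intro Max_ge) auto
  obtain Ti Si where i_eq: "i = (Ti, Si)" by fastforce
  have Ti: "Ti \<in> SYT n" "Si \<in> SYT n" "shape Ti = shape Si" using i(1) by (auto simp: i_eq pairs_def)
  have "act (s i) \<Delta> c = 0" for c
  proof (rule act_\<Delta>_eq_0I[OF s[OF i(1)]])
    fix s' assume s': "symm n s'"
    let ?l = "\<lambda>k. act (s k * s') \<Delta> (mon n \<rho>)"
    let ?C = "stab n (col_of (fst i))"
    have each: "(\<Sum>\<tau>\<in>?C. act (s' * (s k * bip k)) \<Delta> (dual_mon i \<tau>)) = (if k = i then pairing i i * ?l i else 0)"
      if k: "k \<in> pairs" for k
    proof (cases "k \<in> ?X")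
      case False
      then have "act (s k) \<Delta> = (\<lambda>_. 0)" using k by (auto simp: fun_eq_iff)
      moreover have "s' * (s k * bip k) = (s' * bip k) * s k" by (simp add: mult_ac)
      ultimately have "act (s' * (s k * bip k)) \<Delta> = (\<lambda>_. 0)"
        by (simp only: act_mult) (simp add: act_def fun_eq_iff)
      moreover have "k \<noteq> i" using False i by auto
      ultimately show ?thesis by simp
    next
      case True
      obtain Tk Sk where k_eq: "k = (Tk, Sk)" by fastforce
      have Tk: "Tk \<in> SYT n" "Sk \<in> SYT n" "shape Tk = shape Sk" using k by (auto simp: k_eq pairs_def)
      \<comment> \<open>This is why the degree leads the key: by maximality no term exceeds the
        degree of \<open>\<rho>\<close>, and the symmetric coefficients act as scalars.\<close>
      have "degree (cc Sk) \<le> degree (cc Si)" using max[OF True] by (auto simp: key_def i_eq k_eq)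
      then have deg: "degree (cc Sk) + degree (cv Si) \<le> degree \<rho>" using degree_cc_cv[OF Ti(2)] by linarith
      have term_eq: "act (s' * s k) \<Delta> (term_mon k \<sigma> + dual_mon i \<tau>) = eps n \<rho> (term_mon k \<sigma> + dual_mon i \<tau>) * ?l k"
        if \<sigma>: "\<sigma> \<in> stab n (row_of (fst k))" and \<tau>: "\<tau> \<in> ?C" for \<sigma> \<tau>
      proof -
        have p: "(\<lambda>x. transfer n Tk Sk (\<sigma> x)) permutes {1..n}" "(\<lambda>x. transfer n Ti Si (\<tau> x)) permutes {1..n}"
          using permutes_compose[OF _ transfer(2)[OF Tk], of \<sigma>] permutes_compose[OF _ transfer(2)[OF Ti], of \<tau>] \<sigma> \<tau>
          by (simp_all add: stab_def o_def)
        have "degree (\<lambda>x. cc Sk (transfer n Tk Sk (\<sigma> x))) + degree (\<lambda>x. cv Si (transfer n Ti Si (\<tau> x))) \<le> degree \<rho>"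
          using deg degree_permute[OF p(1), of "cc Sk"] degree_permute[OF p(2), of "cv Si"] by simp
        from symm_act_low_degree_add[OF symm_mult[OF s' s[OF k]] this]
        show ?thesis by (simp add: term_mon_def dual_mon_def i_eq k_eq mult.commute)
      qed
      have "(\<Sum>\<tau>\<in>?C. act (s' * (s k * bip k)) \<Delta> (dual_mon i \<tau>)) =
          (\<Sum>\<tau>\<in>?C. \<Sum>\<sigma>\<in>stab n (row_of (fst k)). eps n \<rho> (term_mon k \<sigma> + dual_mon i \<tau>) * ?l k)"
      proof (rule sum.cong[OF refl])
        fix \<tau> assume \<tau>: "\<tau> \<in> ?C"
        have "s' * (s k * bip k) = bip k * (s' * s k)" by (simp add: mult_ac)
        then have "act (s' * (s k * bip k)) \<Delta> (dual_mon i \<tau>) =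
            (\<Sum>\<sigma>\<in>stab n (row_of (fst k)). act (s' * s k) \<Delta> (term_mon k \<sigma> + dual_mon i \<tau>))"
          by (simp only: act_mult[of "bip k"]) (simp add: bip_def act_sum act_single)
        also have "\<dots> = (\<Sum>\<sigma>\<in>stab n (row_of (fst k)). eps n \<rho> (term_mon k \<sigma> + dual_mon i \<tau>) * ?l k)"
          by (rule sum.cong[OF refl]) (use term_eq \<tau> in blast)
        finally show "act (s' * (s k * bip k)) \<Delta> (dual_mon i \<tau>) =
            (\<Sum>\<sigma>\<in>stab n (row_of (fst k)). eps n \<rho> (term_mon k \<sigma> + dual_mon i \<tau>) * ?l k)" .
      qed
      also have "\<dots> = pairing k i * ?l k"
        unfolding pairing_def sum_distrib_right by (rule sum.swap)
      also have "\<dots> = (if k = i then pairing i i * ?l i else 0)"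
        using pairing_triangular[OF k i(1) max[OF True]] by auto
      finally show ?thesis .
    qed
    have "act (\<Sum>j\<in>pairs. s j * bip j) \<Delta> = (\<lambda>_. 0)" using zero by (simp add: fun_eq_iff)
    then have "act (s' * (\<Sum>j\<in>pairs. s j * bip j)) \<Delta> = (\<lambda>_. 0)"
      by (simp only: act_mult) (simp add: act_def fun_eq_iff)
    then have "0 = (\<Sum>\<tau>\<in>?C. act (s' * (\<Sum>j\<in>pairs. s j * bip j)) \<Delta> (dual_mon i \<tau>))" by simp
    also have "\<dots> = (\<Sum>k\<in>pairs. \<Sum>\<tau>\<in>?C. act (s' * (s k * bip k)) \<Delta> (dual_mon i \<tau>))"
      unfolding sum_distrib_left act_sum by (rule sum.swap)
    also have "\<dots> = (\<Sum>k\<in>pairs. if k = i then pairing i i * ?l i else 0)" by (rule sum.cong[OF refl each])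
    also have "\<dots> = pairing i i * ?l i" using finite_pairs i(1) by simp
    finally show "?l i = 0" using pairing_diagonal[OF i(1)] by simp
  qed
  with i(2) show False by blast
qed

end

section \<open>The quotient space\<close>

lemma comb_closed:
  assumes "\<And>z. z \<in> Z \<Longrightarrow> f z \<in> carrier (xy_ring n)"
  shows "(\<Sum>z\<in>Z. const (c z) * f z) \<in> carrier (xy_ring n)"
  using assms by (induction Z rule: infinite_finite_induct) (simp_all add: xy_ring_closed)

context
  fixes n :: nat and I :: "xypoly set"
  assumes I: "ideal I (xy_ring n)"
begin

interpretation ideal I "xy_ring n" by (rule I)
interpretation R: cring "xy_ring n" by (rule cring_xy_ring)
interpretation Q: cring "xy_ring n Quot I" by (rule quotient_is_cring[OF cring_xy_ring])
interpretation h: ring_hom_ring "xy_ring n" "xy_ring n Quot I" "quot_map n I"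
  using rcos_ring_hom_ring by (simp add: quot_map_def[abs_def])
interpretation V: vectorspace "class_ring :: complex ring" "quot_space n I"
  by (rule vectorspace_quot_space[OF I])

lemma quot_space_simps:
  "carrier (quot_space n I) = quot_map n I ` carrier (xy_ring n)"
  "zero (quot_space n I) = quot_map n I 0"
  "f \<in> carrier (xy_ring n) \<Longrightarrow> g \<in> carrier (xy_ring n) \<Longrightarrow>
    quot_map n I f \<oplus>\<^bsub>quot_space n I\<^esub> quot_map n I g = quot_map n I (f + g)"
  "f \<in> carrier (xy_ring n) \<Longrightarrow> c \<odot>\<^bsub>quot_space n I\<^esub> quot_map n I f = quot_map n I (const c * f)"
proof -
  show "carrier (quot_space n I) = quot_map n I ` carrier (xy_ring n)"
    by (auto simp: quot_space_def Let_def quot_map_def FactRing_def A_RCOSETS_def')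
  show "zero (quot_space n I) = quot_map n I 0"
    using h.hom_zero by (simp add: quot_space_def Let_def)
  show "quot_map n I f \<oplus>\<^bsub>quot_space n I\<^esub> quot_map n I g = quot_map n I (f + g)"
    if "f \<in> carrier (xy_ring n)" "g \<in> carrier (xy_ring n)"
    using h.hom_add[OF that] by (simp add: quot_space_def Let_def)
  show "c \<odot>\<^bsub>quot_space n I\<^esub> quot_map n I f = quot_map n I (const c * f)" if "f \<in> carrier (xy_ring n)"
    using h.hom_mult[OF const_in_carrier that, of c] by (simp add: quot_space_def Let_def)
qed

lemma quot_map_eq_iff:
  assumes "f \<in> carrier (xy_ring n)" "g \<in> carrier (xy_ring n)"
  shows "quot_map n I f = quot_map n I g \<longleftrightarrow> f - g \<in> I"
proof -
  have "\<ominus>\<^bsub>xy_ring n\<^esub> g = - g"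
    by (rule minus_equality) (use assms in \<open>auto simp: xy_ring_closed\<close>)
  then have "f \<ominus>\<^bsub>xy_ring n\<^esub> g = f - g" by (simp add: a_minus_def)
  then show ?thesis
    using quotient_eq_iff_same_a_r_cos[OF I assms] by (simp add: quot_map_def)
qed

lemma lincomb_quot_map:
  assumes "finite Z" "\<And>z. z \<in> Z \<Longrightarrow> f z \<in> carrier (xy_ring n)" "inj_on (\<lambda>z. quot_map n I (f z)) Z"
  shows "V.lincomb a ((\<lambda>z. quot_map n I (f z)) ` Z) =
    quot_map n I (\<Sum>z\<in>Z. const (a (quot_map n I (f z))) * f z)"
  using assms
proof (induction Z rule: finite_induct)
  case empty
  then show ?case by (simp add: V.lincomb_def quot_space_simps)
next
  case (insert z Z)
  let ?q = "\<lambda>z. quot_map n I (f z)"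
  have f: "f z \<in> carrier (xy_ring n)" "\<And>w. w \<in> Z \<Longrightarrow> f w \<in> carrier (xy_ring n)" using insert.prems(1) by auto
  have inj: "inj_on ?q Z" "?q z \<notin> ?q ` Z"
    using insert.prems(2) insert.hyps(2) by (simp_all add: inj_on_insert)
  have cl: "a v \<odot>\<^bsub>quot_space n I\<^esub> v \<in> carrier (quot_space n I)" if "v \<in> carrier (quot_space n I)" for v
    by (rule V.smult_closed) (use that in \<open>simp_all add: class_ring_simps\<close>)
  have qc: "?q w \<in> carrier (quot_space n I)" if "w \<in> insert z Z" for w
    unfolding quot_space_simps using insert.prems(1)[OF that] by (rule imageI)
  have "V.lincomb a (?q ` insert z Z) = a (?q z) \<odot>\<^bsub>quot_space n I\<^esub> ?q z \<oplus>\<^bsub>quot_space n I\<^esub> V.lincomb a (?q ` Z)"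
    unfolding V.lincomb_def image_insert
    by (rule V.finsum_insert) (use insert.hyps inj cl qc in auto)
  also have "\<dots> = quot_map n I (const (a (?q z)) * f z + (\<Sum>w\<in>Z. const (a (?q w)) * f w))"
  proof -
    have IH: "V.lincomb a (?q ` Z) = quot_map n I (\<Sum>w\<in>Z. const (a (?q w)) * f w)"
      by (rule insert.IH) (fact f inj)+
    show ?thesis unfolding IH quot_space_simps(4)[OF f(1)]
      by (rule quot_space_simps(3)) (auto intro: xy_ring_closed comb_closed f)
  qed
  also have "const (a (?q z)) * f z + (\<Sum>w\<in>Z. const (a (?q w)) * f w) = (\<Sum>w\<in>insert z Z. const (a (?q w)) * f w)"
    using insert.hyps by simp
  finally show ?case .
qed

text \<open>Independence is assumed of the indexed family, so injectivity comes along: a coincidence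
  of two cosets would be a relation with coefficients 1 and -1.\<close>

lemma quot_map_independent:
  assumes fin: "finite Z" and f: "\<And>z. z \<in> Z \<Longrightarrow> f z \<in> carrier (xy_ring n)"
    and indep: "\<And>c z. (\<Sum>z\<in>Z. const (c z) * f z) \<in> I \<Longrightarrow> z \<in> Z \<Longrightarrow> c z = 0"
  shows "inj_on (\<lambda>z. quot_map n I (f z)) Z" "V.lin_indpt ((\<lambda>z. quot_map n I (f z)) ` Z)"
proof -
  show inj: "inj_on (\<lambda>z. quot_map n I (f z)) Z"
  proof (rule inj_onI, rule ccontr)
    fix z w assume zw: "z \<in> Z" "w \<in> Z" "quot_map n I (f z) = quot_map n I (f w)" "z \<noteq> w"
    let ?c = "\<lambda>v. (if v = z then 1 else 0) + (if v = w then -1 else 0) :: complex"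
    have "const (?c v) * f v = (if v = z then f v else 0) + (if v = w then const (-1) * f v else 0)" for v
      using zw(4) by (simp add: const_simps)
    then have "(\<Sum>v\<in>Z. const (?c v) * f v) = f z + const (-1) * f w"
      using fin zw(1,2) by (simp add: sum.distrib)
    also have "\<dots> = f z - f w" by (simp add: const_def single_uminus)
    also have "\<dots> \<in> I" using quot_map_eq_iff[OF f[OF zw(1)] f[OF zw(2)]] zw(3) by simp
    finally have "?c z = 0" using indep[of ?c, OF _ zw(1)] by blast
    then show False using zw(4) by simp
  qed
  show "V.lin_indpt ((\<lambda>z. quot_map n I (f z)) ` Z)"
  proof (rule V.finite_lin_indpt2)
    fix a assume "V.lincomb a ((\<lambda>z. quot_map n I (f z)) ` Z) = \<zero>\<^bsub>quot_space n I\<^esub>"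
    then have "quot_map n I (\<Sum>z\<in>Z. const (a (quot_map n I (f z))) * f z) = quot_map n I 0"
      by (simp only: lincomb_quot_map[OF fin f inj] quot_space_simps(2))
    then have "(\<Sum>z\<in>Z. const (a (quot_map n I (f z))) * f z) \<in> I"
      using quot_map_eq_iff[OF comb_closed[of Z f] zero_one_in_carrier(1)] f by simp
    from indep[of "\<lambda>z. a (quot_map n I (f z))", OF this]
    show "\<forall>v\<in>(\<lambda>z. quot_map n I (f z)) ` Z. a v = \<zero>\<^bsub>class_ring\<^esub>" by (simp add: class_ring_simps)
  qed (use fin f in \<open>auto simp: quot_space_simps\<close>)
qed

lemma quot_map_gen_set:
  assumes fin: "finite Z" and f: "\<And>z. z \<in> Z \<Longrightarrow> f z \<in> carrier (xy_ring n)"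
    and gen: "\<And>P. P \<in> carrier (xy_ring n) \<Longrightarrow> \<exists>c. P - (\<Sum>z\<in>Z. const (c z) * f z) \<in> I"
  shows "V.gen_set ((\<lambda>z. quot_map n I (f z)) ` Z)"
proof -
  let ?S = "(\<lambda>z. quot_map n I (f z)) ` Z"
  have S: "?S \<subseteq> carrier (quot_space n I)" using f by (auto simp: quot_space_simps)
  have mem: "quot_map n I (\<Sum>z\<in>Y. const (c z) * f z) \<in> V.span ?S" if "finite Y" "Y \<subseteq> Z" for Y c
    using that
  proof (induction Y rule: finite_induct)
    case empty
    show ?case using V.span_zero[of ?S] by (simp add: quot_space_simps)
  next
    case (insert z Y)
    have fz: "f z \<in> carrier (xy_ring n)" "\<And>w. w \<in> Y \<Longrightarrow> f w \<in> carrier (xy_ring n)" using insert.prems f by auto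
    have "quot_map n I (f z) \<in> V.span ?S" using V.in_own_span[OF S] insert.prems by auto
    then have "c z \<odot>\<^bsub>quot_space n I\<^esub> quot_map n I (f z) \<in> V.span ?S"
      using V.span_is_submodule[OF S] by (intro submodule.smult_closed) (auto simp: class_ring_simps)
    then have "c z \<odot>\<^bsub>quot_space n I\<^esub> quot_map n I (f z) \<oplus>\<^bsub>quot_space n I\<^esub>
        quot_map n I (\<Sum>w\<in>Y. const (c w) * f w) \<in> V.span ?S"
      using insert.IH insert.prems by (intro V.span_add1 S) auto
    also have "c z \<odot>\<^bsub>quot_space n I\<^esub> quot_map n I (f z) \<oplus>\<^bsub>quot_space n I\<^esub>
        quot_map n I (\<Sum>w\<in>Y. const (c w) * f w) = quot_map n I (\<Sum>w\<in>insert z Y. const (c w) * f w)"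
      using insert.hyps fz comb_closed[of Y f n c]
      by (simp add: quot_space_simps xy_ring_closed)
    finally show ?case .
  qed
  have "carrier (quot_space n I) \<subseteq> V.span ?S"
  proof
    fix v assume "v \<in> carrier (quot_space n I)"
    then obtain P where P: "P \<in> carrier (xy_ring n)" "v = quot_map n I P" by (auto simp: quot_space_simps)
    obtain c where "P - (\<Sum>z\<in>Z. const (c z) * f z) \<in> I" using gen[OF P(1)] by blast
    then have "v = quot_map n I (\<Sum>z\<in>Z. const (c z) * f z)"
      using quot_map_eq_iff[OF P(1) comb_closed[of Z f n c]] f P(2) by simp
    then show "v \<in> V.span ?S" using mem[OF fin] by simp
  qed
  then show ?thesis using V.span_is_subset2[OF S] by blast
qed

text \<open>The generating family bounds the dimension by the number of its indices. An independent
  family with at least as many indices has injective cosets, so it reaches the dimension and is a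
  basis.\<close>

lemma quot_space_basis:
  assumes Z: "finite Z" "\<And>z. z \<in> Z \<Longrightarrow> f z \<in> carrier (xy_ring n)"
    and indep: "\<And>c z. (\<Sum>z\<in>Z. const (c z) * f z) \<in> I \<Longrightarrow> z \<in> Z \<Longrightarrow> c z = 0"
    and Y: "finite Y" "\<And>y. y \<in> Y \<Longrightarrow> g y \<in> carrier (xy_ring n)"
    and gen: "\<And>P. P \<in> carrier (xy_ring n) \<Longrightarrow> \<exists>c. P - (\<Sum>y\<in>Y. const (c y) * g y) \<in> I"
    and card: "card Y \<le> card Z"
  shows "V.basis ((\<lambda>z. quot_map n I (f z)) ` Z)"
proof -
  let ?S = "(\<lambda>y. quot_map n I (g y)) ` Y"
  have S: "finite ?S" "?S \<subseteq> carrier (quot_space n I)" using Y by (auto simp: quot_space_simps)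
  have gS: "V.gen_set ?S" by (rule quot_map_gen_set) (fact Y gen)+
  have inj: "inj_on (\<lambda>z. quot_map n I (f z)) Z" by (rule quot_map_independent(1)) (fact Z indep)+
  have "V.dim \<le> card ?S" by (rule V.gen_ge_dim[OF S gS])
  also have "\<dots> \<le> card Y" by (rule card_image_le[OF Y(1)])
  also have "\<dots> \<le> card ((\<lambda>z. quot_map n I (f z)) ` Z)"
    using card card_image[OF inj] by simp
  finally have le: "V.dim \<le> card ((\<lambda>z. quot_map n I (f z)) ` Z)" .
  show ?thesis
  proof (rule V.dim_li_is_basis)
    show "V.fin_dim" unfolding V.fin_dim_def using S gS by blast
    show "V.lin_indpt ((\<lambda>z. quot_map n I (f z)) ` Z)" 
      by (rule quot_map_independent(2)) (fact Z indep)+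
  qed (use Z le in \<open>auto simp: quot_space_simps\<close>)
qed

end

section \<open>The basis\<close>

context exponents begin

text \<open>In a bipermanent the permutation moves the variables, in \<open>term_mon\<close> it is
  composed with the exponents. The passage inverts it, which the sum over the group absorbs.\<close>

lemma bipermanent_cocharge:
  assumes T: "T \<in> SYT n" and S: "S \<in> SYT n" and sh: "shape T = shape S"
    and V: "V = map (map (\<lambda>i. split_at (cocharge S N) (cocharge S i))) S"
  shows "bipermanent n T V = bip (T, S)"
proof -
  let ?e = "\<lambda>i. cc S (transfer n T S i)"
  have V_nth: "V ! row_of T i ! col_of T i = (nat (?e i), nat (- ?e i))" if i: "i \<in> {1..n}" for i
  proof -
    have "row_of T i < length S \<and> col_of T i < length (S ! row_of T i)"
      using SYT_pos(1)[OF T i] shape_cells[OF sh] by (auto simp: cells_def pos_def)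
    then have "V ! row_of T i ! col_of T i = split_at (cocharge S N) (cocharge S (transfer n T S i))"
      using i by (simp add: V transfer_def)
    also have "\<dots> = (nat (?e i), nat (- ?e i))" by (auto simp: split_at_def cc_def)
    finally show ?thesis .
  qed
  have summand: "(\<Prod>i\<in>{1..n}. let v = V ! row_of T i ! col_of T i in var (Xvar (\<sigma> i)) ^ fst v * var (Yvar (\<sigma> i)) ^ snd v) =
      Poly_Mapping.single (term_mon (T, S) (inv_into UNIV \<sigma>)) 1" if "\<sigma> \<in> stab n (row_of T)" for \<sigma>
  proof -
    have \<sigma>: "\<sigma> permutes {1..n}" using that by (simp add: stab_def)
    let ?F = "\<lambda>j e. Poly_Mapping.single (Xvar j) (nat e) + Poly_Mapping.single (Yvar j) (nat (- e))"
    have "(\<Prod>i\<in>{1..n}. let v = V ! row_of T i ! col_of T i in var (Xvar (\<sigma> i)) ^ fst v * var (Yvar (\<sigma> i)) ^ snd v) =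
        (\<Prod>i\<in>{1..n}. Poly_Mapping.single (?F (\<sigma> i) (?e i)) 1)"
      by (rule prod.cong[OF refl]) (simp only: V_nth Let_def fst_conv snd_conv var_power mult_single mult_1)
    also have "\<dots> = Poly_Mapping.single (\<Sum>i\<in>{1..n}. ?F (\<sigma> i) (?e i)) 1" by (rule prod_single_1) simp
    also have "(\<Sum>i\<in>{1..n}. ?F (\<sigma> i) (?e i)) = (\<Sum>i\<in>{1..n}. ?F i (?e (inv_into UNIV \<sigma> i)))"
      using sum.permute[OF \<sigma>, of "\<lambda>i. ?F i (?e (inv_into UNIV \<sigma> i))"]
      by (simp add: o_def permutes_inverses(2)[OF \<sigma>])
    also have "\<dots> = term_mon (T, S) (inv_into UNIV \<sigma>)" by (simp add: term_mon_def mon_def)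
    finally show ?thesis .
  qed
  have "bipermanent n T V = (\<Sum>\<sigma>\<in>stab n (row_of T). Poly_Mapping.single (term_mon (T, S) (inv_into UNIV \<sigma>)) 1)"
    unfolding bipermanent_def row_group_eq_stab[OF T] by (rule sum.cong[OF refl summand])
  also have "\<dots> = (\<Sum>\<sigma>\<in>stab n (row_of T). Poly_Mapping.single (term_mon (T, S) \<sigma>) 1)"
  proof (rule sum.reindex_bij_witness[where i = "inv_into UNIV" and j = "inv_into UNIV"])
    fix \<sigma> assume \<sigma>: "\<sigma> \<in> stab n (row_of T)"
    then have "\<sigma> permutes {1..n}" by (simp add: stab_def)
    then show "inv_into UNIV (inv_into UNIV \<sigma>) = \<sigma>" "inv_into UNIV (inv_into UNIV \<sigma>) = \<sigma>"
      by (simp_all add: permutes_inv_inv)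
    show "inv_into UNIV \<sigma> \<in> stab n (row_of T)" "inv_into UNIV \<sigma> \<in> stab n (row_of T)"
      using stab_inv[OF \<sigma>] by simp_all
  qed simp
  finally show ?thesis by (simp add: bip_def)
qed

lemma single_mon_closed: "Poly_Mapping.single (mon n e) c \<in> carrier (xy_ring n)"
  using keys_mon[of n e] by (simp add: carrier_xy_ring)

lemma bip_closed: "bip j \<in> carrier (xy_ring n)"
proof -
  have s: "Poly_Mapping.single (term_mon j \<sigma>) 1 \<in> carrier (xy_ring n)" for \<sigma>
    unfolding term_mon_def by (rule single_mon_closed)
  have "(\<Sum>\<sigma>\<in>A. Poly_Mapping.single (term_mon j \<sigma>) (1::complex)) \<in> carrier (xy_ring n)" for A
    by (induction A rule: infinite_finite_induct) (simp_all add: s xy_ring_closed)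
  then show ?thesis by (simp add: bip_def)
qed

end

context hollow_params begin

abbreviation "\<gamma> \<equiv> ((m1, m2), (k1, k2), (p1, p2))"

definition bb :: "(nat list list \<times> nat list list) \<times> nat list \<times> nat list \<Rightarrow> xypoly" where
  "bb w = hh (fst (snd w)) (snd (snd w)) * bip (fst w)"

lemma Bset_eq: "Bset dim \<gamma> = bip ` pairs"
proof -
  have sh: "shape (cocharge_diagram \<gamma> S) = shape S" for S by (simp add: shape_def)
  have b: "bipermanent dim T (cocharge_diagram \<gamma> S) = bip (T, S)"
    if "T \<in> SYT dim" "S \<in> SYT dim" "shape T = shape S" for T S
    by (rule bipermanent_cocharge[OF that]) (simp add: piv_def)
  show ?thesis
  proof (intro Set.set_eqI iffI)
    fix f assume "f \<in> Bset dim \<gamma>"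
    then obtain T V where T: "T \<in> SYT dim" "f = bipermanent dim T V" "V \<in> CO dim \<gamma>" "shape T = shape V"
      unfolding Bset_def by blast
    then obtain S where S: "V = cocharge_diagram \<gamma> S" "S \<in> SYT dim" by (auto simp only: CO_def)
    then have "shape T = shape S" using T(4) sh by simp
    then have "f = bip (T, S)" "(T, S) \<in> pairs" using b[OF T(1) S(2)] T S by (simp_all add: pairs_def)
    then show "f \<in> bip ` pairs" by blast
  next
    fix f assume "f \<in> bip ` pairs"
    then obtain T S where TS: "T \<in> SYT dim" "S \<in> SYT dim" "shape T = shape S" "f = bip (T, S)"
      by (auto simp: pairs_def)
    then have "f = bipermanent dim T (cocharge_diagram \<gamma> S)" "shape T = shape (cocharge_diagram \<gamma> S)"
      by (simp_all only: b sh)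
    moreover have "cocharge_diagram \<gamma> S \<in> CO dim \<gamma>" unfolding CO_def using TS(2) by (rule imageI)
    ultimately show "f \<in> Bset dim \<gamma>" unfolding Bset_def using TS(1) by blast
  qed
qed

lemma BBset_eq: "BBset dim \<gamma> = bb ` (pairs \<times> QP)"
proof -
  have "BBset dim \<gamma> = {hh q q' * b | q q' b. b \<in> bip ` pairs \<and> q \<in> QQ 1 \<and> q' \<in> QQ (- 1)}"
    by (simp add: Bset_eq hh_def vars_eq QQ_def kk_def pp_def)
  also have "\<dots> = bb ` (pairs \<times> QP)"
    by (force simp: bb_def image_iff)
  finally show ?thesis .
qed

lemma bb_closed: "bb w \<in> carrier (xy_ring dim)"
  unfolding bb_def by (rule xy_ring_closed(2)[OF symm_carrier[OF symm_hh] bip_closed])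

text \<open>Collecting the terms of each pair of tableaux gives a relation between bipermanents with
  symmetric coefficients. Each coefficient kills \<open>\<Delta>\<close>, and then the independence
  of the complete homogeneous products applies inside it.\<close>

lemma bb_independent:
  assumes c: "(\<Sum>w\<in>pairs \<times> QP. const (c w) * bb w) \<in> hollow_ideal dim \<gamma>" and w: "w \<in> pairs \<times> QP"
  shows "c w = 0"
proof -
  let ?s = "\<lambda>j. \<Sum>z\<in>QP. const (c (j, z)) * hh (fst z) (snd z)"
  have "(\<Sum>w\<in>pairs \<times> QP. const (c w) * bb w) = (\<Sum>j\<in>pairs. \<Sum>z\<in>QP. const (c (j, z)) * bb (j, z))"
    unfolding sum.cartesian_product by (simp add: case_prod_beta)
  also have "\<dots> = (\<Sum>j\<in>pairs. ?s j * bip j)"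
    by (simp add: bb_def sum_distrib_right mult.assoc)
  finally have zero: "\<And>b. act (\<Sum>j\<in>pairs. ?s j * bip j) \<Delta> b = 0"
    using c by (simp add: mem_hollow_ideal)
  obtain j z where w_eq: "w = (j, z)" "j \<in> pairs" "z \<in> QP" using w by blast
  have "act (?s j) \<Delta> b = 0" for b
    by (rule bip_independent[OF _ zero w_eq(2)]) (intro symm_sum symm_mult symm_const symm_hh)
  then show ?thesis using hh_independent[of "\<lambda>z. c (j, z)", OF _ w_eq(3)] w_eq(1) by blast
qed

definition gg :: "(nat \<Rightarrow> nat) \<times> nat list \<times> nat list \<Rightarrow> xypoly" where
  "gg y = hh (fst (snd y)) (snd (snd y)) * Poly_Mapping.single (mon dim (descent_exp (fst y))) 1"

lemma gg_closed: "gg y \<in> carrier (xy_ring dim)"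
  unfolding gg_def by (rule xy_ring_closed(2)[OF symm_carrier[OF symm_hh] single_mon_closed])

lemma gg_spanning:
  assumes P: "P \<in> carrier (xy_ring dim)"
  shows "\<exists>c. P - (\<Sum>y\<in>{u. u permutes {1..dim}} \<times> QP. const (c y) * gg y) \<in> hollow_ideal dim \<gamma>"
proof -
  obtain c where c: "\<And>b. act (P - (\<Sum>u | u permutes {1..dim}. \<Sum>z\<in>QP. const (c u z) *
      (hh (fst z) (snd z) * Poly_Mapping.single (mon dim (descent_exp u)) 1))) \<Delta> b = 0"
    using generators[OF P] by blast
  let ?d = "\<lambda>y. c (fst y) (snd y)" and ?Y = "{u. u permutes {1..dim}} \<times> QP"
  have eq: "(\<Sum>u | u permutes {1..dim}. \<Sum>z\<in>QP. const (c u z) *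
      (hh (fst z) (snd z) * Poly_Mapping.single (mon dim (descent_exp u)) 1)) = (\<Sum>y\<in>?Y. const (?d y) * gg y)"
    unfolding sum.cartesian_product by (simp add: case_prod_beta gg_def)
  have "(\<Sum>y\<in>?Y. const (?d y) * gg y) \<in> carrier (xy_ring dim)"
    by (rule comb_closed) (rule gg_closed)
  then have "P - (\<Sum>y\<in>?Y. const (?d y) * gg y) \<in> carrier (xy_ring dim)"
    using xy_ring_closed(1)[OF P xy_ring_closed(3)] by simp
  then have "P - (\<Sum>y\<in>?Y. const (?d y) * gg y) \<in> hollow_ideal dim \<gamma>"
    using c unfolding mem_hollow_ideal eq by blast
  then show ?thesis by (rule exI[of _ ?d])
qed

lemma quotient_basis:
  "inj_on (quot_map dim (hollow_ideal dim \<gamma>)) (BBset dim \<gamma>) \<and>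
    module.lin_indpt class_ring (quot_space dim (hollow_ideal dim \<gamma>))
      (quot_map dim (hollow_ideal dim \<gamma>) ` BBset dim \<gamma>) \<and>
    vectorspace.basis class_ring (quot_space dim (hollow_ideal dim \<gamma>))
      (quot_map dim (hollow_ideal dim \<gamma>) ` BBset dim \<gamma>)"
proof -
  let ?I = "hollow_ideal dim \<gamma>" and ?W = "pairs \<times> QP" and ?Y = "{u. u permutes {1..dim}} \<times> QP"
  have I: "ideal ?I (xy_ring dim)" by (rule ideal_hollow_ideal)
  have finW: "finite ?W" by (simp add: finite_pairs finite_QQ)
  have finY: "finite ?Y" by (simp add: finite_permutations finite_QQ)
  \<comment> \<open>There are \<open>fact dim\<close> permutations and at least as many pairs of
    tableaux, while the factor \<open>card QP\<close> is common to both families.\<close>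
  have "card ?Y = fact dim * card QP"
    by (simp add: card_cartesian_product card_permutations[OF refl])
  also have "\<dots> \<le> card pairs * card QP"
    using card_SYT_pairs(2)[of dim] by (intro mult_right_mono) (simp_all add: pairs_def)
  also have "\<dots> = card ?W" by (rule card_cartesian_product[symmetric])
  finally have card: "card ?Y \<le> card ?W" .
  have img: "quot_map dim ?I ` BBset dim \<gamma> = (\<lambda>w. quot_map dim ?I (bb w)) ` ?W"
    unfolding BBset_eq by (rule image_image)
  have "inj_on (\<lambda>w. quot_map dim ?I (bb w)) ?W"
    by (rule quot_map_independent(1)[OF I finW bb_closed]) (rule bb_independent)
  then have "inj_on (quot_map dim ?I) (BBset dim \<gamma>)"
    unfolding BBset_eq by (intro inj_on_imageI) (simp add: o_def)
  moreover have "module.lin_indpt class_ring (quot_space dim ?I) (quot_map dim ?I ` BBset dim \<gamma>)"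
    unfolding img by (rule quot_map_independent(2)[OF I finW bb_closed]) (rule bb_independent)
  moreover have "vectorspace.basis class_ring (quot_space dim ?I) (quot_map dim ?I ` BBset dim \<gamma>)"
    unfolding img
  proof (rule quot_space_basis[where g = gg and Y = ?Y, OF I finW bb_closed])
    show "c w = 0" if "(\<Sum>w\<in>?W. const (c w) * bb w) \<in> ?I" "w \<in> ?W" for c w
      using that by (rule bb_independent)
    show "\<exists>c. P - (\<Sum>y\<in>?Y. const (c y) * gg y) \<in> ?I" if "P \<in> carrier (xy_ring dim)" for P
      using that by (rule gg_spanning)
  qed (rule finY gg_closed card)+
  ultimately show ?thesis by blast
qed

end

theorem theorem26:
  fixes m1 m2 k1 k2 p1 p2 n :: nat and \<gamma> :: params
  assumes "m1 \<ge> 1" and "m2 \<ge> 1" and "k1 \<ge> 1" and "k2 \<ge> 1"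
    and "\<gamma> = ((m1, m2), (k1, k2), (p1, p2))"
    and "n = m1 + p1 + m2 + p2 + 1"
  shows "inj_on (quot_map n (hollow_ideal n \<gamma>)) (BBset n \<gamma>) \<and>
    module.lin_indpt class_ring (quot_space n (hollow_ideal n \<gamma>))
      (quot_map n (hollow_ideal n \<gamma>) ` BBset n \<gamma>) \<and>
    vectorspace.basis class_ring (quot_space n (hollow_ideal n \<gamma>))
      (quot_map n (hollow_ideal n \<gamma>) ` BBset n \<gamma>)"
proof -
  interpret hollow_params m1 m2 k1 k2 p1 p2 by unfold_locales (fact assms)+
  have "n = dim" by (simp add: dim_def assms(6))
  with quotient_basis show ?thesis unfolding assms(5) by simp
qed

end
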